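(* Let $1\le p\le\infty$, let $E$ be a Banach space and $X$ a Banach lattice. Suppose that $E^{*}$ has the approximation property or $X^{****}$ has the positive metric approximation property. If an operator $S:E\to X$ has a positively $p$-nuclear adjoint $S^*:X^*\to E^*$, then $S$ is latticially $p$-nuclear and $\widetilde\nu_{p}(S)=\widetilde\nu^{p}(S^{*})$.
   Context: All Banach spaces and Banach lattices are real; operators are bounded and linear. $p\in[1,\infty]$ and $p^{*}$ is the conjugate exponent. $X^{****}$ is the fourth dual. For a Banach lattice $X$, $X_+$ is the positive cone. For a Banach space $E$, $l_p(E)$ is the space of $p$-summable sequences with norm $\|(u_n)_n\|_p=(\sum_n\|u_n\|^p)^{1/p}$, and $l_p^w(E)$ is the space of weakly $p$-summable sequences with norm $\|(u_n)_n\|_p^w=\sup_{u^*\in B_{E^*}}(\sum_n|\langle u^*,u_n\rangle|^p)^{1/p}$ (usual modification for exponent $\infty$). $l_p^w(X)_+$ denotes the sequences in $l_p^w(X)$ with all terms in $X_+$. $u^*\otimes x$ is the operator $u\mapsto\langle u^*,u\rangle x$. Latticially $p$-nuclear: $S:E\to X$ (with $X$ a Banach lattice) is latticially $p$-nuclear if $S=\sum_{j=1}^\infty u_j^*\otimes x_j$ with $(u_j^* )_j\in l_p(E^* )$ and $(x_j)_j\in l^w_{p^*}(X)_+$; $\widetilde\nu_p(S)=\inf\|(u_j^* )_j\|_p\|(x_j)_j\|^w_{p^*}$ over all such representations. Positively $p$-nuclear: $T:X\to E$ is positively $p$-nuclear if $T=\sum_{j=1}^\infty x_j^*\otimes u_j$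 with $(x_j^* )_j\in l^w_{p^*}(X^* )_+$ and $(u_j)_j\in l_p(E)$; $\widetilde\nu^p(T)=\inf\|(x_j^* )_j\|^w_{p^*}\|(u_j)_j\|_p$ over all such representations. $E$ has the approximation property if for every $\epsilon>0$ and compact $K\subset E$ there is a finite rank operator $S$ on $E$ with $\|Su-u\|<\epsilon$ for all $u\in K$. A Banach lattice $X$ has the positive metric approximation property if for every $\epsilon>0$ and compact $K\subset X$ there is a positive finite rank operator $R$ on $X$ with $\|R\|\le1$ and $\|Rx-x\|<\epsilon$ for all $x\in K$. *)

theory Defs
  imports "HOL-Analysis.Analysis"
begin

section \<open>Banach lattices and duals\<close>

text \<open>The modulus of \<open>x\<close> is \<open>sup x (- x)\<close>.\<close>

class banach_lattice = banach + ordered_real_vector + lattice +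
  assumes norm_mono_modulus: "sup x (- x) \<le> sup y (- y) \<Longrightarrow> norm x \<le> norm y"

instance real :: banach_lattice
  by standard (simp add: sup_real_def max_def split: if_splits)

type_synonym 'a dual = "'a \<Rightarrow>\<^sub>L real"

text \<open>
  Spaces of operators carry the order induced by the positive operators. On the dual of a
  Banach lattice, and hence on all iterated duals, this is the usual Banach lattice order.
  Only the positive cone of a dual enters the definitions below, so the bare order relation
  is all that is needed; accordingly the definitions that are applied to duals of Banach
  lattices are stated for normed spaces with a relation \<open>\<le>\<close>.
\<close>

instantiation blinfun :: ("{real_normed_vector, ord}", "{real_normed_vector, ord}") ord
begin

definition less_eq_blinfun :: "'a \<Rightarrow>\<^sub>L 'b \<Rightarrow> 'a \<Rightarrow>\<^sub>L 'b \<Rightarrow> bool"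
  where "f \<le> g \<longleftrightarrow> (\<forall>x\<ge>0. blinfun_apply f x \<le> blinfun_apply g x)"

definition less_blinfun :: "'a \<Rightarrow>\<^sub>L 'b \<Rightarrow> 'a \<Rightarrow>\<^sub>L 'b \<Rightarrow> bool"
  where "f < g \<longleftrightarrow> f \<le> g \<and> \<not> g \<le> (f :: 'a \<Rightarrow>\<^sub>L 'b)"

instance ..

end

lemma blinfun_nonneg_iff: "0 \<le> f \<longleftrightarrow> (\<forall>x\<ge>0. 0 \<le> blinfun_apply f x)"
  by (simp add: less_eq_blinfun_def)

lift_definition dual_map ::
  "'a::real_normed_vector \<Rightarrow>\<^sub>L 'b::real_normed_vector \<Rightarrow> 'b dual \<Rightarrow>\<^sub>L 'a dual"
  is "\<lambda>S f. f o\<^sub>L S"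
  by (rule bounded_bilinear.bounded_linear_left[OF bounded_bilinear_blinfun_compose])

lemma dual_map_apply: "blinfun_apply (blinfun_apply (dual_map S) f) u = f (S u)"
  by (simp add: dual_map.rep_eq)

lift_definition rank_one ::
  "'a::real_normed_vector dual \<Rightarrow> 'b::real_normed_vector \<Rightarrow> 'a \<Rightarrow>\<^sub>L 'b"
  is "\<lambda>f x u. f u *\<^sub>R x"
  by (rule bounded_linear_compose[OF bounded_linear_scaleR_left])


section \<open>Summable and weakly summable sequences\<close>

text \<open>Exponents are elements of \<open>ennreal\<close>; there \<open>inverse 0 = \<infinity>\<close> and \<open>inverse \<infinity> = 0\<close>.\<close>

definition conjugate_exponent :: "ennreal \<Rightarrow> ennreal"
  where "conjugate_exponent p = inverse (1 - inverse p)"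

lemma conjugate_exponent_1: "conjugate_exponent 1 = \<infinity>"
  by (simp add: conjugate_exponent_def)

lemma conjugate_exponent_infinity: "conjugate_exponent \<infinity> = 1"
  by (simp add: conjugate_exponent_def)

lemma conjugate_exponent_conjugate:
  assumes "1 \<le> p"
  shows "inverse p + inverse (conjugate_exponent p) = 1"
proof -
  have "inverse p \<le> 1"
  proof (cases p)
    case (real r)
    then have "1 \<le> r"
      using assms by (simp flip: ennreal_1)
    then show ?thesis
      using real by (simp add: inverse_ennreal field_simps flip: ennreal_1)
  qed simp
  then show ?thesis
    using add_diff_inverse_ennreal divide_ennreal_def one_divide_one_divide_ennreal
    unfolding conjugate_exponent_def by force
qed

definition in_lp :: "ennreal \<Rightarrow> (nat \<Rightarrow> 'a::real_normed_vector) \<Rightarrow> bool"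
  where "in_lp p u \<longleftrightarrow>
    (if p = \<infinity> then bounded (range u) else summable (\<lambda>n. norm (u n) powr enn2real p))"

definition lp_norm :: "ennreal \<Rightarrow> (nat \<Rightarrow> 'a::real_normed_vector) \<Rightarrow> real"
  where "lp_norm p u =
    (if p = \<infinity> then (SUP n. norm (u n))
     else (\<Sum>n. norm (u n) powr enn2real p) powr (1 / enn2real p))"

text \<open>
  For a weakly \<open>p\<close>-summable sequence the supremum defining the norm is automatically finite,
  since the dual is complete.
\<close>

definition in_weak_lp :: "ennreal \<Rightarrow> (nat \<Rightarrow> 'a::real_normed_vector) \<Rightarrow> bool"
  where "in_weak_lp p u \<longleftrightarrow> (\<forall>f :: 'a dual. in_lp p (\<lambda>n. blinfun_apply f (u n)))"

definition weak_lp_norm :: "ennreal \<Rightarrow> (nat \<Rightarrow> 'a::real_normed_vector) \<Rightarrow> real"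
  where "weak_lp_norm p u = (SUP f\<in>(cball 0 1 :: 'a dual set). lp_norm p (\<lambda>n. blinfun_apply f (u n)))"


section \<open>Nuclear operators\<close>

text \<open>
  The series converge in the operator norm. For \<open>p < \<infinity>\<close> convergence is automatic; for
  \<open>p = \<infinity>\<close> it is part of the requirement on a representation.
\<close>

definition latticially_nuclear_rep ::
  "ennreal \<Rightarrow> 'e::real_normed_vector \<Rightarrow>\<^sub>L 'x::{real_normed_vector, ord}
    \<Rightarrow> (nat \<Rightarrow> 'e dual) \<Rightarrow> (nat \<Rightarrow> 'x) \<Rightarrow> bool"
  where "latticially_nuclear_rep p S u x \<longleftrightarrow>
    in_lp p u \<and> in_weak_lp (conjugate_exponent p) x \<and> (\<forall>j. 0 \<le> x j) \<and>
    (\<lambda>j. rank_one (u j) (x j)) sums S"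

definition latticially_nuclear ::
  "ennreal \<Rightarrow> 'e::real_normed_vector \<Rightarrow>\<^sub>L 'x::{real_normed_vector, ord} \<Rightarrow> bool"
  where "latticially_nuclear p S \<longleftrightarrow> (\<exists>u x. latticially_nuclear_rep p S u x)"

definition latticially_nuclear_norm ::
  "ennreal \<Rightarrow> 'e::real_normed_vector \<Rightarrow>\<^sub>L 'x::{real_normed_vector, ord} \<Rightarrow> real"
  where "latticially_nuclear_norm p S =
    Inf {lp_norm p u * weak_lp_norm (conjugate_exponent p) x | u x. latticially_nuclear_rep p S u x}"

definition positively_nuclear_rep ::
  "ennreal \<Rightarrow> 'x::{real_normed_vector, ord} \<Rightarrow>\<^sub>L 'e::real_normed_vector
    \<Rightarrow> (nat \<Rightarrow> 'x dual) \<Rightarrow> (nat \<Rightarrow> 'e) \<Rightarrow> bool"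
  where "positively_nuclear_rep p T x u \<longleftrightarrow>
    in_weak_lp (conjugate_exponent p) x \<and> (\<forall>j. 0 \<le> x j) \<and> in_lp p u \<and>
    (\<lambda>j. rank_one (x j) (u j)) sums T"

definition positively_nuclear ::
  "ennreal \<Rightarrow> 'x::{real_normed_vector, ord} \<Rightarrow>\<^sub>L 'e::real_normed_vector \<Rightarrow> bool"
  where "positively_nuclear p T \<longleftrightarrow> (\<exists>x u. positively_nuclear_rep p T x u)"

definition positively_nuclear_norm ::
  "ennreal \<Rightarrow> 'x::{real_normed_vector, ord} \<Rightarrow>\<^sub>L 'e::real_normed_vector \<Rightarrow> real"
  where "positively_nuclear_norm p T =
    Inf {weak_lp_norm (conjugate_exponent p) x * lp_norm p u | x u. positively_nuclear_rep p T x u}"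


section \<open>Approximation properties\<close>

definition finite_rank :: "'a::real_normed_vector \<Rightarrow>\<^sub>L 'b::real_normed_vector \<Rightarrow> bool"
  where "finite_rank S \<longleftrightarrow> (\<exists>B. finite B \<and> range (blinfun_apply S) \<subseteq> span B)"

definition approximation_property :: "'e::real_normed_vector itself \<Rightarrow> bool"
  where "approximation_property _ \<longleftrightarrow>
    (\<forall>\<epsilon>>0. \<forall>K :: 'e set. compact K \<longrightarrow>
      (\<exists>S :: 'e \<Rightarrow>\<^sub>L 'e. finite_rank S \<and> (\<forall>u\<in>K. norm (S u - u) < \<epsilon>)))"

definition positive_metric_approximation_property ::
  "'x::{real_normed_vector, ord} itself \<Rightarrow> bool"
  where "positive_metric_approximation_property _ \<longleftrightarrow>
    (\<forall>\<epsilon>>0. \<forall>K :: 'x set. compact K \<longrightarrow>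
      (\<exists>R :: 'x \<Rightarrow>\<^sub>L 'x. 0 \<le> R \<and> finite_rank R \<and> norm R \<le> 1 \<and>
        (\<forall>x\<in>K. norm (R x - x) < \<epsilon>)))"

end

theory Submission
  imports Defs "HOL-Library.Lattice_Algebras"
begin

text \<open>
  If \<open>S\<^sup>* = \<Sum> \<xi>\<^sub>j \<otimes> u\<^sub>j\<close> with positive \<open>\<xi>\<^sub>j\<close> in the bidual of \<open>X\<close>, then \<open>J S = \<Sum> u\<^sub>j \<otimes> \<xi>\<^sub>j\<close> for the
  canonical embedding \<open>J\<close> of \<open>X\<close> into its bidual, and the \<open>\<xi>\<^sub>j\<close> have to be replaced by elements of \<open>X\<close>
  at no cost. It is enough to find a finite representation \<open>B\<close> in \<open>X\<close> of the same cost such that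
  \<open>J (S - B)\<close> has a representation of arbitrarily small cost, and to iterate. If no such \<open>B\<close>
  exists, Hahn--Banach separation yields an operator \<open>W\<close> from \<open>E\<^sup>*\<close> to the third dual of \<open>X\<close> for which
  the traces \<open>\<Sum> W(u\<^sub>j)(\<xi>\<^sub>j)\<close>, taken modulo the functionals coming from \<open>X\<close>, stay away from \<open>0\<close>.
  But \<open>J S\<close> is annihilated by the functionals that vanish on \<open>X\<close>, so these traces vanish for \<open>W\<close> of finite
  rank; the approximation property, applied to the \<open>u\<^sub>j\<close> or to the \<open>\<xi>\<^sub>j\<close> in the fourth dual, carries this
  over to all \<open>W\<close>. For \<open>p = \<infinity>\<close> the norm cost is not additive, and upper bounds in the lattice take its place.
\<close>

section \<open>The Hahn--Banach theorem\<close>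

text \<open>The traces live in the fourth dual because "modulo functionals coming from X" is
  realised by \<open>bidual_defect\<close>, a difference of two positive contractive embeddings of
  the bidual of X into its own bidual. Operators on the fourth dual are applied to the two images of
  each \<xi>_j separately: for finite p, positivity and contractivity keep the new vectors within
  the trace estimates that hold for the old ones, so tails of traces remain small and approximation
  at finitely many vectors suffices. Operators on the dual of E act on the u_j instead, which are
  first divided by weights so that they fill a compact set. Approximation of bidual elements by
  elements of the space is needed at two levels: from X to the bidual when the separation is
  exploited, and from the bidual to the fourth dual when traces are bounded. For p = \<infinity> the
  obstacle is to turn a bound for the values of a finite rank operator into a bound for one of its
  representations in X; this is what the partitions of elements of the lattice are for.\<close>

definition sublinear_on :: "'a::real_vector set \<Rightarrow> ('a \<Rightarrow> real) \<Rightarrow> bool"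
  where "sublinear_on U p \<longleftrightarrow>
    (\<forall>x\<in>U. \<forall>y\<in>U. p (x + y) \<le> p x + p y) \<and> (\<forall>x\<in>U. \<forall>c\<ge>0. p (c *\<^sub>R x) = c * p x)"

lemma sublinear_on_uminus:
  assumes "subspace U" "sublinear_on U p" "x \<in> U"
  shows "- p (- x) \<le> p x"
proof -
  have "p (x + - x) \<le> p x + p (- x)" "p (0 *\<^sub>R x) = 0 * p x"
    using assms subspace_neg[OF assms(1,3)] unfolding sublinear_on_def by blast+
  then show ?thesis by simp
qed

text \<open>One inequality suffices for homogeneity: applied to \<open>c *\<^sub>R x\<close> with
  factor \<open>inverse c\<close> it yields the reverse one. Most functionals below are infima, for
  which only upper bounds are immediate.\<close>

lemma sublinear_onI:
  assumes "subspace U"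
    and "\<And>x y. x \<in> U \<Longrightarrow> y \<in> U \<Longrightarrow> p (x + y) \<le> p x + p y"
    and scale: "\<And>x c. x \<in> U \<Longrightarrow> 0 < c \<Longrightarrow> p (c *\<^sub>R x) \<le> c * p x"
    and "p 0 = 0"
  shows "sublinear_on U p"
  unfolding sublinear_on_def
proof (intro conjI ballI allI impI)
  fix x and c :: real assume x: "x \<in> U" and "0 \<le> c"
  show "p (c *\<^sub>R x) = c * p x"
  proof (cases "c = 0")
    case False
    with \<open>0 \<le> c\<close> have c: "0 < c" by simp
    have "p (inverse c *\<^sub>R (c *\<^sub>R x)) \<le> inverse c * p (c *\<^sub>R x)"
      using x c by (intro scale) (simp_all add: subspace_scale assms)
    then have "c * p x \<le> p (c *\<^sub>R x)"
      using c by (simp add: field_simps)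
    then show ?thesis using scale[OF x c] by simp
  qed (simp add: assms)
qed (use assms in auto)

text \<open>By Zorn's lemma there is a minimal sublinear functional below \<open>p\<close>, and
  minimality forces linearity. A chain has its pointwise infimum as lower bound; it is finite since
  \<open>- p (- x) \<le> q x\<close> for every sublinear \<open>q\<close> below
  \<open>p\<close>.\<close>

lemma hahn_banach_sublinear:
  fixes p :: "'a::real_vector \<Rightarrow> real"
  assumes U: "subspace U" and p: "sublinear_on U p"
  obtains \<phi> where "\<And>x. x \<in> U \<Longrightarrow> \<phi> x \<le> p x"
    and "\<And>x y. x \<in> U \<Longrightarrow> y \<in> U \<Longrightarrow> \<phi> (x + y) = \<phi> x + \<phi> y"
    and "\<And>x c. x \<in> U \<Longrightarrow> \<phi> (c *\<^sub>R x) = c * \<phi> x"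
proof -
  \<comment> \<open>Prescribing the value 0 outside \<open>U\<close> makes functionals that agree on
    \<open>U\<close> equal, as antisymmetry of \<open>P\<close> requires. Smaller functionals are
    higher for \<open>P\<close>, so a maximal element for \<open>P\<close> is a minimal
    functional.\<close>
  define A where "A = {q. sublinear_on U q \<and> (\<forall>x\<in>U. q x \<le> p x) \<and> (\<forall>x. x \<notin> U \<longrightarrow> q x = 0)}"
  define P where "P q r \<longleftrightarrow> (\<forall>x. r x \<le> q x)" for q r :: "'a \<Rightarrow> real"
  have lower: "- p (- x) \<le> q x" if "q \<in> A" "x \<in> U" for q x
    using sublinear_on_uminus[OF U, of q x] that U unfolding A_def
    by (smt (verit) mem_Collect_eq subspace_neg)
  have INF_mem: "(\<lambda>x. if x \<in> U then INF q\<in>C. q x else 0) \<in> A"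
    if C: "C \<noteq> {}" "C \<subseteq> A" "\<And>q r. q \<in> C \<Longrightarrow> r \<in> C \<Longrightarrow> P q r \<or> P r q" for C
  proof -
    let ?u = "\<lambda>x. INF q\<in>C. q x"
    have bdd: "bdd_below ((\<lambda>q. q x) ` C)" if "x \<in> U" for x
      using lower that C(2) by (intro bdd_belowI[of _ "- p (- x)"]) auto
    have le: "?u x \<le> q x" if "x \<in> U" "q \<in> C" for x q
      using cINF_lower[OF bdd] that by blast
    have "sublinear_on U (\<lambda>x. if x \<in> U then ?u x else 0)"
    proof (rule sublinear_onI[OF U])
      fix x y assume xy: "x \<in> U" "y \<in> U"
      have xyU: "x + y \<in> U" using xy U by (simp add: subspace_add)
      have "?u (x + y) \<le> q x + r y" if qr: "q \<in> C" "r \<in> C" for q r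
      proof -
        obtain s where s: "s \<in> C" "s x \<le> q x" "s y \<le> r y"
          using C(3)[OF qr] qr unfolding P_def by blast
        have "?u (x + y) \<le> s (x + y)" using le s xyU by simp
        also have "\<dots> \<le> s x + s y"
          using s C xy unfolding A_def sublinear_on_def by blast
        finally show ?thesis using s by simp
      qed
      then have "?u (x + y) - r y \<le> ?u x" if "r \<in> C" for r
        using that C(1) by (intro cINF_greatest) (auto simp: algebra_simps)
      then have "?u (x + y) - ?u x \<le> ?u y"
        using C(1) by (intro cINF_greatest) (auto simp: algebra_simps)
      then show "(if x + y \<in> U then ?u (x + y) else 0) \<le>
          (if x \<in> U then ?u x else 0) + (if y \<in> U then ?u y else 0)"
        using xy xyU by simp
    next
      fix x and c :: real assume x: "x \<in> U" and c: "0 < c"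
      have cx: "c *\<^sub>R x \<in> U" using x U by (simp add: subspace_scale)
      have "?u (c *\<^sub>R x) / c \<le> q x" if "q \<in> C" for q
      proof -
        have "?u (c *\<^sub>R x) \<le> q (c *\<^sub>R x)" using le cx that by simp
        also have "\<dots> = c * q x" using that C(2) c x unfolding A_def sublinear_on_def by auto
        finally show ?thesis using c by (simp add: field_simps)
      qed
      then have "?u (c *\<^sub>R x) / c \<le> ?u x" using C(1) by (intro cINF_greatest) auto
      then show "(if c *\<^sub>R x \<in> U then ?u (c *\<^sub>R x) else 0) \<le> c * (if x \<in> U then ?u x else 0)"
        using c x cx by (simp add: field_simps)
    next
      have "q 0 = 0" if "q \<in> C" for q
      proof -
        have "q (0 *\<^sub>R 0) = 0 * q 0"
          using that C(2) subspace_0[OF U] unfolding A_def sublinear_on_def by blast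
        then show ?thesis by simp
      qed
      then have "(\<lambda>q. q 0) ` C = (\<lambda>_. 0) ` C" by (intro image_cong) auto
      also have "\<dots> = {0}" using C(1) by auto
      finally have "?u 0 = 0" by (simp only: cInf_singleton)
      then show "(if 0 \<in> U then ?u 0 else 0) = 0" by simp
    qed
    moreover have "?u x \<le> p x" if "x \<in> U" for x
    proof -
      obtain q where "q \<in> C" using C(1) by blast
      then show ?thesis using le[OF that \<open>q \<in> C\<close>] C(2) that unfolding A_def by fastforce
    qed
    ultimately show ?thesis unfolding A_def by simp
  qed
  have "\<exists>m\<in>A. \<forall>a\<in>A. P m a \<longrightarrow> a = m"
  proof (rule predicate_Zorn)
    show "partial_order_on A (relation_of P A)"
    proof (rule partial_order_on_relation_ofI)
      fix q r s assume "P q r" "P r s"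
      then show "P q s" unfolding P_def using order_trans by blast
    next
      fix q r assume "P q r" "P r q"
      then have "q x = r x" for x unfolding P_def by (simp add: order_antisym)
      then show "q = r" by blast
    qed (simp add: P_def)
  next
    fix C assume C: "C \<in> Chains (relation_of P A)"
    show "\<exists>u\<in>A. \<forall>a\<in>C. P a u"
    proof (cases "C = {}")
      case True
      have "(\<lambda>x. if x \<in> U then p x else 0) \<in> A"
        using p U unfolding A_def sublinear_on_def
        by (auto simp: subspace_add subspace_scale)
      then show ?thesis using True by blast
    next
      case False
      have CA: "C \<subseteq> A" and tot: "\<And>q r. q \<in> C \<Longrightarrow> r \<in> C \<Longrightarrow> P q r \<or> P r q"
        using C unfolding Chains_def relation_of_def by auto
      have "P a (\<lambda>x. if x \<in> U then INF q\<in>C. q x else 0)" if "a \<in> C" for a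
        unfolding P_def
      proof
        fix x
        show "(if x \<in> U then INF q\<in>C. q x else 0) \<le> a x"
        proof (cases "x \<in> U")
          case True
          then have "bdd_below ((\<lambda>q. q x) ` C)"
            using lower CA by (intro bdd_belowI[of _ "- p (- x)"]) auto
          then show ?thesis using True that cINF_lower[of "\<lambda>q. q x" C a] by simp
        qed (use that CA in \<open>auto simp: A_def\<close>)
      qed
      then show ?thesis using INF_mem[OF False CA tot] by blast
    qed
  qed
  then obtain m where m: "m \<in> A" and min: "\<And>a. a \<in> A \<Longrightarrow> P m a \<Longrightarrow> a = m" by blast
  have sub: "m (x + y) \<le> m x + m y" if "x \<in> U" "y \<in> U" for x y
    using m that unfolding A_def sublinear_on_def by blast
  have hom: "m (c *\<^sub>R x) = c * m x" if "x \<in> U" "0 \<le> c" for x c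
    using m that unfolding A_def sublinear_on_def by blast
  have add: "m (x + y) = m x + m y" if x: "x \<in> U" and y: "y \<in> U" for x y
  proof -
    \<comment> \<open>This functional is sublinear and below \<open>m\<close>, so minimality makes
      it equal to \<open>m\<close>; its value is at most the term for \<open>t = 1\<close>, which
      reads \<open>m x \<le> m (x + y) - m y\<close>.\<close>
    let ?I = "\<lambda>x. INF t\<in>{0..}. m (x + t *\<^sub>R y) - t * m y"
    let ?q = "\<lambda>x. if x \<in> U then ?I x else 0"
    have low: "- m (- x) \<le> m (x + t *\<^sub>R y) - t * m y" if "x \<in> U" "0 \<le> t" for x t
    proof -
      have "m ((x + t *\<^sub>R y) + - x) \<le> m (x + t *\<^sub>R y) + m (- x)"
        using that y U by (intro sub) (auto simp: subspace_add subspace_scale subspace_neg)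
      then show ?thesis using hom[OF y that(2)] by simp
    qed
    have bdd: "bdd_below ((\<lambda>t. m (x + t *\<^sub>R y) - t * m y) ` {0..})" if "x \<in> U" for x
      using low that by (intro bdd_belowI[of _ "- m (- x)"]) auto
    have le: "?I x \<le> m (x + t *\<^sub>R y) - t * m y" if "x \<in> U" "0 \<le> t" for x t
      using cINF_lower[OF bdd, of x t] that by simp
    have lem: "?I x \<le> m x" if "x \<in> U" for x using le[OF that, of 0] by simp
    have "sublinear_on U ?q"
    proof (rule sublinear_onI[OF U])
      fix u v assume uv: "u \<in> U" "v \<in> U"
      have uvU: "u + v \<in> U" using uv U by (simp add: subspace_add)
      have *: "?I (u + v) \<le> (m (u + s *\<^sub>R y) - s * m y) + (m (v + t *\<^sub>R y) - t * m y)"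
        if "0 \<le> s" "0 \<le> t" for s t
      proof -
        have "?I (u + v) \<le> m ((u + v) + (s + t) *\<^sub>R y) - (s + t) * m y"
          using le uvU that by simp
        also have "(u + v) + (s + t) *\<^sub>R y = (u + s *\<^sub>R y) + (v + t *\<^sub>R y)"
          by (simp add: algebra_simps)
        also have "m \<dots> \<le> m (u + s *\<^sub>R y) + m (v + t *\<^sub>R y)"
          using uv y U by (intro sub) (auto simp: subspace_add subspace_scale)
        finally show ?thesis by (simp add: algebra_simps)
      qed
      have "?I (u + v) - (m (v + t *\<^sub>R y) - t * m y) \<le> ?I u" if "0 \<le> t" for t
        using *[OF _ that] by (intro cINF_greatest) (auto simp: algebra_simps)
      then have "?I (u + v) - ?I u \<le> ?I v"
        by (intro cINF_greatest) (auto simp: algebra_simps)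
      then show "?q (u + v) \<le> ?q u + ?q v" using uv uvU by simp
    next
      fix u and c :: real assume u: "u \<in> U" and c: "0 < c"
      have cu: "c *\<^sub>R u \<in> U" using u U by (simp add: subspace_scale)
      have "?I (c *\<^sub>R u) / c \<le> m (u + t *\<^sub>R y) - t * m y" if "0 \<le> t" for t
      proof -
        have "?I (c *\<^sub>R u) \<le> m (c *\<^sub>R u + (c * t) *\<^sub>R y) - (c * t) * m y"
          using le cu that c by simp
        also have "c *\<^sub>R u + (c * t) *\<^sub>R y = c *\<^sub>R (u + t *\<^sub>R y)" by (simp add: algebra_simps)
        also have "m \<dots> = c * m (u + t *\<^sub>R y)"
          using u y U c by (intro hom) (auto simp: subspace_add subspace_scale)
        finally show ?thesis using c by (simp add: field_simps)
      qed
      then have "?I (c *\<^sub>R u) / c \<le> ?I u" by (intro cINF_greatest) auto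
      then show "?q (c *\<^sub>R u) \<le> c * ?q u" using c u cu by (simp add: field_simps)
    next
      have "m (0 *\<^sub>R y) = 0" using hom[OF y, of 0] by simp
      then have "?I 0 = (INF t\<in>{0::real..}. 0)" using hom[OF y] by (intro INF_cong) auto
      then show "?q 0 = 0" by simp
    qed
    moreover have "?q x \<le> p x" if "x \<in> U" for x
      using lem[OF that] m that unfolding A_def by fastforce
    ultimately have "?q \<in> A" unfolding A_def by simp
    moreover have "P m ?q" unfolding P_def using lem m by (auto simp: A_def)
    ultimately have "?q = m" by (rule min)
    from fun_cong[OF this, of x] have "m x = ?I x" using x by simp
    also have "\<dots> \<le> m (x + 1 *\<^sub>R y) - 1 * m y" by (rule le[OF x]) simp
    finally show ?thesis using sub[OF x y] by simp
  qed
  have "m (c *\<^sub>R x) = c * m x" if x: "x \<in> U" for x c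
  proof (cases "0 \<le> c")
    case False
    have "m (c *\<^sub>R x + (- c) *\<^sub>R x) = m (c *\<^sub>R x) + m ((- c) *\<^sub>R x)"
      using x U by (intro add) (auto simp: subspace_scale simp del: scaleR_minus_left)
    moreover have "m ((- c) *\<^sub>R x) = (- c) * m x" using False by (intro hom[OF x]) simp
    moreover have "m (0 *\<^sub>R x) = 0" using hom[OF x, of 0] by simp
    ultimately show ?thesis by simp
  qed (rule hom[OF x])
  then show thesis using that[of m] add m unfolding A_def by blast
qed

definition convex_cone_set :: "('a::real_vector) set \<Rightarrow> bool"
  where "convex_cone_set G \<longleftrightarrow> 0 \<in> G \<and> (\<forall>x\<in>G. \<forall>y\<in>G. x + y \<in> G) \<and> (\<forall>x\<in>G. \<forall>c>0. c *\<^sub>R x \<in> G)"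

text \<open>
  A form of the Hahn--Banach theorem that contains the extension, separation and sandwich
  theorems: apply it to a cone of pairs \<open>(v, b)\<close>, each of which prescribes a lower bound \<open>b\<close> for
  the value of the functional at \<open>v\<close>.
\<close>

lemma hahn_banach_cone:
  fixes p :: "'a::real_vector \<Rightarrow> real"
  assumes U: "subspace U" and p: "sublinear_on U p"
    and G: "convex_cone_set G" "\<And>v b. (v, b) \<in> G \<Longrightarrow> v \<in> U \<and> b \<le> p v"
  obtains \<phi> where "\<And>x. x \<in> U \<Longrightarrow> \<phi> x \<le> p x"
    and "\<And>x y. x \<in> U \<Longrightarrow> y \<in> U \<Longrightarrow> \<phi> (x + y) = \<phi> x + \<phi> y"
    and "\<And>x c. x \<in> U \<Longrightarrow> \<phi> (c *\<^sub>R x) = c * \<phi> x"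
    and "\<And>v b. (v, b) \<in> G \<Longrightarrow> b \<le> \<phi> v"
proof -
  have p_add: "p (x + y) \<le> p x + p y" if "x \<in> U" "y \<in> U" for x y
    using p that unfolding sublinear_on_def by blast
  have p_hom: "p (c *\<^sub>R x) = c * p x" if "x \<in> U" "0 \<le> c" for x c
    using p that unfolding sublinear_on_def by blast
  have p0: "p 0 = 0" using p_hom[OF subspace_0[OF U], of 0] by simp
  have G0: "(0, 0) \<in> G" using G(1) unfolding convex_cone_set_def zero_prod_def by blast
  have Gadd: "(v + w, b + d) \<in> G" if "(v, b) \<in> G" "(w, d) \<in> G" for v b w d
  proof -
    have "(v, b) + (w, d) \<in> G" using G(1) that unfolding convex_cone_set_def by blast
    then show ?thesis by simp
  qed
  have Gsc: "(c *\<^sub>R v, c * b) \<in> G" if "(v, b) \<in> G" "0 < c" for v b c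
  proof -
    have "c *\<^sub>R (v, b) \<in> G" using G(1) that unfolding convex_cone_set_def by blast
    then show ?thesis by simp
  qed
  \<comment> \<open>Any linear \<open>\<phi>\<close> below \<open>q\<close> has both properties: the
    element \<open>(0, 0)\<close> of \<open>G\<close> gives \<open>\<phi> \<le> p\<close>, and
    evaluation at \<open>- v\<close> gives \<open>\<phi> (- v) \<le> p 0 - b = - b\<close>.\<close>
  define q where "q x = (INF g\<in>G. p (x + fst g) - snd g)" for x
  have low: "- p (- x) \<le> p (x + fst g) - snd g" if "x \<in> U" "g \<in> G" for x g
  proof -
    obtain v b where g: "g = (v, b)" by fastforce
    have v: "v \<in> U" "b \<le> p v" using G(2) that g by blast+
    have "p ((x + v) + - x) \<le> p (x + v) + p (- x)"
      using that v U by (intro p_add) (auto simp: subspace_add subspace_neg)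
    then show ?thesis using v g by simp
  qed
  have bdd: "bdd_below ((\<lambda>g. p (x + fst g) - snd g) ` G)" if "x \<in> U" for x
    using low that by (intro bdd_belowI[of _ "- p (- x)"]) auto
  have le: "q x \<le> p (x + v) - b" if "x \<in> U" "(v, b) \<in> G" for x v b
    using cINF_lower[OF bdd, OF that] unfolding q_def by simp
  have ge: "a \<le> q x" if "\<And>v b. (v, b) \<in> G \<Longrightarrow> a \<le> p (x + v) - b" for a x
    unfolding q_def using G0 that by (intro cINF_greatest) auto
  have "sublinear_on U q"
  proof (rule sublinear_onI[OF U])
    fix x y assume xy: "x \<in> U" "y \<in> U"
    have xyU: "x + y \<in> U" using xy U by (simp add: subspace_add)
    have *: "q (x + y) \<le> (p (x + v) - b) + (p (y + w) - d)"
      if g: "(v, b) \<in> G" "(w, d) \<in> G" for v b w d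
    proof -
      have "q (x + y) \<le> p ((x + y) + (v + w)) - (b + d)" using le[OF xyU Gadd[OF g]] .
      also have "(x + y) + (v + w) = (x + v) + (y + w)" by simp
      also have "p \<dots> \<le> p (x + v) + p (y + w)"
        using xy g G(2) U by (intro p_add) (auto simp: subspace_add)
      finally show ?thesis by simp
    qed
    have "q (x + y) - (p (y + w) - d) \<le> q x" if "(w, d) \<in> G" for w d
    proof (rule ge)
      fix v b assume "(v, b) \<in> G"
      then show "q (x + y) - (p (y + w) - d) \<le> p (x + v) - b" using *[OF _ that] by fastforce
    qed
    then have "q (x + y) - q x \<le> q y" by (intro ge) (fastforce simp: algebra_simps)
    then show "q (x + y) \<le> q x + q y" by simp
  next
    fix x and c :: real assume x: "x \<in> U" and c: "0 < c"
    have "q (c *\<^sub>R x) / c \<le> q x"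
    proof (rule ge)
      fix v b assume g: "(v, b) \<in> G"
      have "q (c *\<^sub>R x) \<le> p (c *\<^sub>R x + c *\<^sub>R v) - c * b"
        using le[OF _ Gsc[OF g c]] x U by (simp add: subspace_scale)
      also have "p (c *\<^sub>R x + c *\<^sub>R v) = c * p (x + v)"
        using p_hom[of "x + v" c] x g G(2) U c by (simp add: subspace_add scaleR_add_right)
      finally show "q (c *\<^sub>R x) / c \<le> p (x + v) - b" using c by (simp add: field_simps)
    qed
    then show "q (c *\<^sub>R x) \<le> c * q x" using c by (simp add: field_simps)
  next
    have "0 \<le> q 0" using G(2) by (intro ge) auto
    moreover have "q 0 \<le> 0" using le[OF subspace_0[OF U] G0] p0 by simp
    ultimately show "q 0 = 0" by simp
  qed
  from hahn_banach_sublinear[OF U this] obtain \<phi> where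
    \<phi>: "\<And>x. x \<in> U \<Longrightarrow> \<phi> x \<le> q x"
      "\<And>x y. x \<in> U \<Longrightarrow> y \<in> U \<Longrightarrow> \<phi> (x + y) = \<phi> x + \<phi> y"
      "\<And>x c. x \<in> U \<Longrightarrow> \<phi> (c *\<^sub>R x) = c * \<phi> x" by blast
  have "\<phi> x \<le> p x" if "x \<in> U" for x
    using \<phi>(1)[OF that] le[OF that G0] by simp
  moreover have "b \<le> \<phi> v" if g: "(v, b) \<in> G" for v b
  proof -
    have v: "v \<in> U" using G(2) g by blast
    have "\<phi> (- v) \<le> q (- v)" using v U by (intro \<phi>) (simp add: subspace_neg)
    also have "\<dots> \<le> p (- v + v) - b" using v U g by (intro le) (simp_all add: subspace_neg)
    finally show ?thesis using \<phi>(3)[OF v, of "-1"] p0 by simp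
  qed
  ultimately show thesis using that \<phi> by blast
qed

lemma sublinear_on_norm: "0 \<le> K \<Longrightarrow> sublinear_on UNIV (\<lambda>x::'a::real_normed_vector. K * norm x)"
  unfolding sublinear_on_def
  by (auto simp: distrib_left[symmetric] intro!: mult_left_mono norm_triangle_ineq)

lemma hahn_banach_cone_dual:
  fixes G :: "('a::real_normed_vector \<times> real) set"
  assumes G: "convex_cone_set G" "\<And>v b. (v, b) \<in> G \<Longrightarrow> b \<le> K * norm v" and K: "0 \<le> K"
  obtains \<phi> :: "'a dual" where "norm \<phi> \<le> K" "\<And>v b. (v, b) \<in> G \<Longrightarrow> b \<le> \<phi> v"
proof -
  obtain \<phi> where \<phi>: "\<And>x::'a. \<phi> x \<le> K * norm x" "\<And>x y. \<phi> (x + y) = \<phi> x + \<phi> y"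
    "\<And>x c. \<phi> (c *\<^sub>R x) = c * \<phi> x" "\<And>v b. (v, b) \<in> G \<Longrightarrow> b \<le> \<phi> v"
    using hahn_banach_cone[OF subspace_UNIV sublinear_on_norm[OF K] G(1)] G(2) by (metis UNIV_I)
  have *: "norm (\<phi> x) \<le> norm x * K" for x
    using \<phi>(1)[of x] \<phi>(1)[of "- x"] \<phi>(3)[of "-1" x] by (simp add: mult.commute)
  then have bl: "bounded_linear \<phi>" by (intro bounded_linear_intro[of _ K]) (auto simp: \<phi>)
  have "norm (Blinfun \<phi>) \<le> K"
    using K * by (intro norm_blinfun_bound) (auto simp: bounded_linear_Blinfun_apply[OF bl] mult.commute)
  then show thesis using that[of "Blinfun \<phi>"] \<phi>(4) by (simp add: bounded_linear_Blinfun_apply[OF bl])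
qed

lemma norming_functional:
  fixes x :: "'a::real_normed_vector"
  obtains f :: "'a dual" where "norm f \<le> 1" "f x = norm x"
proof -
  define g where "g t = (t *\<^sub>R x, t * norm x)" for t
  let ?G = "range g"
  have G: "convex_cone_set ?G"
    unfolding convex_cone_set_def
  proof (intro conjI ballI allI impI)
    have "0 = g 0" by (simp add: zero_prod_def g_def)
    then show "0 \<in> ?G" by blast
  next
    fix u v assume "u \<in> ?G" "v \<in> ?G"
    then obtain s t where "u = g s" "v = g t" by blast
    then have "u + v = g (s + t)" by (simp add: g_def algebra_simps)
    then show "u + v \<in> ?G" by blast
  next
    fix u and c :: real assume "u \<in> ?G"
    then obtain s where "u = g s" by blast
    then have "c *\<^sub>R u = g (c * s)" by (simp add: g_def)
    then show "c *\<^sub>R u \<in> ?G" by blast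
  qed
  have bound: "b \<le> 1 * norm v" if "(v, b) \<in> ?G" for v b
    using that by (auto simp: g_def intro!: mult_right_mono)
  obtain f :: "'a dual" where f: "norm f \<le> 1" "\<And>v b. (v, b) \<in> ?G \<Longrightarrow> b \<le> f v"
    by (rule hahn_banach_cone_dual[OF G bound]) auto
  have "g 1 = (x, norm x)" by (simp add: g_def)
  then have "(x, norm x) \<in> ?G" by (metis rangeI)
  then have "norm x \<le> f x" by (rule f(2))
  moreover have "f x \<le> norm x"
    using norm_blinfun[of f x] f(1) mult_right_mono[OF f(1), of "norm x"] by auto
  ultimately show thesis using that[of f] f(1) by simp
qed

section \<open>Norms of functionals and the embedding into the bidual\<close>

lift_definition bidual :: "'a::real_normed_vector \<Rightarrow>\<^sub>L 'a dual dual"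
  is blinfun.prod_left by (rule blinfun.bounded_linear_prod_left)

lemma bidual_apply [simp]: "bidual x f = f x"
  by (simp add: bidual.rep_eq blinfun.prod_left.rep_eq)

lemma norm_le_dual:
  fixes x :: "'a::real_normed_vector"
  assumes "\<And>f::'a dual. norm f \<le> 1 \<Longrightarrow> \<bar>blinfun_apply f x\<bar> \<le> b"
  shows "norm x \<le> b"
proof -
  obtain f :: "'a dual" where "norm f \<le> 1" "f x = norm x" by (rule norming_functional)
  then show ?thesis using assms[of f] by simp
qed

lemma blinfun_le_norm:
  fixes f :: "'a::real_normed_vector dual"
  assumes "norm f \<le> 1"
  shows "\<bar>f x\<bar> \<le> norm x"
  using norm_blinfun[of f x] mult_right_mono[OF assms, of "norm x"] by auto

lemma norm_bidual [simp]: "norm (bidual x) = norm x"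
proof (rule antisym)
  show "norm (bidual x) \<le> norm x"
    using norm_blinfun[of _ x] by (intro norm_blinfun_bound) (auto simp: mult.commute[of "norm x"] simp del: real_norm_def)
  show "norm x \<le> norm (bidual x)"
  proof (rule norm_le_dual)
    fix f :: "'a dual" assume "norm f \<le> 1"
    then show "\<bar>f x\<bar> \<le> norm (bidual x)"
      using norm_blinfun[of "bidual x" f] mult_left_mono[of "norm f" 1 "norm (bidual x)"] by auto
  qed
qed

lemma norm_bidual_compose [simp]: "norm (bidual o\<^sub>L S) = norm S"
  by (simp add: norm_blinfun.rep_eq[of "bidual o\<^sub>L S"] norm_blinfun.rep_eq[of S] onorm_def)

lemma norm_dual_le:
  fixes f :: "'a::real_normed_vector dual"
  assumes "0 \<le> b" "\<And>x. norm x \<le> 1 \<Longrightarrow> f x \<le> b"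
  shows "norm f \<le> b"
proof (rule norm_blinfun_bound)
  fix x
  show "norm (f x) \<le> b * norm x"
  proof (cases "x = 0")
    case False
    have "f (x /\<^sub>R norm x) \<le> b" "f ((- x) /\<^sub>R norm x) \<le> b"
      using False by (auto intro!: assms(2))
    then have "f x \<le> b * norm x" "- f x \<le> b * norm x"
      using False by (simp_all add: blinfun.bilinear_simps field_simps)
    then show ?thesis by auto
  qed (simp add: blinfun.bilinear_simps)
qed fact

section \<open>Ordered normed spaces and their duals\<close>

text \<open>An order structure that Banach lattices have and that passes at once to spaces of
  operators, hence to all iterated duals. It stands in for the lattice structure of the duals, which
  is never constructed.\<close>

class cone_space = real_normed_vector + ord +
  assumes cone_le_iff: "x \<le> y \<longleftrightarrow> 0 \<le> y - x"
    and cone_zero: "0 \<le> 0"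
    and cone_add: "0 \<le> x \<Longrightarrow> 0 \<le> y \<Longrightarrow> 0 \<le> x + y"
    and cone_scaleR: "0 \<le> c \<Longrightarrow> 0 \<le> x \<Longrightarrow> 0 \<le> c *\<^sub>R x"

instance banach_lattice \<subseteq> cone_space
  by standard (simp_all add: scaleR_nonneg_nonneg)

subclass (in banach_lattice) lattice_ab_group_add ..

instance blinfun :: ("{real_normed_vector, ord}", cone_space) cone_space
proof
  fix f g :: "'a \<Rightarrow>\<^sub>L 'b" and c :: real
  show "f \<le> g \<longleftrightarrow> 0 \<le> g - f"
    unfolding less_eq_blinfun_def by (simp add: blinfun.bilinear_simps cone_le_iff[of "f _"])
  show "(0 :: 'a \<Rightarrow>\<^sub>L 'b) \<le> 0" by (simp add: less_eq_blinfun_def cone_zero)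
  show "0 \<le> f + g" if "0 \<le> f" "0 \<le> g"
    using that by (simp add: less_eq_blinfun_def blinfun.bilinear_simps cone_add)
  show "0 \<le> c *\<^sub>R f" if "0 \<le> c" "0 \<le> f"
    using that by (simp add: less_eq_blinfun_def blinfun.bilinear_simps cone_scaleR)
qed

lemma cone_sum:
  fixes f :: "'i \<Rightarrow> 'a::cone_space"
  assumes "\<And>i. i \<in> I \<Longrightarrow> 0 \<le> f i"
  shows "0 \<le> sum f I"
  using assms by (induction I rule: infinite_finite_induct) (auto simp: cone_zero cone_add)

lemma cone_trans:
  fixes x y z :: "'a::cone_space"
  assumes "x \<le> y" "y \<le> z"
  shows "x \<le> z"
  using cone_add[of "y - x" "z - y"] assms
  by (simp add: cone_le_iff[of x y] cone_le_iff[of y z] cone_le_iff[of x z])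

lemma cone_add_mono:
  fixes x y z w :: "'a::cone_space"
  assumes "x \<le> y" "z \<le> w"
  shows "x + z \<le> y + w"
  using cone_add[of "y - x" "w - z"] assms
  by (simp add: cone_le_iff[of x y] cone_le_iff[of z w] cone_le_iff[of "x + z"] algebra_simps)

lemma cone_refl: "x \<le> (x::'a::cone_space)"
  by (simp add: cone_le_iff[of x x] cone_zero)

lemma cone_scaleR_mono:
  fixes x y :: "'a::cone_space"
  assumes "0 \<le> c" "x \<le> y"
  shows "c *\<^sub>R x \<le> c *\<^sub>R y"
  using cone_scaleR[of c "y - x"] assms
  by (simp add: cone_le_iff[of x y] cone_le_iff[of "c *\<^sub>R x"] algebra_simps)

lemma cone_uminus_le:
  fixes x y :: "'a::cone_space"
  shows "x \<le> - y \<longleftrightarrow> y \<le> - x" "- x \<le> y \<longleftrightarrow> - y \<le> x"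
  by (simp_all add: cone_le_iff[of x "- y"] cone_le_iff[of y "- x"] cone_le_iff[of "- x" y]
      cone_le_iff[of "- y" x] minus_diff_commute add.commute)

lemma dual_nonnegD:
  fixes f :: "'a::{real_normed_vector,ord} dual"
  shows "0 \<le> f \<Longrightarrow> 0 \<le> x \<Longrightarrow> 0 \<le> f x"
  by (simp add: blinfun_nonneg_iff)

lemma dual_nonneg_mono:
  fixes f :: "'a::cone_space dual"
  assumes "0 \<le> f" "x \<le> y"
  shows "f x \<le> f y"
  using dual_nonnegD[OF assms(1), of "y - x"] assms(2)
  by (simp add: cone_le_iff[of x y] blinfun.bilinear_simps)

lemma bidual_nonneg:
  fixes x :: "'a::{real_normed_vector,ord}"
  shows "0 \<le> x \<Longrightarrow> 0 \<le> bidual x"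
  by (simp add: blinfun_nonneg_iff)

text \<open>Both parts hold in Banach lattices, and each part for a space gives the other for its dual.\<close>

definition regular_norm :: "'a::cone_space itself \<Rightarrow> bool"
  where "regular_norm _ \<longleftrightarrow>
    (\<forall>x::'a. \<exists>z. x \<le> z \<and> - x \<le> z \<and> norm z \<le> norm x) \<and>
    (\<forall>x y::'a. - y \<le> x \<longrightarrow> x \<le> y \<longrightarrow> norm x \<le> norm y)"

lemma regular_norm_modulus:
  fixes x :: "'a::cone_space"
  assumes "regular_norm TYPE('a)"
  obtains z where "x \<le> z" "- x \<le> z" "0 \<le> z" "norm z \<le> norm x"
proof -
  obtain z where z: "x \<le> z" "- x \<le> z" "norm z \<le> norm x"
    using assms unfolding regular_norm_def by blast
  have "0 \<le> (1/2) *\<^sub>R ((z - x) + (z - - x))"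
    using z by (intro cone_scaleR cone_add) (auto simp only: cone_le_iff[of x z] cone_le_iff[of "- x" z])
  then show thesis using that z by (simp add: algebra_simps flip: scaleR_2)
qed

lemma regular_norm_mono:
  fixes x y :: "'a::cone_space"
  assumes "regular_norm TYPE('a)" "0 \<le> x" "x \<le> y"
  shows "norm x \<le> norm y"
proof -
  have "0 \<le> x + y" using assms cone_add cone_trans by blast
  then have "- y \<le> x" by (simp add: cone_le_iff[of "- y"])
  then show ?thesis using assms unfolding regular_norm_def by blast
qed

lemma regular_norm_banach_lattice: "regular_norm TYPE('a::banach_lattice)"
  unfolding regular_norm_def
proof (intro conjI allI impI)
  fix x :: 'a
  have "0 \<le> sup x (- x)"
    using add_mono[OF sup_ge1[of x "- x"] sup_ge2[of "- x" x]]
    by (simp add: zero_le_double_add_iff_zero_le_single_add)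
  then have "sup (sup x (- x)) (- sup x (- x)) = sup x (- x)"
    by (intro sup_absorb1) (metis neg_le_0_iff_le order_trans)
  then have "norm (sup x (- x)) \<le> norm x" by (intro norm_mono_modulus) simp
  then show "\<exists>z. x \<le> z \<and> - x \<le> z \<and> norm z \<le> norm x"
    by (intro exI[of _ "sup x (- x)"]) simp
next
  fix x y :: 'a assume "- y \<le> x" "x \<le> y"
  then have "sup x (- x) \<le> y" by (simp add: minus_le_iff)
  then show "norm x \<le> norm y" by (intro norm_mono_modulus) (rule order_trans[OF _ sup_ge1])
qed

lemma regular_norm_dual:
  assumes Y: "regular_norm TYPE('y::cone_space)"
  shows "regular_norm TYPE('y dual)"
  unfolding regular_norm_def
proof (intro conjI allI impI)
  fix f :: "'y dual"
  \<comment> \<open>The lower bounds prescribed at \<open>x\<close> have as supremum the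
    Riesz-Kantorovich value of the modulus of \<open>f\<close>, the supremum of \<open>f\<close>
    over the order interval from \<open>- x\<close> to \<open>x\<close>. The Hahn-Banach theorem
    yields a dominating functional without additivity of that formula.\<close>
  let ?G = "{(x, b). \<exists>a. - x \<le> a \<and> a \<le> x \<and> b \<le> f a}"
  have G: "convex_cone_set ?G"
    unfolding convex_cone_set_def
  proof (intro conjI ballI allI impI)
    show "0 \<in> ?G" by (auto simp: zero_prod_def cone_zero blinfun.zero_right intro!: exI[of _ 0])
  next
    fix g h assume "g \<in> ?G" "h \<in> ?G"
    then obtain x b a x' b' a' where "g = (x, b)" "h = (x', b')" "- x \<le> a" "a \<le> x" "b \<le> f a"
      "- x' \<le> a'" "a' \<le> x'" "b' \<le> f a'" by blast
    then show "g + h \<in> ?G"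
      using cone_add_mono[of "- x" a "- x'" a'] cone_add_mono[of a x a' x']
      by (auto simp: blinfun.bilinear_simps algebra_simps intro!: exI[of _ "a + a'"])
  next
    fix g and c :: real assume "g \<in> ?G" "0 < c"
    then obtain x b a where "g = (x, b)" "- x \<le> a" "a \<le> x" "b \<le> f a" by blast
    then show "c *\<^sub>R g \<in> ?G"
      using cone_scaleR_mono[of c "- x" a] cone_scaleR_mono[of c a x] \<open>0 < c\<close>
      by (auto simp: blinfun.bilinear_simps intro!: exI[of _ "c *\<^sub>R a"])
  qed
  have bound: "b \<le> norm f * norm x" if xb: "(x, b) \<in> ?G" for x b
  proof -
    obtain a where a: "- x \<le> a" "a \<le> x" "b \<le> f a" using xb by blast
    have "norm a \<le> norm x" using Y a unfolding regular_norm_def by blast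
    then have "norm f * norm a \<le> norm f * norm x" by (simp add: mult_left_mono)
    then show ?thesis using a norm_blinfun[of f a] by auto
  qed
  obtain h :: "'y dual" where h: "norm h \<le> norm f" "\<And>x b. (x, b) \<in> ?G \<Longrightarrow> b \<le> h x"
    using hahn_banach_cone_dual[of ?G "norm f", OF G bound] by auto
  have "f x \<le> h x" "- f x \<le> h x" if "0 \<le> x" for x
  proof -
    have "- x \<le> x" using cone_add[OF that that] by (simp add: cone_le_iff[of "- x"])
    then have "(x, f x) \<in> ?G" "(x, - f x) \<in> ?G"
      by (auto simp: cone_refl blinfun.bilinear_simps intro: exI[of _ x] exI[of _ "- x"])
    then show "f x \<le> h x" "- f x \<le> h x" using h(2) by blast+
  qed
  then show "\<exists>h. f \<le> h \<and> - f \<le> h \<and> norm h \<le> norm f"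
    using h(1) by (auto simp: less_eq_blinfun_def blinfun.bilinear_simps intro!: exI[of _ h])
next
  fix a b :: "'y dual" assume ab: "- b \<le> a" "a \<le> b"
  show "norm a \<le> norm b"
  proof (rule norm_dual_le)
    fix x :: 'y assume x: "norm x \<le> 1"
    obtain y where y: "x \<le> y" "- x \<le> y" "norm y \<le> norm x"
      using Y unfolding regular_norm_def by blast
    have "0 \<le> y - x" "0 \<le> y + x" using y by (simp_all add: cone_le_iff[of x] cone_le_iff[of "- x"])
    \<comment> \<open>The vector \<open>x\<close> is half the difference of the positive vectors
      \<open>y + x\<close> and \<open>y - x\<close>; combining the two inequalities gives
      \<open>2 * a x \<le> 2 * b y\<close>.\<close>
    then have "a (y + x) \<le> b (y + x)" "- b (y - x) \<le> a (y - x)"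
      using ab by (auto simp: less_eq_blinfun_def blinfun.bilinear_simps)
    then have "a x \<le> b y" by (simp add: blinfun.bilinear_simps)
    also have "\<dots> \<le> norm b * norm y" using norm_blinfun[of b y] by simp
    also have "\<dots> \<le> norm b" using y x mult_left_mono[of "norm y" 1 "norm b"] by simp
    finally show "a x \<le> norm b" .
  qed simp
qed

text \<open>Uniform boundedness by a gliding hump. With \<open>norm (v n)\<close> above
  \<open>4 ^ n\<close>, moving the functional by \<open>(1/3) ^ n\<close> along plus or minus a
  norming functional makes its value at \<open>v n\<close> at least \<open>2/3\<close> of
  \<open>(1/3) ^ n * norm (v n)\<close>. All later moves together change this value by at most
  \<open>1/2\<close> of the same quantity, so \<open>1/6\<close> of it survives, which exceeds
  \<open>(1/6) * (4/3) ^ n\<close>.\<close>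

lemma weakly_bounded_imp_bounded:
  fixes V :: "'a::real_normed_vector set"
  assumes wb: "\<And>f::'a dual. \<exists>K. \<forall>v\<in>V. \<bar>blinfun_apply f v\<bar> \<le> K"
  shows "\<exists>K. \<forall>v\<in>V. norm v \<le> K"
proof (rule ccontr)
  assume unb: "\<not> ?thesis"
  have "\<forall>n::nat. \<exists>v. v \<in> V \<and> 4 ^ n < norm v" using unb by (meson not_le)
  then obtain v where v: "\<And>n::nat. v n \<in> V" "\<And>n. 4 ^ n < norm (v n)" by metis
  have step: "\<exists>g::'a dual. dist g f \<le> (1/3) ^ n \<and> (2/3) * (1/3) ^ n * norm (v n) \<le> \<bar>blinfun_apply g (v n)\<bar>" for f n
  proof -
    obtain h :: "'a dual" where h: "norm h \<le> 1" "h (v n) = norm (v n)" by (rule norming_functional)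
    let ?c = "(1/3::real) ^ n"
    have "dist (f + ?c *\<^sub>R h) f \<le> ?c" "dist (f - ?c *\<^sub>R h) f \<le> ?c"
      using h by (simp_all add: dist_norm)
    moreover have "?c * norm (v n) \<le> \<bar>(f + ?c *\<^sub>R h) (v n)\<bar> \<or> ?c * norm (v n) \<le> \<bar>(f - ?c *\<^sub>R h) (v n)\<bar>"
      using h(2) by (auto simp: blinfun.bilinear_simps)
    moreover have "(2/3) * ?c * norm (v n) \<le> ?c * norm (v n)" by (simp add: mult_right_mono)
    ultimately show ?thesis by (meson order_trans)
  qed
  then obtain G where G: "\<And>(f::'a dual) n. dist (G f n) f \<le> (1/3) ^ n"
    "\<And>f n. (2/3) * (1/3) ^ n * norm (v n) \<le> \<bar>blinfun_apply (G f n) (v n)\<bar>" by metis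
  define F where "F = rec_nat 0 (\<lambda>n f. G f n)"
  have F: "dist (F (Suc n)) (F n) \<le> (1/3) ^ n" "(2/3) * (1/3) ^ n * norm (v n) \<le> \<bar>F (Suc n) (v n)\<bar>" for n
    using G unfolding F_def by simp_all
  have dist_F: "dist (F (n + k)) (F n) \<le> (3/2) * (1/3) ^ n" for n k
  proof -
    have "dist (F (n + k)) (F n) \<le> (3/2) * (1/3) ^ n * (1 - (1/3) ^ k)"
    proof (induction k)
      case (Suc k)
      have "dist (F (n + Suc k)) (F n) \<le> dist (F (Suc (n + k))) (F (n + k)) + dist (F (n + k)) (F n)"
        by (simp add: dist_triangle)
      also have "\<dots> \<le> (1/3) ^ (n + k) + (3/2) * (1/3) ^ n * (1 - (1/3) ^ k)"
        using Suc F(1) by (intro add_mono) auto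
      also have "\<dots> = (3/2) * (1/3) ^ n * (1 - (1/3) ^ Suc k)" by (simp add: power_add field_simps)
      finally show ?case .
    qed simp
    also have "\<dots> \<le> (3/2) * (1/3) ^ n * 1" by (intro mult_left_mono) auto
    finally show ?thesis by simp
  qed
  have "Cauchy F"
  proof (rule metric_CauchyI)
    fix e :: real assume e: "0 < e"
    obtain N where "(1/3::real) ^ N < e / 3"
      using real_arch_pow_inv[of "e / 3" "1/3"] e by auto
    then have N: "(3/2) * (1/3) ^ N < e / 2" by simp
    have "dist (F m) (F N) < e / 2" if "N \<le> m" for m
      using dist_F[of N "m - N"] N that by simp
    then have "dist (F m) (F n) < e" if "N \<le> m" "N \<le> n" for m n
      using that dist_triangle_half_l by blast
    then show "\<exists>N. \<forall>m\<ge>N. \<forall>n\<ge>N. dist (F m) (F n) < e" by blast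
  qed
  then obtain f where f: "F \<longlonglongrightarrow> f" using Cauchy_convergent convergent_def by blast
  have dist_f: "dist f (F n) \<le> (3/2) * (1/3) ^ n" for n
  proof (rule LIMSEQ_le_const2)
    show "(\<lambda>k. dist (F k) (F n)) \<longlonglongrightarrow> dist f (F n)" using f by (intro tendsto_intros)
    show "\<exists>N. \<forall>k\<ge>N. dist (F k) (F n) \<le> (3/2) * (1/3) ^ n"
      using dist_F[of n] by (metis le_add_diff_inverse)
  qed
  obtain K where K: "\<And>n. \<bar>f (v n)\<bar> \<le> K" using wb[of f] v(1) by blast
  have "(1/6) * (4/3) ^ n \<le> K" for n
  proof -
    have "\<bar>F (Suc n) (v n) - f (v n)\<bar> \<le> dist f (F (Suc n)) * norm (v n)"
      using norm_blinfun[of "F (Suc n) - f" "v n"] by (simp add: blinfun.bilinear_simps dist_norm norm_minus_commute)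
    also have "\<dots> \<le> (3/2) * (1/3) ^ Suc n * norm (v n)" by (intro mult_right_mono dist_f) simp
    also have "\<dots> = (1/2) * ((1/3) ^ n * norm (v n))" by simp
    finally have "\<bar>F (Suc n) (v n) - f (v n)\<bar> \<le> (1/2) * ((1/3) ^ n * norm (v n))" .
    moreover have "(2/3) * ((1/3) ^ n * norm (v n)) \<le> \<bar>F (Suc n) (v n)\<bar>"
      using F(2)[of n] by (simp add: mult.assoc)
    ultimately have "(1/6) * ((1/3) ^ n * norm (v n)) \<le> K" using K[of n] by linarith
    moreover have "(1/3) ^ n * 4 ^ n \<le> (1/3) ^ n * norm (v n)"
      using v(2)[of n] by (intro mult_left_mono) auto
    ultimately show ?thesis by (simp add: power_mult_distrib[symmetric])
  qed
  then have "(4/3) ^ n \<le> 6 * K" for n by (simp add: field_simps)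
  moreover obtain n where "6 * K < (4/3::real) ^ n" using real_arch_pow[of "4/3" "6 * K"] by auto
  ultimately show False using not_le by blast
qed

section \<open>Finite rank operators and traces\<close>

lemma compact_insert_limit:
  fixes f :: "nat \<Rightarrow> 'a::topological_space"
  assumes f: "f \<longlonglongrightarrow> l"
  shows "compact (insert l (range f))"
proof (rule compactI)
  fix C assume C: "\<forall>t\<in>C. open t" "insert l (range f) \<subseteq> \<Union>C"
  then obtain t where t: "t \<in> C" "l \<in> t" by blast
  then have "\<forall>\<^sub>F n in sequentially. f n \<in> t" using C(1) topological_tendstoD[OF f] by blast
  then obtain N where N: "\<And>n. N \<le> n \<Longrightarrow> f n \<in> t" unfolding eventually_sequentially by blast
  have "\<forall>n. \<exists>s\<in>C. f n \<in> s" using C(2) by blast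
  then obtain g where g: "\<And>n. g n \<in> C" "\<And>n. f n \<in> g n" by metis
  have "insert l (range f) \<subseteq> \<Union>(insert t (g ` {..<N}))"
  proof
    fix x assume "x \<in> insert l (range f)"
    then consider "x = l" | n where "x = f n" by blast
    then show "x \<in> \<Union>(insert t (g ` {..<N}))"
    proof cases
      case (2 n)
      then show ?thesis using N[of n] g(2)[of n] by (cases "n < N") auto
    qed (use t in auto)
  qed
  then show "\<exists>C'\<subseteq>C. finite C' \<and> insert l (range f) \<subseteq> \<Union>C'"
    using g(1) t(1) by (intro exI[of _ "insert t (g ` {..<N})"]) auto
qed

lemma norm_blinfun_le_unit:
  fixes T :: "'a::real_normed_vector \<Rightarrow>\<^sub>L 'b::real_normed_vector"
  assumes "0 \<le> b" "\<And>x. norm x \<le> 1 \<Longrightarrow> norm (T x) \<le> b"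
  shows "norm T \<le> b"
proof (rule norm_blinfun_bound)
  fix x
  show "norm (T x) \<le> b * norm x"
  proof (cases "x = 0")
    case False
    have "norm (T (x /\<^sub>R norm x)) \<le> b" using False by (intro assms(2)) simp
    then show ?thesis using False by (simp add: blinfun.bilinear_simps field_simps)
  qed (simp add: blinfun.bilinear_simps)
qed fact

lemma rank_one_apply [simp]: "rank_one f x u = f u *\<^sub>R x"
  by (simp add: rank_one.rep_eq)

lemma rank_one_add_left: "rank_one (f + g) x = rank_one f x + rank_one g x"
  and rank_one_add_right: "rank_one f (x + y) = rank_one f x + rank_one f y"
  and rank_one_scaleR_left: "rank_one (c *\<^sub>R f) x = c *\<^sub>R rank_one f x"
  and rank_one_scaleR_right: "rank_one f (c *\<^sub>R x) = c *\<^sub>R rank_one f x"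
  and rank_one_diff_right: "rank_one f (x - y) = rank_one f x - rank_one f y"
  and rank_one_uminus_left: "rank_one (- f) x = - rank_one f x"
  and rank_one_0_left [simp]: "rank_one 0 x = 0"
  and rank_one_0_right [simp]: "rank_one f 0 = 0"
  by (rule blinfun_eqI; simp add: blinfun.bilinear_simps algebra_simps)+

lemma rank_one_sum_left: "rank_one (\<Sum>i\<in>I. f i) x = (\<Sum>i\<in>I. rank_one (f i) x)"
  by (rule blinfun_eqI) (simp add: blinfun.sum_left scaleR_sum_left)

lemma rank_one_sum_right: "rank_one f (\<Sum>i\<in>I. x i) = (\<Sum>i\<in>I. rank_one f (x i))"
  by (induction I rule: infinite_finite_induct) (auto simp: rank_one_add_right)

lemma blinfun_compose_rank_one: "T o\<^sub>L rank_one f x = rank_one f (T x)"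
  by (rule blinfun_eqI) (simp add: blinfun.bilinear_simps)

lemma blinfun_compose_sum_right: "T o\<^sub>L (\<Sum>i\<in>I. f i) = (\<Sum>i\<in>I. T o\<^sub>L f i)"
  by (rule blinfun_eqI) (simp add: blinfun.sum_left blinfun.sum_right)

lemma blinfun_compose_simps:
  "T o\<^sub>L (R + Q) = (T o\<^sub>L R) + (T o\<^sub>L Q)" "T o\<^sub>L (R - Q) = (T o\<^sub>L R) - (T o\<^sub>L Q)"
  "T o\<^sub>L (c *\<^sub>R R) = c *\<^sub>R (T o\<^sub>L R)" "T o\<^sub>L (- R) = - (T o\<^sub>L R)"
  by (rule blinfun_eqI; simp add: blinfun.bilinear_simps)+

text \<open>Coordinates on a span that are bounded on the whole space; with them finite rank
  operators become finite sums of \<open>rank_one\<close>, for which traces can be computed. A new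
  vector counts only through its component \<open>d\<close> outside the old span, which may be
  0.\<close>

lemma finite_dimensional_projection:
  fixes B :: "'a::real_normed_vector set"
  assumes "finite B"
  obtains n and \<phi> :: "nat \<Rightarrow> 'a dual" and b
  where "\<And>k. b k \<in> span B" "\<And>x. x \<in> span B \<Longrightarrow> (\<Sum>k<n. \<phi> k x *\<^sub>R b k) = x"
proof -
  have "\<exists>n (\<phi> :: nat \<Rightarrow> 'a dual) b. (\<forall>k. b k \<in> span B) \<and>
      (\<forall>x\<in>span B. (\<Sum>k<n. blinfun_apply (\<phi> k) x *\<^sub>R b k) = x)"
    using assms
  proof (induction B rule: finite_induct)
    case empty
    show ?case by (intro exI[of _ 0] exI[of _ "\<lambda>_. 0"]) auto
  next
    case (insert c B)
    then obtain n and \<phi> :: "nat \<Rightarrow> 'a dual" and b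
      where b: "\<And>k. b k \<in> span B" and \<phi>: "\<And>x. x \<in> span B \<Longrightarrow> (\<Sum>k<n. \<phi> k x *\<^sub>R b k) = x"
      by blast
    define P where "P = (\<Sum>k<n. rank_one (\<phi> k) (b k))"
    have P_apply: "P x = (\<Sum>k<n. \<phi> k x *\<^sub>R b k)" for x by (simp add: P_def blinfun.sum_left)
    have P_mem: "P x \<in> span B" for x
      unfolding P_apply using b by (intro span_sum span_scale) auto
    have P_id: "P x = x" if "x \<in> span B" for x using \<phi> that P_apply by simp
    define d where "d = c - P c"
    have span_insert: "\<exists>t. x - t *\<^sub>R d \<in> span B" if x: "x \<in> span (insert c B)" for x
    proof -
      obtain t where t: "x - t *\<^sub>R c \<in> span B" using span_breakdown_eq x by blast
      have "x - t *\<^sub>R d = (x - t *\<^sub>R c) + t *\<^sub>R P c" by (simp add: d_def algebra_simps)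
      also have "\<dots> \<in> span B" using t P_mem by (intro span_add span_scale)
      finally show ?thesis by blast
    qed
    have sub: "span B \<subseteq> span (insert c B)" by (intro span_mono) auto
    have d_mem: "d \<in> span (insert c B)"
      unfolding d_def using sub P_mem[of c] span_base[of c "insert c B"] by (blast intro: span_diff)
    show ?case
    proof (cases "d = 0")
      case True
      then have "span (insert c B) \<subseteq> span B" using span_insert by auto
      then show ?thesis using b \<phi> sub by blast
    next
      case False
      obtain f :: "'a dual" where f: "f d = norm d" by (rule norming_functional)
      \<comment> \<open>The factor \<open>id_blinfun - P\<close> makes \<open>\<psi>\<close> vanish
        on \<open>span B\<close>, and \<open>P d = 0\<close> makes its value at \<open>d\<close>
        equal to 1.\<close>
      define \<psi> where "\<psi> = (1 / norm d) *\<^sub>R (f o\<^sub>L (id_blinfun - P))"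
      have P_d: "P d = 0" unfolding d_def by (simp add: blinfun.bilinear_simps P_id[OF P_mem])
      have \<psi>_d: "\<psi> d = 1"
        using False by (simp add: \<psi>_def blinfun.bilinear_simps P_d f)
      have \<psi>_0: "\<psi> x = 0" if "x \<in> span B" for x
        using P_id[OF that] by (simp add: \<psi>_def blinfun.bilinear_simps)
      let ?\<phi> = "\<lambda>k. if k < n then \<phi> k else \<psi>" and ?b = "\<lambda>k. if k < n then b k else d"
      have id: "(\<Sum>k<Suc n. blinfun_apply (?\<phi> k) x *\<^sub>R ?b k) = x" if x: "x \<in> span (insert c B)" for x
      proof -
        have "(\<Sum>k<Suc n. ?\<phi> k x *\<^sub>R ?b k) = P x + \<psi> x *\<^sub>R d" by (simp add: P_apply)
        moreover obtain t where t: "x - t *\<^sub>R d \<in> span B" using span_insert[OF x] by blast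
        moreover have "P x = P (x - t *\<^sub>R d)" by (simp add: blinfun.bilinear_simps P_d)
        moreover have "\<psi> x = t" using \<psi>_0[OF t] by (simp add: blinfun.bilinear_simps \<psi>_d)
        ultimately show ?thesis using P_id[OF t] by simp
      qed
      have mem: "?b k \<in> span (insert c B)" for k using b sub d_mem by auto
      show ?thesis
        by (intro exI[of _ "Suc n"] exI[of _ ?\<phi>] exI[of _ ?b] conjI allI ballI mem id)
    qed
  qed
  then show thesis using that by blast
qed

lemma finite_rankE:
  fixes R :: "'a::real_normed_vector \<Rightarrow>\<^sub>L 'b::real_normed_vector"
  assumes "finite_rank R"
  obtains n :: nat and \<phi> b where "R = (\<Sum>k<n. rank_one (\<phi> k) (b k))"
proof -
  obtain B where B: "finite B" "range (blinfun_apply R) \<subseteq> span B"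
    using assms unfolding finite_rank_def by blast
  obtain n and \<phi> :: "nat \<Rightarrow> 'b dual" and b
    where \<phi>: "\<And>x. x \<in> span B \<Longrightarrow> (\<Sum>k<n. \<phi> k x *\<^sub>R b k) = x"
    using finite_dimensional_projection[OF B(1)] by metis
  have "R = (\<Sum>k<n. rank_one (\<phi> k o\<^sub>L R) (b k))"
  proof (rule blinfun_eqI)
    fix x
    have "R x \<in> span B" using B(2) by blast
    then show "R x = (\<Sum>k<n. rank_one (\<phi> k o\<^sub>L R) (b k)) x"
      using \<phi>[of "R x"] by (simp add: blinfun.sum_left)
  qed
  then show thesis by (rule that)
qed

lemma dual_map_blinfun_apply [simp]: "dual_map T f x = f (T x)"
  by (rule dual_map_apply)

text \<open>
  The two embeddings \<open>bidual\<close> and \<open>dual_map (dual_map bidual)\<close> of the bidual into the fourth dual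
  agree exactly on the space itself. Their difference is the adjoint of the projection of the third
  dual onto the annihilator of the space.
\<close>

definition bidual_defect :: "'x::real_normed_vector dual dual \<Rightarrow>\<^sub>L 'x dual dual dual dual"
  where "bidual_defect = bidual - dual_map (dual_map bidual)"

lemma bidual_defect_apply: "bidual_defect \<xi> h = h \<xi> - \<xi> (dual_map bidual h)"
  by (simp add: bidual_defect_def blinfun.bilinear_simps)

lemma bidual_defect_bidual [simp]: "bidual_defect (bidual x) = 0"
  by (rule blinfun_eqI) (simp add: bidual_defect_apply)

lemma norm_dual_map_bidual_le: "norm (dual_map bidual h) \<le> norm h"
proof (rule norm_blinfun_bound)
  fix x
  show "norm (dual_map bidual h x) \<le> norm h * norm x" using norm_blinfun[of h "bidual x"] by simp
qed simp

lemma norm_dual_map_dual_map_bidual_le: "norm (dual_map (dual_map bidual) \<xi>) \<le> norm \<xi>"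
proof (rule norm_blinfun_bound)
  fix h
  have "\<bar>\<xi> (dual_map bidual h)\<bar> \<le> norm \<xi> * norm (dual_map bidual h)" using norm_blinfun[of \<xi>] by simp
  also have "\<dots> \<le> norm \<xi> * norm h" by (intro mult_left_mono norm_dual_map_bidual_le) simp
  finally show "norm (dual_map (dual_map bidual) \<xi> h) \<le> norm \<xi> * norm h" by simp
qed simp

lemma dual_map_nonneg:
  fixes T :: "'a::{real_normed_vector,ord} \<Rightarrow>\<^sub>L 'b::{real_normed_vector,ord}"
  assumes "\<And>x. 0 \<le> x \<Longrightarrow> 0 \<le> T x" "0 \<le> f"
  shows "0 \<le> dual_map T f"
  using assms by (simp add: blinfun_nonneg_iff)

lemma dual_map_bidual_nonneg:
  fixes h :: "'x::{real_normed_vector,ord} dual dual dual"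
  shows "0 \<le> h \<Longrightarrow> 0 \<le> dual_map bidual h"
  by (intro dual_map_nonneg bidual_nonneg)

lemma dual_map_dual_map_bidual_nonneg:
  fixes \<xi> :: "'x::{real_normed_vector,ord} dual dual"
  shows "0 \<le> \<xi> \<Longrightarrow> 0 \<le> dual_map (dual_map bidual) \<xi>"
  by (intro dual_map_nonneg dual_map_bidual_nonneg)

section \<open>Traces along a series of rank one operators into the bidual\<close>

locale bidual_series =
  fixes S :: "'e::real_normed_vector \<Rightarrow>\<^sub>L 'x::real_normed_vector"
    and u :: "nat \<Rightarrow> 'e dual" and \<xi> :: "nat \<Rightarrow> 'x dual dual"
  assumes sums: "(\<lambda>j. rank_one (u j) (\<xi> j)) sums (bidual o\<^sub>L S)"
begin

text \<open>As \<open>h\<close> annihilates X, it kills \<open>bidual o\<^sub>L S\<close>; hence the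
  sum is \<open>h\<close> composed with the error of the \<open>m\<close>-th partial sum, and
  convergence in operator norm applies.\<close>

lemma annihilator_tendsto_0:
  fixes h :: "'x dual dual dual"
  assumes h: "\<And>x. h (bidual x) = 0"
  shows "(\<lambda>m. \<Sum>j<m. h (\<xi> j) *\<^sub>R u j) \<longlonglongrightarrow> 0"
proof (rule Lim_null_comparison)
  let ?A = "\<lambda>m. \<Sum>j<m. rank_one (u j) (\<xi> j)"
  show "\<forall>\<^sub>F m in sequentially. norm (\<Sum>j<m. h (\<xi> j) *\<^sub>R u j) \<le> norm h * norm (?A m - (bidual o\<^sub>L S))"
  proof (intro always_eventually allI norm_blinfun_bound)
    fix m e
    have "(\<Sum>j<m. h (\<xi> j) *\<^sub>R u j) e = h ((?A m - (bidual o\<^sub>L S)) e)"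
      by (simp add: blinfun.sum_left blinfun.sum_right blinfun.bilinear_simps h mult.commute)
    also have "norm \<dots> \<le> norm h * (norm (?A m - (bidual o\<^sub>L S)) * norm e)"
      by (rule order_trans[OF norm_blinfun]) (intro mult_left_mono norm_blinfun norm_ge_zero)
    finally show "norm ((\<Sum>j<m. h (\<xi> j) *\<^sub>R u j) e) \<le> norm h * norm (?A m - (bidual o\<^sub>L S)) * norm e"
      by (simp add: mult.assoc)
  qed simp
  have "(\<lambda>m. ?A m - (bidual o\<^sub>L S)) \<longlonglongrightarrow> 0"
    using sums unfolding sums_def by (simp add: LIM_zero)
  then show "(\<lambda>m. norm h * norm (?A m - (bidual o\<^sub>L S))) \<longlonglongrightarrow> 0"
    by (intro tendsto_mult_right_zero tendsto_norm_zero)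
qed

lemma annihilator_tendsto_0':
  fixes h :: "'x dual dual dual" and g :: "'e dual dual"
  assumes h: "\<And>x. h (bidual x) = 0"
  shows "(\<lambda>m. \<Sum>j<m. h (\<xi> j) * g (u j)) \<longlonglongrightarrow> 0"
proof -
  have "(\<lambda>m. g (\<Sum>j<m. h (\<xi> j) *\<^sub>R u j)) \<longlonglongrightarrow> g 0"
    by (intro blinfun.tendsto tendsto_const annihilator_tendsto_0 h)
  then show ?thesis by (simp add: blinfun.sum_right blinfun.bilinear_simps)
qed

text \<open>The sequence \<open>u j /\<^sub>R \<beta> j\<close> together with its limit 0 is
  compact, so some finite rank \<open>P\<close> moves it by less than \<open>\<epsilon>\<close>.
  Then \<open>u j - P (u j)\<close> is bounded by \<open>\<epsilon> * \<beta> j\<close>, and the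
  bound \<open>K\<close> for all sequences dominated by the weights makes its trace at most
  \<open>\<epsilon> * K\<close>. Thus the weights turn uniform approximation on a compact set into a
  small total error.\<close>

lemma defect_trace_approximation_property:
  fixes W :: "'e dual \<Rightarrow>\<^sub>L 'x dual dual dual" and \<beta> :: "nat \<Rightarrow> real"
  assumes AP: "approximation_property TYPE('e dual)"
    and \<beta>: "\<And>j. 0 < \<beta> j" "(\<lambda>j. u j /\<^sub>R \<beta> j) \<longlonglongrightarrow> 0"
    and K: "\<And>v m. (\<And>j. norm (v j) \<le> \<beta> j) \<Longrightarrow> \<bar>\<Sum>j<m. bidual_defect (\<xi> j) (W (v j))\<bar> \<le> K"
  shows "(\<lambda>m. \<Sum>j<m. bidual_defect (\<xi> j) (W (u j))) \<longlonglongrightarrow> 0"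
proof (rule LIMSEQ_I)
  fix r :: real assume r: "0 < r"
  have K0: "0 \<le> K" using K[of "\<lambda>_. 0" 0] \<beta>(1) by (simp add: less_imp_le)
  define \<epsilon> where "\<epsilon> = r / (2 * (K + 1))"
  have \<epsilon>: "0 < \<epsilon>" "\<epsilon> * K < r / 2" using r K0 by (simp_all add: \<epsilon>_def field_simps)
  have "compact (insert 0 (range (\<lambda>j. u j /\<^sub>R \<beta> j)))"
    by (rule compact_insert_limit[OF \<beta>(2)])
  then obtain P :: "'e dual \<Rightarrow>\<^sub>L 'e dual" where P: "finite_rank P"
    "\<And>j. norm (P (u j /\<^sub>R \<beta> j) - u j /\<^sub>R \<beta> j) < \<epsilon>"
    using AP \<epsilon>(1) unfolding approximation_property_def by (meson insertCI rangeI)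
  obtain n :: nat and \<phi> b where Psum: "P = (\<Sum>k<n. rank_one (\<phi> k) (b k))" by (rule finite_rankE[OF P(1)])
  \<comment> \<open>For finite rank \<open>P\<close> the trace splits into finitely many traces of
    rank one operators; their functionals on the bidual factor through \<open>bidual_defect\<close>
    and therefore annihilate X.\<close>
  have "(\<lambda>m. \<Sum>k<n. \<Sum>j<m. (bidual (W (b k)) o\<^sub>L bidual_defect) (\<xi> j) * \<phi> k (u j)) \<longlonglongrightarrow> (\<Sum>k<n. 0)"
    by (intro tendsto_sum annihilator_tendsto_0') (simp add: blinfun.bilinear_simps)
  also have "(\<lambda>m. \<Sum>k<n. \<Sum>j<m. (bidual (W (b k)) o\<^sub>L bidual_defect) (\<xi> j) * \<phi> k (u j)) =
      (\<lambda>m. \<Sum>j<m. bidual_defect (\<xi> j) (W (P (u j))))"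
    by (subst sum.swap) (simp add: Psum blinfun.sum_left blinfun.sum_right blinfun.bilinear_simps mult.commute)
  finally have lim: "(\<lambda>m. \<Sum>j<m. bidual_defect (\<xi> j) (W (P (u j)))) \<longlonglongrightarrow> 0" by simp
  obtain M where M: "\<And>m. M \<le> m \<Longrightarrow> \<bar>\<Sum>j<m. bidual_defect (\<xi> j) (W (P (u j)))\<bar> < r / 2"
    using LIMSEQ_D[OF lim, of "r / 2"] r by auto
  have close: "\<bar>\<Sum>j<m. bidual_defect (\<xi> j) (W (u j - P (u j)))\<bar> \<le> \<epsilon> * K" for m
  proof -
    have "norm ((u j - P (u j)) /\<^sub>R \<epsilon>) \<le> \<beta> j" for j
    proof -
      have "u j - P (u j) = - \<beta> j *\<^sub>R (P (u j /\<^sub>R \<beta> j) - u j /\<^sub>R \<beta> j)"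
        using \<beta>(1)[of j] by (simp add: blinfun.bilinear_simps algebra_simps)
      then have "norm (u j - P (u j)) = \<beta> j * norm (P (u j /\<^sub>R \<beta> j) - u j /\<^sub>R \<beta> j)"
        using \<beta>(1)[of j] by simp
      also have "\<dots> \<le> \<beta> j * \<epsilon>" using P(2)[of j] \<beta>(1)[of j] by (intro mult_left_mono) auto
      finally show ?thesis
        using \<epsilon>(1) by (simp only: norm_scaleR) (simp add: field_simps)
    qed
    then have "\<bar>\<Sum>j<m. bidual_defect (\<xi> j) (W ((u j - P (u j)) /\<^sub>R \<epsilon>))\<bar> \<le> K" by (rule K)
    then have "\<bar>(\<Sum>j<m. bidual_defect (\<xi> j) (W (u j - P (u j)))) / \<epsilon>\<bar> \<le> K"
      by (simp add: blinfun.scaleR_right divide_inverse mult.commute flip: sum_distrib_left)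
    then show ?thesis using \<epsilon>(1) by (simp add: field_simps)
  qed
  have "norm ((\<Sum>j<m. bidual_defect (\<xi> j) (W (u j))) - 0) < r" if "M \<le> m" for m
  proof -
    have "(\<Sum>j<m. bidual_defect (\<xi> j) (W (u j))) =
        (\<Sum>j<m. bidual_defect (\<xi> j) (W (u j - P (u j)))) + (\<Sum>j<m. bidual_defect (\<xi> j) (W (P (u j))))"
      by (simp add: blinfun.bilinear_simps flip: sum.distrib)
    then show ?thesis using close[of m] M[OF that] \<epsilon>(2) by (simp add: abs_if split: if_splits)
  qed
  then show "\<exists>M. \<forall>m\<ge>M. norm ((\<Sum>j<m. bidual_defect (\<xi> j) (W (u j))) - 0) < r" by blast
qed

end

text \<open>Now the vectors \<open>bidual_defect (\<xi> j)\<close> are approximated, but only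
  finitely many of them, so the tail must be controlled uniformly over the admissible operators. The
  set \<open>Z\<close> lets this control rely on \<open>R\<close> being close to the identity at
  further vectors chosen after \<open>r\<close>: none for finite exponents, two for the infinite
  one.\<close>

lemma (in bidual_series) defect_trace_positive_approximation_property:
  fixes W :: "'e dual \<Rightarrow>\<^sub>L 'x dual dual dual"
  fixes \<R> :: "('x dual dual dual dual \<Rightarrow>\<^sub>L 'x dual dual dual dual) set"
  assumes AP: "\<And>\<epsilon> Z. 0 < \<epsilon> \<Longrightarrow> compact Z \<Longrightarrow> \<exists>R\<in>\<R>. finite_rank R \<and> (\<forall>w\<in>Z. norm (R w - w) < \<epsilon>)"
    and tail: "\<And>r. 0 < r \<Longrightarrow> \<exists>N Z \<delta>. finite Z \<and> 0 < \<delta> \<and> (\<forall>R\<in>\<R>. (\<forall>w\<in>Z. norm (R w - w) < \<delta>) \<longrightarrow>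
      (\<forall>m\<ge>N. \<bar>\<Sum>j=N..<m. (bidual_defect (\<xi> j) - R (bidual_defect (\<xi> j))) (W (u j))\<bar> \<le> r))"
  shows "(\<lambda>m. \<Sum>j<m. bidual_defect (\<xi> j) (W (u j))) \<longlonglongrightarrow> 0"
proof (rule LIMSEQ_I)
  fix r :: real assume r: "0 < r"
  let ?D = "\<lambda>j. bidual_defect (\<xi> j)"
  have "0 < r / 4" using r by simp
  from tail[OF this] obtain N Z \<delta> where Z: "finite Z" "0 < \<delta>"
    and tl: "\<forall>R\<in>\<R>. (\<forall>w\<in>Z. norm (R w - w) < \<delta>) \<longrightarrow>
      (\<forall>m\<ge>N. \<bar>\<Sum>j=N..<m. (?D j - R (?D j)) (W (u j))\<bar> \<le> r / 4)"
    by (elim exE conjE)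
  \<comment> \<open>Accuracy \<open>r / (4 * s)\<close> at the first \<open>N\<close> vectors makes
    the head at most \<open>r / 4\<close>; the summand 1 keeps \<open>s\<close> positive.\<close>
  define s where "s = (\<Sum>j<N. norm (W (u j))) + 1"
  have s: "0 < s" unfolding s_def by (simp add: add_nonneg_pos sum_nonneg)
  have pos: "0 < min \<delta> (r / (4 * s))" using r s Z(2) by simp
  have "compact (Z \<union> ?D ` {..<N})" using Z by (intro finite_imp_compact) auto
  from AP[OF pos this] obtain R where R: "R \<in> \<R>" "finite_rank R"
    "\<And>w. w \<in> Z \<union> ?D ` {..<N} \<Longrightarrow> norm (R w - w) < min \<delta> (r / (4 * s))"
    by blast
  obtain n :: nat and \<phi> b where Rsum: "R = (\<Sum>k<n. rank_one (\<phi> k) (b k))" by (rule finite_rankE[OF R(2)])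
  have "(\<lambda>m. \<Sum>k<n. \<Sum>j<m. (\<phi> k o\<^sub>L bidual_defect) (\<xi> j) * (b k o\<^sub>L W) (u j)) \<longlonglongrightarrow> (\<Sum>k<n. 0)"
    by (intro tendsto_sum annihilator_tendsto_0') (simp add: blinfun.bilinear_simps)
  also have "(\<lambda>m. \<Sum>k<n. \<Sum>j<m. (\<phi> k o\<^sub>L bidual_defect) (\<xi> j) * (b k o\<^sub>L W) (u j)) =
      (\<lambda>m. \<Sum>j<m. R (?D j) (W (u j)))"
    by (subst sum.swap) (simp add: Rsum blinfun.sum_left blinfun.bilinear_simps)
  finally have lim: "(\<lambda>m. \<Sum>j<m. R (?D j) (W (u j))) \<longlonglongrightarrow> 0" by simp
  obtain M where M: "\<And>m. M \<le> m \<Longrightarrow> \<bar>\<Sum>j<m. R (?D j) (W (u j))\<bar> < r / 2"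
    using LIMSEQ_D[OF lim, of "r / 2"] r by auto
  have head: "\<bar>\<Sum>j<N. (?D j - R (?D j)) (W (u j))\<bar> \<le> r / 4"
  proof -
    have "\<bar>\<Sum>j<N. (?D j - R (?D j)) (W (u j))\<bar> \<le> (\<Sum>j<N. \<bar>(?D j - R (?D j)) (W (u j))\<bar>)" by (rule sum_abs)
    also have "\<dots> \<le> (\<Sum>j<N. r / (4 * s) * norm (W (u j)))"
    proof (rule sum_mono)
      fix j assume "j \<in> {..<N}"
      then have "norm (?D j - R (?D j)) \<le> r / (4 * s)" using R(3)[of "?D j"] by (simp add: norm_minus_commute)
      then have "norm (?D j - R (?D j)) * norm (W (u j)) \<le> r / (4 * s) * norm (W (u j))" by (rule mult_right_mono) simp
      then show "\<bar>(?D j - R (?D j)) (W (u j))\<bar> \<le> r / (4 * s) * norm (W (u j))"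
        using norm_blinfun[of "?D j - R (?D j)" "W (u j)"] by simp
    qed
    also have "\<dots> = r / (4 * s) * (s - 1)" by (simp add: s_def sum_distrib_left)
    also have "\<dots> \<le> r / (4 * s) * s" using r s by (intro mult_left_mono) auto
    finally show ?thesis using s by simp
  qed
  have "norm ((\<Sum>j<m. ?D j (W (u j))) - 0) < r" if m: "max M N \<le> m" for m
  proof -
    have "(\<Sum>j<m. f j) = (\<Sum>j<N. f j) + (\<Sum>j=N..<m. f j)" for f :: "nat \<Rightarrow> real"
      using m by (metis atLeast0LessThan le0 max.bounded_iff sum.atLeastLessThan_concat)
    then have "(\<Sum>j<m. (?D j - R (?D j)) (W (u j))) =
        (\<Sum>j<N. (?D j - R (?D j)) (W (u j))) + (\<Sum>j=N..<m. (?D j - R (?D j)) (W (u j)))" .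
    moreover have "(\<Sum>j<m. ?D j (W (u j))) =
        (\<Sum>j<m. (?D j - R (?D j)) (W (u j))) + (\<Sum>j<m. R (?D j) (W (u j)))"
      by (simp add: blinfun.bilinear_simps flip: sum.distrib)
    moreover have "\<bar>\<Sum>j=N..<m. (?D j - R (?D j)) (W (u j))\<bar> \<le> r / 4"
      using tl[rule_format, OF R(1), of m] R(3) m by simp
    moreover have "\<bar>\<Sum>j<m. R (?D j) (W (u j))\<bar> < r / 2" using M m by simp
    ultimately show ?thesis using head by (simp add: abs_if split: if_splits)
  qed
  then show "\<exists>M. \<forall>m\<ge>M. norm ((\<Sum>j<m. ?D j (W (u j))) - 0) < r" by blast
qed

section \<open>Finite tuples\<close>

lemma sum_lessThan_add:
  fixes f :: "nat \<Rightarrow> 'a::comm_monoid_add"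
  shows "(\<Sum>i<n + m. f i) = (\<Sum>i<n. f i) + (\<Sum>i<m. f (n + i))"
  by (induction m) (simp_all add: add.assoc)

definition seq_append :: "nat \<Rightarrow> (nat \<Rightarrow> 'a) \<Rightarrow> (nat \<Rightarrow> 'a) \<Rightarrow> nat \<Rightarrow> 'a"
  where "seq_append n u v i = (if i < n then u i else v (i - n))"

lemma seq_append_simps [simp]:
  "i < n \<Longrightarrow> seq_append n u v i = u i"
  "seq_append n u v (n + i) = v i"
  by (simp_all add: seq_append_def)

text \<open>Tuples of length \<open>M\<close> carry the maximum norm when they are realised as
  bounded continuous functions on the natural numbers. A functional on such functions restricts to a
  tuple of functionals whose norms add up to at most its norm.\<close>

lemma hahn_banach_tuple:
  fixes Z :: "((nat \<Rightarrow> 'y::real_normed_vector) \<times> real) set"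
  assumes zero: "(\<lambda>_. 0, 0) \<in> Z"
    and add: "\<And>z b z' b'. (z, b) \<in> Z \<Longrightarrow> (z', b') \<in> Z \<Longrightarrow> (\<lambda>k. z k + z' k, b + b') \<in> Z"
    and scale: "\<And>z b c. (z, b) \<in> Z \<Longrightarrow> 0 < c \<Longrightarrow> (\<lambda>k. c *\<^sub>R z k, c * b) \<in> Z"
    and bound: "\<And>z b m. (z, b) \<in> Z \<Longrightarrow> 0 \<le> m \<Longrightarrow> (\<And>k. k < M \<Longrightarrow> norm (z k) \<le> m) \<Longrightarrow> b \<le> K * m"
    and K: "0 \<le> K"
  obtains G :: "nat \<Rightarrow> 'y dual" where "(\<Sum>k<M. norm (G k)) \<le> K"
    and "\<And>z b. (z, b) \<in> Z \<Longrightarrow> b \<le> (\<Sum>k<M. G k (z k))"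
proof -
  have cont: "(\<lambda>j. if j = k then y else 0) \<in> bcontfun" for k :: nat and y :: 'y
    by (rule bcontfun_normI[of _ "norm y"]) auto
  define d :: "nat \<Rightarrow> 'y \<Rightarrow> (nat \<Rightarrow>\<^sub>C 'y)" where "d k y = Bcontfun (\<lambda>j. if j = k then y else 0)" for k y
  have d_apply: "apply_bcontfun (d k y) j = (if j = k then y else 0)" for k y j
    unfolding d_def using cont[of k y] by (simp add: Bcontfun_inverse)
  have d_lin: "bounded_linear (d k)" for k
  proof (rule bounded_linear_intro[of _ 1])
    show "norm (d k y) \<le> norm y * 1" for y by (rule norm_bound) (simp add: d_apply)
  qed (rule bcontfun_eqI; simp add: d_apply)+
  define \<delta> where "\<delta> k = Blinfun (d k)" for k
  have \<delta>_apply: "blinfun_apply (\<delta> k) y = d k y" for k y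
    by (simp add: \<delta>_def bounded_linear_Blinfun_apply[OF d_lin])
  define E where "E z = (\<Sum>k<M. \<delta> k (z k))" for z
  have E_apply: "apply_bcontfun (E z) j = (if j < M then z j else 0)" for z j
    unfolding E_def by (induction M) (auto simp: \<delta>_apply d_apply less_Suc_eq)
  have E_le: "norm (E z) \<le> m" if "\<And>k. k < M \<Longrightarrow> norm (z k) \<le> m" "0 \<le> m" for z m
    using that by (intro norm_bound) (simp add: E_apply)
  have le_E: "norm (z k) \<le> norm (E z)" if "k < M" for z k
    using norm_bounded[of "E z" k] that by (simp add: E_apply)
  let ?G = "(\<lambda>(z, b). (E z, b)) ` Z"
  have cone: "convex_cone_set ?G"
    unfolding convex_cone_set_def
  proof (intro conjI ballI allI impI)
    have "0 = (E (\<lambda>_. 0), 0::real)" by (simp add: E_def zero_prod_def)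
    then show "0 \<in> ?G" using zero by force
  next
    fix g h assume "g \<in> ?G" "h \<in> ?G"
    then obtain z b z' b' where *: "(z, b) \<in> Z" "(z', b') \<in> Z" "g = (E z, b)" "h = (E z', b')" by auto
    then have "g + h = (E (\<lambda>k. z k + z' k), b + b')"
      by (simp add: E_def blinfun.bilinear_simps sum.distrib)
    then show "g + h \<in> ?G" using add[OF *(1,2)] by force
  next
    fix g and c :: real assume "g \<in> ?G" "0 < c"
    then obtain z b where *: "(z, b) \<in> Z" "g = (E z, b)" by auto
    then have "c *\<^sub>R g = (E (\<lambda>k. c *\<^sub>R z k), c * b)"
      by (simp add: E_def blinfun.bilinear_simps scaleR_sum_right)
    then show "c *\<^sub>R g \<in> ?G" using scale[OF *(1) \<open>0 < c\<close>] by force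
  qed
  have "b \<le> K * norm v" if "(v, b) \<in> ?G" for v b
    using that bound le_E by auto
  from hahn_banach_cone_dual[OF cone this K] obtain \<phi> :: "(nat \<Rightarrow>\<^sub>C 'y) dual"
    where \<phi>: "norm \<phi> \<le> K" "\<And>v b. (v, b) \<in> ?G \<Longrightarrow> b \<le> \<phi> v" by blast
  define G where "G k = \<phi> o\<^sub>L \<delta> k" for k
  have \<phi>_E: "\<phi> (E z) = (\<Sum>k<M. G k (z k))" for z by (simp add: E_def G_def blinfun.sum_right)
  have "(\<Sum>k<M. norm (G k)) \<le> K"
  proof (rule ccontr)
    assume neg: "\<not> ?thesis"
    \<comment> \<open>The supposed excess over \<open>K\<close> is divided into \<open>M + 1\<close>
      parts, so that losing one part in each of the \<open>M\<close> coordinates still leaves a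
      contradiction.\<close>
    define e where "e = ((\<Sum>k<M. norm (G k)) - K) / (real M + 1)"
    have e: "0 < e" using neg by (simp add: e_def)
    have "\<exists>y. norm y \<le> 1 \<and> norm (G k) - e \<le> G k y" for k
    proof (rule ccontr)
      assume "\<nexists>y. norm y \<le> 1 \<and> norm (G k) - e \<le> G k y"
      then have *: "\<And>y. norm y \<le> 1 \<Longrightarrow> G k y \<le> norm (G k) - e" by force
      then have "0 \<le> norm (G k) - e" using *[of 0] by (simp add: blinfun.zero_right)
      then have "norm (G k) \<le> norm (G k) - e" by (rule norm_dual_le[OF _ *])
      then show False using e by simp
    qed
    then obtain z where z: "\<And>k. norm (z k) \<le> 1" "\<And>k. norm (G k) - e \<le> G k (z k)" by metis
    have "(\<Sum>k<M. norm (G k)) - real M * e = (\<Sum>k<M. norm (G k) - e)" by (simp add: sum_subtractf)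
    also have "\<dots> \<le> \<phi> (E z)" unfolding \<phi>_E by (intro sum_mono z)
    also have "\<dots> \<le> norm \<phi> * norm (E z)" using norm_blinfun[of \<phi> "E z"] by simp
    also have "\<dots> \<le> K * 1" using \<phi>(1) K E_le[of z 1] z by (intro mult_mono) auto
    finally have "(\<Sum>k<M. norm (G k)) - K \<le> real M * e" by simp
    also have "real M * e < (real M + 1) * e" using e by simp
    also have "\<dots> = (\<Sum>k<M. norm (G k)) - K" by (simp add: e_def)
    finally show False by simp
  qed
  moreover have "b \<le> (\<Sum>k<M. G k (z k))" if "(z, b) \<in> Z" for z b
    using \<phi>(2)[of "E z" b] that unfolding \<phi>_E by force
  ultimately show thesis by (rule that)
qed

lemma bilinear_form_blinfun:
  fixes B :: "'a::real_normed_vector \<Rightarrow> 'b::real_normed_vector \<Rightarrow> real"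
  assumes "\<And>x x' y. B (x + x') y = B x y + B x' y" "\<And>c x y. B (c *\<^sub>R x) y = c * B x y"
    and "\<And>x y y'. B x (y + y') = B x y + B x y'" "\<And>c x y. B x (c *\<^sub>R y) = c * B x y"
    and "\<And>x y. \<bar>B x y\<bar> \<le> K * (norm x * norm y)"
  obtains W :: "'a \<Rightarrow>\<^sub>L 'b dual" where "\<And>x y. W x y = B x y"
proof -
  interpret bb: bounded_bilinear "\<lambda>y x. B x y"
    using assms by unfold_locales (auto intro!: exI[of _ K] simp: ac_simps)
  show thesis
    using that[of "Blinfun bb.prod_left"]
    by (simp add: bounded_linear_Blinfun_apply bb.bounded_linear_prod_left bb.prod_left.rep_eq)
qed

text \<open>The weights are the reciprocal square roots of the tails \<open>r j\<close>: as
  \<open>a j = r j - r (Suc j)\<close>, the weighted terms are dominated by the differences of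
  \<open>2 * sqrt (r j)\<close>, which telescope.\<close>

lemma summable_growing_weights:
  fixes a :: "nat \<Rightarrow> real"
  assumes a: "summable a" "\<And>j. 0 < a j"
  obtains \<gamma> K where "\<And>j. 0 < \<gamma> j" "(\<lambda>j. 1 / \<gamma> j) \<longlonglongrightarrow> 0" "\<And>n. (\<Sum>j<n. \<gamma> j * a j) \<le> K"
proof -
  define r where "r j = (\<Sum>i. a (i + j))" for j
  have r_pos: "0 < r j" for j
    unfolding r_def using a by (intro suminf_pos) (simp_all add: summable_iff_shift)
  have r_Suc: "r j - r (Suc j) = a j" for j
    unfolding r_def using suminf_split_head[of "\<lambda>i. a (i + j)"] a(1) by (simp add: summable_iff_shift)
  have "r = (\<lambda>j. suminf a - (\<Sum>i<j. a i))"
    unfolding r_def using suminf_minus_initial_segment[OF a(1)] by auto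
  moreover have "(\<lambda>j. suminf a - (\<Sum>i<j. a i)) \<longlonglongrightarrow> suminf a - suminf a"
    by (intro tendsto_intros summable_LIMSEQ a)
  ultimately have "r \<longlonglongrightarrow> 0" by simp
  then have lim: "(\<lambda>j. sqrt (r j)) \<longlonglongrightarrow> 0" using tendsto_real_sqrt by fastforce
  have telescope: "1 / sqrt (r j) * a j \<le> 2 * sqrt (r j) - 2 * sqrt (r (Suc j))" for j
  proof -
    have mono: "sqrt (r (Suc j)) \<le> sqrt (r j)" using r_Suc[of j] a(2)[of j] by simp
    have "a j = (sqrt (r j) - sqrt (r (Suc j))) * (sqrt (r j) + sqrt (r (Suc j)))"
      using r_Suc[of j] r_pos[of j] r_pos[of "Suc j"] by (simp add: algebra_simps)
    also have "\<dots> \<le> (sqrt (r j) - sqrt (r (Suc j))) * (2 * sqrt (r j))"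
      using mono by (intro mult_left_mono) auto
    finally show ?thesis using r_pos[of j] by (simp add: field_simps)
  qed
  have "(\<Sum>j<n. 1 / sqrt (r j) * a j) \<le> 2 * sqrt (r 0) - 2 * sqrt (r n)" for n
  proof (induction n)
    case (Suc n)
    then show ?case using telescope[of n] by simp
  qed simp
  then have "(\<Sum>j<n. 1 / sqrt (r j) * a j) \<le> 2 * sqrt (r 0)" for n
    using r_pos[of n] by (smt (verit) real_sqrt_gt_zero)
  then show thesis
    using r_pos lim by (intro that[of "\<lambda>j. 1 / sqrt (r j)" "2 * sqrt (r 0)"]) simp_all
qed

section \<open>Representations for finite exponents\<close>

locale finite_exponent =
  fixes P :: real
  assumes P_ge_1: "1 \<le> P"
begin

text \<open>
  By Young's inequality this expresses that the weak \<open>\<ell>\<^sub>q\<close>-norm of the tuple is at most \<open>t\<^sup>1\<^sup>/\<^sup>q\<close>, where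
  \<open>q\<close> is conjugate to \<open>P\<close>. In this form the condition is additive in \<open>t\<close>.
\<close>

definition weak_bound :: "nat \<Rightarrow> (nat \<Rightarrow> 'y::real_normed_vector) \<Rightarrow> real \<Rightarrow> bool"
  where "weak_bound n y t \<longleftrightarrow>
    (\<forall>a::nat \<Rightarrow> real. norm (\<Sum>i<n. a i *\<^sub>R y i) \<le> (\<Sum>i<n. \<bar>a i\<bar> powr P) / P + t * (1 - 1 / P))"

lemma weak_boundD:
  "weak_bound n y t \<Longrightarrow>
    norm (\<Sum>i<n. a i *\<^sub>R y i) \<le> (\<Sum>i<n. \<bar>a i\<bar> powr P) / P + t * (1 - 1 / P)"
  unfolding weak_bound_def by blast

text \<open>The conjugate exponent enters only through its reciprocal \<open>1 - 1 / P\<close>,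
  which makes sense also for \<open>P = 1\<close>.\<close>

lemma young:
  assumes "0 \<le> x" "0 < t"
  shows "x * t powr (1 - 1 / P) \<le> x powr P / P + t * (1 - 1 / P)"
proof (cases "P = 1")
  case False
  then have P: "1 < P" using P_ge_1 by simp
  define q where "q = 1 / (1 - 1 / P)"
  have q: "1 < q" "1 / P + 1 / q = 1" using P by (simp_all add: q_def field_simps)
  have "x * t powr (1 - 1 / P) \<le> x powr P / P + (t powr (1 - 1 / P)) powr q / q"
    using assms P q by (intro Youngs_inequality) auto
  also have "(t powr (1 - 1 / P)) powr q = t" using assms P by (simp add: powr_powr q_def)
  finally show ?thesis by (simp add: q_def)
qed (use assms in simp)

text \<open>Young's inequality for \<open>t\<close> is sharp at \<open>x = t powr (1 / P)\<close>,
  so rescaling unit coefficients by this factor recovers the homogeneous bound from the additive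
  one.\<close>

lemma weak_bound_iff:
  assumes t: "0 < t"
  shows "weak_bound n y t \<longleftrightarrow>
    (\<forall>a::nat \<Rightarrow> real. (\<Sum>i<n. \<bar>a i\<bar> powr P) \<le> 1 \<longrightarrow> norm (\<Sum>i<n. a i *\<^sub>R y i) \<le> t powr (1 - 1 / P))"
proof (intro iffI allI impI)
  fix a :: "nat \<Rightarrow> real" assume wb: "weak_bound n y t" and a: "(\<Sum>i<n. \<bar>a i\<bar> powr P) \<le> 1"
  define s where "s = t powr (1 / P)"
  have s: "0 < s" "s powr P = t" using t P_ge_1 by (simp_all add: s_def powr_powr)
  have "s * norm (\<Sum>i<n. a i *\<^sub>R y i) = norm (\<Sum>i<n. (s * a i) *\<^sub>R y i)"
    using s(1) by (simp flip: scaleR_scaleR scaleR_sum_right)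
  also have "\<dots> \<le> (\<Sum>i<n. \<bar>s * a i\<bar> powr P) / P + t * (1 - 1 / P)"
    by (rule weak_boundD[OF wb])
  also have "(\<Sum>i<n. \<bar>s * a i\<bar> powr P) = t * (\<Sum>i<n. \<bar>a i\<bar> powr P)"
    using s by (simp add: abs_mult powr_mult sum_distrib_left)
  also have "t * (\<Sum>i<n. \<bar>a i\<bar> powr P) / P \<le> t * 1 / P"
    using a t P_ge_1 by (intro divide_right_mono mult_left_mono) auto
  finally have "s * norm (\<Sum>i<n. a i *\<^sub>R y i) \<le> t" by (simp add: algebra_simps)
  then have "norm (\<Sum>i<n. a i *\<^sub>R y i) \<le> t / s" using s by (simp add: field_simps)
  also have "t / s = t powr (1 - 1 / P)" using t by (simp add: s_def powr_diff)
  finally show "norm (\<Sum>i<n. a i *\<^sub>R y i) \<le> t powr (1 - 1 / P)" .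
next
  assume nb: "\<forall>a::nat \<Rightarrow> real. (\<Sum>i<n. \<bar>a i\<bar> powr P) \<le> 1 \<longrightarrow> norm (\<Sum>i<n. a i *\<^sub>R y i) \<le> t powr (1 - 1 / P)"
  show "weak_bound n y t"
    unfolding weak_bound_def
  proof
    fix a :: "nat \<Rightarrow> real"
    define \<alpha> where "\<alpha> = (\<Sum>i<n. \<bar>a i\<bar> powr P) powr (1 / P)"
    have sum0: "0 \<le> (\<Sum>i<n. \<bar>a i\<bar> powr P)" by (simp add: sum_nonneg)
    have \<alpha>P: "\<alpha> powr P = (\<Sum>i<n. \<bar>a i\<bar> powr P)" using sum0 P_ge_1 by (simp add: \<alpha>_def powr_powr)
    show "norm (\<Sum>i<n. a i *\<^sub>R y i) \<le> (\<Sum>i<n. \<bar>a i\<bar> powr P) / P + t * (1 - 1 / P)"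
    proof (cases "\<alpha> = 0")
      case True
      then have "(\<Sum>i<n. \<bar>a i\<bar> powr P) = 0" using \<alpha>P P_ge_1 by simp
      then have "\<And>i. i < n \<Longrightarrow> a i = 0" by (simp add: sum_nonneg_eq_0_iff)
      then have "(\<Sum>i<n. a i *\<^sub>R y i) = 0" by simp
      then show ?thesis using sum0 t P_ge_1 by simp
    next
      case False
      then have \<alpha>: "0 < \<alpha>" unfolding \<alpha>_def by simp
      have "(\<Sum>i<n. \<bar>a i / \<alpha>\<bar> powr P) = (\<Sum>i<n. \<bar>a i\<bar> powr P) / \<alpha> powr P"
        using \<alpha> by (simp add: abs_divide powr_divide sum_divide_distrib)
      also have "\<dots> = 1" unfolding \<alpha>P[symmetric] using \<alpha> by simp
      finally have "norm (\<Sum>i<n. (a i / \<alpha>) *\<^sub>R y i) \<le> t powr (1 - 1 / P)" using nb by simp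
      moreover have "(\<Sum>i<n. a i *\<^sub>R y i) = \<alpha> *\<^sub>R (\<Sum>i<n. (a i / \<alpha>) *\<^sub>R y i)"
        using \<alpha> by (simp add: scaleR_sum_right)
      ultimately have "norm (\<Sum>i<n. a i *\<^sub>R y i) \<le> \<alpha> * t powr (1 - 1 / P)"
        using \<alpha> by simp
      also have "\<dots> \<le> \<alpha> powr P / P + t * (1 - 1 / P)" using \<alpha> t by (intro young) auto
      finally show ?thesis by (simp add: \<alpha>P)
    qed
  qed
qed

lemma weak_bound_append:
  assumes "weak_bound n y s" "weak_bound m z t"
  shows "weak_bound (n + m) (seq_append n y z) (s + t)"
  unfolding weak_bound_def
proof
  fix a :: "nat \<Rightarrow> real"
  have "norm (\<Sum>i<n + m. a i *\<^sub>R seq_append n y z i) \<le>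
      norm (\<Sum>i<n. a i *\<^sub>R y i) + norm (\<Sum>i<m. a (n + i) *\<^sub>R z i)"
    by (simp add: sum_lessThan_add norm_triangle_ineq)
  also have "\<dots> \<le> ((\<Sum>i<n. \<bar>a i\<bar> powr P) / P + s * (1 - 1 / P)) +
      ((\<Sum>i<m. \<bar>a (n + i)\<bar> powr P) / P + t * (1 - 1 / P))"
    by (intro add_mono weak_boundD[OF assms(1)] weak_boundD[OF assms(2)])
  finally show "norm (\<Sum>i<n + m. a i *\<^sub>R seq_append n y z i) \<le>
      (\<Sum>i<n + m. \<bar>a i\<bar> powr P) / P + (s + t) * (1 - 1 / P)"
    unfolding sum_lessThan_add by (simp add: algebra_simps add_divide_distrib)
qed

lemma weak_bound_slice:
  assumes "weak_bound n y t" "k + m \<le> n"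
  shows "weak_bound m (\<lambda>i. y (k + i)) t"
  unfolding weak_bound_def
proof
  fix a :: "nat \<Rightarrow> real"
  define b where "b i = (if k \<le> i \<and> i < k + m then a (i - k) else 0)" for i
  have split: "(\<Sum>i<n. f i) = (\<Sum>i<m. f (k + i))"
    if "\<And>i. \<not> (k \<le> i \<and> i < k + m) \<Longrightarrow> f i = 0" for f :: "nat \<Rightarrow> 'b::comm_monoid_add"
  proof -
    obtain l where l: "n = (k + m) + l" using assms(2) le_Suc_ex by blast
    show ?thesis unfolding l sum_lessThan_add[of f "k + m" l] sum_lessThan_add[of f k m] using that by simp
  qed
  have "norm (\<Sum>i<n. b i *\<^sub>R y i) \<le> (\<Sum>i<n. \<bar>b i\<bar> powr P) / P + t * (1 - 1 / P)"
    using assms(1) unfolding weak_bound_def by blast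
  moreover have "(\<Sum>i<n. b i *\<^sub>R y i) = (\<Sum>i<m. b (k + i) *\<^sub>R y (k + i))"
    by (rule split) (auto simp: b_def)
  moreover have "(\<Sum>i<n. \<bar>b i\<bar> powr P) = (\<Sum>i<m. \<bar>b (k + i)\<bar> powr P)"
    by (rule split) (auto simp: b_def)
  moreover have "i < m \<Longrightarrow> b (k + i) = a i" for i by (simp add: b_def)
  ultimately show "norm (\<Sum>i<m. a i *\<^sub>R y (k + i)) \<le> (\<Sum>i<m. \<bar>a i\<bar> powr P) / P + t * (1 - 1 / P)"
    by (simp cong: sum.cong_simp)
qed

lemma weak_bound_mono: "weak_bound n y s \<Longrightarrow> s \<le> t \<Longrightarrow> weak_bound n y t"
  unfolding weak_bound_def using mult_right_mono[of s t "1 - 1 / P"] P_ge_1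
  by (force intro: order_trans)

lemma weak_bound_contraction:
  fixes T :: "'y::real_normed_vector \<Rightarrow>\<^sub>L 'z::real_normed_vector"
  assumes "weak_bound n y t" "\<And>x. norm (T x) \<le> norm x"
  shows "weak_bound n (\<lambda>i. blinfun_apply T (y i)) t"
  unfolding weak_bound_def
proof
  fix a :: "nat \<Rightarrow> real"
  have "norm (\<Sum>i<n. a i *\<^sub>R T (y i)) = norm (T (\<Sum>i<n. a i *\<^sub>R y i))"
    by (simp add: blinfun.sum_right blinfun.scaleR_right)
  also have "\<dots> \<le> norm (\<Sum>i<n. a i *\<^sub>R y i)" by (rule assms)
  also have "\<dots> \<le> (\<Sum>i<n. \<bar>a i\<bar> powr P) / P + t * (1 - 1 / P)"
    using assms(1) unfolding weak_bound_def by blast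
  finally show "norm (\<Sum>i<n. a i *\<^sub>R T (y i)) \<le> (\<Sum>i<n. \<bar>a i\<bar> powr P) / P + t * (1 - 1 / P)" .
qed

text \<open>A factor \<open>\<theta>\<close> of an operator is split into
  \<open>\<theta> powr (1 / P)\<close> for the functionals and the complementary power for the
  vectors; both halves of the cost are then multiplied by exactly \<open>\<theta>\<close>.\<close>

lemma weak_bound_scale:
  assumes "weak_bound n y t" "0 < \<theta>"
  shows "weak_bound n (\<lambda>i. \<theta> powr (1 - 1 / P) *\<^sub>R y i) (\<theta> * t)"
  unfolding weak_bound_def
proof
  fix a :: "nat \<Rightarrow> real"
  define s where "s = \<theta> powr (1 / P)"
  have s: "0 < s" "s powr P = \<theta>" "\<theta> powr (1 - 1 / P) = \<theta> / s"
    using assms(2) P_ge_1 by (simp_all add: s_def powr_powr powr_diff)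
  have "norm (\<Sum>i<n. a i *\<^sub>R \<theta> powr (1 - 1 / P) *\<^sub>R y i) = norm (\<theta> *\<^sub>R (\<Sum>i<n. (a i / s) *\<^sub>R y i))"
    by (simp add: scaleR_sum_right s(3) mult.commute)
  also have "\<dots> = \<theta> * norm (\<Sum>i<n. (a i / s) *\<^sub>R y i)" using assms(2) by simp
  also have "\<dots> \<le> \<theta> * ((\<Sum>i<n. \<bar>a i / s\<bar> powr P) / P + t * (1 - 1 / P))"
    using assms(2) by (intro mult_left_mono weak_boundD[OF assms(1)]) auto
  also have "(\<Sum>i<n. \<bar>a i / s\<bar> powr P) = (\<Sum>i<n. \<bar>a i\<bar> powr P) / \<theta>"
    using s by (simp add: abs_divide powr_divide sum_divide_distrib)
  finally show "norm (\<Sum>i<n. a i *\<^sub>R \<theta> powr (1 - 1 / P) *\<^sub>R y i) \<le>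
      (\<Sum>i<n. \<bar>a i\<bar> powr P) / P + \<theta> * t * (1 - 1 / P)"
    using assms(2) by (simp add: algebra_simps)
qed

text \<open>
  The analogue for this norm of the weak* density of the positive part of a ball in the positive
  part of the bidual ball.
\<close>

lemma weak_bound_bidual:
  fixes f :: "nat \<Rightarrow> 'y::cone_space dual" and w :: "nat \<Rightarrow> 'y dual dual"
  assumes t: "0 < t"
    and f: "\<And>y. (\<And>i. i < n \<Longrightarrow> 0 \<le> y i) \<Longrightarrow> weak_bound n y t \<Longrightarrow> (\<Sum>i<n. f i (y i)) \<le> \<kappa>"
    and w: "\<And>i. i < n \<Longrightarrow> 0 \<le> w i" "weak_bound n w t"
  shows "(\<Sum>i<n. w i (f i)) \<le> \<kappa>"
proof -
  define \<tau> where "\<tau> = t powr (1 - 1 / P)"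
  have \<tau>: "0 < \<tau>" using t by (simp add: \<tau>_def)
  have \<kappa>: "0 \<le> \<kappa>"
    using f[of "\<lambda>_. 0"] t P_ge_1 by (simp add: cone_zero weak_bound_def sum_nonneg blinfun.zero_right)
  have approx: "(\<Sum>i<n. w i (f i)) \<le> \<kappa> * (1 + real n / real N)" if N: "0 < N" for N :: nat
  proof -
    \<comment> \<open>The set \<open>A\<close> is a finite net of coefficients in the unit ball of
      \<ell>_P in dimension \<open>n\<close>. Through it the weak norm of a tuple is, up to the
      factor \<open>1 + n / N\<close>, a maximum of finitely many norms, to which
      \<open>hahn_banach_tuple\<close> applies.\<close>
    define grid where "grid = (\<lambda>k::int. real_of_int k / real N) ` {- int N..int N}"
    define A where "A = {a::nat \<Rightarrow> real. (\<forall>i. (i \<in> {..<n} \<longrightarrow> a i \<in> grid) \<and> (i \<notin> {..<n} \<longrightarrow> a i = 0)) \<and>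
      (\<Sum>i<n. \<bar>a i\<bar> powr P) \<le> 1}"
    have "finite A"
      unfolding A_def grid_def
      by (rule finite_subset[OF _ finite_set_of_finite_funs[of "{..<n}" "(\<lambda>k::int. real_of_int k / real N) ` {- int N..int N}" 0]]) auto
    then obtain M :: nat and g where g: "A = g ` {..<M}"
      by (metis finite_imp_nat_seg_image_inj_on lessThan_def)
    have in_A: "\<exists>k<M. g k = a" if "a \<in> A" for a using that g by auto
    have unit_in_A: "(\<lambda>i. if i = j then 1 else 0) \<in> A" if "j < n" for j
    proof -
      have "1 \<in> grid" unfolding grid_def using N by (intro image_eqI[of _ _ "int N"]) auto
      moreover have "0 \<in> grid" unfolding grid_def by (intro image_eqI[of _ _ 0]) auto
      moreover have "(\<Sum>i<n. \<bar>if i = j then 1 else 0 :: real\<bar> powr P) = (\<Sum>i<n. if i = j then 1 else 0)"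
        by (intro sum.cong) auto
      ultimately show ?thesis using that unfolding A_def by (auto simp del: abs_if)
    qed
    \<comment> \<open>Rounding towards 0 does not increase absolute values, so rounded coefficients
      remain in the unit ball and hence belong to the net.\<close>
    define rnd where "rnd x = real_of_int (if 0 \<le> x then \<lfloor>real N * x\<rfloor> else \<lceil>real N * x\<rceil>) / real N" for x :: real
    have rnd: "\<bar>rnd x\<bar> \<le> \<bar>x\<bar>" "\<bar>x - rnd x\<bar> \<le> 1 / real N" for x
    proof -
      have "\<bar>real_of_int (if 0 \<le> x then \<lfloor>real N * x\<rfloor> else \<lceil>real N * x\<rceil>)\<bar> \<le> real N * \<bar>x\<bar> \<and>
          \<bar>real N * x - real_of_int (if 0 \<le> x then \<lfloor>real N * x\<rfloor> else \<lceil>real N * x\<rceil>)\<bar> \<le> 1"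
      proof (cases "0 \<le> x")
        case True
        then have "0 \<le> \<lfloor>real N * x\<rfloor>" by simp
        then show ?thesis using True of_int_floor_le[of "real N * x"] real_of_int_floor_add_one_gt[of "real N * x"] by simp linarith
      next
        case False
        then have "\<lceil>real N * x\<rceil> \<le> 0" by (simp add: mult_nonneg_nonpos)
        then have "real_of_int \<lceil>real N * x\<rceil> \<le> 0" by simp
        then show ?thesis
          using False le_of_int_ceiling[of "real N * x"] of_int_ceiling_le_add_one[of "real N * x"] by simp linarith
      qed
      moreover have "x - rnd x = (real N * x - real_of_int (if 0 \<le> x then \<lfloor>real N * x\<rfloor> else \<lceil>real N * x\<rceil>)) / N"
        using N by (simp add: rnd_def diff_divide_distrib)
      ultimately show "\<bar>rnd x\<bar> \<le> \<bar>x\<bar>" "\<bar>x - rnd x\<bar> \<le> 1 / real N"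
        using N by (simp_all add: rnd_def abs_divide field_simps)
    qed
    have rnd_grid: "rnd x \<in> grid" if "\<bar>x\<bar> \<le> 1" for x
    proof -
      have "\<bar>rnd x\<bar> \<le> 1" using rnd(1)[of x] that by simp
      then have "\<bar>real_of_int (if 0 \<le> x then \<lfloor>real N * x\<rfloor> else \<lceil>real N * x\<rceil>)\<bar> \<le> real_of_int (int N)"
        using N by (simp add: rnd_def abs_divide field_simps)
      then show ?thesis unfolding grid_def rnd_def by (intro imageI) (auto simp: abs_le_iff)
    qed
    \<comment> \<open>The unit vectors belong to the net, so every \<open>norm (y j)\<close> is at
      most \<open>m\<close>; the rounding then costs at most \<open>n\<close> times
      \<open>m / N\<close>.\<close>
    have norm_net: "norm (\<Sum>i<n. a i *\<^sub>R y i) \<le> (1 + real n / real N) * m"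
      if m: "\<And>k. k < M \<Longrightarrow> norm (\<Sum>i<n. g k i *\<^sub>R y i) \<le> m" and a: "(\<Sum>i<n. \<bar>a i\<bar> powr P) \<le> 1"
      for y :: "nat \<Rightarrow> 'y" and m a
    proof -
      have y: "norm (y j) \<le> m" if j: "j < n" for j
      proof -
        obtain k where k: "k < M" "g k = (\<lambda>i. if i = j then 1 else 0)" using in_A unit_in_A[OF j] by blast
        have "(\<Sum>i<n. g k i *\<^sub>R y i) = (\<Sum>i<n. if i = j then y j else 0)"
          unfolding k by (intro sum.cong) auto
        then show ?thesis using m[OF k(1)] j by simp
      qed
      define a' where "a' i = (if i < n then rnd (a i) else 0)" for i
      have "\<bar>a i\<bar> \<le> 1" if "i < n" for i
      proof -
        have "\<bar>a i\<bar> powr P \<le> (\<Sum>i<n. \<bar>a i\<bar> powr P)" using that by (intro member_le_sum) auto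
        then have "\<bar>a i\<bar> powr P \<le> 1" using a by simp
        moreover have "1 < \<bar>a i\<bar> powr P" if "1 < \<bar>a i\<bar>" using that P_ge_1 by (intro gr_one_powr) auto
        ultimately show ?thesis by linarith
      qed
      moreover have "(\<Sum>i<n. \<bar>a' i\<bar> powr P) \<le> (\<Sum>i<n. \<bar>a i\<bar> powr P)"
        using rnd(1) P_ge_1 by (intro sum_mono powr_mono2) (auto simp: a'_def)
      ultimately have "a' \<in> A" using a rnd_grid by (auto simp: A_def a'_def)
      then obtain k where k: "k < M" "g k = a'" using in_A by blast
      have "(\<Sum>i<n. a i *\<^sub>R y i) = (\<Sum>i<n. a' i *\<^sub>R y i) + (\<Sum>i<n. (a i - a' i) *\<^sub>R y i)"
        by (simp add: algebra_simps flip: sum.distrib)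
      also have "norm \<dots> \<le> norm (\<Sum>i<n. a' i *\<^sub>R y i) + norm (\<Sum>i<n. (a i - a' i) *\<^sub>R y i)"
        by (rule norm_triangle_ineq)
      also have "\<dots> \<le> m + (\<Sum>i<n. 1 / real N * m)"
      proof (rule add_mono)
        show "norm (\<Sum>i<n. a' i *\<^sub>R y i) \<le> m" using m[OF k(1)] k(2) by simp
        have "norm ((a i - a' i) *\<^sub>R y i) \<le> 1 / real N * m" if i: "i \<in> {..<n}" for i
        proof -
          have "\<bar>a i - a' i\<bar> * norm (y i) \<le> 1 / real N * m"
            using rnd(2) y i by (intro mult_mono) (auto simp: a'_def)
          then show ?thesis by simp
        qed
        then show "norm (\<Sum>i<n. (a i - a' i) *\<^sub>R y i) \<le> (\<Sum>i<n. 1 / real N * m)"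
          by (rule sum_norm_le)
      qed
      also have "\<dots> = (1 + real n / real N) * m" by (simp add: algebra_simps)
      finally show ?thesis .
    qed
    define K where "K = \<kappa> * (1 + real n / real N) / \<tau>"
    have K: "0 \<le> K" using \<kappa> \<tau> by (simp add: K_def)
    let ?z = "\<lambda>y k. \<Sum>i<n. g k i *\<^sub>R y i"
    \<comment> \<open>Every positive tuple prescribes a lower bound at the vector of its net
      combinations. The functionals \<open>G k\<close> obtained from this satisfy
      \<open>f i \<le> (\<Sum>k<M. g k i *\<^sub>R G k)\<close> in the dual order, an inequality to
      which the positive \<open>w i\<close> can be applied.\<close>
    let ?Z = "{(?z y, \<Sum>i<n. f i (y i)) | y. \<forall>i<n. 0 \<le> y i}"
    obtain G :: "nat \<Rightarrow> 'y dual" where G: "(\<Sum>k<M. norm (G k)) \<le> K"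
      and G_ge: "\<And>z b. (z, b) \<in> ?Z \<Longrightarrow> b \<le> (\<Sum>k<M. G k (z k))"
    proof (rule hahn_banach_tuple[of ?Z M K])
      show "(\<lambda>_. 0, 0) \<in> ?Z"
        by (auto simp: cone_zero blinfun.zero_right intro!: exI[of _ "\<lambda>_. 0"])
    next
      fix z b z' b' assume "(z, b) \<in> ?Z" "(z', b') \<in> ?Z"
      then obtain y y' where "\<forall>i<n. 0 \<le> y i" "\<forall>i<n. 0 \<le> y' i" "z = ?z y" "z' = ?z y'"
        "b = (\<Sum>i<n. f i (y i))" "b' = (\<Sum>i<n. f i (y' i))" by auto
      then show "(\<lambda>k. z k + z' k, b + b') \<in> ?Z"
        by (auto simp: cone_add blinfun.bilinear_simps algebra_simps sum.distrib intro!: exI[of _ "\<lambda>i. y i + y' i"])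
    next
      fix z b and c :: real assume "(z, b) \<in> ?Z" and c: "0 < c"
      then obtain y where "\<forall>i<n. 0 \<le> y i" "z = ?z y" "b = (\<Sum>i<n. f i (y i))" by auto
      then show "(\<lambda>k. c *\<^sub>R z k, c * b) \<in> ?Z" using c
        by (auto simp: cone_scaleR blinfun.bilinear_simps scaleR_sum_right sum_distrib_left mult.commute
            intro!: exI[of _ "\<lambda>i. c *\<^sub>R y i"])
    next
      fix z b m assume "(z, b) \<in> ?Z" and m: "0 \<le> m" "\<And>k. k < M \<Longrightarrow> norm (z k) \<le> m"
      then obtain y where y: "\<forall>i<n. 0 \<le> y i" and z: "z = ?z y" and b: "b = (\<Sum>i<n. f i (y i))" by auto
      \<comment> \<open>The tuple is rescaled by a multiple of \<open>1 / m'\<close>; the case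
        \<open>m = 0\<close> is therefore reached only in the limit.\<close>
      have bound: "b \<le> K * m'" if m': "0 < m'" "m \<le> m'" for m'
      proof -
        define c where "c = \<tau> / ((1 + real n / real N) * m')"
        have "0 < 1 + real n / real N" by (simp add: add_pos_nonneg)
        then have c: "0 < c" using \<tau> m' by (simp add: c_def)
        have "weak_bound n (\<lambda>i. c *\<^sub>R y i) t"
          unfolding weak_bound_iff[OF t] \<tau>_def[symmetric]
        proof (intro allI impI)
          fix a :: "nat \<Rightarrow> real" assume "(\<Sum>i<n. \<bar>a i\<bar> powr P) \<le> 1"
          then have "norm (\<Sum>i<n. a i *\<^sub>R y i) \<le> (1 + real n / real N) * m'"
            using norm_net[of y m' a] m(2) m'(2) z by (meson order_trans)
          then have "c * norm (\<Sum>i<n. a i *\<^sub>R y i) \<le> c * ((1 + real n / real N) * m')"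
            using c by (intro mult_left_mono) auto
          also have "c * ((1 + real n / real N) * m') = \<tau>" using m'(1) \<open>0 < 1 + real n / real N\<close> by (simp add: c_def)
          finally have "c * norm (\<Sum>i<n. a i *\<^sub>R y i) \<le> \<tau>" .
          moreover have "(\<Sum>i<n. a i *\<^sub>R c *\<^sub>R y i) = c *\<^sub>R (\<Sum>i<n. a i *\<^sub>R y i)"
            by (simp add: scaleR_sum_right mult.commute)
          ultimately show "norm (\<Sum>i<n. a i *\<^sub>R c *\<^sub>R y i) \<le> \<tau>"
            using c by simp
        qed
        then have "(\<Sum>i<n. f i (c *\<^sub>R y i)) \<le> \<kappa>" using y c by (intro f) (auto simp: cone_scaleR)
        then have "c * b \<le> \<kappa>" by (simp add: b blinfun.bilinear_simps sum_distrib_left)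
        then have "b \<le> \<kappa> / c" using c by (simp add: field_simps)
        also have "\<kappa> / c = K * m'" by (simp add: c_def K_def)
        finally show ?thesis .
      qed
      show "b \<le> K * m"
      proof (rule field_le_epsilon)
        fix e :: real assume e: "0 < e"
        have "b \<le> K * (m + e / (K + 1))" using e K m(1) by (intro bound) (auto intro: add_nonneg_pos)
        also have "\<dots> \<le> K * m + e" using e K by (simp add: field_simps)
        finally show "b \<le> K * m + e" .
      qed
    qed (use K in auto)
    have f_le: "f i y \<le> (\<Sum>k<M. g k i * G k y)" if i: "i < n" and y: "0 \<le> y" for i y
    proof -
      let ?y = "\<lambda>j. if j = i then y else 0"
      have "(?z ?y, \<Sum>j<n. f j (?y j)) \<in> ?Z" using y by (auto simp: cone_zero intro!: exI[of _ ?y])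
      then have "(\<Sum>j<n. f j (?y j)) \<le> (\<Sum>k<M. G k (?z ?y k))" by (rule G_ge)
      moreover have "(\<Sum>j<n. f j (?y j)) = (\<Sum>j<n. if j = i then f i y else 0)"
        by (intro sum.cong) (auto simp: blinfun.zero_right)
      moreover have "?z ?y k = (\<Sum>j<n. if j = i then g k i *\<^sub>R y else 0)" for k
        by (intro sum.cong) auto
      ultimately show ?thesis using i by (simp add: blinfun.bilinear_simps)
    qed
    have "(\<Sum>i<n. w i (f i)) \<le> (\<Sum>i<n. w i (\<Sum>k<M. g k i *\<^sub>R G k))"
    proof (rule sum_mono)
      fix i assume i: "i \<in> {..<n}"
      then have "f i \<le> (\<Sum>k<M. g k i *\<^sub>R G k)"
        using f_le by (auto simp: less_eq_blinfun_def blinfun.sum_left blinfun.bilinear_simps)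
      then show "w i (f i) \<le> w i (\<Sum>k<M. g k i *\<^sub>R G k)" using w(1) i by (intro dual_nonneg_mono) auto
    qed
    also have "\<dots> = (\<Sum>k<M. (\<Sum>i<n. g k i *\<^sub>R w i) (G k))"
      by (simp add: blinfun.sum_left blinfun.sum_right blinfun.bilinear_simps) (rule sum.swap)
    also have "\<dots> \<le> (\<Sum>k<M. \<tau> * norm (G k))"
    proof (rule sum_mono)
      fix k assume "k \<in> {..<M}"
      then have "(\<Sum>i<n. \<bar>g k i\<bar> powr P) \<le> 1" using g by (auto simp: A_def)
      then have "norm (\<Sum>i<n. g k i *\<^sub>R w i) \<le> \<tau>" using w(2) unfolding weak_bound_iff[OF t] \<tau>_def by blast
      then have "norm (\<Sum>i<n. g k i *\<^sub>R w i) * norm (G k) \<le> \<tau> * norm (G k)" by (rule mult_right_mono) simp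
      then show "(\<Sum>i<n. g k i *\<^sub>R w i) (G k) \<le> \<tau> * norm (G k)"
        using norm_blinfun[of "\<Sum>i<n. g k i *\<^sub>R w i" "G k"] by simp
    qed
    also have "\<dots> \<le> \<tau> * K" using G \<tau> by (simp flip: sum_distrib_left)
    also have "\<dots> = \<kappa> * (1 + real n / real N)" using \<tau> by (simp add: K_def)
    finally show ?thesis .
  qed
  have "(\<lambda>N. \<kappa> * (1 + real n / real (Suc N))) \<longlonglongrightarrow> \<kappa> * (1 + 0)"
    by (intro tendsto_intros LIMSEQ_Suc lim_const_over_n)
  then show ?thesis
    using approx[OF zero_less_Suc]
    by (intro LIMSEQ_le_const[of "\<lambda>N. \<kappa> * (1 + real n / real (Suc N))"]) auto
qed

end

lemma tail_sums_small:
  fixes a :: "nat \<Rightarrow> real"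
  assumes a: "\<And>j. 0 \<le> a j" "\<And>n. (\<Sum>j<n. a j) \<le> c" and e: "0 < e"
  obtains N where "\<And>n m. N \<le> n \<Longrightarrow> (\<Sum>i<m. a (n + i)) \<le> e"
proof -
  have sa: "summable a" by (rule summableI_nonneg_bounded[OF a])
  obtain N where N: "\<And>n. N \<le> n \<Longrightarrow> \<bar>(\<Sum>j<n. a j) - suminf a\<bar> < e"
    using LIMSEQ_D[OF summable_LIMSEQ[OF sa] e] by auto
  have "(\<Sum>i<m. a (n + i)) \<le> e" if "N \<le> n" for n m
  proof -
    have "(\<Sum>i<m. a (n + i)) = (\<Sum>j<n + m. a j) - (\<Sum>j<n. a j)" by (simp add: sum_lessThan_add)
    also have "(\<Sum>j<n + m. a j) \<le> suminf a" by (rule sum_le_suminf[OF sa]) (use a in auto)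
    finally show ?thesis using N[OF that] by linarith
  qed
  then show thesis by (rule that)
qed

text \<open>An upper bound for positive \<open>y\<close> is all that a gauge of positive
  representations provides. It becomes two-sided because \<open>x\<close> may change sign, and it
  extends to every \<open>y\<close> as a difference of two positive vectors of no larger norm, at
  the price of the factor 2.\<close>

lemma positive_form_blinfun:
  fixes B :: "'a::real_normed_vector \<Rightarrow> 'y::cone_space \<Rightarrow> real"
  assumes Y: "regular_norm TYPE('y)"
    and B: "\<And>x x' y. B (x + x') y = B x y + B x' y" "\<And>c x y. B (c *\<^sub>R x) y = c * B x y"
      "\<And>x y y'. B x (y + y') = B x y + B x y'" "\<And>c x y. B x (c *\<^sub>R y) = c * B x y"
    and bound: "\<And>x y. 0 \<le> y \<Longrightarrow> B x y \<le> K * (norm x * norm y)"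
    and K: "0 \<le> K"
  obtains W :: "'a \<Rightarrow>\<^sub>L 'y dual" where "\<And>x y. W x y = B x y"
proof -
  have *: "B x y \<le> (2 * K) * (norm x * norm y)" for x y
  proof -
    obtain z where z: "y \<le> z" "- y \<le> z" "norm z \<le> norm y" using regular_norm_modulus[OF Y, of y] by metis
    define p q where "p = (1 / 2) *\<^sub>R (z + y)" and "q = (1 / 2) *\<^sub>R (z - y)"
    have pq: "0 \<le> p" "0 \<le> q"
      using z unfolding p_def q_def cone_le_iff[of y z] cone_le_iff[of "- y" z]
      by (auto intro!: cone_scaleR)
    have y: "y = p + (- 1) *\<^sub>R q" by (simp add: p_def q_def algebra_simps flip: scaleR_2)
    have np: "norm p \<le> norm y" "norm q \<le> norm y"
      using norm_triangle_ineq[of z y] norm_triangle_ineq4[of z y] z(3) by (simp_all add: p_def q_def)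
    have "B x y = B x p + (- 1) * B x q" by (subst y) (simp only: B)
    also have "\<dots> = B x p + B ((- 1) *\<^sub>R x) q" by (simp only: B)
    also have "\<dots> \<le> K * (norm x * norm p) + K * (norm x * norm q)"
      using bound[OF pq(1), of x] bound[OF pq(2), of "(- 1) *\<^sub>R x"] by simp
    also have "\<dots> \<le> K * (norm x * norm y) + K * (norm x * norm y)"
      using K np by (intro add_mono mult_left_mono) auto
    finally show ?thesis by simp
  qed
  have "\<bar>B x y\<bar> \<le> (2 * K) * (norm x * norm y)" for x y
    using *[of x y] *[of "(- 1) *\<^sub>R x" y] B(2)[of "- 1" x y] by simp
  from bilinear_form_blinfun[OF B this] show thesis using that by blast
qed

section \<open>Representations with an additive cost\<close>

context finite_exponent
begin

text \<open>One number bounds both the \<open>P\<close>-th powers of the functionals and the weak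
  norm of the vectors. Moving a scalar from one side to the other brings a product of norms into
  this balanced form, since \<open>t powr (1 / P) * t powr (1 - 1 / P) = t\<close> for positive
  \<open>t\<close>, and the balanced cost is additive under concatenation.\<close>

definition fin_rep :: "('e::real_normed_vector \<Rightarrow>\<^sub>L 'y::{real_normed_vector,ord}) \<Rightarrow> real \<Rightarrow> bool"
  where "fin_rep T t \<longleftrightarrow> (\<exists>n v y. (\<forall>i<n. 0 \<le> y i) \<and> (\<Sum>i<n. norm (v i) powr P) \<le> t \<and>
    weak_bound n y t \<and> T = (\<Sum>i<n. rank_one (v i) (y i)))"

definition series_rep ::
  "('e::real_normed_vector \<Rightarrow>\<^sub>L 'y::{real_normed_vector,ord}) \<Rightarrow> real \<Rightarrow> (nat \<Rightarrow> 'e dual) \<Rightarrow> (nat \<Rightarrow> 'y) \<Rightarrow> bool"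
  where "series_rep T t u \<xi> \<longleftrightarrow> (\<forall>j. 0 \<le> \<xi> j) \<and> (\<forall>n. (\<Sum>j<n. norm (u j) powr P) \<le> t) \<and>
    (\<forall>n. weak_bound n \<xi> t) \<and> (\<lambda>j. rank_one (u j) (\<xi> j)) sums T"

lemma fin_repI:
  assumes "\<And>i. i < n \<Longrightarrow> 0 \<le> y i" "(\<Sum>i<n. norm (v i) powr P) \<le> t" "weak_bound n y t"
    "T = (\<Sum>i<n. rank_one (v i) (y i))"
  shows "fin_rep T t"
  using assms unfolding fin_rep_def by blast

lemma fin_repE:
  fixes T :: "'e::real_normed_vector \<Rightarrow>\<^sub>L 'y::{real_normed_vector,ord}"
  assumes "fin_rep T t"
  obtains n v y where "\<And>i. i < n \<Longrightarrow> 0 \<le> y i" "(\<Sum>i<n. norm (v i) powr P) \<le> t"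
    "weak_bound n y t" "T = (\<Sum>i<n. rank_one (v i) (y i))"
  using assms unfolding fin_rep_def by blast

lemma fin_rep_nonneg:
  assumes "fin_rep T t"
  shows "0 \<le> t"
proof -
  obtain n v y where "\<And>i. i < n \<Longrightarrow> 0 \<le> y i" "(\<Sum>i<n. norm (v i) powr P) \<le> t"
    "weak_bound n y t" "T = (\<Sum>i<n. rank_one (v i) (y i))" by (rule fin_repE[OF assms], rule that)
  moreover have "0 \<le> (\<Sum>i<n. norm (v i) powr P)" by (simp add: sum_nonneg)
  ultimately show ?thesis by linarith
qed

lemma fin_rep_0: "fin_rep 0 0"
  by (rule fin_repI[of 0 "\<lambda>_. undefined" "\<lambda>_. undefined"]) (simp_all add: weak_bound_def)

lemma fin_rep_mono: "fin_rep T s \<Longrightarrow> s \<le> t \<Longrightarrow> fin_rep T t"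
  unfolding fin_rep_def using weak_bound_mono order_trans by blast

lemma fin_rep_add:
  assumes "fin_rep T s" "fin_rep T' t"
  shows "fin_rep (T + T') (s + t)"
proof -
  obtain n v y where 1: "\<And>i. i < n \<Longrightarrow> 0 \<le> y i" "(\<Sum>i<n. norm (v i) powr P) \<le> s" "weak_bound n y s"
    "T = (\<Sum>i<n. rank_one (v i) (y i))" by (rule fin_repE[OF assms(1)], rule that)
  obtain m w z where 2: "\<And>i. i < m \<Longrightarrow> 0 \<le> z i" "(\<Sum>i<m. norm (w i) powr P) \<le> t" "weak_bound m z t"
    "T' = (\<Sum>i<m. rank_one (w i) (z i))" by (rule fin_repE[OF assms(2)], rule that)
  show ?thesis
  proof (rule fin_repI[of "n + m" "seq_append n y z" "seq_append n v w"])
    show "0 \<le> seq_append n y z i" if "i < n + m" for i using 1 2 that by (auto simp: seq_append_def)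
    show "(\<Sum>i<n + m. norm (seq_append n v w i) powr P) \<le> s + t"
      using 1 2 by (simp add: sum_lessThan_add add_mono)
    show "weak_bound (n + m) (seq_append n y z) (s + t)" by (rule weak_bound_append[OF 1(3) 2(3)])
    show "T + T' = (\<Sum>i<n + m. rank_one (seq_append n v w i) (seq_append n y z i))"
      using 1 2 by (simp add: sum_lessThan_add)
  qed
qed

lemma fin_rep_scaleR:
  fixes T :: "'e::real_normed_vector \<Rightarrow>\<^sub>L 'y::cone_space"
  assumes "fin_rep T t" "0 < c"
  shows "fin_rep (c *\<^sub>R T) (c * t)"
proof -
  obtain n v y where 1: "\<And>i. i < n \<Longrightarrow> 0 \<le> y i" "(\<Sum>i<n. norm (v i) powr P) \<le> t" "weak_bound n y t"
    "T = (\<Sum>i<n. rank_one (v i) (y i))" by (rule fin_repE[OF assms(1)], rule that)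
  show ?thesis
  proof (rule fin_repI[of n "\<lambda>i. c powr (1 - 1 / P) *\<^sub>R y i" "\<lambda>i. c powr (1 / P) *\<^sub>R v i"])
    show "0 \<le> c powr (1 - 1 / P) *\<^sub>R y i" if "i < n" for i using 1 that by (intro cone_scaleR) auto
    have "(\<Sum>i<n. norm (c powr (1 / P) *\<^sub>R v i) powr P) = c * (\<Sum>i<n. norm (v i) powr P)"
      using assms(2) P_ge_1 by (simp add: powr_mult powr_powr sum_distrib_left)
    then show "(\<Sum>i<n. norm (c powr (1 / P) *\<^sub>R v i) powr P) \<le> c * t" using 1(2) assms(2) by simp
    show "weak_bound n (\<lambda>i. c powr (1 - 1 / P) *\<^sub>R y i) (c * t)" by (rule weak_bound_scale[OF 1(3) assms(2)])
    have "c powr (1 / P) * c powr (1 - 1 / P) = c" using assms(2) by (simp flip: powr_add)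
    then show "c *\<^sub>R T = (\<Sum>i<n. rank_one (c powr (1 / P) *\<^sub>R v i) (c powr (1 - 1 / P) *\<^sub>R y i))"
      by (simp add: 1(4) rank_one_scaleR_left rank_one_scaleR_right scaleR_sum_right mult.commute)
  qed
qed

lemma fin_rep_uminus:
  assumes "fin_rep T t"
  shows "fin_rep (- T) t"
proof -
  obtain n v y where 1: "\<And>i. i < n \<Longrightarrow> 0 \<le> y i" "(\<Sum>i<n. norm (v i) powr P) \<le> t" "weak_bound n y t"
    "T = (\<Sum>i<n. rank_one (v i) (y i))" by (rule fin_repE[OF assms(1)], rule that)
  show ?thesis
    by (rule fin_repI[of n y "\<lambda>i. - v i"]) (use 1 in \<open>simp_all add: rank_one_uminus_left sum_negf\<close>)
qed

lemma fin_rep_norm: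
  fixes T :: "'a::real_normed_vector \<Rightarrow>\<^sub>L 'y::{real_normed_vector,ord}"
  assumes "fin_rep T t"
  shows "norm T \<le> t"
proof (rule norm_blinfun_le_unit[OF fin_rep_nonneg[OF assms]])
  fix e :: 'a assume e: "norm e \<le> 1"
  obtain n v y where "\<And>i. i < n \<Longrightarrow> 0 \<le> y i" and 1: "(\<Sum>i<n. norm (v i) powr P) \<le> t" "weak_bound n y t"
    "T = (\<Sum>i<n. rank_one (v i) (y i))" by (rule fin_repE[OF assms(1)], rule that)
  have le: "norm (T e) \<le> (\<Sum>i<n. \<bar>v i e\<bar> powr P) / P + t * (1 - 1 / P)"
    unfolding 1(3) by (simp add: blinfun.sum_left weak_boundD[OF 1(2)])
  have "(\<Sum>i<n. \<bar>v i e\<bar> powr P) \<le> (\<Sum>i<n. norm (v i) powr P)"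
  proof (rule sum_mono)
    fix i
    have "norm (v i) * norm e \<le> norm (v i)" using e by (simp add: mult_left_le)
    then have "\<bar>v i e\<bar> \<le> norm (v i)" using norm_blinfun[of "v i" e] by simp
    then show "\<bar>v i e\<bar> powr P \<le> norm (v i) powr P" using P_ge_1 by (intro powr_mono2) auto
  qed
  then have "(\<Sum>i<n. \<bar>v i e\<bar> powr P) / P \<le> t / P" using 1(1) P_ge_1 by (intro divide_right_mono) auto
  then have "norm (T e) \<le> t / P + t * (1 - 1 / P)" using le by linarith
  then show "norm (T e) \<le> t" by (simp add: algebra_simps)
qed

lemma fin_rep_rank_one:
  fixes y :: "'y::cone_space"
  assumes y: "0 \<le> y"
  shows "fin_rep (rank_one u y) (norm u * norm y)"
proof (cases "u = 0 \<or> y = 0")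
  case True
  then show ?thesis using fin_rep_0 by auto
next
  case False
  define t where "t = norm u * norm y"
  have t: "0 < t" using False by (simp add: t_def)
  show ?thesis
    unfolding t_def[symmetric]
  proof (rule fin_repI[of 1 "\<lambda>_. (t powr (1 - 1 / P) / norm y) *\<^sub>R y" "\<lambda>_. (t powr (1 / P) / norm u) *\<^sub>R u"])
    show "0 \<le> (t powr (1 - 1 / P) / norm y) *\<^sub>R y" using y by (intro cone_scaleR) auto
    show "(\<Sum>i<1::nat. norm ((t powr (1 / P) / norm u) *\<^sub>R u) powr P) \<le> t"
      using False t P_ge_1 by (simp add: powr_powr)
    show "weak_bound 1 (\<lambda>_. (t powr (1 - 1 / P) / norm y) *\<^sub>R y) t"
      unfolding weak_bound_def
      using young[OF abs_ge_zero t] False by (simp add: abs_mult)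
    define a b where "a = t powr (1 / P) / norm u" and "b = t powr (1 - 1 / P) / norm y"
    have "t powr (1 / P) * t powr (1 - 1 / P) = t" using t by (simp flip: powr_add)
    then have "a * b = 1" using False by (simp add: a_def b_def t_def)
    then show "rank_one u y = (\<Sum>i<1::nat. rank_one ((t powr (1 / P) / norm u) *\<^sub>R u) ((t powr (1 - 1 / P) / norm y) *\<^sub>R y))"
      unfolding a_def[symmetric] b_def[symmetric]
      by (simp add: rank_one_scaleR_left rank_one_scaleR_right mult.commute[of b a])
  qed
qed

lemma series_rep_prefix: "series_rep T t u \<xi> \<Longrightarrow> fin_rep (\<Sum>j<m. rank_one (u j) (\<xi> j)) t"
  unfolding series_rep_def by (intro fin_repI[of m \<xi> u]) auto

lemma series_rep_norm:
  assumes "series_rep T t u \<xi>"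
  shows "norm T \<le> t"
proof (rule LIMSEQ_le_const2)
  show "(\<lambda>m. norm (\<Sum>j<m. rank_one (u j) (\<xi> j))) \<longlonglongrightarrow> norm T"
    using assms unfolding series_rep_def sums_def by (intro tendsto_norm) auto
  show "\<exists>N. \<forall>m\<ge>N. norm (\<Sum>j<m. rank_one (u j) (\<xi> j)) \<le> t"
    using fin_rep_norm[OF series_rep_prefix[OF assms]] by blast
qed

lemma series_rep_prepend:
  assumes "fin_rep B s" "series_rep T t u \<xi>"
  shows "\<exists>u' \<xi>'. series_rep (B + T) (s + t) u' \<xi>'"
proof -
  obtain n v y where 1: "\<And>i. i < n \<Longrightarrow> 0 \<le> y i" "(\<Sum>i<n. norm (v i) powr P) \<le> s" "weak_bound n y s"
    "B = (\<Sum>i<n. rank_one (v i) (y i))" by (rule fin_repE[OF assms(1)], rule that)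
  have 2: "\<And>j. 0 \<le> \<xi> j" "\<And>n. (\<Sum>j<n. norm (u j) powr P) \<le> t" "\<And>n. weak_bound n \<xi> t"
    "(\<lambda>j. rank_one (u j) (\<xi> j)) sums T" using assms(2) unfolding series_rep_def by auto
  have "series_rep (B + T) (s + t) (seq_append n v u) (seq_append n y \<xi>)"
    unfolding series_rep_def
  proof (intro conjI allI)
    show "0 \<le> seq_append n y \<xi> j" for j using 1 2 by (auto simp: seq_append_def)
    show "(\<Sum>j<m. norm (seq_append n v u j) powr P) \<le> s + t" for m
    proof -
      have "(\<Sum>j<m. norm (seq_append n v u j) powr P) \<le> (\<Sum>j<n + m. norm (seq_append n v u j) powr P)"
        by (intro sum_mono2) auto
      also have "\<dots> \<le> s + t" using 1(2) 2(2)[of m] by (simp add: sum_lessThan_add add_mono)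
      finally show ?thesis .
    qed
    show "weak_bound m (seq_append n y \<xi>) (s + t)" for m
      using weak_bound_slice[OF weak_bound_append[OF 1(3) 2(3)[of m]], of 0 m] by simp
    have "(\<lambda>j. rank_one (seq_append n v u (j + n)) (seq_append n y \<xi> (j + n))) sums T"
      using 2(4) by (simp add: add.commute[of _ n])
    then have "(\<lambda>j. rank_one (seq_append n v u j) (seq_append n y \<xi> j)) sums
        (T + (\<Sum>j<n. rank_one (seq_append n v u j) (seq_append n y \<xi> j)))"
      by (rule sums_iff_shift[THEN iffD1])
    then show "(\<lambda>j. rank_one (seq_append n v u j) (seq_append n y \<xi> j)) sums (B + T)"
      by (simp add: 1(4) add.commute)
  qed
  then show ?thesis by blast
qed

text \<open>A trace bound for tuples in the space passes to its bidual by
  \<open>weak_bound_bidual\<close>, applied to the functionals \<open>W (v i)\<close>. The factor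
  \<open>l\<close> records that small \<open>v i\<close> give a small trace even if the
  \<open>w i\<close> only satisfy the bound \<open>c\<close>; this is the situation in the
  tails.\<close>

lemma trace_form_bidual:
  fixes W :: "'e::real_normed_vector dual \<Rightarrow>\<^sub>L 'y::cone_space dual" and w :: "nat \<Rightarrow> 'y dual dual"
  assumes c: "0 < c"
    and W: "\<And>n v y. (\<And>i. i < n \<Longrightarrow> 0 \<le> y i) \<Longrightarrow> (\<Sum>i<n. norm (v i) powr P) \<le> c \<Longrightarrow>
      weak_bound n y c \<Longrightarrow> (\<Sum>i<n. blinfun_apply (W (v i)) (y i)) \<le> c"
    and l: "0 < l" and v: "(\<Sum>i<n. norm (v i) powr P) \<le> l powr P * c"
    and w: "\<And>i. i < n \<Longrightarrow> 0 \<le> w i" "weak_bound n w c"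
  shows "\<bar>\<Sum>i<n. w i (W (v i))\<bar> \<le> l * c"
proof -
  have *: "(\<Sum>i<n. w i (W (v i))) \<le> l * c" if v: "(\<Sum>i<n. norm (v i) powr P) \<le> l powr P * c" for v
  proof (rule weak_bound_bidual[OF c _ w])
    fix y :: "nat \<Rightarrow> 'y" assume y: "\<And>i. i < n \<Longrightarrow> 0 \<le> y i" "weak_bound n y c"
    have "(\<Sum>i<n. norm (v i /\<^sub>R l) powr P) = (\<Sum>i<n. norm (v i) powr P) / l powr P"
      using l by (simp add: powr_divide sum_divide_distrib flip: divide_inverse_commute)
    also have "\<dots> \<le> c" using v l by (simp add: field_simps)
    finally have "(\<Sum>i<n. W (v i /\<^sub>R l) (y i)) \<le> c" by (intro W y)
    then have "(\<Sum>i<n. W (v i) (y i)) / l \<le> c"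
      by (simp add: blinfun.bilinear_simps divide_inverse mult.commute flip: sum_distrib_left)
    then show "(\<Sum>i<n. W (v i) (y i)) \<le> l * c" using l by (simp add: field_simps)
  qed auto
  show ?thesis
    using *[OF v] *[of "\<lambda>i. - v i"] v by (simp add: blinfun.bilinear_simps sum_negf)
qed

end

text \<open>The vectors \<open>bidual_defect (\<xi> j)\<close> are not positive, but each of the two
  embeddings preserves positivity and weak bounds, so every estimate is made for the two embeddings
  separately.\<close>

lemma (in finite_exponent) defect_trace_tendsto_0:
  fixes S :: "'e::real_normed_vector \<Rightarrow>\<^sub>L 'x::cone_space" and W :: "'e dual \<Rightarrow>\<^sub>L 'x dual dual dual"
  assumes rep: "series_rep (bidual o\<^sub>L S) c u \<xi>" and c: "0 < c"
    and W: "\<And>n v y. (\<And>i. i < n \<Longrightarrow> 0 \<le> y i) \<Longrightarrow> (\<Sum>i<n. norm (v i) powr P) \<le> c \<Longrightarrow>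
      weak_bound n y c \<Longrightarrow> (\<Sum>i<n. blinfun_apply (W (v i)) (y i)) \<le> c"
    and AP: "approximation_property TYPE('e dual) \<or>
      positive_metric_approximation_property TYPE('x dual dual dual dual)"
  shows "(\<lambda>m. \<Sum>j<m. bidual_defect (\<xi> j) (blinfun_apply W (u j))) \<longlonglongrightarrow> 0"
proof -
  have \<xi>: "\<And>j. 0 \<le> \<xi> j" "\<And>n. weak_bound n \<xi> c" and u: "\<And>n. (\<Sum>j<n. norm (u j) powr P) \<le> c"
    using rep unfolding series_rep_def by auto
  interpret bidual_series S u \<xi> using rep unfolding series_rep_def by unfold_locales auto
  have bd1: "weak_bound n (\<lambda>j. bidual (y j)) c" if "weak_bound n y c" for n and y :: "nat \<Rightarrow> 'x dual dual"
    by (rule weak_bound_contraction[OF that]) simp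
  have bd2: "weak_bound n (\<lambda>j. dual_map (dual_map bidual) (y j)) c"
    if "weak_bound n y c" for n and y :: "nat \<Rightarrow> 'x dual dual"
    by (rule weak_bound_contraction[OF that]) (rule norm_dual_map_dual_map_bidual_le)
  have form: "\<bar>\<Sum>i<n. w i (W (v i))\<bar> \<le> l * c"
    if l: "0 < l" "(\<Sum>i<n. norm (v i) powr P) \<le> l powr P * c" and w: "\<And>i. 0 \<le> w i" "weak_bound n w c"
    for n l and v :: "nat \<Rightarrow> 'e dual" and w :: "nat \<Rightarrow> 'x dual dual dual dual"
    by (rule trace_form_bidual[OF c _ l w], rule W)
  from AP show ?thesis
  proof
    assume AP: "approximation_property TYPE('e dual)"
    \<comment> \<open>The summand \<open>(1/2) ^ j\<close> keeps the weights positive where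
      \<open>u j\<close> vanishes.\<close>
    define a where "a j = norm (u j) powr P + (1/2) ^ j" for j
    have "summable (\<lambda>j. norm (u j) powr P)" using u by (intro summableI_nonneg_bounded) auto
    then have sa: "summable a" unfolding a_def by (intro summable_add) auto
    have a0: "0 < a j" for j unfolding a_def by (intro add_nonneg_pos) auto
    obtain \<gamma> K where \<gamma>: "\<And>j. 0 < \<gamma> j" "(\<lambda>j. 1 / \<gamma> j) \<longlonglongrightarrow> 0" "\<And>n. (\<Sum>j<n. \<gamma> j * a j) \<le> K"
      by (rule summable_growing_weights[OF sa a0], rule that)
    \<comment> \<open>Normalises the weights: sequences dominated by \<open>\<beta>\<close> have
      cost at most \<open>c\<close>, while \<open>u j /\<^sub>R \<beta> j\<close> still tends to 0
      because \<open>\<gamma> j\<close> tends to infinity.\<close>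
    define \<theta> where "\<theta> = c / max K 1"
    have \<theta>: "0 < \<theta>" using c by (simp add: \<theta>_def)
    define \<beta> where "\<beta> j = (\<theta> * (\<gamma> j * a j)) powr (1 / P)" for j
    have \<beta>: "0 < \<beta> j" "\<beta> j powr P = \<theta> * (\<gamma> j * a j)" for j
      using \<theta> \<gamma>(1)[of j] a0[of j] P_ge_1 by (simp_all add: \<beta>_def powr_powr)
    have sum_\<beta>: "(\<Sum>j<n. \<beta> j powr P) \<le> c" for n
    proof -
      have "(\<Sum>j<n. \<beta> j powr P) = \<theta> * (\<Sum>j<n. \<gamma> j * a j)" by (simp add: \<beta> sum_distrib_left)
      also have "\<dots> \<le> \<theta> * max K 1" using \<gamma>(3)[of n] \<theta> by (intro mult_left_mono) auto
      finally show ?thesis by (simp add: \<theta>_def)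
    qed
    show ?thesis
    proof (rule defect_trace_approximation_property[OF AP \<beta>(1), where K = "2 * c"])
      show "(\<lambda>j. u j /\<^sub>R \<beta> j) \<longlonglongrightarrow> 0"
      proof (rule Lim_null_comparison)
        have "norm (u j /\<^sub>R \<beta> j) \<le> ((1 / \<theta>) * (1 / \<gamma> j)) powr (1 / P)" for j
        proof -
          have "norm (u j /\<^sub>R \<beta> j) = ((norm (u j) / \<beta> j) powr P) powr (1 / P)"
            using \<beta>(1)[of j] P_ge_1 by (simp add: powr_powr divide_inverse_commute)
          also have "(norm (u j) / \<beta> j) powr P = norm (u j) powr P / \<beta> j powr P"
            using \<beta>(1)[of j] by (simp add: powr_divide)
          also have "(norm (u j) powr P / \<beta> j powr P) powr (1 / P) \<le> ((1 / \<theta>) * (1 / \<gamma> j)) powr (1 / P)"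
          proof (rule powr_mono2)
            have "norm (u j) powr P / \<beta> j powr P \<le> a j / \<beta> j powr P"
              by (intro divide_right_mono) (auto simp: a_def)
            also have "\<dots> = (1 / \<theta>) * (1 / \<gamma> j)" using a0[of j] by (simp add: \<beta>(2))
            finally show "norm (u j) powr P / \<beta> j powr P \<le> (1 / \<theta>) * (1 / \<gamma> j)" .
          qed (use P_ge_1 in auto)
          finally show ?thesis .
        qed
        then show "\<forall>\<^sub>F j in sequentially. norm (u j /\<^sub>R \<beta> j) \<le> ((1 / \<theta>) * (1 / \<gamma> j)) powr (1 / P)"
          by (intro always_eventually) blast
        show "(\<lambda>j. ((1 / \<theta>) * (1 / \<gamma> j)) powr (1 / P)) \<longlonglongrightarrow> 0"
          using \<theta> \<gamma>(1) P_ge_1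
          by (intro tendsto_zero_powrI[where b = "1 / P"] tendsto_mult_right_zero \<gamma>(2) tendsto_const always_eventually)
            (auto simp: less_imp_le)
      qed
    next
      fix v :: "nat \<Rightarrow> 'e dual" and m assume v: "\<And>j. norm (v j) \<le> \<beta> j"
      have "(\<Sum>j<m. norm (v j) powr P) \<le> (\<Sum>j<m. \<beta> j powr P)"
        using v P_ge_1 by (intro sum_mono powr_mono2) auto
      then have v': "(\<Sum>j<m. norm (v j) powr P) \<le> 1 powr P * c" using sum_\<beta>[of m] by simp
      have "\<bar>\<Sum>j<m. bidual (\<xi> j) (W (v j))\<bar> \<le> 1 * c"
        by (rule form[OF zero_less_one v']) (auto intro: bidual_nonneg bd1 \<xi>)
      moreover have "\<bar>\<Sum>j<m. dual_map (dual_map bidual) (\<xi> j) (W (v j))\<bar> \<le> 1 * c"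
        by (rule form[OF zero_less_one v']) (auto intro: dual_map_dual_map_bidual_nonneg bd2 \<xi> simp del: dual_map_blinfun_apply)
      ultimately show "\<bar>\<Sum>j<m. bidual_defect (\<xi> j) (W (v j))\<bar> \<le> 2 * c"
        by (simp add: bidual_defect_def blinfun.diff_left sum_subtractf)
    qed
  next
    assume AP: "positive_metric_approximation_property TYPE('x dual dual dual dual)"
    define \<R> where "\<R> = {R :: 'x dual dual dual dual \<Rightarrow>\<^sub>L 'x dual dual dual dual. 0 \<le> R \<and> norm R \<le> 1}"
    show ?thesis
    proof (rule defect_trace_positive_approximation_property[of \<R>])
      fix \<epsilon> :: real and Z :: "'x dual dual dual dual set" assume "0 < \<epsilon>" "compact Z"
      then show "\<exists>R\<in>\<R>. finite_rank R \<and> (\<forall>w\<in>Z. norm (R w - w) < \<epsilon>)"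
        using AP unfolding positive_metric_approximation_property_def \<R>_def by blast
    next
      fix r :: real assume r: "0 < r"
      \<comment> \<open>Four traces occur in the tail, those of the two embeddings with and without
        \<open>R\<close>; each is at most \<open>l * c = r / 4\<close>.\<close>
      define l where "l = r / (4 * c)"
      have l: "0 < l" using r c by (simp add: l_def)
      obtain N where N: "\<And>n m. N \<le> n \<Longrightarrow> (\<Sum>i<m. norm (u (n + i)) powr P) \<le> l powr P * c"
        using tail_sums_small[of "\<lambda>j. norm (u j) powr P" c "l powr P * c"] u c l
        by (auto simp: powr_gt_zero)
      have "\<bar>\<Sum>j=N..<m. (bidual_defect (\<xi> j) - R (bidual_defect (\<xi> j))) (W (u j))\<bar> \<le> r"
        if R: "R \<in> \<R>" for R m
      proof -
        have R_pos: "0 \<le> R w" if "0 \<le> w" for w using R that unfolding \<R>_def by (auto simp: blinfun_nonneg_iff less_eq_blinfun_def[of 0 R])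
        have R_norm: "norm (R w) \<le> norm w" for w
          using R norm_blinfun[of R w] mult_right_mono[of "norm R" 1 "norm w"] unfolding \<R>_def by auto
        let ?n = "m - N" and ?v = "\<lambda>i. u (N + i)"
        let ?J = "\<lambda>i. bidual (\<xi> (N + i))" and ?K = "\<lambda>i. dual_map (dual_map bidual) (\<xi> (N + i))"
        have wb: "weak_bound ?n (\<lambda>i. \<xi> (N + i)) c" by (rule weak_bound_slice[OF \<xi>(2)[of "N + ?n"]]) simp
        have J: "0 \<le> ?J i" "weak_bound ?n ?J c" for i by (auto intro: bidual_nonneg bd1 wb \<xi>)
        have K: "0 \<le> ?K i" "weak_bound ?n ?K c" for i
          by (auto intro: dual_map_dual_map_bidual_nonneg bd2 wb \<xi>)
        have RJ: "0 \<le> R (?J i)" "weak_bound ?n (\<lambda>i. R (?J i)) c" for i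
          by (intro R_pos J weak_bound_contraction R_norm)+
        have RK: "0 \<le> R (?K i)" "weak_bound ?n (\<lambda>i. R (?K i)) c" for i
          by (intro R_pos K weak_bound_contraction R_norm)+
        have "(\<Sum>j=N..<m. (bidual_defect (\<xi> j) - R (bidual_defect (\<xi> j))) (W (u j))) =
            (\<Sum>i<?n. (bidual_defect (\<xi> (N + i)) - R (bidual_defect (\<xi> (N + i)))) (W (?v i)))"
          by (simp add: sum.atLeastLessThan_shift_0 atLeast0LessThan)
        also have "\<dots> = (\<Sum>i<?n. ?J i (W (?v i))) - (\<Sum>i<?n. ?K i (W (?v i)))
            - (\<Sum>i<?n. R (?J i) (W (?v i))) + (\<Sum>i<?n. R (?K i) (W (?v i)))"
          by (simp add: bidual_defect_def blinfun.bilinear_simps sum_subtractf sum.distrib del: dual_map_blinfun_apply bidual_apply)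
        finally have eq: "(\<Sum>j=N..<m. (bidual_defect (\<xi> j) - R (bidual_defect (\<xi> j))) (W (u j))) = \<dots>" .
        have *: "\<bar>\<Sum>i<?n. w i (W (?v i))\<bar> \<le> r / 4"
          if "\<And>i. 0 \<le> w i" "weak_bound ?n w c" for w :: "nat \<Rightarrow> 'x dual dual dual dual"
          using form[OF l N[OF order_refl] that] c by (simp add: l_def)
        show ?thesis
          unfolding eq using *[OF J] *[OF K] *[OF RJ] *[OF RK] by linarith
      qed
      then show "\<exists>N Z \<delta>. finite Z \<and> 0 < \<delta> \<and> (\<forall>R\<in>\<R>. (\<forall>w\<in>Z. norm (R w - w) < \<delta>) \<longrightarrow>
          (\<forall>m\<ge>N. \<bar>\<Sum>j=N..<m. (bidual_defect (\<xi> j) - R (bidual_defect (\<xi> j))) (W (u j))\<bar> \<le> r))"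
        by (intro exI[of _ N] exI[of _ "{}"] exI[of _ 1]) auto
    qed
  qed
qed

section \<open>The gauge of finite representations and the separation argument\<close>

lemma (in finite_exponent) fin_rep_sublinear:
  fixes T :: "'e::real_normed_vector \<Rightarrow>\<^sub>L 'y::cone_space"
  defines "U \<equiv> {T::'e \<Rightarrow>\<^sub>L 'y. \<exists>t. fin_rep T t}" and "\<nu> \<equiv> \<lambda>T::'e \<Rightarrow>\<^sub>L 'y. Inf {t. fin_rep T t}"
  shows "subspace U" "sublinear_on U \<nu>" "\<And>T t. fin_rep T t \<Longrightarrow> \<nu> T \<le> t"
    "\<And>T b. T \<in> U \<Longrightarrow> (\<And>t. fin_rep T t \<Longrightarrow> b \<le> t) \<Longrightarrow> b \<le> \<nu> T"
proof -
  have bdd: "bdd_below {t. fin_rep T t}" for T :: "'e \<Rightarrow>\<^sub>L 'y"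
    using fin_rep_nonneg by (intro bdd_belowI[of _ 0]) auto
  show le: "\<nu> T \<le> t" if "fin_rep T t" for T t
    unfolding \<nu>_def using bdd that by (intro cInf_lower) auto
  show ge: "b \<le> \<nu> T" if "T \<in> U" "\<And>t. fin_rep T t \<Longrightarrow> b \<le> t" for T b
    unfolding \<nu>_def using that by (intro cInf_greatest) (auto simp: U_def)
  show U: "subspace U"
  proof (rule subspaceI)
    show "0 \<in> U" using fin_rep_0 unfolding U_def by blast
    show "T + T' \<in> U" if "T \<in> U" "T' \<in> U" for T T' using that fin_rep_add unfolding U_def by blast
    show "r *\<^sub>R T \<in> U" if "T \<in> U" for r T
    proof -
      obtain t where t: "fin_rep T t" using \<open>T \<in> U\<close> unfolding U_def by blast
      consider "r = 0" | "0 < r" | "r < 0" by linarith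
      then show ?thesis
      proof cases
        case 1
        then show ?thesis using fin_rep_0 unfolding U_def by auto
      next
        case 2
        then show ?thesis using fin_rep_scaleR[OF t] unfolding U_def by blast
      next
        case 3
        then show ?thesis using fin_rep_scaleR[OF fin_rep_uminus[OF t], of "- r"] unfolding U_def by auto
      qed
    qed
  qed
  show "sublinear_on U \<nu>"
  proof (rule sublinear_onI[OF U])
    fix T T' assume T: "T \<in> U" "T' \<in> U"
    have *: "\<nu> (T + T') \<le> s + t" if "fin_rep T s" "fin_rep T' t" for s t
      using le[OF fin_rep_add[OF that]] .
    have "\<nu> (T + T') - s \<le> \<nu> T'" if "fin_rep T s" for s
      using *[OF that] by (intro ge T) (simp add: algebra_simps)
    then have "\<nu> (T + T') - \<nu> T' \<le> \<nu> T" by (intro ge T) (simp add: algebra_simps)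
    then show "\<nu> (T + T') \<le> \<nu> T + \<nu> T'" by simp
  next
    fix T and r :: real assume T: "T \<in> U" and r: "0 < r"
    have "\<nu> (r *\<^sub>R T) / r \<le> \<nu> T"
    proof (rule ge[OF T])
      fix t assume "fin_rep T t"
      then have "\<nu> (r *\<^sub>R T) \<le> r * t" by (intro le fin_rep_scaleR r)
      then show "\<nu> (r *\<^sub>R T) / r \<le> t" using r by (simp add: field_simps)
    qed
    then show "\<nu> (r *\<^sub>R T) \<le> r * \<nu> T" using r by (simp add: field_simps)
  next
    have "0 \<le> \<nu> 0" using fin_rep_nonneg subspace_0[OF U] by (intro ge)
    then show "\<nu> 0 = 0" using le[OF fin_rep_0] by simp
  qed
qed

context finite_exponent
begin

lemma series_rep_mono: "series_rep T s u \<xi> \<Longrightarrow> s \<le> t \<Longrightarrow> series_rep T t u \<xi>"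
  unfolding series_rep_def using weak_bound_mono order_trans by blast

lemma fin_rep_bidual_compose:
  fixes B :: "'e::real_normed_vector \<Rightarrow>\<^sub>L 'x::cone_space"
  assumes "fin_rep B t"
  shows "fin_rep (bidual o\<^sub>L B) t"
proof -
  obtain n v y where 1: "\<And>i. i < n \<Longrightarrow> 0 \<le> y i" "(\<Sum>i<n. norm (v i) powr P) \<le> t" "weak_bound n y t"
    "B = (\<Sum>i<n. rank_one (v i) (y i))" by (rule fin_repE[OF assms], rule that)
  show ?thesis
    by (rule fin_repI[of n "\<lambda>i. bidual (y i)" v])
      (use 1 in \<open>auto simp: bidual_nonneg blinfun_compose_sum_right blinfun_compose_rank_one intro: weak_bound_contraction\<close>)
qed

lemma fin_rep_convex:
  fixes B :: "'e::real_normed_vector \<Rightarrow>\<^sub>L 'y::cone_space"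
  assumes B: "fin_rep B c" "fin_rep B' c" and ab: "0 \<le> a" "0 \<le> b" "a + b = 1"
  shows "fin_rep (a *\<^sub>R B + b *\<^sub>R B') c"
proof -
  consider "a = 0" "b = 1" | "b = 0" "a = 1" | "0 < a" "0 < b" using ab by linarith
  then show ?thesis
  proof cases
    case 3
    then have "fin_rep (a *\<^sub>R B + b *\<^sub>R B') (a * c + b * c)" by (intro fin_rep_add fin_rep_scaleR B)
    then show ?thesis using ab by (simp flip: distrib_right)
  qed (use B in simp_all)
qed

text \<open>Only the tails of \<open>u\<close> become small; those of \<open>\<xi>\<close> merely
  keep the bound \<open>c\<close>. Multiplying \<open>\<xi>\<close> by \<open>b\<close> turns that
  bound into \<open>t\<close>, and a late tail of \<open>u\<close> absorbs the reciprocal factor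
  \<open>a\<close>. The last clause records that the rank one terms are unchanged, so partial sums
  of the tail are differences of partial sums of the whole series.\<close>

lemma series_rep_tail:
  fixes T :: "'e::real_normed_vector \<Rightarrow>\<^sub>L 'y::cone_space"
  assumes rep: "series_rep T c u \<xi>" and c: "0 < c" and t: "0 < t"
  shows "\<exists>N. \<forall>n\<ge>N. \<exists>u' \<xi>'. series_rep (T - (\<Sum>j<n. rank_one (u j) (\<xi> j))) t u' \<xi>' \<and>
    (\<forall>i. rank_one (u' i) (\<xi>' i) = rank_one (u (n + i)) (\<xi> (n + i)))"
proof -
  have \<xi>: "\<And>j. 0 \<le> \<xi> j" "\<And>n. weak_bound n \<xi> c" and u: "\<And>n. (\<Sum>j<n. norm (u j) powr P) \<le> c"
    and sums: "(\<lambda>j. rank_one (u j) (\<xi> j)) sums T"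
    using rep unfolding series_rep_def by auto
  define \<theta> where "\<theta> = t / c"
  have \<theta>: "0 < \<theta>" using c t by (simp add: \<theta>_def)
  define a b where "a = \<theta> powr - (1 - 1 / P)" and "b = \<theta> powr (1 - 1 / P)"
  have ab: "0 < a" "0 < b" "b * a = 1" using \<theta> by (simp_all add: a_def b_def flip: powr_add)
  obtain N where N: "\<And>n m. N \<le> n \<Longrightarrow> (\<Sum>i<m. norm (u (n + i)) powr P) \<le> t / a powr P"
    using tail_sums_small[of "\<lambda>j. norm (u j) powr P" c "t / a powr P"] u t ab(1) by auto
  have "series_rep (T - (\<Sum>j<n. rank_one (u j) (\<xi> j))) t (\<lambda>i. a *\<^sub>R u (n + i)) (\<lambda>i. b *\<^sub>R \<xi> (n + i))"
    if n: "N \<le> n" for n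
    unfolding series_rep_def
  proof (intro conjI allI)
    show "0 \<le> b *\<^sub>R \<xi> (n + j)" for j using ab \<xi> by (intro cone_scaleR) auto
    show "(\<Sum>j<m. norm (a *\<^sub>R u (n + j)) powr P) \<le> t" for m
    proof -
      have "(\<Sum>j<m. norm (a *\<^sub>R u (n + j)) powr P) = a powr P * (\<Sum>j<m. norm (u (n + j)) powr P)"
        using ab by (simp add: powr_mult sum_distrib_left)
      also have "\<dots> \<le> a powr P * (t / a powr P)" by (intro mult_left_mono N n) simp
      finally show ?thesis using ab by simp
    qed
    have "weak_bound m (\<lambda>i. \<xi> (n + i)) c" for m by (rule weak_bound_slice[OF \<xi>(2)[of "n + m"]]) simp
    from weak_bound_scale[OF this \<theta>] show "weak_bound m (\<lambda>j. b *\<^sub>R \<xi> (n + j)) t" for m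
      using c by (simp add: b_def \<theta>_def)
    have "(\<lambda>j. rank_one (u (j + n)) (\<xi> (j + n))) sums (T - (\<Sum>j<n. rank_one (u j) (\<xi> j)))"
      by (rule sums_split_initial_segment[OF sums])
    then show "(\<lambda>j. rank_one (a *\<^sub>R u (n + j)) (b *\<^sub>R \<xi> (n + j))) sums (T - (\<Sum>j<n. rank_one (u j) (\<xi> j)))"
      using ab(3) by (simp add: rank_one_scaleR_left rank_one_scaleR_right add.commute[of _ n])
  qed
  moreover have "rank_one (a *\<^sub>R u (n + i)) (b *\<^sub>R \<xi> (n + i)) = rank_one (u (n + i)) (\<xi> (n + i))" for n i
    using ab(3) by (simp add: rank_one_scaleR_left rank_one_scaleR_right)
  ultimately show ?thesis by blast
qed

lemma series_rep_step:
  fixes S :: "'e::real_normed_vector \<Rightarrow>\<^sub>L 'x::cone_space"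
  assumes X: "regular_norm TYPE('x)"
    and rep: "series_rep (bidual o\<^sub>L S) c u \<xi>" and c: "0 < c" and \<eta>: "0 < \<eta>"
    and AP: "approximation_property TYPE('e dual) \<or>
      positive_metric_approximation_property TYPE('x dual dual dual dual)"
  shows "\<exists>B. fin_rep B c \<and> (\<exists>u' \<xi>'. series_rep (bidual o\<^sub>L (S - B)) \<eta> u' \<xi>')"
proof (rule ccontr)
  assume neg: "\<not> ?thesis"
  have \<xi>: "\<And>j. 0 \<le> \<xi> j" "\<And>n. weak_bound n \<xi> c" and u: "\<And>n. (\<Sum>j<n. norm (u j) powr P) \<le> c"
    using rep unfolding series_rep_def by auto
  define A where "A m = (\<Sum>j<m. rank_one (u j) (\<xi> j))" for m
  \<comment> \<open>The gauge is defined through finite representations, so a partial sum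
    \<open>A N\<close> is separated in place of \<open>bidual o\<^sub>L S\<close>; the remainder has
    cost at most \<open>\<eta> / 8\<close>.\<close>
  obtain N where N: "\<And>n. N \<le> n \<Longrightarrow> \<exists>u' \<xi>'. series_rep ((bidual o\<^sub>L S) - A n) (\<eta> / 8) u' \<xi>' \<and>
      (\<forall>i. rank_one (u' i) (\<xi>' i) = rank_one (u (n + i)) (\<xi> (n + i)))"
    using series_rep_tail[OF rep c, of "\<eta> / 8"] \<eta> unfolding A_def by auto
  define U where "U = {T :: 'e \<Rightarrow>\<^sub>L 'x dual dual. \<exists>t. fin_rep T t}"
  define \<nu> where "\<nu> T = Inf {t. fin_rep T t}" for T :: "'e \<Rightarrow>\<^sub>L 'x dual dual"
  note U = fin_rep_sublinear(1)[where 'e = 'e and 'y = "'x dual dual", folded U_def]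
  note \<nu> = fin_rep_sublinear(2)[where 'e = 'e and 'y = "'x dual dual", folded U_def \<nu>_def]
  note \<nu>_le = fin_rep_sublinear(3)[where 'e = 'e and 'y = "'x dual dual", folded \<nu>_def]
  note le_\<nu> = fin_rep_sublinear(4)[where 'e = 'e and 'y = "'x dual dual", folded U_def \<nu>_def]
  have A_rep: "fin_rep (A m) c" for m unfolding A_def by (rule series_rep_prefix[OF rep])
  have in_U: "T \<in> U" if "fin_rep T t" for T t using that unfolding U_def by blast
  \<comment> \<open>Since \<open>\<eta> / 2 + \<eta> / 8 \<le> \<eta>\<close>, a cheaper
    representation together with the remainder would give the \<open>B\<close> that is assumed not
    to exist.\<close>
  have big: "\<eta> / 2 \<le> t" if B: "fin_rep B c" and t: "fin_rep (A N - (bidual o\<^sub>L B)) t" for B t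
  proof (rule ccontr)
    assume "\<not> \<eta> / 2 \<le> t"
    then have "fin_rep (A N - (bidual o\<^sub>L B)) (\<eta> / 2)" using fin_rep_mono[OF t] by simp
    moreover obtain u' \<xi>' where "series_rep ((bidual o\<^sub>L S) - A N) (\<eta> / 8) u' \<xi>'" using N[OF order_refl] by blast
    ultimately obtain u'' \<xi>'' where
      "series_rep ((A N - (bidual o\<^sub>L B)) + ((bidual o\<^sub>L S) - A N)) (\<eta> / 2 + \<eta> / 8) u'' \<xi>''"
      using series_rep_prepend by blast
    then have "series_rep (bidual o\<^sub>L (S - B)) (\<eta> / 2 + \<eta> / 8) u'' \<xi>''" by (simp add: blinfun_compose_simps)
    then have "series_rep (bidual o\<^sub>L (S - B)) \<eta> u'' \<xi>''"
      by (rule series_rep_mono) (use \<eta> in simp)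
    then show False using neg B by blast
  qed
  \<comment> \<open>The cone generated by the operators \<open>A N - (bidual o\<^sub>L B)\<close>,
    at which the functional shall be at least \<open>\<eta> / 2\<close>. They form a convex set by
    \<open>fin_rep_convex\<close>, so sums stay in the cone.\<close>
  define G where "G = {(s *\<^sub>R (A N - (bidual o\<^sub>L B)), b) | s B b. 0 \<le> s \<and> fin_rep B c \<and> b \<le> s * (\<eta> / 2)}"
  have G_I: "(s *\<^sub>R (A N - (bidual o\<^sub>L B)), b) \<in> G" if "0 \<le> s" "fin_rep B c" "b \<le> s * (\<eta> / 2)" for s B b
    unfolding G_def using that by blast
  have mem_U: "A N - (bidual o\<^sub>L B) \<in> U" if "fin_rep B c" for B
    using U in_U[OF A_rep] in_U[OF fin_rep_bidual_compose[OF that]] by (rule subspace_diff)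
  have fin0: "fin_rep (0 :: 'e \<Rightarrow>\<^sub>L 'x) c" by (rule fin_rep_mono[OF fin_rep_0]) (use c in simp)
  have cone: "convex_cone_set G"
    unfolding convex_cone_set_def
  proof (intro conjI ballI allI impI)
    show "0 \<in> G" using G_I[OF order_refl fin0, of 0] by (simp add: zero_prod_def)
  next
    fix g h assume "g \<in> G" "h \<in> G"
    then obtain s B b s' B' b' where
      1: "0 \<le> s" "fin_rep B c" "b \<le> s * (\<eta> / 2)" "g = (s *\<^sub>R (A N - (bidual o\<^sub>L B)), b)" and
      2: "0 \<le> s'" "fin_rep B' c" "b' \<le> s' * (\<eta> / 2)" "h = (s' *\<^sub>R (A N - (bidual o\<^sub>L B')), b')"
      unfolding G_def by blast
    show "g + h \<in> G"
    proof (cases "s + s' = 0")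
      case True
      then have "s = 0" "s' = 0" using 1 2 by auto
      then have "g + h = (0 *\<^sub>R (A N - (bidual o\<^sub>L B)), b + b')" "b + b' \<le> 0 * (\<eta> / 2)" using 1 2 by auto
      then show ?thesis using G_I[OF order_refl 1(2)] by simp
    next
      case False
      define B'' where "B'' = (s / (s + s')) *\<^sub>R B + (s' / (s + s')) *\<^sub>R B'"
      have "fin_rep B'' c"
        unfolding B''_def using 1 2 False by (intro fin_rep_convex) (auto simp flip: add_divide_distrib)
      moreover have "(s + s') *\<^sub>R B'' = s *\<^sub>R B + s' *\<^sub>R B'" using False by (simp add: B''_def scaleR_add_right)
      then have "(s + s') *\<^sub>R (bidual o\<^sub>L B'') = s *\<^sub>R (bidual o\<^sub>L B) + s' *\<^sub>R (bidual o\<^sub>L B')"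
        by (metis blinfun_compose_simps(1,3))
      then have "g + h = ((s + s') *\<^sub>R (A N - (bidual o\<^sub>L B'')), b + b')"
        using 1 2 by (simp add: algebra_simps)
      moreover have "b + b' \<le> (s + s') * (\<eta> / 2)" using 1 2 by (simp add: algebra_simps add_divide_distrib)
      ultimately show ?thesis using G_I[of "s + s'" B'' "b + b'"] 1(1) 2(1) by simp
    qed
  next
    fix g and r :: real assume "g \<in> G" and r: "0 < r"
    then obtain s B b where "0 \<le> s" "fin_rep B c" "b \<le> s * (\<eta> / 2)" "g = (s *\<^sub>R (A N - (bidual o\<^sub>L B)), b)"
      unfolding G_def by blast
    then have "r *\<^sub>R g = ((r * s) *\<^sub>R (A N - (bidual o\<^sub>L B)), r * b)" "0 \<le> r * s" "r * b \<le> (r * s) * (\<eta> / 2)" "fin_rep B c"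
      using r by (auto simp: mult.assoc)
    then show "r *\<^sub>R g \<in> G" using G_I[of "r * s" B "r * b"] by simp
  qed
  have bound: "v \<in> U \<and> b \<le> \<nu> v" if vb: "(v, b) \<in> G" for v b
  proof -
    obtain s B where s: "0 \<le> s" "fin_rep B c" "b \<le> s * (\<eta> / 2)" "v = s *\<^sub>R (A N - (bidual o\<^sub>L B))"
      using vb unfolding G_def by auto
    have m: "A N - (bidual o\<^sub>L B) \<in> U" by (rule mem_U[OF s(2)])
    have "\<eta> / 2 \<le> \<nu> (A N - (bidual o\<^sub>L B))" using big[OF s(2)] by (intro le_\<nu> m)
    then have "s * (\<eta> / 2) \<le> s * \<nu> (A N - (bidual o\<^sub>L B))" by (intro mult_left_mono s)
    also have "\<dots> = \<nu> v" using \<nu> m s(1,4) unfolding sublinear_on_def by simp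
    finally have "s * (\<eta> / 2) \<le> \<nu> v" .
    then show ?thesis using s m U by (auto simp: subspace_scale)
  qed
  obtain \<phi> where \<phi>_le: "\<And>T. T \<in> U \<Longrightarrow> \<phi> T \<le> \<nu> T"
    and \<phi>_add: "\<And>T T'. T \<in> U \<Longrightarrow> T' \<in> U \<Longrightarrow> \<phi> (T + T') = \<phi> T + \<phi> T'"
    and \<phi>_scale: "\<And>T r. T \<in> U \<Longrightarrow> \<phi> (r *\<^sub>R T) = r * \<phi> T"
    and \<phi>_ge: "\<And>v b. (v, b) \<in> G \<Longrightarrow> b \<le> \<phi> v"
    by (rule hahn_banach_cone[OF U \<nu> cone bound], assumption, rule that)
  have \<phi>_diff: "\<phi> (T - T') = \<phi> T - \<phi> T'" if "T \<in> U" "T' \<in> U" for T T'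
    using \<phi>_add[of T "(- 1) *\<^sub>R T'"] \<phi>_scale[of T' "- 1"] that U by (simp add: subspace_neg)
  have Y: "regular_norm TYPE('x dual dual)" by (intro regular_norm_dual X)
  have pos_U: "rank_one v y \<in> U" if "0 \<le> y" for v :: "'e dual" and y :: "'x dual dual"
    using in_U[OF fin_rep_rank_one[OF that]] .
  have rank_one_U: "rank_one v y \<in> U" for v :: "'e dual" and y :: "'x dual dual"
  proof -
    obtain z where z: "y \<le> z" "0 \<le> z" using regular_norm_modulus[OF Y, of y] by metis
    have "rank_one v (z - (z - y)) \<in> U"
      unfolding rank_one_diff_right[of v z "z - y"]
      using z unfolding cone_le_iff[of y z] by (intro subspace_diff U pos_U)
    then show ?thesis by simp
  qed
  \<comment> \<open>On finite representations the separating functional is determined by its values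
    at rank one operators, that is, it is the trace against \<open>W\<close>; the gauge of a rank
    one operator bounds \<open>W\<close>.\<close>
  obtain W :: "'e dual \<Rightarrow>\<^sub>L 'x dual dual dual" where W: "\<And>v y. W v y = \<phi> (rank_one v y)"
  proof (rule positive_form_blinfun[OF Y, of "\<lambda>v y. \<phi> (rank_one v y)" 1])
    show "\<phi> (rank_one v y) \<le> 1 * (norm v * norm y)" if "0 \<le> y" for v :: "'e dual" and y :: "'x dual dual"
      using \<phi>_le[OF rank_one_U, of v y] \<nu>_le[OF fin_rep_rank_one[OF that, of v]] by simp
  next
    fix W' :: "'e dual \<Rightarrow>\<^sub>L 'x dual dual dual" assume "\<And>v y. W' v y = \<phi> (rank_one v y)"
    then show thesis by (rule that)
  qed (simp_all add: rank_one_add_left rank_one_add_right rank_one_scaleR_left rank_one_scaleR_right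
      \<phi>_add \<phi>_scale rank_one_U)
  have \<phi>_sum: "\<phi> (\<Sum>i<n. rank_one (v i) (y i)) = (\<Sum>i<n. W (v i) (y i))" for n :: nat and v :: "nat \<Rightarrow> 'e dual" and y :: "nat \<Rightarrow> 'x dual dual"
  proof (induction n)
    case 0
    then show ?case using \<phi>_scale[OF rank_one_U, of 0 undefined undefined] by simp
  next
    case (Suc n)
    then show ?case using U by (simp add: \<phi>_add rank_one_U W subspace_sum)
  qed
  have W_le: "(\<Sum>i<n. W (v i) (y i)) \<le> c"
    if "\<And>i. i < n \<Longrightarrow> 0 \<le> y i" "(\<Sum>i<n. norm (v i) powr P) \<le> c" "weak_bound n y c"
    for n and v :: "nat \<Rightarrow> 'e dual" and y :: "nat \<Rightarrow> 'x dual dual"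
  proof -
    have "fin_rep (\<Sum>i<n. rank_one (v i) (y i)) c" by (rule fin_repI[of n y v]) (use that in auto)
    then have "\<phi> (\<Sum>i<n. rank_one (v i) (y i)) \<le> c" using \<phi>_le[OF in_U] \<nu>_le by (meson order_trans)
    then show ?thesis unfolding \<phi>_sum .
  qed
  have lim: "(\<lambda>m. \<Sum>j<m. bidual_defect (\<xi> j) (W (u j))) \<longlonglongrightarrow> 0"
    by (rule defect_trace_tendsto_0[OF rep c W_le AP])
  \<comment> \<open>Passing from \<open>A N\<close> to \<open>A m\<close> uses up
    \<open>\<eta> / 8\<close> of the gap \<open>\<eta> / 2\<close>. So traces of admissible positive
    tuples in X are at most \<open>\<phi> (A m) - 3 * \<eta> / 8\<close>, and by
    \<open>weak_bound_bidual\<close> the same holds for the \<xi>_j paired with the restrictions of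
    the \<open>W (u j)\<close> to X. What is missing to \<open>\<phi> (A m)\<close> is the defect
    trace.\<close>
  have "3 * \<eta> / 8 \<le> (\<Sum>j<m. bidual_defect (\<xi> j) (W (u j)))" if m: "N \<le> m" for m
  proof -
    have tail: "\<phi> (A N) - \<phi> (A m) \<le> \<eta> / 8"
    proof -
      obtain u' \<xi>' where r: "series_rep ((bidual o\<^sub>L S) - A N) (\<eta> / 8) u' \<xi>'"
        "\<And>i. rank_one (u' i) (\<xi>' i) = rank_one (u (N + i)) (\<xi> (N + i))" using N[OF order_refl] by blast
      have "fin_rep (- (\<Sum>i<m - N. rank_one (u' i) (\<xi>' i))) (\<eta> / 8)"
        by (intro fin_rep_uminus series_rep_prefix[OF r(1)])
      moreover have "A m = A N + (\<Sum>i<m - N. rank_one (u' i) (\<xi>' i))"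
        unfolding A_def r(2) using sum_lessThan_add[of "\<lambda>j. rank_one (u j) (\<xi> j)" N "m - N"] m by simp
      ultimately have rep': "fin_rep (A N - A m) (\<eta> / 8)" by simp
      then have "\<phi> (A N - A m) \<le> \<eta> / 8" using \<phi>_le[OF in_U] \<nu>_le by (meson order_trans)
      then show ?thesis using \<phi>_diff in_U[OF A_rep] by simp
    qed
    have "(\<Sum>j<m. \<xi> j (dual_map bidual (W (u j)))) \<le> \<phi> (A m) - 3 * \<eta> / 8"
    proof (rule weak_bound_bidual[OF c])
      fix x :: "nat \<Rightarrow> 'x" assume x: "\<And>i. i < m \<Longrightarrow> 0 \<le> x i" "weak_bound m x c"
      define B where "B = (\<Sum>j<m. rank_one (u j) (x j))"
      have B: "fin_rep B c" unfolding B_def using x u by (intro fin_repI[of m x u]) auto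
      have JB: "(bidual o\<^sub>L B) \<in> U" by (rule in_U[OF fin_rep_bidual_compose[OF B]])
      have "(1 *\<^sub>R (A N - (bidual o\<^sub>L B)), \<eta> / 2) \<in> G" using B by (intro G_I) auto
      from \<phi>_ge[OF this] have "\<eta> / 2 \<le> \<phi> (A N - (bidual o\<^sub>L B))" by simp
      then have "\<phi> (bidual o\<^sub>L B) \<le> \<phi> (A N) - \<eta> / 2" using \<phi>_diff[OF in_U[OF A_rep] JB] by simp
      also have "\<phi> (bidual o\<^sub>L B) = (\<Sum>j<m. W (u j) (bidual (x j)))"
        unfolding B_def blinfun_compose_sum_right blinfun_compose_rank_one by (rule \<phi>_sum)
      finally show "(\<Sum>j<m. dual_map bidual (W (u j)) (x j)) \<le> \<phi> (A m) - 3 * \<eta> / 8" using tail by simp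
    qed (use \<xi> in auto)
    moreover have "\<phi> (A m) = (\<Sum>j<m. W (u j) (\<xi> j))" unfolding A_def by (rule \<phi>_sum)
    ultimately show ?thesis by (simp add: bidual_defect_apply sum_subtractf)
  qed
  then have "3 * \<eta> / 8 \<le> 0" by (intro LIMSEQ_le_const[OF lim]) blast
  then show False using \<eta> by simp
qed

end

section \<open>Concatenation of blocks\<close>

text \<open>When blocks of lengths \<open>r k\<close> are written one after the other, position
  \<open>n\<close> holds entry \<open>i\<close> of block \<open>k\<close>.\<close>

fun block_index :: "(nat \<Rightarrow> nat) \<Rightarrow> nat \<Rightarrow> nat \<times> nat"
  where "block_index r 0 = (0, 0)"
  | "block_index r (Suc n) =
      (case block_index r n of (k, i) \<Rightarrow> if Suc i < r k then (k, Suc i) else (Suc k, 0))"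

text \<open>An empty block would be entered at index 0, where it has no entry.\<close>

locale blocks =
  fixes r :: "nat \<Rightarrow> nat"
  assumes r_pos: "\<And>k. 0 < r k"
begin

lemma block_index_less: "block_index r n = (k, i) \<Longrightarrow> i < r k"
  by (induction n arbitrary: k i) (auto simp: r_pos split: prod.splits if_splits)

lemma block_sum:
  fixes F :: "nat \<Rightarrow> nat \<Rightarrow> 'a::comm_monoid_add"
  shows "block_index r n = (k, i) \<Longrightarrow>
    (\<Sum>j<n. case block_index r j of (l, q) \<Rightarrow> F l q) = (\<Sum>l<k. \<Sum>q<r l. F l q) + (\<Sum>q<i. F k q)"
proof (induction n arbitrary: k i)
  case (Suc n)
  obtain l q where lq: "block_index r n = (l, q)" by fastforce
  have "q < r l" by (rule block_index_less[OF lq])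
  then have "\<not> Suc q < r l \<Longrightarrow> r l = Suc q" by simp
  then show ?case using Suc.IH[OF lq] Suc.prems lq by (auto simp: add.assoc split: if_splits)
qed simp

lemma block_index_eq:
  assumes "block_index r n = (k, i)"
  shows "n = (\<Sum>l<k. r l) + i"
  using block_sum[OF assms, of "\<lambda>_ _. 1 :: nat"] by (simp add: case_prod_beta)

lemma block_index_at_top: "filterlim (\<lambda>n. fst (block_index r n)) at_top sequentially"
  unfolding filterlim_at_top eventually_sequentially
proof (intro allI exI impI)
  fix K n :: nat assume n: "(\<Sum>l<K. r l) \<le> n"
  obtain k i where ki: "block_index r n = (k, i)" by fastforce
  show "K \<le> fst (block_index r n)"
  proof (rule ccontr)
    assume "\<not> ?thesis"
    then have k: "Suc k \<le> K" using ki by simp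
    have "n < (\<Sum>l<Suc k. r l)" using block_index_eq[OF ki] block_index_less[OF ki] by simp
    also have "\<dots> \<le> (\<Sum>l<K. r l)" using k by (intro sum_mono2) auto
    finally show False using n by simp
  qed
qed

text \<open>A partial sum of the concatenated series may stop inside a block, so convergence of the
  series of whole blocks is supplemented by a bound for incomplete blocks that tends to 0.\<close>

lemma block_sums:
  fixes F :: "nat \<Rightarrow> nat \<Rightarrow> 'a::real_normed_vector"
  assumes T: "(\<lambda>l. \<Sum>q<r l. F l q) sums T"
    and part: "\<And>l i. i < r l \<Longrightarrow> norm (\<Sum>q<i. F l q) \<le> e l" and e: "e \<longlonglongrightarrow> 0"
  shows "(\<lambda>n. case block_index r n of (l, q) \<Rightarrow> F l q) sums T"
  unfolding sums_def
proof -
  let ?k = "\<lambda>n. fst (block_index r n)" and ?i = "\<lambda>n. snd (block_index r n)"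
  have eq: "(\<Sum>j<n. case block_index r j of (l, q) \<Rightarrow> F l q) =
      (\<Sum>l<?k n. \<Sum>q<r l. F l q) + (\<Sum>q<?i n. F (?k n) q)" for n
    by (rule block_sum) simp
  have "(\<lambda>n. \<Sum>l<?k n. \<Sum>q<r l. F l q) \<longlonglongrightarrow> T"
    using T unfolding sums_def by (rule filterlim_compose[OF _ block_index_at_top])
  moreover have "(\<lambda>n. \<Sum>q<?i n. F (?k n) q) \<longlonglongrightarrow> 0"
  proof (rule Lim_null_comparison)
    show "\<forall>\<^sub>F n in sequentially. norm (\<Sum>q<?i n. F (?k n) q) \<le> e (?k n)"
      using block_index_less by (intro always_eventually allI part) (simp add: prod_eq_iff)
    show "(\<lambda>n. e (?k n)) \<longlonglongrightarrow> 0" by (rule filterlim_compose[OF e block_index_at_top])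
  qed
  ultimately show "(\<lambda>n. \<Sum>j<n. case block_index r j of (l, q) \<Rightarrow> F l q) \<longlonglongrightarrow> T"
    unfolding eq using tendsto_add by fastforce
qed

end

context finite_exponent
begin

text \<open>A zero term is appended to exclude empty blocks. The bounds are stated for initial
  segments because the concatenated series may be cut anywhere.\<close>

lemma fin_rep_nonemptyE:
  fixes T :: "'e::real_normed_vector \<Rightarrow>\<^sub>L 'y::cone_space"
  assumes "fin_rep T t"
  obtains n v y where "0 < n" "\<And>i. 0 \<le> y i" "\<And>m. m \<le> n \<Longrightarrow> (\<Sum>i<m. norm (v i) powr P) \<le> t"
    "\<And>m. m \<le> n \<Longrightarrow> weak_bound m y t" "T = (\<Sum>i<n. rank_one (v i) (y i))"
proof -
  obtain n v y where 1: "\<And>i. i < n \<Longrightarrow> 0 \<le> y i" "(\<Sum>i<n. norm (v i) powr P) \<le> t" "weak_bound n y t"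
    "T = (\<Sum>i<n. rank_one (v i) (y i))" by (rule fin_repE[OF assms], rule that)
  let ?v = "seq_append n v (\<lambda>_. 0)" and ?y = "seq_append n y (\<lambda>_. 0)"
  have "weak_bound 1 (\<lambda>_. 0 :: 'y) 0" using P_ge_1 by (simp add: weak_bound_def)
  from weak_bound_append[OF 1(3) this] have wb: "weak_bound (n + 1) ?y t" by simp
  show thesis
  proof (rule that[of "n + 1" ?y ?v])
    show "0 \<le> ?y i" for i using 1(1) by (auto simp: seq_append_def cone_zero)
    show "(\<Sum>i<m. norm (?v i) powr P) \<le> t" if "m \<le> n + 1" for m
    proof -
      have "(\<Sum>i<m. norm (?v i) powr P) \<le> (\<Sum>i<n + 1. norm (?v i) powr P)" using that by (intro sum_mono2) auto
      also have "\<dots> = (\<Sum>i<n. norm (v i) powr P)"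
        unfolding sum_lessThan_add using seq_append_simps(2)[of n v "\<lambda>_. 0" 0] by simp
      finally show ?thesis using 1(2) by simp
    qed
    show "weak_bound m ?y t" if "m \<le> n + 1" for m using weak_bound_slice[OF wb, of 0 m] that by simp
    show "T = (\<Sum>i<n + 1. rank_one (?v i) (?y i))"
      unfolding sum_lessThan_add 1(4) using seq_append_simps(2)[of n v "\<lambda>_. 0" 0] by simp
  qed simp
qed

lemma series_rep_descend:
  fixes S :: "'e::real_normed_vector \<Rightarrow>\<^sub>L 'x::cone_space"
  assumes X: "regular_norm TYPE('x)"
    and rep: "series_rep (bidual o\<^sub>L S) c u \<xi>" and c: "0 < c" and \<eta>: "0 < \<eta>"
    and AP: "approximation_property TYPE('e dual) \<or>
      positive_metric_approximation_property TYPE('x dual dual dual dual)"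
  shows "\<exists>v x. series_rep S (c + \<eta>) v x"
proof -
  \<comment> \<open>The first block costs as much as the given representation, and all later ones
    together at most \<open>\<eta>\<close>.\<close>
  define e where "e n = (if n = 0 then c else \<eta> / 2 ^ n)" for n :: nat
  have e: "0 < e n" for n using c \<eta> by (simp add: e_def)
  have "(\<Sum>l<Suc k. e l) = c + \<eta> - \<eta> / 2 ^ k" for k
    by (induction k) (simp_all add: e_def field_simps)
  then have sum_e: "(\<Sum>l<Suc k. e l) \<le> c + \<eta>" for k using \<eta> by simp
  have "(\<lambda>n. \<eta> / 2 ^ n) \<longlonglongrightarrow> 0"
    using LIMSEQ_divide_realpow_zero[of 2 \<eta>] by simp
  moreover have "\<forall>\<^sub>F n in sequentially. e n = \<eta> / 2 ^ n"
    using eventually_gt_at_top[of 0] by eventually_elim (simp add: e_def)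
  ultimately have e_lim: "e \<longlonglongrightarrow> 0" by (rule Lim_transform_eventually[OF _ eventually_mono]) simp
  \<comment> \<open>Here \<open>f n\<close> is what remains of \<open>S\<close> after
    \<open>n\<close> steps. It has cost \<open>e n\<close> in the bidual, so the remainders tend to
    0 in norm and their differences telescope to \<open>S\<close>.\<close>
  have "\<exists>f. \<forall>n. ((\<exists>u \<xi>. series_rep (bidual o\<^sub>L f n) (e n) u \<xi>) \<and> (n = 0 \<longrightarrow> f n = S)) \<and>
      fin_rep (f n - f (Suc n)) (e n)"
  proof (rule dependent_nat_choice)
    show "\<exists>T. (\<exists>u \<xi>. series_rep (bidual o\<^sub>L T) (e 0) u \<xi>) \<and> (0 = (0::nat) \<longrightarrow> T = S)"
      using rep by (auto simp: e_def)
  next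
    fix T and n :: nat
    assume "(\<exists>u \<xi>. series_rep (bidual o\<^sub>L T) (e n) u \<xi>) \<and> (n = 0 \<longrightarrow> T = S)"
    then obtain u \<xi> where r: "series_rep (bidual o\<^sub>L T) (e n) u \<xi>" by blast
    obtain B where "fin_rep B (e n)" "\<exists>u' \<xi>'. series_rep (bidual o\<^sub>L (T - B)) (e (Suc n)) u' \<xi>'"
      using series_rep_step[OF X r e e AP] by blast
    then show "\<exists>T'. ((\<exists>u \<xi>. series_rep (bidual o\<^sub>L T') (e (Suc n)) u \<xi>) \<and> (Suc n = 0 \<longrightarrow> T' = S)) \<and>
        fin_rep (T - T') (e n)"
      by (intro exI[of _ "T - B"]) simp
  qed
  then obtain f where f: "\<And>n. \<exists>u \<xi>. series_rep (bidual o\<^sub>L f n) (e n) u \<xi>" "f 0 = S"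
    "\<And>n. fin_rep (f n - f (Suc n)) (e n)" by blast
  have "norm (f n) \<le> e n" for n using f(1)[of n] series_rep_norm by fastforce
  then have "f \<longlonglongrightarrow> 0" by (intro Lim_null_comparison[OF _ e_lim] always_eventually) blast
  then have "(\<lambda>n. f n - f (Suc n)) sums (f 0 - 0)" by (rule telescope_sums')
  then have sums: "(\<lambda>n. f n - f (Suc n)) sums S" by (simp add: f(2))
  define good where "good l z \<longleftrightarrow> 0 < fst z \<and> (\<forall>i. 0 \<le> snd (snd z) i) \<and>
      (\<forall>m\<le>fst z. (\<Sum>i<m. norm (fst (snd z) i) powr P) \<le> e l) \<and>
      (\<forall>m\<le>fst z. weak_bound m (snd (snd z)) (e l)) \<and>
      f l - f (Suc l) = (\<Sum>i<fst z. rank_one (fst (snd z) i) (snd (snd z) i))"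
    for l and z :: "nat \<times> (nat \<Rightarrow> 'e dual) \<times> (nat \<Rightarrow> 'x)"
  have "\<exists>z. good l z" for l
  proof (rule fin_rep_nonemptyE[OF f(3)[of l]])
    fix n v y
    assume "0 < n" "\<And>i. 0 \<le> y i" "\<And>m. m \<le> n \<Longrightarrow> (\<Sum>i<m. norm (v i) powr P) \<le> e l"
      "\<And>m. m \<le> n \<Longrightarrow> weak_bound m y (e l)" "f l - f (Suc l) = (\<Sum>i<n. rank_one (v i) (y i))"
    then have "good l (n, v, y)" by (simp add: good_def)
    then show "\<exists>z. good l z" by blast
  qed
  then obtain z where z: "\<And>l. good l (z l)" by metis
  define r V Y where "r l = fst (z l)" and "V l = fst (snd (z l))" and "Y l = snd (snd (z l))" for l
  have r: "0 < r l" and Y: "0 \<le> Y l i" and V: "m \<le> r l \<Longrightarrow> (\<Sum>i<m. norm (V l i) powr P) \<le> e l"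
    and wb: "m \<le> r l \<Longrightarrow> weak_bound m (Y l) (e l)"
    and B: "f l - f (Suc l) = (\<Sum>i<r l. rank_one (V l i) (Y l i))" for l i m
    using z[of l] by (simp_all add: good_def r_def V_def Y_def)
  interpret blocks r by unfold_locales (rule r)
  define v x where "v n = (case block_index r n of (l, q) \<Rightarrow> V l q)"
    and "x n = (case block_index r n of (l, q) \<Rightarrow> Y l q)" for n
  have "series_rep S (c + \<eta>) v x"
    unfolding series_rep_def
  proof (intro conjI allI)
    show "0 \<le> x j" for j using Y by (simp add: x_def split: prod.split)
  next
    fix n
    obtain k i where ki: "block_index r n = (k, i)" by fastforce
    have i: "i \<le> r k" using block_index_less[OF ki] by simp
    have "(\<Sum>j<n. norm (v j) powr P) = (\<Sum>j<n. case block_index r j of (l, q) \<Rightarrow> norm (V l q) powr P)"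
      by (intro sum.cong) (auto simp: v_def split: prod.split)
    also have "\<dots> = (\<Sum>l<k. \<Sum>q<r l. norm (V l q) powr P) + (\<Sum>q<i. norm (V k q) powr P)"
      by (rule block_sum[OF ki])
    also have "\<dots> \<le> (\<Sum>l<k. e l) + e k" by (intro add_mono sum_mono V i order_refl)
    also have "\<dots> \<le> c + \<eta>" using sum_e[of k] by simp
    finally show "(\<Sum>j<n. norm (v j) powr P) \<le> c + \<eta>" .
    show "weak_bound n x (c + \<eta>)"
      unfolding weak_bound_def
    proof
      fix a :: "nat \<Rightarrow> real"
      \<comment> \<open>The coefficients are regrouped along the blocks, so that the weak bounds of
        the single blocks can be added.\<close>
      define a' where "a' l q = a ((\<Sum>l<l. r l) + q)" for l q
      have split: "(\<Sum>j<n. F (a j) (block_index r j)) =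
          (\<Sum>l<k. \<Sum>q<r l. F (a' l q) (l, q)) + (\<Sum>q<i. F (a' k q) (k, q))" for F :: "real \<Rightarrow> nat \<times> nat \<Rightarrow> 'b::comm_monoid_add"
      proof -
        have "(\<Sum>j<n. F (a j) (block_index r j)) = (\<Sum>j<n. case block_index r j of (l, q) \<Rightarrow> F (a' l q) (l, q))"
          by (intro sum.cong) (auto simp: a'_def dest: block_index_eq split: prod.split)
        also have "\<dots> = (\<Sum>l<k. \<Sum>q<r l. F (a' l q) (l, q)) + (\<Sum>q<i. F (a' k q) (k, q))" by (rule block_sum[OF ki])
        finally show ?thesis .
      qed
      have "(\<Sum>j<n. a j *\<^sub>R x j) = (\<Sum>l<k. \<Sum>q<r l. a' l q *\<^sub>R Y l q) + (\<Sum>q<i. a' k q *\<^sub>R Y k q)"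
        using split[of "\<lambda>t (l, q). t *\<^sub>R Y l q"] by (simp add: x_def case_prod_beta)
      also have "norm \<dots> \<le> (\<Sum>l<k. norm (\<Sum>q<r l. a' l q *\<^sub>R Y l q)) + norm (\<Sum>q<i. a' k q *\<^sub>R Y k q)"
        by (intro order_trans[OF norm_triangle_ineq] add_mono norm_sum order_refl)
      also have "\<dots> \<le> (\<Sum>l<k. (\<Sum>q<r l. \<bar>a' l q\<bar> powr P) / P + e l * (1 - 1 / P)) +
          ((\<Sum>q<i. \<bar>a' k q\<bar> powr P) / P + e k * (1 - 1 / P))"
        by (intro add_mono sum_mono weak_boundD wb i order_refl)
      also have "\<dots> = (\<Sum>j<n. \<bar>a j\<bar> powr P) / P + (\<Sum>l<Suc k. e l) * (1 - 1 / P)"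
        using split[of "\<lambda>t _. \<bar>t\<bar> powr P"]
        by (simp add: sum.distrib add_divide_distrib sum_divide_distrib sum_distrib_right distrib_right)
      also have "\<dots> \<le> (\<Sum>j<n. \<bar>a j\<bar> powr P) / P + (c + \<eta>) * (1 - 1 / P)"
        using sum_e[of k] P_ge_1 by (intro add_left_mono mult_right_mono) auto
      finally show "norm (\<Sum>j<n. a j *\<^sub>R x j) \<le> (\<Sum>j<n. \<bar>a j\<bar> powr P) / P + (c + \<eta>) * (1 - 1 / P)" .
    qed
  next
    have "(\<lambda>n. case block_index r n of (l, q) \<Rightarrow> rank_one (V l q) (Y l q)) sums S"
    proof (rule block_sums[OF _ _ e_lim])
      show "(\<lambda>l. \<Sum>q<r l. rank_one (V l q) (Y l q)) sums S" using sums by (simp add: B)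
      show "norm (\<Sum>q<i. rank_one (V l q) (Y l q)) \<le> e l" if "i < r l" for l i
        using that Y V wb by (intro fin_rep_norm fin_repI[of i "Y l" "V l"]) auto
    qed
    moreover have "(\<lambda>n. case block_index r n of (l, q) \<Rightarrow> rank_one (V l q) (Y l q)) = (\<lambda>j. rank_one (v j) (x j))"
      by (auto simp: v_def x_def split: prod.split)
    ultimately show "(\<lambda>j. rank_one (v j) (x j)) sums S" by simp
  qed
  then show ?thesis by blast
qed

end

section \<open>Duality of sequence spaces\<close>

text \<open>Finite sequences in the unit ball of \<ell>_p. They norm the conjugate sequence space,
  so weak norms become suprema of norms of finite linear combinations, for all exponents
  alike.\<close>

definition unit_coeffs :: "ennreal \<Rightarrow> nat \<Rightarrow> (nat \<Rightarrow> real) \<Rightarrow> bool"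
  where "unit_coeffs p n a \<longleftrightarrow>
    (if p = \<infinity> then \<forall>i<n. \<bar>a i\<bar> \<le> 1 else (\<Sum>i<n. \<bar>a i\<bar> powr enn2real p) \<le> 1)"

lemma exponent_cases:
  assumes "1 \<le> (p::ennreal)"
  obtains "p = 1" "conjugate_exponent p = \<infinity>"
  | P where "1 < P" "p = ennreal P" "conjugate_exponent p = ennreal (P / (P - 1))"
  | "p = \<infinity>" "conjugate_exponent p = 1"
proof (cases p)
  case (real P)
  then have "1 \<le> P" using assms by (simp flip: ennreal_1)
  show thesis
  proof (cases "P = 1")
    case True
    then show thesis using that(1) real by (simp add: conjugate_exponent_1)
  next
    case False
    then have P: "1 < P" using \<open>1 \<le> P\<close> by simp
    have "1 - inverse p = ennreal (1 - 1 / P)"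
      using real P by (simp add: inverse_ennreal divide_inverse flip: ennreal_1 ennreal_minus)
    then have "conjugate_exponent p = ennreal (inverse (1 - 1 / P))"
      using P unfolding conjugate_exponent_def by (simp add: inverse_ennreal)
    also have "inverse (1 - 1 / P) = P / (P - 1)" using P by (simp add: field_simps)
    finally show thesis using that(2)[OF P] real by simp
  qed
next
  case top
  then show thesis using that(3) conjugate_exponent_infinity by simp
qed

lemma sum_le_lp_norm:
  fixes b :: "nat \<Rightarrow> real"
  assumes p: "1 \<le> p" and b: "in_lp (conjugate_exponent p) b" and a: "unit_coeffs p n a"
  shows "\<bar>\<Sum>i<n. a i * b i\<bar> \<le> lp_norm (conjugate_exponent p) b"
  using p
proof (cases rule: exponent_cases)
  case 1
  have bdd: "bdd_above (range (\<lambda>n. norm (b n)))"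
    using b 1(2) by (auto simp: in_lp_def bounded_iff bdd_above_def)
  have le: "\<bar>b i\<bar> \<le> lp_norm (conjugate_exponent p) b" for i
    using cSUP_upper[OF UNIV_I bdd, of i] by (simp add: lp_norm_def 1(2))
  have "\<bar>\<Sum>i<n. a i * b i\<bar> \<le> (\<Sum>i<n. \<bar>a i\<bar> * \<bar>b i\<bar>)" by (rule order_trans[OF sum_abs]) (simp add: abs_mult)
  also have "\<dots> \<le> (\<Sum>i<n. \<bar>a i\<bar> * lp_norm (conjugate_exponent p) b)" by (intro sum_mono mult_left_mono le) simp
  also have "\<dots> \<le> 1 * lp_norm (conjugate_exponent p) b"
    unfolding sum_distrib_right[symmetric]
    using a le[of 0] by (intro mult_right_mono) (auto simp: unit_coeffs_def 1(1))
  finally show ?thesis by simp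
next
  case (2 P)
  define Q where "Q = P / (P - 1)"
  have Q: "1 < Q" "1 / P + 1 / Q = 1" using 2 by (simp_all add: Q_def field_simps)
  have eQ: "enn2real (conjugate_exponent p) = Q" "conjugate_exponent p \<noteq> top" and eP: "enn2real p = P" "p \<noteq> top"
    using 2 Q by (simp_all add: Q_def)
  have sb: "summable (\<lambda>i. \<bar>b i\<bar> powr Q)" using b by (simp add: in_lp_def eQ)
  define s where "s = (\<Sum>i. \<bar>b i\<bar> powr Q)"
  have s0: "0 \<le> s" unfolding s_def by (intro suminf_nonneg sb) auto
  have part: "(\<Sum>i<n. \<bar>b i\<bar> powr Q) \<le> s" unfolding s_def by (intro sum_le_suminf sb) auto
  have N: "lp_norm (conjugate_exponent p) b = s powr (1 / Q)" by (simp add: lp_norm_def eQ s_def)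
  show ?thesis
  proof (cases "s = 0")
    case True
    have "\<bar>b i\<bar> powr Q = 0" for i
      using sum_le_suminf[OF sb, of "{i}"] True by (simp add: s_def)
    then show ?thesis by (simp add: N)
  next
    case False
    define t where "t = s powr (1 / Q)"
    have t: "0 < t" "t powr Q = s" using False s0 Q by (simp_all add: t_def powr_powr)
    have "(\<Sum>i<n. \<bar>a i\<bar> * (\<bar>b i\<bar> / t)) \<le> (\<Sum>i<n. \<bar>a i\<bar> powr P / P + (\<bar>b i\<bar> / t) powr Q / Q)"
      using Q 2(1) t by (intro sum_mono Youngs_inequality) auto
    also have "\<dots> = (\<Sum>i<n. \<bar>a i\<bar> powr P) / P + (\<Sum>i<n. \<bar>b i\<bar> powr Q) / s / Q"
      using t by (simp add: sum.distrib sum_divide_distrib powr_divide)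
    also have "\<dots> \<le> 1 / P + 1 / Q"
    proof (intro add_mono divide_right_mono)
      show "(\<Sum>i<n. \<bar>a i\<bar> powr P) \<le> 1" using a by (simp add: unit_coeffs_def eP)
      show "(\<Sum>i<n. \<bar>b i\<bar> powr Q) / s \<le> 1" using part False s0 by (simp add: field_simps)
    qed (use Q 2 in auto)
    finally have "(\<Sum>i<n. \<bar>a i\<bar> * \<bar>b i\<bar>) \<le> t"
      using t Q by (simp add: field_simps flip: sum_divide_distrib)
    moreover have "\<bar>\<Sum>i<n. a i * b i\<bar> \<le> (\<Sum>i<n. \<bar>a i\<bar> * \<bar>b i\<bar>)" by (rule order_trans[OF sum_abs]) (simp add: abs_mult)
    ultimately show ?thesis by (simp add: N t_def)
  qed
next
  case 3
  have sb: "summable (\<lambda>i. \<bar>b i\<bar>)" using b by (simp add: in_lp_def 3(2))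
  have "\<bar>\<Sum>i<n. a i * b i\<bar> \<le> (\<Sum>i<n. \<bar>a i\<bar> * \<bar>b i\<bar>)" by (rule order_trans[OF sum_abs]) (simp add: abs_mult)
  also have "\<dots> \<le> (\<Sum>i<n. 1 * \<bar>b i\<bar>)"
    using a by (intro sum_mono mult_right_mono) (auto simp: unit_coeffs_def 3(1))
  also have "\<dots> \<le> (\<Sum>i. \<bar>b i\<bar>)" using sum_le_suminf[OF sb, of "{..<n}"] by simp
  finally show ?thesis
    using suminf_nonneg[OF sb] by (simp add: lp_norm_def 3(2))
qed

lemma in_lpI_finite:
  fixes b :: "nat \<Rightarrow> 'a::real_normed_vector"
  assumes P: "1 \<le> P" and b: "\<And>n. (\<Sum>i<n. norm (b i) powr P) \<le> t"
  shows "in_lp (ennreal P) b" "lp_norm (ennreal P) b \<le> t powr (1 / P)"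
proof -
  have sb: "summable (\<lambda>i. norm (b i) powr P)" by (rule summableI_nonneg_bounded[OF _ b]) simp
  then show "in_lp (ennreal P) b" using P by (simp add: in_lp_def)
  have "(\<Sum>i. norm (b i) powr P) \<le> t" by (rule suminf_le_const[OF sb b])
  then show "lp_norm (ennreal P) b \<le> t powr (1 / P)"
    using P suminf_nonneg[OF sb] by (simp add: lp_norm_def powr_mono2)
qed

lemma in_lp_dualI:
  fixes b :: "nat \<Rightarrow> real"
  assumes p: "1 \<le> p" and K: "\<And>n a. unit_coeffs p n a \<Longrightarrow> (\<Sum>i<n. a i * b i) \<le> K"
  shows "in_lp (conjugate_exponent p) b" "lp_norm (conjugate_exponent p) b \<le> K"
proof -
  have "unit_coeffs p 0 (\<lambda>_. 0)" by (simp add: unit_coeffs_def)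
  from K[OF this] have K0: "0 \<le> K" by simp
  have "in_lp (conjugate_exponent p) b \<and> lp_norm (conjugate_exponent p) b \<le> K"
    using p
  proof (cases rule: exponent_cases)
    case 1
    have le: "\<bar>b i\<bar> \<le> K" for i
    proof -
      let ?a = "\<lambda>j. if j = i then sgn (b i) else 0"
      have "(\<Sum>j<Suc i. \<bar>?a j\<bar>) = (\<Sum>j<Suc i. if j = i then \<bar>sgn (b i)\<bar> else 0)" by (intro sum.cong) auto
      then have "unit_coeffs p (Suc i) ?a" by (simp add: unit_coeffs_def 1(1) abs_sgn_eq)
      from K[OF this] have "(\<Sum>j<Suc i. ?a j * b j) \<le> K" .
      moreover have "(\<Sum>j<Suc i. ?a j * b j) = (\<Sum>j<Suc i. if j = i then \<bar>b i\<bar> else 0)"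
        by (intro sum.cong) (auto simp: sgn_mult_self_eq abs_sgn mult.commute)
      ultimately show ?thesis by simp
    qed
    then show ?thesis
      by (auto simp: in_lp_def lp_norm_def 1(2) bounded_iff intro!: cSUP_least)
  next
    case (2 P)
    define Q where "Q = P / (P - 1)"
    have Q: "1 < Q" "1 / P + 1 / Q = 1" "(Q - 1) * P = Q" using 2 by (simp_all add: Q_def field_simps)
    have eP: "enn2real p = P" "p \<noteq> top" using 2 by simp_all
    have "(\<Sum>i<n. norm (b i) powr Q) \<le> K powr Q" for n
    proof (cases "(\<Sum>i<n. \<bar>b i\<bar> powr Q) = 0")
      case False
      define s where "s = (\<Sum>i<n. \<bar>b i\<bar> powr Q)"
      have s: "0 < s" using False sum_nonneg[of "{..<n}" "\<lambda>i. \<bar>b i\<bar> powr Q"] by (simp add: s_def order_less_le)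
      \<comment> \<open>The extremal coefficients in Hoelder's inequality; they have unit norm in
        \<ell>_P because \<open>(Q - 1) * P = Q\<close>.\<close>
      define a where "a i = sgn (b i) * \<bar>b i\<bar> powr (Q - 1) / s powr (1 / P)" for i
      have "\<bar>a i\<bar> powr P = \<bar>b i\<bar> powr Q / s" for i
      proof (cases "b i = 0")
        case True
        then show ?thesis by (simp add: a_def)
      next
        case False
        then have "\<bar>a i\<bar> = \<bar>b i\<bar> powr (Q - 1) / s powr (1 / P)" by (simp add: a_def abs_mult abs_sgn_eq)
        then show ?thesis using s 2(1) by (simp add: powr_divide powr_powr Q(3))
      qed
      then have "(\<Sum>i<n. \<bar>a i\<bar> powr P) = (\<Sum>i<n. \<bar>b i\<bar> powr Q) / s" by (simp add: sum_divide_distrib)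
      then have "(\<Sum>i<n. \<bar>a i\<bar> powr P) = s / s" by (simp only: s_def[symmetric])
      then have "unit_coeffs p n a" using s by (simp add: unit_coeffs_def eP)
      have "a i * b i = \<bar>b i\<bar> powr Q / s powr (1 / P)" for i
      proof (cases "b i = 0")
        case False
        have "a i * b i = (sgn (b i) * b i) * \<bar>b i\<bar> powr (Q - 1) / s powr (1 / P)" by (simp add: a_def)
        also have "sgn (b i) * b i = \<bar>b i\<bar> powr 1" using False by (simp add: sgn_if)
        also have "\<bar>b i\<bar> powr 1 * \<bar>b i\<bar> powr (Q - 1) = \<bar>b i\<bar> powr Q" by (simp only: powr_add[symmetric]) simp
        finally show ?thesis .
      qed (simp add: a_def)
      then have "(\<Sum>i<n. a i * b i) = (\<Sum>i<n. \<bar>b i\<bar> powr Q) / s powr (1 / P)" by (simp add: sum_divide_distrib)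
      then have "s / s powr (1 / P) \<le> K" using K[OF \<open>unit_coeffs p n a\<close>] by (simp only: s_def[symmetric])
      also have "s / s powr (1 / P) = s powr (1 / Q)"
      proof -
        have "1 / Q = 1 - 1 / P" using Q(2) by simp
        then show ?thesis using s by (simp add: powr_diff)
      qed
      finally have "(s powr (1 / Q)) powr Q \<le> K powr Q" using Q by (intro powr_mono2) auto
      then show ?thesis using s Q by (simp add: powr_powr s_def)
    qed simp
    from in_lpI_finite[OF _ this] show ?thesis
      using Q K0 by (simp add: 2(3) Q_def[symmetric] powr_powr)
  next
    case 3
    have part: "(\<Sum>i<n. \<bar>b i\<bar>) \<le> K" for n
    proof -
      have "unit_coeffs p n (\<lambda>i. sgn (b i))" by (simp add: unit_coeffs_def 3(1) abs_sgn_eq)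
      moreover have "sgn (b i) * b i = \<bar>b i\<bar>" for i by (simp add: sgn_if)
      ultimately show ?thesis using K[of n "\<lambda>i. sgn (b i)"] by simp
    qed
    have "(\<Sum>i<n. norm (b i) powr 1) \<le> K" for n using part by simp
    from in_lpI_finite[OF _ this] show ?thesis using K0 by (simp add: 3(2))
  qed
  then show "in_lp (conjugate_exponent p) b" "lp_norm (conjugate_exponent p) b \<le> K" by auto
qed

lemma in_weak_lpI:
  fixes x :: "nat \<Rightarrow> 'y::real_normed_vector"
  assumes p: "1 \<le> p" and K: "\<And>n a. unit_coeffs p n a \<Longrightarrow> norm (\<Sum>i<n. a i *\<^sub>R x i) \<le> K"
  shows "in_weak_lp (conjugate_exponent p) x" "weak_lp_norm (conjugate_exponent p) x \<le> K"
proof -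
  have *: "(\<Sum>i<n. a i * f (x i)) \<le> norm f * K" if "unit_coeffs p n a" for f :: "'y dual" and n a
  proof -
    have "(\<Sum>i<n. a i * f (x i)) = f (\<Sum>i<n. a i *\<^sub>R x i)" by (simp add: blinfun.sum_right blinfun.scaleR_right)
    also have "\<dots> \<le> norm f * norm (\<Sum>i<n. a i *\<^sub>R x i)" using norm_blinfun[of f] by (metis abs_le_D1 real_norm_def)
    also have "\<dots> \<le> norm f * K" by (intro mult_left_mono K that) simp
    finally show ?thesis .
  qed
  show "in_weak_lp (conjugate_exponent p) x"
    unfolding in_weak_lp_def using in_lp_dualI(1)[OF p *] by blast
  have "unit_coeffs p 0 (\<lambda>_. 0)" by (simp add: unit_coeffs_def)
  from K[OF this] have K0: "0 \<le> K" by simp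
  show "weak_lp_norm (conjugate_exponent p) x \<le> K"
    unfolding weak_lp_norm_def
  proof (rule cSUP_least)
    fix f :: "'y dual" assume "f \<in> cball 0 1"
    then have "norm f * K \<le> 1 * K" using K0 by (intro mult_right_mono) auto
    moreover have "lp_norm (conjugate_exponent p) (\<lambda>n. f (x n)) \<le> norm f * K"
      by (rule in_lp_dualI(2)[OF p *])
    ultimately show "lp_norm (conjugate_exponent p) (\<lambda>n. f (x n)) \<le> K" by simp
  qed auto
qed

text \<open>
  The uniform boundedness principle makes the supremum in \<^const>\<open>weak_lp_norm\<close> that of a bounded set.
\<close>

lemma norm_sum_le_weak_lp_norm:
  fixes x :: "nat \<Rightarrow> 'y::real_normed_vector"
  assumes p: "1 \<le> p" and x: "in_weak_lp (conjugate_exponent p) x" and a: "unit_coeffs p n a"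
  shows "norm (\<Sum>i<n. a i *\<^sub>R x i) \<le> weak_lp_norm (conjugate_exponent p) x"
proof -
  have le: "\<bar>f (\<Sum>i<n. a i *\<^sub>R x i)\<bar> \<le> lp_norm (conjugate_exponent p) (\<lambda>n. f (x n))"
    if "unit_coeffs p n a" for f :: "'y dual" and n a
    using sum_le_lp_norm[OF p _ that, of "\<lambda>n. f (x n)"] x
    by (simp add: in_weak_lp_def blinfun.sum_right blinfun.scaleR_right)
  define V where "V = {\<Sum>i<n. a i *\<^sub>R x i | n a. unit_coeffs p n a}"
  have "\<exists>K. \<forall>v\<in>V. norm v \<le> K"
    by (rule weakly_bounded_imp_bounded) (use le in \<open>unfold V_def, blast\<close>)
  then obtain K where "\<And>n a. unit_coeffs p n a \<Longrightarrow> norm (\<Sum>i<n. a i *\<^sub>R x i) \<le> K" unfolding V_def by blast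
  then have K: "(\<Sum>i<n. a i * f (x i)) \<le> K" if "unit_coeffs p n a" "norm f \<le> 1" for f :: "'y dual" and n a
    using blinfun_le_norm[OF that(2), of "\<Sum>i<n. a i *\<^sub>R x i"] that(1)
    by (fastforce simp: blinfun.sum_right blinfun.scaleR_right)
  have bdd: "bdd_above ((\<lambda>f. lp_norm (conjugate_exponent p) (\<lambda>n. blinfun_apply f (x n))) ` (cball 0 1 :: 'y dual set))"
    using in_lp_dualI(2)[OF p K] by (intro bdd_aboveI[of _ K]) auto
  show ?thesis
  proof (rule norm_le_dual)
    fix f :: "'y dual" assume "norm f \<le> 1"
    then have "lp_norm (conjugate_exponent p) (\<lambda>n. f (x n)) \<le> weak_lp_norm (conjugate_exponent p) x"
      unfolding weak_lp_norm_def by (intro cSUP_upper bdd) simp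
    then show "\<bar>f (\<Sum>i<n. a i *\<^sub>R x i)\<bar> \<le> weak_lp_norm (conjugate_exponent p) x"
      using le[OF a, of f] by linarith
  qed
qed

section \<open>Transposed series and the two kinds of nuclear representation\<close>

lemma norm_flip_le:
  fixes T :: "'a::real_normed_vector \<Rightarrow>\<^sub>L 'b::real_normed_vector dual" and T' :: "'b \<Rightarrow>\<^sub>L 'a dual"
  assumes "\<And>x y. T x y = T' y x"
  shows "norm T \<le> norm T'"
proof (intro norm_blinfun_bound norm_ge_zero)
  fix x y
  have "norm (T x y) \<le> norm (T' y) * norm x" unfolding assms by (rule norm_blinfun)
  also have "\<dots> \<le> (norm T' * norm y) * norm x" by (intro mult_right_mono norm_blinfun) simp
  finally show "norm (T x y) \<le> norm T' * norm x * norm y" by (simp add: ac_simps)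
qed simp

text \<open>The adjoint and \<open>bidual o\<^sub>L S\<close> are the two operators of one bilinear
  form, and transposition does not increase norms; convergence in operator norm is therefore
  preserved.\<close>

lemma sums_bidual_of_sums_dual_map:
  fixes S :: "'e::real_normed_vector \<Rightarrow>\<^sub>L 'x::real_normed_vector"
  assumes "(\<lambda>j. rank_one (\<xi> j) (u j)) sums dual_map S"
  shows "(\<lambda>j. rank_one (u j) (\<xi> j)) sums (bidual o\<^sub>L S)"
  unfolding sums_def
proof (rule LIM_zero_cancel, rule Lim_null_comparison)
  show "\<forall>\<^sub>F m in sequentially. norm ((\<Sum>j<m. rank_one (u j) (\<xi> j)) - (bidual o\<^sub>L S)) \<le>
      norm ((\<Sum>j<m. rank_one (\<xi> j) (u j)) - dual_map S)"
    by (intro always_eventually allI norm_flip_le)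
      (simp add: blinfun.diff_left blinfun.sum_left blinfun.scaleR_left mult.commute)
  show "(\<lambda>m. norm ((\<Sum>j<m. rank_one (\<xi> j) (u j)) - dual_map S)) \<longlonglongrightarrow> 0"
    using assms unfolding sums_def by (intro tendsto_norm_zero LIM_zero)
qed

lemma sums_dual_map:
  fixes S :: "'e::real_normed_vector \<Rightarrow>\<^sub>L 'x::real_normed_vector"
  assumes "(\<lambda>j. rank_one (v j) (x j)) sums S"
  shows "(\<lambda>j. rank_one (bidual (x j)) (v j)) sums dual_map S"
  unfolding sums_def
proof (rule LIM_zero_cancel, rule Lim_null_comparison)
  have "norm ((\<Sum>j<m. rank_one (bidual (x j)) (v j)) - dual_map S) \<le> norm (bidual o\<^sub>L ((\<Sum>j<m. rank_one (v j) (x j)) - S))" for m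
    by (rule norm_flip_le)
      (simp add: blinfun.diff_left blinfun.diff_right blinfun.sum_left blinfun.sum_right blinfun.scaleR_left blinfun.scaleR_right mult.commute)
  then show "\<forall>\<^sub>F m in sequentially. norm ((\<Sum>j<m. rank_one (bidual (x j)) (v j)) - dual_map S) \<le>
      norm ((\<Sum>j<m. rank_one (v j) (x j)) - S)"
    by (intro always_eventually) simp
  show "(\<lambda>m. norm ((\<Sum>j<m. rank_one (v j) (x j)) - S)) \<longlonglongrightarrow> 0"
    using assms unfolding sums_def by (intro tendsto_norm_zero LIM_zero)
qed

lemma weak_lp_norm_nonneg:
  assumes "1 \<le> p" "in_weak_lp (conjugate_exponent p) x"
  shows "0 \<le> weak_lp_norm (conjugate_exponent p) x"
  using norm_sum_le_weak_lp_norm[OF assms, of 0 "\<lambda>_. 0"] by (simp add: unit_coeffs_def)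

text \<open>The easy inequality between the two nuclear norms: a representation of \<open>S\<close>
  is transposed and its vectors are embedded, at no higher cost.\<close>

lemma positively_nuclear_rep_dual_map:
  fixes S :: "'e::real_normed_vector \<Rightarrow>\<^sub>L 'x::{real_normed_vector,ord}"
  assumes p: "1 \<le> p" and rep: "latticially_nuclear_rep p S v x"
  shows "positively_nuclear_rep p (dual_map S) (\<lambda>j. bidual (x j)) v"
    "weak_lp_norm (conjugate_exponent p) (\<lambda>j. bidual (x j)) \<le> weak_lp_norm (conjugate_exponent p) x"
proof -
  have x: "in_weak_lp (conjugate_exponent p) x" using rep by (simp add: latticially_nuclear_rep_def)
  have *: "norm (\<Sum>i<n. a i *\<^sub>R bidual (x i)) \<le> weak_lp_norm (conjugate_exponent p) x"
    if "unit_coeffs p n a" for n a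
  proof -
    have "(\<Sum>i<n. a i *\<^sub>R bidual (x i)) = bidual (\<Sum>i<n. a i *\<^sub>R x i)"
      by (simp add: blinfun.sum_right blinfun.scaleR_right)
    then show ?thesis using norm_sum_le_weak_lp_norm[OF p x that] by simp
  qed
  show "weak_lp_norm (conjugate_exponent p) (\<lambda>j. bidual (x j)) \<le> weak_lp_norm (conjugate_exponent p) x"
    by (rule in_weak_lpI(2)[OF p *])
  have "in_weak_lp (conjugate_exponent p) (\<lambda>j. bidual (x j))"
    by (rule in_weak_lpI(1)[OF p *])
  then show "positively_nuclear_rep p (dual_map S) (\<lambda>j. bidual (x j)) v"
    using rep by (auto simp: latticially_nuclear_rep_def positively_nuclear_rep_def bidual_nonneg sums_dual_map)
qed

text \<open>Either norm of a representation may vanish, whereas balancing it divides by one of them;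
  both are therefore increased slightly.\<close>

lemma product_perturbation:
  fixes a b e :: real
  assumes "0 \<le> a" "0 \<le> b" "0 < e"
  obtains a' b' where "a < a'" "b < b'" "a' * b' \<le> a * b + e"
proof -
  define d where "d = min 1 (e / (a + b + 1))"
  have d: "0 < d" "d \<le> 1" using assms by (auto simp: d_def)
  have "d * (a + b + 1) \<le> e / (a + b + 1) * (a + b + 1)"
    using assms by (intro mult_right_mono) (auto simp: d_def)
  then have de: "d * (a + b + 1) \<le> e" using assms by simp
  have "(a + d) * (b + d) = a * b + d * (a + b + d)" by (simp add: algebra_simps)
  also have "\<dots> \<le> a * b + d * (a + b + 1)" using d by (intro add_left_mono mult_left_mono) auto
  finally show thesis using that[of "a + d" "b + d"] d de by simp
qed

lemma latticially_nuclear_rep_finite_exponent: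
  fixes S :: "'e::real_normed_vector \<Rightarrow>\<^sub>L 'x::banach_lattice"
  assumes p: "1 \<le> p" "p \<noteq> \<infinity>"
    and AP: "approximation_property TYPE('e dual) \<or>
      positive_metric_approximation_property TYPE('x dual dual dual dual)"
    and rep: "positively_nuclear_rep p (dual_map S) \<xi> u" and e: "0 < e"
  shows "\<exists>v x. latticially_nuclear_rep p S v x \<and>
    lp_norm p v * weak_lp_norm (conjugate_exponent p) x \<le>
      weak_lp_norm (conjugate_exponent p) \<xi> * lp_norm p u + e"
proof -
  obtain P where P: "p = ennreal P" "1 \<le> P"
  proof (cases p)
    case (real r)
    then show thesis using that[of r] p by (simp flip: ennreal_1)
  qed (use p in simp)
  interpret finite_exponent P by unfold_locales (rule P)
  have eP: "enn2real p = P" "p \<noteq> top" using P by simp_all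
  have \<xi>: "in_weak_lp (conjugate_exponent p) \<xi>" "\<And>j. 0 \<le> \<xi> j" and u: "in_lp p u"
    and sums: "(\<lambda>j. rank_one (u j) (\<xi> j)) sums (bidual o\<^sub>L S)"
    using rep sums_bidual_of_sums_dual_map by (auto simp: positively_nuclear_rep_def)
  have su: "summable (\<lambda>n. norm (u n) powr P)" using u by (simp add: in_lp_def eP)
  define s where "s = (\<Sum>n. norm (u n) powr P)"
  have s: "0 \<le> s" unfolding s_def by (rule suminf_nonneg[OF su]) simp
  have N: "lp_norm p u = s powr (1 / P)" by (simp add: lp_norm_def eP s_def)
  obtain b a where ab: "weak_lp_norm (conjugate_exponent p) \<xi> < b" "lp_norm p u < a"
    "b * a \<le> weak_lp_norm (conjugate_exponent p) \<xi> * lp_norm p u + e / 2"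
    using product_perturbation[of "weak_lp_norm (conjugate_exponent p) \<xi>" "lp_norm p u" "e / 2"]
      weak_lp_norm_nonneg[OF p(1) \<xi>(1)] N e by auto
  have b0: "0 < b" using ab(1) weak_lp_norm_nonneg[OF p(1) \<xi>(1)] by simp
  have a0: "0 < a" using ab(2) N powr_ge_zero[of s "1 / P"] by linarith
  define t where "t = a * b"
  have t: "0 < t" using a0 b0 by (simp add: t_def)
  \<comment> \<open>Balances the two factors: \<open>l * a = t powr (1 / P)\<close> and
    \<open>b / l = t powr (1 - 1 / P)\<close>.\<close>
  define l where "l = t powr (1 / P) / a"
  have l: "0 < l" using t a0 by (simp add: l_def)
  have "series_rep (bidual o\<^sub>L S) t (\<lambda>j. l *\<^sub>R u j) (\<lambda>j. (1 / l) *\<^sub>R \<xi> j)"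
    unfolding series_rep_def
  proof (intro conjI allI)
    show "0 \<le> (1 / l) *\<^sub>R \<xi> j" for j using l \<xi>(2) by (intro cone_scaleR) auto
    show "(\<Sum>j<n. norm (l *\<^sub>R u j) powr P) \<le> t" for n
    proof -
      have "(\<Sum>j<n. norm (l *\<^sub>R u j) powr P) = l powr P * (\<Sum>j<n. norm (u j) powr P)"
        using l by (simp add: powr_mult sum_distrib_left)
      also have "\<dots> \<le> l powr P * s" unfolding s_def by (intro mult_left_mono sum_le_suminf su) auto
      also have "s = lp_norm p u powr P" using s P(2) by (simp add: N powr_powr)
      also have "l powr P * lp_norm p u powr P \<le> l powr P * a powr P"
        using ab(2) P(2) N by (intro mult_left_mono powr_mono2) auto
      also have "\<dots> = t" using t a0 P(2) by (simp add: l_def powr_divide powr_powr)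
      finally show ?thesis .
    qed
    show "weak_bound n (\<lambda>j. (1 / l) *\<^sub>R \<xi> j) t" for n
      unfolding weak_bound_iff[OF t]
    proof (intro allI impI)
      fix c :: "nat \<Rightarrow> real" assume "(\<Sum>i<n. \<bar>c i\<bar> powr P) \<le> 1"
      then have "unit_coeffs p n c" by (simp add: unit_coeffs_def eP)
      from norm_sum_le_weak_lp_norm[OF p(1) \<xi>(1) this]
      have le: "norm (\<Sum>i<n. c i *\<^sub>R \<xi> i) \<le> b" using ab(1) by simp
      have "(\<Sum>i<n. c i *\<^sub>R (1 / l) *\<^sub>R \<xi> i) = (1 / l) *\<^sub>R (\<Sum>i<n. c i *\<^sub>R \<xi> i)"
        by (simp add: scaleR_sum_right mult.commute)
      then have "norm (\<Sum>i<n. c i *\<^sub>R (1 / l) *\<^sub>R \<xi> i) = (1 / l) * norm (\<Sum>i<n. c i *\<^sub>R \<xi> i)"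
        using l by simp
      also have "\<dots> \<le> (1 / l) * b" using l le by (intro mult_left_mono) auto
      also have "\<dots> = t / t powr (1 / P)" by (simp add: l_def t_def)
      also have "\<dots> = t powr (1 - 1 / P)" using t by (simp add: powr_diff)
      finally show "norm (\<Sum>i<n. c i *\<^sub>R (1 / l) *\<^sub>R \<xi> i) \<le> t powr (1 - 1 / P)" .
    qed
    show "(\<lambda>j. rank_one (l *\<^sub>R u j) ((1 / l) *\<^sub>R \<xi> j)) sums (bidual o\<^sub>L S)"
      using sums l by (simp add: rank_one_scaleR_left rank_one_scaleR_right)
  qed
  from series_rep_descend[OF regular_norm_banach_lattice this t _ AP, of "e / 2"] e
  obtain v x where r: "series_rep S (t + e / 2) v x" by auto
  have te: "0 < t + e / 2" using t e by simp
  have v: "in_lp p v" "lp_norm p v \<le> (t + e / 2) powr (1 / P)"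
    using in_lpI_finite[OF P(2)] r unfolding series_rep_def P(1) by blast+
  have *: "norm (\<Sum>i<n. c i *\<^sub>R x i) \<le> (t + e / 2) powr (1 - 1 / P)" if "unit_coeffs p n c" for n c
    using r that unfolding series_rep_def weak_bound_iff[OF te] by (simp add: unit_coeffs_def eP)
  have x: "in_weak_lp (conjugate_exponent p) x"
    "weak_lp_norm (conjugate_exponent p) x \<le> (t + e / 2) powr (1 - 1 / P)"
    by (rule in_weak_lpI[OF p(1) *], assumption)+
  have "latticially_nuclear_rep p S v x"
    using v x r by (simp add: latticially_nuclear_rep_def series_rep_def)
  moreover have "lp_norm p v * weak_lp_norm (conjugate_exponent p) x \<le>
      (t + e / 2) powr (1 / P) * (t + e / 2) powr (1 - 1 / P)"
    using v x weak_lp_norm_nonneg[OF p(1) x(1)] by (intro mult_mono) auto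
  moreover have "(t + e / 2) powr (1 / P) * (t + e / 2) powr (1 - 1 / P) = t + e / 2"
    using te by (simp flip: powr_add)
  moreover have "t + e / 2 \<le> weak_lp_norm (conjugate_exponent p) \<xi> * lp_norm p u + e"
    using ab(3) by (simp add: t_def mult.commute)
  ultimately show ?thesis by (intro exI[of _ v] exI[of _ x]) linarith
qed

section \<open>Partitions in vector lattices\<close>

lemma lattice_diff_inf: "a - inf b c = sup (a - b) (a - c)"
  and lattice_diff_sup: "a - sup b c = inf (a - b) (a - c)"
  and lattice_sup_diff: "sup a b - c = sup (a - c) (b - c)"
  for a b c :: "'a::lattice_ab_group_add"
  using add_sup_distrib_left[of a "- b" "- c"] add_inf_distrib_left[of a "- b" "- c"]
    add_sup_distrib_right[of a b "- c"]
  by (simp_all add: diff_inf_eq_sup diff_sup_eq_inf)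

lemma inf_pos_neg_part:
  fixes a :: "'a::lattice_ab_group_add"
  shows "inf (sup a 0) (sup (- a) 0) = 0"
proof -
  have "sup (- a) 0 = sup a 0 - a"
    using lattice_sup_diff[of a 0 a] by (simp add: sup_commute)
  moreover have "inf (sup a 0 - 0) (sup a 0 - a) = sup a 0 - sup 0 a" by (rule lattice_diff_sup[symmetric])
  ultimately show ?thesis by (simp add: sup_commute)
qed

lemma inf_add_le:
  fixes a b e :: "'a::lattice_ab_group_add"
  assumes "0 \<le> a" "0 \<le> b" "0 \<le> e"
  shows "inf e (a + b) \<le> inf e a + inf e b"
proof -
  let ?z = "inf e (a + b)"
  have z: "?z \<le> e" "?z \<le> a + b" "0 \<le> ?z" using assms by simp_all
  have "?z - inf e b = sup (?z - e) (?z - b)" by (rule lattice_diff_inf)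
  also have "\<dots> \<le> inf e a"
  proof (intro le_supI le_infI)
    show "?z - e \<le> e" "?z - e \<le> a" using z(1) assms by (simp_all add: diff_le_eq add_increasing)
    show "?z - b \<le> e" using z(1) assms(2) by (simp add: diff_le_eq add_increasing2)
    show "?z - b \<le> a" using z(2) by (simp add: diff_le_eq)
  qed
  finally show ?thesis unfolding diff_le_eq .
qed

text \<open>The infima with \<open>e\<close> are disjoint as well, so their sum is their supremum
  and stays below \<open>e\<close>.\<close>

lemma inf_add_disjoint:
  fixes a b e :: "'a::lattice_ab_group_add"
  assumes "0 \<le> a" "0 \<le> b" "0 \<le> e" "inf a b = 0"
  shows "inf e (a + b) = inf e a + inf e b"
proof (rule antisym)
  show "inf e (a + b) \<le> inf e a + inf e b" by (rule inf_add_le) fact+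
  have "inf (inf e a) (inf e b) \<le> inf a b" by (intro le_infI) (auto intro: le_infI1 le_infI2)
  moreover have "0 \<le> inf (inf e a) (inf e b)" using assms by simp
  ultimately have "inf (inf e a) (inf e b) = 0" using assms(4) by simp
  then have "inf e a + inf e b = sup (inf e a) (inf e b)" using add_eq_inf_sup[of "inf e a" "inf e b"] by simp
  also have "\<dots> \<le> e" by simp
  finally show "inf e a + inf e b \<le> inf e (a + b)" by (simp add: add_mono)
qed

text \<open>For functions: the second difference of the positive part is the hat
  \<open>max (e - |b|) 0\<close>. In a lattice it follows by cutting, as the positive part of
  \<open>c - e\<close> is that of \<open>c\<close> minus its infimum with \<open>e\<close>, and from
  the disjointness of the positive and the negative part of \<open>b\<close>.\<close>

lemma second_difference_pos_part:
  fixes b e :: "'a::lattice_ab_group_add"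
  assumes e: "0 \<le> e"
  shows "sup (b + e) 0 - sup b 0 - sup b 0 + sup (b - e) 0 = sup (e - (sup b 0 + sup (- b) 0)) 0"
proof -
  let ?p = "sup b 0" and ?n = "sup (- b) 0"
  have cut: "sup (c - e) 0 = sup c 0 - inf (sup c 0) e" for c
  proof -
    have "sup c 0 - inf (sup c 0) e = sup (sup c 0 - sup c 0) (sup c 0 - e)" by (rule lattice_diff_inf)
    also have "sup c 0 - e = sup (c - e) (0 - e)" by (rule lattice_sup_diff)
    finally have "sup c 0 - inf (sup c 0) e = sup 0 (sup (c - e) (- e))" by simp
    also have "sup 0 (sup (c - e) (- e)) = sup (c - e) 0"
    proof -
      have "sup 0 (- e) = 0" using e by (simp add: sup_absorb1)
      then have "sup 0 (sup (c - e) (- e)) = sup (c - e) 0" by (metis sup_assoc sup_commute)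
      then show ?thesis .
    qed
    finally show ?thesis by simp
  qed
  have "?n = ?p - b" using lattice_sup_diff[of b 0 b] by (simp add: sup_commute)
  then have b: "b = ?p - ?n" by simp
  have "sup (b + e) 0 - (b + e) = sup (- b - e) 0"
    unfolding lattice_sup_diff by (simp add: sup_commute)
  then have "sup (b + e) 0 = (b + e) + sup (- b - e) 0" by (simp add: diff_eq_eq add.commute)
  also have "sup (- b - e) 0 = ?n - inf ?n e" by (rule cut)
  finally have 1: "sup (b + e) 0 = (b + e) + (?n - inf ?n e)" .
  have "sup (e - (?p + ?n)) 0 = e - inf e (?p + ?n)"
    unfolding lattice_diff_inf by (simp add: sup_commute)
  also have "inf e (?p + ?n) = inf e ?p + inf e ?n"
    by (intro inf_add_disjoint e inf_pos_neg_part) simp_all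
  finally have 2: "sup (e - (?p + ?n)) 0 = e - (inf ?p e + inf ?n e)" by (simp add: inf_commute)
  have alg: "(x + y) + (n - k) - p - p + (p - l) = (x - (p - n)) + (y - (l + k))" for x y n k p l :: 'a
    by (simp add: algebra_simps)
  have "(b + e) + (?n - inf ?n e) - ?p - ?p + (?p - inf ?p e) = (b - (?p - ?n)) + (e - (inf ?p e + inf ?n e))"
    by (rule alg)
  also have "b - (?p - ?n) = 0" unfolding b[symmetric] by (rule diff_self)
  finally show ?thesis unfolding 1 2 cut[of b] add_0 .
qed

lemma riesz_decomposition:
  fixes a :: "'a::lattice_ab_group_add"
  assumes "finite J" "\<And>j. j \<in> J \<Longrightarrow> 0 \<le> \<nu> j" "0 \<le> a" "a \<le> (\<Sum>j\<in>J. \<nu> j)"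
  shows "\<exists>\<rho>. (\<forall>j\<in>J. 0 \<le> \<rho> j \<and> \<rho> j \<le> \<nu> j) \<and> (\<Sum>j\<in>J. \<rho> j) = a"
  using assms
proof (induction J arbitrary: a rule: finite_induct)
  case (insert i J)
  define m where "m = inf a (\<nu> i)"
  have m: "m \<le> a" "m \<le> \<nu> i" "0 \<le> m" using insert.prems by (simp_all add: m_def)
  have "a - m = sup (a - a) (a - \<nu> i)" unfolding m_def by (rule lattice_diff_inf)
  also have "\<dots> \<le> (\<Sum>j\<in>J. \<nu> j)"
    using insert by (intro le_supI) (auto simp: diff_le_eq add.commute intro: sum_nonneg)
  finally have le: "a - m \<le> (\<Sum>j\<in>J. \<nu> j)" .
  have ge: "0 \<le> a - m" using m by simp
  obtain \<rho> where \<rho>: "\<forall>j\<in>J. 0 \<le> \<rho> j \<and> \<rho> j \<le> \<nu> j" "(\<Sum>j\<in>J. \<rho> j) = a - m"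
    using insert.IH[OF insert.prems(1)[OF insertI2] ge le] by blast
  have "(\<Sum>j\<in>J. (\<rho>(i := m)) j) = (\<Sum>j\<in>J. \<rho> j)" using insert.hyps by (intro sum.cong) auto
  then have "(\<Sum>j\<in>insert i J. (\<rho>(i := m)) j) = a" using insert.hyps \<rho>(2) by simp
  then show ?case
    using \<rho>(1) m by (intro exI[of _ "\<rho>(i := m)"] conjI) auto
qed auto

text \<open>Two partitions of the same element have a common refinement; one \<open>\<mu> k\<close>
  at a time is distributed over the \<open>\<nu> j\<close> and subtracted from them. It merges
  partitions made for different vectors.\<close>

lemma riesz_refinement:
  fixes \<mu> :: "'i \<Rightarrow> 'a::lattice_ab_group_add"
  assumes "finite I" "finite J" "\<And>i. i \<in> I \<Longrightarrow> 0 \<le> \<mu> i" "\<And>j. j \<in> J \<Longrightarrow> 0 \<le> \<nu> j"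
    and "(\<Sum>i\<in>I. \<mu> i) = (\<Sum>j\<in>J. \<nu> j)"
  shows "\<exists>w. (\<forall>i\<in>I. \<forall>j\<in>J. 0 \<le> w i j) \<and> (\<forall>i\<in>I. (\<Sum>j\<in>J. w i j) = \<mu> i) \<and> (\<forall>j\<in>J. (\<Sum>i\<in>I. w i j) = \<nu> j)"
  using assms
proof (induction I arbitrary: \<nu> rule: finite_induct)
  case empty
  then have "\<forall>j\<in>J. \<nu> j = 0" using sum_nonneg_eq_0_iff[of J \<nu>] by simp
  then show ?case by simp
next
  case (insert k I)
  have le: "\<mu> k \<le> (\<Sum>j\<in>J. \<nu> j)"
    using insert.prems(2) insert.hyps insert.prems(4)[symmetric] by (simp add: sum_nonneg)
  obtain \<rho> where \<rho>: "\<forall>j\<in>J. 0 \<le> \<rho> j \<and> \<rho> j \<le> \<nu> j" "(\<Sum>j\<in>J. \<rho> j) = \<mu> k"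
    using riesz_decomposition[OF insert.prems(1,3) insert.prems(2)[OF insertI1] le] by blast
  have eq: "(\<Sum>i\<in>I. \<mu> i) = (\<Sum>j\<in>J. \<nu> j - \<rho> j)"
    using insert.prems(4) insert.hyps \<rho>(2) by (simp add: sum_subtractf eq_diff_eq add.commute)
  then obtain w where w: "\<forall>i\<in>I. \<forall>j\<in>J. 0 \<le> w i j" "\<forall>i\<in>I. (\<Sum>j\<in>J. w i j) = \<mu> i"
    "\<forall>j\<in>J. (\<Sum>i\<in>I. w i j) = \<nu> j - \<rho> j"
    using insert.IH[OF insert.prems(1) insert.prems(2)[OF insertI2] _ eq] \<rho>(1) by auto
  have "(\<Sum>i\<in>I. (w(k := \<rho>)) i j) = (\<Sum>i\<in>I. w i j)" for j
    using insert.hyps by (intro sum.cong) auto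
  then show ?case
    using w \<rho> insert.hyps by (intro exI[of _ "w(k := \<rho>)"]) auto
qed

lemma nonneg_le_sum:
  fixes f :: "'i \<Rightarrow> 'a::ordered_comm_monoid_add"
  assumes "finite A" "i \<in> A" "\<And>j. j \<in> A \<Longrightarrow> 0 \<le> f j"
  shows "f i \<le> sum f A"
  using sum_mono2[of A "{i}" f] assms by auto

text \<open>The part of the modulus of \<open>b\<close> above \<open>e\<close>. A positive element
  disjoint from it lives, in the case of functions, where the modulus of \<open>b\<close> is at most
  \<open>e\<close>.\<close>

definition excess :: "'x::banach_lattice \<Rightarrow> 'x \<Rightarrow> 'x"
  where "excess e b = sup ((sup b 0 + sup (- b) 0) - e) 0"

lemma excess_nonneg: "0 \<le> excess e b"
  by (simp add: excess_def)

lemma le_excess: "b \<le> e + excess e b" "- b \<le> e + excess e b"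
proof -
  have "sup b 0 + sup (- b) 0 = e + ((sup b 0 + sup (- b) 0) - e)" by simp
  also have "\<dots> \<le> e + excess e b" unfolding excess_def by (intro add_left_mono sup_ge1)
  finally have "sup b 0 + sup (- b) 0 \<le> e + excess e b" .
  moreover have "b \<le> sup b 0 + sup (- b) 0" "- b \<le> sup b 0 + sup (- b) 0"
    by (simp_all add: add_increasing2 add_increasing)
  ultimately show "b \<le> e + excess e b" "- b \<le> e + excess e b" by (meson order_trans)+
qed

text \<open>For functions, \<open>\<nu> j\<close> is the hat \<open>max (e - |N x - j e|) 0\<close>.
  These hats add up to \<open>e\<close>, and interpolation with them reproduces \<open>N x\<close>
  exactly because it is linear.\<close>

lemma grid_partition:
  fixes x e :: "'x::banach_lattice"
  assumes x: "0 \<le> x" "x \<le> e"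
  obtains \<nu> where "\<And>j. 0 \<le> \<nu> j" "(\<Sum>j\<le>N. \<nu> j) = e" "(\<Sum>j\<le>N. real j *\<^sub>R \<nu> j) = real N *\<^sub>R x"
    "\<And>j. inf (\<nu> j) (excess e (real N *\<^sub>R x - real j *\<^sub>R e)) = 0"
proof -
  have e: "0 \<le> e" using x by (rule order_trans)
  \<comment> \<open>The shift by one lets the second difference at \<open>j = 0\<close> start with
    \<open>\<rho> 0\<close>. Both sums then follow by summation by parts, since
    \<open>\<rho> (Suc N)\<close> and \<open>\<rho> (Suc (Suc N))\<close> vanish.\<close>
  define \<rho> where "\<rho> i = sup (real N *\<^sub>R x - (real i - 1) *\<^sub>R e) 0" for i :: nat
  define \<nu> where "\<nu> j = \<rho> j - \<rho> (Suc j) - \<rho> (Suc j) + \<rho> (Suc (Suc j))" for j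
  have \<nu>: "\<nu> j = sup (- ((sup b 0 + sup (- b) 0) - e)) 0" if b: "b = real N *\<^sub>R x - real j *\<^sub>R e" for j b
    using second_difference_pos_part[OF e, of b] by (simp add: \<nu>_def \<rho>_def b algebra_simps)
  have sum1: "(\<Sum>j<M. \<nu> j) = \<rho> 0 - \<rho> 1 - \<rho> M + \<rho> (Suc M)" for M
    by (induction M) (simp_all add: \<nu>_def)
  have sum2: "(\<Sum>j<M. real j *\<^sub>R \<nu> j) = \<rho> 1 - real M *\<^sub>R \<rho> M + (real M - 1) *\<^sub>R \<rho> (Suc M)" for M
    by (induction M) (simp_all add: \<nu>_def algebra_simps)
  have "\<rho> 0 = real N *\<^sub>R x + e" "\<rho> 1 = real N *\<^sub>R x"
    using x(1) e by (simp_all add: \<rho>_def sup_absorb1 scaleR_nonneg_nonneg)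
  moreover have "\<rho> (Suc N) = 0" "\<rho> (Suc (Suc N)) = 0"
  proof -
    have "real N *\<^sub>R x \<le> real N *\<^sub>R e" using x(2) by (intro scaleR_left_mono) auto
    then show "\<rho> (Suc N) = 0" "\<rho> (Suc (Suc N)) = 0"
      using e by (auto simp: \<rho>_def algebra_simps add_increasing intro!: sup_absorb2)
  qed
  ultimately have "(\<Sum>j\<le>N. \<nu> j) = e" "(\<Sum>j\<le>N. real j *\<^sub>R \<nu> j) = real N *\<^sub>R x"
    unfolding lessThan_Suc_atMost[symmetric] sum1 sum2 by simp_all
  moreover have "inf (\<nu> j) (excess e (real N *\<^sub>R x - real j *\<^sub>R e)) = 0" for j
    unfolding \<nu>[OF refl] excess_def using inf_pos_neg_part inf_commute by metis
  moreover have "0 \<le> \<nu> j" for j unfolding \<nu>[OF refl] by simp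
  ultimately show thesis using that by blast
qed

definition grid_lists :: "nat \<Rightarrow> nat \<Rightarrow> nat list set"
  where "grid_lists N K = {ls. set ls \<subseteq> {..N} \<and> length ls = K}"

lemma finite_grid_lists: "finite (grid_lists N K)"
  unfolding grid_lists_def by (rule finite_lists_length_eq) simp

lemma sum_grid_lists_Suc:
  "(\<Sum>l\<in>grid_lists N (Suc K). F l) = (\<Sum>ls\<in>grid_lists N K. \<Sum>j\<le>N. F (ls @ [j]))"
proof -
  have "grid_lists N (Suc K) = (\<lambda>(ls, j). ls @ [j]) ` (grid_lists N K \<times> {..N})"
  proof (intro equalityI subsetI)
    fix l assume "l \<in> grid_lists N (Suc K)"
    then have l: "set l \<subseteq> {..N}" "length l = Suc K" by (auto simp: grid_lists_def)
    then have "l \<noteq> []" by auto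
    then have "l = butlast l @ [last l]" "set (butlast l) \<subseteq> {..N}" "last l \<le> N"
      using l(1) in_set_butlastD[of _ l] subsetD[OF l(1) last_in_set[of l]] by auto
    moreover have "length (butlast l) = K" using l(2) by simp
    ultimately show "l \<in> (\<lambda>(ls, j). ls @ [j]) ` (grid_lists N K \<times> {..N})"
      by (intro image_eqI[of _ _ "(butlast l, last l)"]) (auto simp: grid_lists_def)
  qed (auto simp: grid_lists_def)
  moreover have "inj_on (\<lambda>(ls, j). ls @ [j]) (grid_lists N K \<times> {..N})" by (auto simp: inj_on_def)
  ultimately show ?thesis by (simp add: sum.reindex sum.cartesian_product) (simp add: case_prod_beta comp_def)
qed

text \<open>The partitions for the single vectors are refined to a common one. Each piece of the
  refinement lies below a piece of either partition and thereby inherits the disjointness from the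
  excesses.\<close>

lemma grid_partition_tuple:
  fixes x :: "nat \<Rightarrow> 'x::banach_lattice"
  assumes "\<And>k. k < K \<Longrightarrow> 0 \<le> x k" "\<And>k. k < K \<Longrightarrow> x k \<le> e" "0 \<le> e"
  shows "\<exists>\<mu>. (\<forall>l\<in>grid_lists N K. 0 \<le> \<mu> l) \<and> (\<Sum>l\<in>grid_lists N K. \<mu> l) = e \<and>
    (\<forall>k<K. (\<Sum>l\<in>grid_lists N K. real (l ! k) *\<^sub>R \<mu> l) = real N *\<^sub>R x k) \<and>
    (\<forall>k<K. \<forall>l\<in>grid_lists N K. inf (\<mu> l) (excess e (real N *\<^sub>R x k - real (l ! k) *\<^sub>R e)) = 0)"
  using assms(1,2)
proof (induction K)
  case 0
  have "grid_lists N 0 = {[]}" by (auto simp: grid_lists_def)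
  then show ?case using assms(3) by (intro exI[of _ "\<lambda>_. e"]) auto
next
  case (Suc K)
  have "\<exists>\<mu>. (\<forall>l\<in>grid_lists N K. 0 \<le> \<mu> l) \<and> (\<Sum>l\<in>grid_lists N K. \<mu> l) = e \<and>
    (\<forall>k<K. (\<Sum>l\<in>grid_lists N K. real (l ! k) *\<^sub>R \<mu> l) = real N *\<^sub>R x k) \<and>
    (\<forall>k<K. \<forall>l\<in>grid_lists N K. inf (\<mu> l) (excess e (real N *\<^sub>R x k - real (l ! k) *\<^sub>R e)) = 0)"
    by (rule Suc.IH) (use Suc.prems in auto)
  then obtain \<mu> where \<mu>: "\<forall>l\<in>grid_lists N K. 0 \<le> \<mu> l" "(\<Sum>l\<in>grid_lists N K. \<mu> l) = e"
    "\<forall>k<K. (\<Sum>l\<in>grid_lists N K. real (l ! k) *\<^sub>R \<mu> l) = real N *\<^sub>R x k"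
    "\<forall>k<K. \<forall>l\<in>grid_lists N K. inf (\<mu> l) (excess e (real N *\<^sub>R x k - real (l ! k) *\<^sub>R e)) = 0"
    by blast
  obtain \<nu> where \<nu>: "\<And>j. 0 \<le> \<nu> j" "(\<Sum>j\<le>N. \<nu> j) = e" "(\<Sum>j\<le>N. real j *\<^sub>R \<nu> j) = real N *\<^sub>R x K"
    "\<And>j. inf (\<nu> j) (excess e (real N *\<^sub>R x K - real j *\<^sub>R e)) = 0"
    by (rule grid_partition[of "x K" e N, OF Suc.prems(1)[OF lessI] Suc.prems(2)[OF lessI]], rule that)
  obtain w where w: "\<forall>l\<in>grid_lists N K. \<forall>j\<in>{..N}. 0 \<le> w l j"
    "\<forall>l\<in>grid_lists N K. (\<Sum>j\<le>N. w l j) = \<mu> l" "\<forall>j\<in>{..N}. (\<Sum>l\<in>grid_lists N K. w l j) = \<nu> j"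
    using riesz_refinement[OF finite_grid_lists finite_atMost, of N K \<mu> N \<nu>] \<mu> \<nu> by auto
  define \<mu>' where "\<mu>' l = w (butlast l) (last l)" for l
  have \<mu>'[simp]: "\<mu>' (l @ [j]) = w l j" for l j by (simp add: \<mu>'_def)
  have len: "l \<in> grid_lists N K \<Longrightarrow> length l = K" for l by (simp add: grid_lists_def)
  have split: "\<exists>ls j. l = ls @ [j] \<and> ls \<in> grid_lists N K \<and> j \<le> N" if "l \<in> grid_lists N (Suc K)" for l
  proof -
    have l: "set l \<subseteq> {..N}" "length l = Suc K" using that by (auto simp: grid_lists_def)
    then show ?thesis by (cases l rule: rev_cases) (auto simp: grid_lists_def)
  qed
  have disj: "inf a c = 0" if "inf b c = 0" "0 \<le> a" "a \<le> b" "0 \<le> c" for a b c :: 'x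
    using that by (metis inf_mono order_antisym order_refl le_infI)
  show ?case
  proof (intro exI[of _ \<mu>'] conjI allI ballI impI)
    show "0 \<le> \<mu>' l" if "l \<in> grid_lists N (Suc K)" for l using split[OF that] w(1) by auto
    show "(\<Sum>l\<in>grid_lists N (Suc K). \<mu>' l) = e" using w(2) \<mu>(2) by (simp add: sum_grid_lists_Suc)
  next
    fix k assume k: "k < Suc K"
    have "(\<Sum>l\<in>grid_lists N (Suc K). real (l ! k) *\<^sub>R \<mu>' l) =
        (\<Sum>l\<in>grid_lists N K. \<Sum>j\<le>N. real ((l @ [j]) ! k) *\<^sub>R w l j)" by (simp add: sum_grid_lists_Suc)
    also have "\<dots> = real N *\<^sub>R x k"
    proof (cases "k = K")
      case True
      have "(\<Sum>l\<in>grid_lists N K. \<Sum>j\<le>N. real ((l @ [j]) ! k) *\<^sub>R w l j) =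
          (\<Sum>l\<in>grid_lists N K. \<Sum>j\<le>N. real j *\<^sub>R w l j)"
        by (intro sum.cong) (auto simp: nth_append len True)
      also have "\<dots> = (\<Sum>j\<le>N. \<Sum>l\<in>grid_lists N K. real j *\<^sub>R w l j)" by (rule sum.swap)
      also have "\<dots> = (\<Sum>j\<le>N. real j *\<^sub>R \<nu> j)" using w(3) by (simp flip: scaleR_sum_right)
      finally show ?thesis using \<nu>(3) True by simp
    next
      case False
      then have "k < K" using k by simp
      then have "(\<Sum>l\<in>grid_lists N K. \<Sum>j\<le>N. real ((l @ [j]) ! k) *\<^sub>R w l j) =
          (\<Sum>l\<in>grid_lists N K. real (l ! k) *\<^sub>R \<mu> l)"
        using w(2) by (intro sum.cong) (auto simp: nth_append len simp flip: scaleR_sum_right)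
      then show ?thesis using \<mu>(3) \<open>k < K\<close> by simp
    qed
    finally show "(\<Sum>l\<in>grid_lists N (Suc K). real (l ! k) *\<^sub>R \<mu>' l) = real N *\<^sub>R x k" .
  next
    fix k l assume k: "k < Suc K" and l: "l \<in> grid_lists N (Suc K)"
    obtain ls j where lsj: "l = ls @ [j]" "ls \<in> grid_lists N K" "j \<le> N" using split[OF l] by blast
    have w0: "0 \<le> w ls j" using w(1) lsj by simp
    show "inf (\<mu>' l) (excess e (real N *\<^sub>R x k - real (l ! k) *\<^sub>R e)) = 0"
    proof (cases "k = K")
      case True
      have "w ls j \<le> (\<Sum>l\<in>grid_lists N K. w l j)"
        using w(1) lsj by (intro nonneg_le_sum[where f="\<lambda>l. w l j"] finite_grid_lists) auto
      then have "w ls j \<le> \<nu> j" using w(3) lsj by simp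
      then show ?thesis
        using disj[OF \<nu>(4)[of j] w0] by (simp add: lsj(1) True nth_append len[OF lsj(2)] excess_nonneg)
    next
      case False
      then have "k < K" using k by simp
      have "w ls j \<le> (\<Sum>j\<le>N. w ls j)" using w(1) lsj by (intro nonneg_le_sum[where f="w ls"]) auto
      then have "w ls j \<le> \<mu> ls" using w(2) lsj by simp
      then show ?thesis
        using disj[OF \<mu>(4)[rule_format, OF \<open>k < K\<close> lsj(2)] w0] \<open>k < K\<close>
        by (simp add: lsj(1) nth_append len[OF lsj(2)] excess_nonneg)
    qed
  qed
qed

section \<open>Finite suprema in the lattice below an element of the bidual\<close>

lemma sup_eq_add_pos_part:
  fixes a b :: "'a::lattice_ab_group_add"
  shows "sup a b = b + sup (a - b) 0"
  using lattice_sup_diff[of a b b] by (simp add: algebra_simps)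

lemma sublinear_pos_part:
  fixes f :: "'x::banach_lattice dual"
  assumes f: "0 \<le> f"
  shows "sublinear_on UNIV (\<lambda>x. f (sup x 0))"
proof (rule sublinear_onI[OF subspace_UNIV])
  fix x y :: 'x
  have "sup (x + y) 0 \<le> sup x 0 + sup y 0" by (intro le_supI add_mono) (auto simp: add_nonneg_nonneg)
  then show "f (sup (x + y) 0) \<le> f (sup x 0) + f (sup y 0)"
    using dual_nonneg_mono[OF f] by (simp flip: blinfun.add_right)
next
  fix x :: 'x and c :: real assume c: "0 < c"
  have "c *\<^sub>R x \<le> c *\<^sub>R sup x 0" "0 \<le> c *\<^sub>R sup x 0"
    using c by (intro scaleR_left_mono scaleR_nonneg_nonneg sup_ge1; simp)+
  then have "sup (c *\<^sub>R x) 0 \<le> c *\<^sub>R sup x 0" by simp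
  then show "f (sup (c *\<^sub>R x) 0) \<le> c * f (sup x 0)"
    using dual_nonneg_mono[OF f] by (metis blinfun.scaleR_right real_scaleR_def)
qed simp

text \<open>The Riesz-Kantorovich formula with attained supremum. A linear functional below the
  sublinear \<open>f (sup x 0)\<close> automatically lies between 0 and \<open>f\<close>, and the
  Hahn-Banach theorem makes the two agree at \<open>c\<close>.\<close>

lemma functional_pos_part_attained:
  fixes f :: "'x::banach_lattice dual" and c :: 'x
  assumes f: "0 \<le> f"
  obtains g :: "'x dual" where "0 \<le> g" "g \<le> f" "f (sup c 0) = g c"
proof -
  define G where "G = {(s *\<^sub>R c, s * f (sup c 0)) | s. 0 \<le> s}"
  have G_I: "(s *\<^sub>R c, s * f (sup c 0)) \<in> G" if "0 \<le> s" for s using that unfolding G_def by blast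
  have cone: "convex_cone_set G"
    unfolding convex_cone_set_def
  proof (intro conjI ballI allI impI)
    show "0 \<in> G" using G_I[of 0] by (simp add: zero_prod_def)
  next
    fix g h assume "g \<in> G" "h \<in> G"
    then obtain s t where "g = (s *\<^sub>R c, s * f (sup c 0))" "h = (t *\<^sub>R c, t * f (sup c 0))" "0 \<le> s" "0 \<le> t"
      unfolding G_def by blast
    then show "g + h \<in> G" using G_I[of "s + t"] by (simp add: algebra_simps)
  next
    fix g and r :: real assume "g \<in> G" "0 < r"
    then obtain s where "g = (s *\<^sub>R c, s * f (sup c 0))" "0 \<le> s" unfolding G_def by blast
    then show "r *\<^sub>R g \<in> G" using G_I[of "r * s"] \<open>0 < r\<close> by (simp add: mult.assoc)
  qed
  have bound: "v \<in> UNIV \<and> b \<le> f (sup v 0)" if vb: "(v, b) \<in> G" for v b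
  proof -
    obtain s where s: "v = s *\<^sub>R c" "b = s * f (sup c 0)" "0 \<le> s" using vb unfolding G_def by auto
    then show ?thesis using sublinear_pos_part[OF f] unfolding sublinear_on_def by simp
  qed
  obtain \<phi> where \<phi>: "\<And>x. x \<in> UNIV \<Longrightarrow> \<phi> x \<le> f (sup x 0)" and \<phi>_add: "\<And>x y. x \<in> UNIV \<Longrightarrow> y \<in> UNIV \<Longrightarrow> \<phi> (x + y) = \<phi> x + \<phi> y"
    and \<phi>_scale: "\<And>x r. x \<in> UNIV \<Longrightarrow> \<phi> (r *\<^sub>R x) = r * \<phi> x" and \<phi>_G: "\<And>v b. (v, b) \<in> G \<Longrightarrow> b \<le> \<phi> v"
    by (rule hahn_banach_cone[OF subspace_UNIV sublinear_pos_part[OF f] cone bound], assumption, rule that)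
  have up: "\<phi> x \<le> norm x * norm f" for x
  proof -
    have "norm (sup x 0) \<le> norm x"
    proof (rule norm_mono_modulus)
      define s where "s = sup x 0"
      have "0 \<le> s" by (simp add: s_def)
      moreover have "s \<le> sup x (- x)"
        using add_mono[OF sup_ge1[of x "- x"] sup_ge2[of "- x" x]]
        unfolding s_def by (intro le_supI) (auto simp: zero_le_double_add_iff_zero_le_single_add)
      moreover have "- s \<le> s" using \<open>0 \<le> s\<close> by (meson neg_le_0_iff_le order_trans)
      ultimately show "sup (sup x 0) (- sup x 0) \<le> sup x (- x)"
        unfolding s_def[symmetric] by (meson le_supI order_trans)
    qed
    then have "norm f * norm (sup x 0) \<le> norm f * norm x" by (intro mult_left_mono) auto
    moreover have "f (sup x 0) \<le> norm f * norm (sup x 0)" using norm_blinfun[of f "sup x 0"] by simp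
    ultimately show ?thesis using \<phi>[of x] by (simp add: mult.commute)
  qed
  have "norm (\<phi> x) \<le> norm x * norm f" for x
    using up[of x] up[of "- x"] \<phi>_scale[of x "-1"] by simp
  then have bl: "bounded_linear \<phi>" by (intro bounded_linear_intro[of _ "norm f"]) (auto simp: \<phi>_add \<phi>_scale)
  define g where "g = Blinfun \<phi>"
  have g: "g x = \<phi> x" for x by (simp add: g_def bounded_linear_Blinfun_apply[OF bl])
  show thesis
  proof (rule that[of g])
    have "0 \<le> \<phi> x" if "0 \<le> x" for x
      using \<phi>[of "- x"] \<phi>_scale[of x "-1"] that by (simp add: sup_absorb2)
    then show "0 \<le> g" by (simp add: blinfun_nonneg_iff g)
    have "\<phi> x \<le> f x" if "0 \<le> x" for x
      using \<phi>[of x] that by (simp add: sup_absorb1)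
    then show "g \<le> f" by (simp add: less_eq_blinfun_def g)
    show "f (sup c 0) = g c" using \<phi>[of c] \<phi>_G[OF G_I[of 1]] by (simp add: g)
  qed
qed

lemma blinfun_leI:
  fixes f g :: "'a::{real_normed_vector,ord} \<Rightarrow>\<^sub>L 'b::{real_normed_vector,ord}"
  shows "(\<And>x. 0 \<le> x \<Longrightarrow> f x \<le> g x) \<Longrightarrow> f \<le> g"
  by (simp add: less_eq_blinfun_def)

lemma blinfun_leD:
  fixes f g :: "'a::{real_normed_vector,ord} \<Rightarrow>\<^sub>L 'b::{real_normed_vector,ord}"
  shows "f \<le> g \<Longrightarrow> 0 \<le> x \<Longrightarrow> f x \<le> g x"
  by (simp add: less_eq_blinfun_def)

text \<open>A functional \<open>g\<close> that attains the positive part of \<open>a - b\<close>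
  splits the supremum: \<open>f (sup a b) = (f - g) b + g a\<close>. Both \<open>f - g\<close> and
  \<open>g\<close> are positive, so the two hypotheses apply and the bounds add up to
  \<open>w f\<close>.\<close>

lemma bidual_sup_le:
  fixes a b :: "'x::banach_lattice" and w :: "'x dual dual"
  assumes "bidual a \<le> w" "bidual b \<le> w"
  shows "bidual (sup a b) \<le> w"
proof (rule blinfun_leI)
  fix f :: "'x dual" assume f: "0 \<le> f"
  obtain g :: "'x dual" where g: "0 \<le> g" "g \<le> f" "f (sup (a - b) 0) = g (a - b)"
    by (rule functional_pos_part_attained[OF f, of "a - b"], rule that)
  have "0 \<le> f - g" using g(2) cone_le_iff[of g f] by simp
  then have "(f - g) b \<le> w (f - g)" "g a \<le> w g"
    using blinfun_leD[OF assms(2), of "f - g"] blinfun_leD[OF assms(1) g(1)] by simp_all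
  then show "bidual (sup a b) f \<le> w f"
    unfolding sup_eq_add_pos_part[of a b] using g(3) by (simp add: blinfun.bilinear_simps)
qed

text \<open>The element is the supremum of \<open>F\<close> and 0; including 0 covers empty
  \<open>F\<close> and makes it positive, as the grid partitions require.\<close>

lemma bidual_Sup_le:
  fixes F :: "'x::banach_lattice set" and w :: "'x dual dual"
  assumes "finite F" "0 \<le> w" "\<And>a. a \<in> F \<Longrightarrow> bidual a \<le> w"
  shows "\<exists>t. 0 \<le> t \<and> (\<forall>a\<in>F. a \<le> t) \<and> (\<forall>e\<ge>0. (\<forall>a\<in>F. a \<le> e) \<longrightarrow> t \<le> e) \<and> bidual t \<le> w"
  using assms
proof (induction F rule: finite_induct)
  case empty
  have "bidual (0 :: 'x) \<le> w" unfolding blinfun.zero_right by (rule empty(1))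
  then have "0 \<le> (0 :: 'x) \<and> (\<forall>a\<in>{}. a \<le> (0 :: 'x)) \<and>
      (\<forall>e\<ge>0. (\<forall>a\<in>{}. a \<le> e) \<longrightarrow> (0 :: 'x) \<le> e) \<and> bidual (0 :: 'x) \<le> w" by blast
  then show ?case by (rule exI)
next
  case (insert c F)
  obtain t where t: "0 \<le> t" "\<forall>a\<in>F. a \<le> t" "\<forall>e\<ge>0. (\<forall>a\<in>F. a \<le> e) \<longrightarrow> t \<le> e" "bidual t \<le> w"
    using insert.IH[OF insert.prems(1) insert.prems(2)[OF insertI2]] by blast
  have "sup t c \<le> e" if "0 \<le> e" "\<forall>a\<in>insert c F. a \<le> e" for e using t(3) that by simp
  moreover have "\<forall>a\<in>insert c F. a \<le> sup t c" using t(2) by (simp add: le_supI1)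
  moreover have "bidual (sup t c) \<le> w" by (intro bidual_sup_le t insert.prems) simp
  moreover have "0 \<le> sup t c" using t(1) by (rule le_supI1)
  ultimately show ?case by blast
qed

section \<open>Representations for the infinite exponent\<close>

text \<open>In a Banach lattice the weak \<ell>_1 norm of a positive tuple is the norm of its sum.
  Keeping the sum itself as a vector-valued cost retains the additivity that its norm lacks.\<close>

definition maj_rep :: "'e::real_normed_vector \<Rightarrow>\<^sub>L 'y::{real_normed_vector, ord} \<Rightarrow> 'y \<Rightarrow> bool"
  where "maj_rep B y \<longleftrightarrow> (\<exists>(n::nat) v x. (\<forall>i<n. norm (v i) \<le> 1 \<and> 0 \<le> x i) \<and>
    B = (\<Sum>i<n. rank_one (v i) (x i)) \<and> y = (\<Sum>i<n. x i))"

lemma maj_repI: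
  fixes v :: "nat \<Rightarrow> 'e::real_normed_vector dual" and x :: "nat \<Rightarrow> 'y::{real_normed_vector, ord}"
  assumes "\<And>i. i < n \<Longrightarrow> norm (v i) \<le> 1" "\<And>i. i < n \<Longrightarrow> 0 \<le> x i"
    "B = (\<Sum>i<n. rank_one (v i) (x i))" "y = (\<Sum>i<n. x i)"
  shows "maj_rep B y"
  using assms unfolding maj_rep_def by blast

lemma maj_repE:
  fixes B :: "'e::real_normed_vector \<Rightarrow>\<^sub>L 'y::{real_normed_vector, ord}"
  assumes "maj_rep B y"
  obtains n :: nat and v x where "\<And>i. i < n \<Longrightarrow> norm (v i) \<le> 1" "\<And>i. i < n \<Longrightarrow> 0 \<le> x i"
    "B = (\<Sum>i<n. rank_one (v i) (x i))" "y = (\<Sum>i<n. x i)"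
  using assms unfolding maj_rep_def by blast

lemma maj_rep_0: "maj_rep 0 0"
  by (rule maj_repI[of 0]) auto

text \<open>Terms with functional 0 enlarge the majorant at will; this later yields the positivity
  of a separating functional.\<close>

lemma maj_rep_slack:
  fixes x :: "'y::{real_normed_vector, ord}"
  assumes "0 \<le> x"
  shows "maj_rep 0 x"
  by (rule maj_repI[of 1 "\<lambda>_. 0" "\<lambda>_. x"]) (use assms in \<open>auto intro: blinfun_eqI\<close>)

lemma maj_rep_add:
  assumes "maj_rep B y" "maj_rep B' y'"
  shows "maj_rep (B + B') (y + y')"
proof -
  obtain n :: nat and v x where 1: "\<And>i. i < n \<Longrightarrow> norm (v i) \<le> 1" "\<And>i. i < n \<Longrightarrow> 0 \<le> x i"
    "B = (\<Sum>i<n. rank_one (v i) (x i))" "y = (\<Sum>i<n. x i)" by (rule maj_repE[OF assms(1)], rule that)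
  obtain m :: nat and w z where 2: "\<And>i. i < m \<Longrightarrow> norm (w i) \<le> 1" "\<And>i. i < m \<Longrightarrow> 0 \<le> z i"
    "B' = (\<Sum>i<m. rank_one (w i) (z i))" "y' = (\<Sum>i<m. z i)" by (rule maj_repE[OF assms(2)], rule that)
  show ?thesis
    by (rule maj_repI[of "n + m" "seq_append n v w" "seq_append n x z"])
      (use 1 2 in \<open>auto simp: seq_append_def sum_lessThan_add\<close>)
qed

lemma maj_rep_scaleR:
  fixes y :: "'y::cone_space"
  assumes "maj_rep B y" "0 \<le> c"
  shows "maj_rep (c *\<^sub>R B) (c *\<^sub>R y)"
proof -
  obtain n :: nat and v x where 1: "\<And>i. i < n \<Longrightarrow> norm (v i) \<le> 1" "\<And>i. i < n \<Longrightarrow> 0 \<le> x i"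
    "B = (\<Sum>i<n. rank_one (v i) (x i))" "y = (\<Sum>i<n. x i)" by (rule maj_repE[OF assms(1)], rule that)
  show ?thesis
    by (rule maj_repI[of n v "\<lambda>i. c *\<^sub>R x i"])
      (use 1 assms(2) in \<open>auto simp: rank_one_scaleR_right scaleR_sum_right intro: cone_scaleR\<close>)
qed

lemma maj_rep_uminus:
  assumes "maj_rep B y"
  shows "maj_rep (- B) y"
proof -
  obtain n :: nat and v x where 1: "\<And>i. i < n \<Longrightarrow> norm (v i) \<le> 1" "\<And>i. i < n \<Longrightarrow> 0 \<le> x i"
    "B = (\<Sum>i<n. rank_one (v i) (x i))" "y = (\<Sum>i<n. x i)" by (rule maj_repE[OF assms(1)], rule that)
  show ?thesis
    by (rule maj_repI[of n "\<lambda>i. - v i" x]) (use 1 in \<open>auto simp: rank_one_uminus_left sum_negf\<close>)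
qed

lemma maj_rep_rank_one:
  fixes x :: "'y::cone_space"
  assumes "0 \<le> x"
  shows "maj_rep (rank_one v x) (norm v *\<^sub>R x)"
proof -
  have "rank_one v x = rank_one (sgn v) (norm v *\<^sub>R x)"
    by (cases "v = 0") (simp_all add: sgn_div_norm rank_one_scaleR_left rank_one_scaleR_right)
  then show ?thesis
    using assms by (intro maj_repI[of 1 "\<lambda>_. sgn v" "\<lambda>_. norm v *\<^sub>R x"]) (auto simp: norm_sgn intro: cone_scaleR)
qed

lemma maj_rep_sum:
  fixes x :: "'i \<Rightarrow> 'y::cone_space"
  assumes "\<And>i. i \<in> I \<Longrightarrow> 0 \<le> x i"
  shows "maj_rep (\<Sum>i\<in>I. rank_one (v i) (x i)) (\<Sum>i\<in>I. norm (v i) *\<^sub>R x i)"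
  using assms
  by (induction I rule: infinite_finite_induct) (auto intro: maj_rep_0 maj_rep_add maj_rep_rank_one)

lemma maj_rep_nonneg:
  fixes y :: "'y::cone_space"
  assumes "maj_rep B y"
  shows "0 \<le> y"
proof -
  obtain n :: nat and x where 1: "\<And>i. i < n \<Longrightarrow> 0 \<le> x i" "y = (\<Sum>i<n. x i)" by (rule maj_repE[OF assms], rule that)
  show ?thesis unfolding 1(2) by (intro cone_sum) (use 1 in auto)
qed

lemma maj_rep_mono:
  fixes y :: "'y::cone_space"
  assumes "maj_rep B y" "y \<le> z"
  shows "maj_rep B z"
  using maj_rep_add[OF assms(1) maj_rep_slack[of "z - y"]] assms(2) cone_le_iff[of y z] by simp

lemma maj_rep_bidual:
  fixes y :: "'y::cone_space"
  assumes "maj_rep B y"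
  shows "maj_rep (bidual o\<^sub>L B) (bidual y)"
proof -
  obtain n :: nat and v x where 1: "\<And>i. i < n \<Longrightarrow> norm (v i) \<le> 1" "\<And>i. i < n \<Longrightarrow> 0 \<le> x i"
    "B = (\<Sum>i<n. rank_one (v i) (x i))" "y = (\<Sum>i<n. x i)" by (rule maj_repE[OF assms], rule that)
  show ?thesis
    by (rule maj_repI[of n v "\<lambda>i. bidual (x i)"])
      (use 1 in \<open>auto simp: bidual_nonneg blinfun_compose_sum_right blinfun_compose_rank_one blinfun.sum_right\<close>)
qed

lemma maj_rep_apply_le:
  fixes y :: "'y::cone_space"
  assumes "maj_rep B y" "norm d \<le> 1"
  shows "B d \<le> y"
proof -
  obtain n :: nat and v x where 1: "\<And>i. i < n \<Longrightarrow> norm (v i) \<le> 1" "\<And>i. i < n \<Longrightarrow> 0 \<le> x i"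
    "B = (\<Sum>i<n. rank_one (v i) (x i))" "y = (\<Sum>i<n. x i)" by (rule maj_repE[OF assms(1)], rule that)
  have "y - B d = (\<Sum>i<n. (1 - v i d) *\<^sub>R x i)"
    unfolding 1 by (simp add: blinfun.sum_left sum_subtractf scaleR_left_diff_distrib)
  moreover have "0 \<le> (1 - v i d) *\<^sub>R x i" if "i < n" for i
  proof -
    have "\<bar>v i d\<bar> \<le> 1" using norm_blinfun[of "v i" d] mult_mono[OF 1(1)[OF that] assms(2)] by simp
    then show ?thesis using 1(2)[OF that] by (intro cone_scaleR) auto
  qed
  then have "0 \<le> (\<Sum>i<n. (1 - v i d) *\<^sub>R x i)" by (intro cone_sum) auto
  ultimately have "0 \<le> y - B d" by simp
  then show ?thesis using cone_le_iff[of "B d" y] by simp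
qed

lemma maj_rep_norm:
  fixes y :: "'y::cone_space"
  assumes Y: "regular_norm TYPE('y)" and B: "maj_rep B y"
  shows "norm B \<le> norm y"
proof (rule norm_blinfun_le_unit)
  fix d :: 'a assume d: "norm d \<le> 1"
  have "B d \<le> y" "- B d \<le> y"
    using maj_rep_apply_le[OF B, of d] maj_rep_apply_le[OF B, of "- d"] d by (simp_all add: blinfun.minus_right)
  then have "- y \<le> B d" "B d \<le> y" using cone_uminus_le(2)[of "B d" y] by auto
  then show "norm (B d) \<le> norm y" using Y unfolding regular_norm_def by blast
qed simp

lemma near_norming_vector:
  fixes V :: "'e::real_normed_vector dual"
  assumes "0 < \<delta>"
  shows "\<exists>d. norm d \<le> 1 \<and> norm V - \<delta> \<le> V d"
proof (rule ccontr)
  assume "\<not> ?thesis"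
  then have *: "V d < norm V - \<delta>" if "norm d \<le> 1" for d using that by force
  from *[of 0] have "0 \<le> norm V - \<delta>" by simp
  then have "norm V \<le> norm V - \<delta>" using * less_imp_le by (intro norm_dual_le) blast+
  then show False using assms by simp
qed

lemma inf_sum_le:
  fixes g :: "nat \<Rightarrow> 'a::lattice_ab_group_add"
  assumes "0 \<le> m" "\<And>k. k < n \<Longrightarrow> 0 \<le> g k"
  shows "inf m (\<Sum>k<n. g k) \<le> (\<Sum>k<n. inf m (g k))"
  using assms(2)
proof (induction n)
  case (Suc n)
  have "inf m (\<Sum>k<Suc n. g k) \<le> inf m (\<Sum>k<n. g k) + inf m (g n)"
    unfolding sum.lessThan_Suc by (intro inf_add_le sum_nonneg assms(1)) (use Suc.prems in auto)
  also have "\<dots> \<le> (\<Sum>k<n. inf m (g k)) + inf m (g n)" using Suc by (intro add_right_mono) simp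
  finally show ?case by simp
qed simp

text \<open>A small multiple of \<open>m\<close> lies below \<open>m\<close> and below the sum of
  the \<open>g k\<close>, hence below the sum of the infima, which is 0. It serves to show that
  pieces of a partition on which an estimate fails are 0.\<close>

lemma disjoint_multiple_eq_0:
  fixes m e :: "'x::banach_lattice" and g :: "nat \<Rightarrow> 'x"
  assumes m: "0 \<le> m" "m \<le> e" and \<gamma>: "0 < \<gamma>" "\<gamma> *\<^sub>R e \<le> (\<Sum>k<n. g k)"
    and g: "\<And>k. k < n \<Longrightarrow> 0 \<le> g k" "\<And>k. k < n \<Longrightarrow> inf m (g k) = 0"
  shows "m = 0"
proof -
  define c where "c = min 1 \<gamma>"
  have c: "0 < c" "c \<le> 1" "c \<le> \<gamma>" using \<gamma> by (simp_all add: c_def)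
  have "c *\<^sub>R m \<le> 1 *\<^sub>R m" by (intro scaleR_right_mono c m)
  moreover have "c *\<^sub>R m \<le> \<gamma> *\<^sub>R e" by (intro scaleR_mono c m) (use \<gamma> in simp)
  ultimately have "c *\<^sub>R m \<le> inf m (\<Sum>k<n. g k)" using order_trans[OF _ \<gamma>(2)] by simp
  also have "\<dots> \<le> (\<Sum>k<n. inf m (g k))" by (intro inf_sum_le m g)
  also have "\<dots> = 0" using g(2) by simp
  finally have "inverse c *\<^sub>R (c *\<^sub>R m) \<le> inverse c *\<^sub>R 0" using c by (intro scaleR_left_mono) auto
  then show ?thesis using c m by simp
qed

text \<open>
  The finite-dimensional ingredient of the case \<open>p = \<infinity>\<close>: in a lattice an operator
  \<open>\<Sum> v\<^sub>k \<otimes> x\<^sub>k\<close> can be rewritten so that \<open>\<Sum> \<parallel>v\<^sub>k\<parallel> x\<^sub>k\<close> almost becomes the supremum of the image of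
  the unit ball. If all \<open>x\<^sub>k\<close> and the supremum \<open>t\<close> were functions, the pieces \<open>\<mu> l\<close> would be the
  functions supported where the ratios of \<open>x\<^sub>k\<close> and \<open>t\<close> to \<open>e\<close> lie near the grid point \<open>l / N\<close>.
\<close>

lemma maj_rep_of_bidual_bound:
  fixes B :: "'e::real_normed_vector \<Rightarrow>\<^sub>L 'x::banach_lattice" and w :: "'x dual dual"
  assumes B: "maj_rep B e" and w: "\<And>d. norm d \<le> 1 \<Longrightarrow> bidual (B d) \<le> w" and \<epsilon>: "0 < \<epsilon>"
  shows "\<exists>y. maj_rep B y \<and> bidual y \<le> w + \<epsilon> *\<^sub>R bidual e"
proof -
  obtain K :: nat and v x where v: "\<And>k. k < K \<Longrightarrow> norm (v k) \<le> 1" and x: "\<And>k. k < K \<Longrightarrow> 0 \<le> x k"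
    and B_eq: "B = (\<Sum>k<K. rank_one (v k) (x k))" and e_eq: "e = (\<Sum>k<K. x k)"
    by (rule maj_repE[OF B], rule that)
  have e: "0 \<le> e" by (rule maj_rep_nonneg[OF B])
  obtain N :: nat where N: "real (K + 2) / \<epsilon> < real N" using reals_Archimedean2 by blast
  then have N_pos: "0 < real N" using \<epsilon> by (smt (verit) divide_nonneg_pos of_nat_0_le_iff)
  have N_le: "real (K + 2) / real N \<le> \<epsilon>" using N N_pos \<epsilon> by (simp add: field_simps)
  \<comment> \<open>On the piece with index \<open>l\<close> the ratios of the \<open>x k\<close> to
    \<open>e\<close> are about \<open>(l ! k) / N\<close>, so there \<open>B\<close> behaves like
    \<open>V l\<close> times \<open>e\<close>.\<close>
  define V where "V l = (\<Sum>k<K. (real (l ! k) / real N) *\<^sub>R v k)" for l :: "nat list"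
  have "\<forall>l. \<exists>d. norm d \<le> 1 \<and> norm (V l) - 1 / real N \<le> V l d"
    by (intro allI near_norming_vector) (use N_pos in simp)
  then obtain d where d: "\<And>l. norm (d l) \<le> 1" "\<And>l. norm (V l) - 1 / real N \<le> V l (d l)" by metis
  let ?G = "grid_lists N (Suc K)"
  have "bidual (0 :: 'x) \<le> w" using w[of 0] by simp
  then have w0: "0 \<le> w" unfolding blinfun.zero_right .
  \<comment> \<open>One nearly norming vector per grid point is enough, so the supremum is finite,
    exists in X and stays below \<open>w\<close>. It becomes an additional coordinate of the
    grid.\<close>
  have "\<exists>t. 0 \<le> t \<and> (\<forall>a\<in>(\<lambda>l. B (d l)) ` ?G. a \<le> t) \<and>
      (\<forall>e\<ge>0. (\<forall>a\<in>(\<lambda>l. B (d l)) ` ?G. a \<le> e) \<longrightarrow> t \<le> e) \<and> bidual t \<le> w"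
    by (rule bidual_Sup_le) (use w w0 d(1) finite_grid_lists in auto)
  then obtain t where t: "0 \<le> t" "\<And>l. l \<in> ?G \<Longrightarrow> B (d l) \<le> t" "bidual t \<le> w"
    and least: "\<forall>e\<ge>0. (\<forall>a\<in>(\<lambda>l. B (d l)) ` ?G. a \<le> e) \<longrightarrow> t \<le> e" by blast
  have "B (d l) \<le> e" for l by (rule maj_rep_apply_le[OF B d(1)])
  then have te: "t \<le> e" using least e by blast
  define x' where "x' k = (if k < K then x k else t)" for k
  have x': "0 \<le> x' k" "x' k \<le> e" for k
    using x t(1) te nonneg_le_sum[of "{..<K}" k x] by (auto simp: x'_def e_eq)
  obtain \<mu> where M: "(\<forall>l\<in>?G. 0 \<le> \<mu> l) \<and> (\<Sum>l\<in>?G. \<mu> l) = e \<and>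
    (\<forall>k<Suc K. (\<Sum>l\<in>?G. real (l ! k) *\<^sub>R \<mu> l) = real N *\<^sub>R x' k) \<and>
    (\<forall>k<Suc K. \<forall>l\<in>?G. inf (\<mu> l) (excess e (real N *\<^sub>R x' k - real (l ! k) *\<^sub>R e)) = 0)"
    using grid_partition_tuple[of "Suc K" x' e N, OF x'(1) x'(2) e] by (rule exE)
  note \<mu> = M[THEN conjunct1] M[THEN conjunct2, THEN conjunct1]
    M[THEN conjunct2, THEN conjunct2, THEN conjunct1] M[THEN conjunct2, THEN conjunct2, THEN conjunct2]
  \<comment> \<open>On a piece, \<open>N * norm (V l)\<close> exceeds the grid value of
    \<open>t\<close> by at most \<open>K + 2\<close>: one for the rounding of each
    \<open>x k\<close>, one for that of \<open>t\<close>, one because \<open>d l\<close> is only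
    nearly norming. Otherwise a positive multiple of \<open>e\<close> lies below a sum of excesses
    disjoint from \<open>\<mu> l\<close>, and the piece is 0.\<close>
  have dir: "norm (V l) *\<^sub>R \<mu> l \<le> (real (l ! K + K + 2) / real N) *\<^sub>R \<mu> l" if l: "l \<in> ?G" for l
  proof (cases "real N * norm (V l) \<le> real (l ! K + K + 2)")
    case True
    then show ?thesis using \<mu>(1) l N_pos by (intro scaleR_right_mono) (auto simp: field_simps)
  next
    case False
    define \<gamma> where "\<gamma> = real N * norm (V l) - real (l ! K + K + 2)"
    define b where "b k = real N *\<^sub>R x' k - real (l ! k) *\<^sub>R e" for k
    define c where "c k = v k (d l)" for k
    have c: "\<bar>c k\<bar> \<le> 1" if "k < K" for k
      using norm_blinfun[of "v k" "d l"] mult_mono[OF v[OF that] d(1)[of l]] by (simp add: c_def)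
    have cb: "- (c k *\<^sub>R b k) \<le> e + excess e (b k)" if "k < K" for k
    proof -
      let ?g = "e + excess e (b k)"
      have g: "0 \<le> ?g" by (intro add_nonneg_nonneg e excess_nonneg)
      have "- (c k *\<^sub>R b k) \<le> \<bar>c k\<bar> *\<^sub>R ?g"
      proof (cases "0 \<le> c k")
        case True
        then show ?thesis using scaleR_left_mono[OF le_excess(2)[of "b k" e], of "c k"] by simp
      next
        case False
        then show ?thesis using scaleR_left_mono[OF le_excess(1)[of "b k" e], of "- c k"] by simp
      qed
      also have "\<dots> \<le> 1 *\<^sub>R ?g" by (intro scaleR_right_mono c that g)
      finally show ?thesis by simp
    qed
    have "(real N * V l (d l)) *\<^sub>R e = (\<Sum>k<K. (c k * real (l ! k)) *\<^sub>R e)"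
      using N_pos by (simp add: V_def blinfun.sum_left blinfun.scaleR_left sum_distrib_left c_def mult.commute flip: scaleR_sum_left)
    also have "\<dots> = (\<Sum>k<K. (real N * c k) *\<^sub>R x k + - (c k *\<^sub>R b k))"
      by (intro sum.cong) (auto simp: b_def x'_def algebra_simps)
    also have "\<dots> = real N *\<^sub>R B (d l) + (\<Sum>k<K. - (c k *\<^sub>R b k))"
      unfolding sum.distrib by (simp add: B_eq blinfun.sum_left scaleR_sum_right c_def)
    finally have eq: "(real N * V l (d l)) *\<^sub>R e = real N *\<^sub>R B (d l) + (\<Sum>k<K. - (c k *\<^sub>R b k))" .
    have "real N *\<^sub>R B (d l) \<le> real N *\<^sub>R t" by (intro scaleR_left_mono t l) simp
    also have "real N *\<^sub>R t = real (l ! K) *\<^sub>R e + b K" by (simp add: b_def x'_def)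
    also have "\<dots> \<le> real (l ! K) *\<^sub>R e + (e + excess e (b K))" by (intro add_left_mono le_excess)
    finally have 1: "real N *\<^sub>R B (d l) \<le> real (l ! K) *\<^sub>R e + (e + excess e (b K))" .
    have 2: "(\<Sum>k<K. - (c k *\<^sub>R b k)) \<le> (\<Sum>k<K. e + excess e (b k))" by (intro sum_mono cb) simp
    have 3: "(real N * V l (d l)) *\<^sub>R e \<le> real (l ! K) *\<^sub>R e + (e + excess e (b K)) + (\<Sum>k<K. e + excess e (b k))"
      unfolding eq by (intro add_mono 1 2)
    have "\<gamma> \<le> real N * V l (d l) - real (l ! K) - real K - 1"
      using mult_left_mono[OF d(2)[of l], of "real N"] N_pos by (simp add: \<gamma>_def algebra_simps)
    then have "\<gamma> *\<^sub>R e \<le> (real N * V l (d l) - real (l ! K) - real K - 1) *\<^sub>R e" by (intro scaleR_right_mono e)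
    also have "\<dots> = (real N * V l (d l)) *\<^sub>R e - real (l ! K) *\<^sub>R e - real K *\<^sub>R e - e"
      by (simp add: scaleR_left_diff_distrib)
    also have "\<dots> \<le> (\<Sum>k<Suc K. excess e (b k))"
      using 3 by (simp add: sum.distrib sum_constant_scaleR algebra_simps)
    finally have "\<mu> l = 0"
      using \<mu>(1,4) l False x' e excess_nonneg nonneg_le_sum[of ?G l \<mu>] finite_grid_lists \<mu>(2)
      by (intro disjoint_multiple_eq_0[of "\<mu> l" e \<gamma> "\<lambda>k. excess e (b k)" "Suc K"]) (auto simp: \<gamma>_def b_def)
    then show ?thesis by simp
  qed
  let ?y = "\<Sum>l\<in>?G. norm (V l) *\<^sub>R \<mu> l"
  have "(\<Sum>l\<in>?G. rank_one (V l) (\<mu> l)) = (\<Sum>l\<in>?G. \<Sum>k<K. rank_one (v k) ((real (l ! k) / real N) *\<^sub>R \<mu> l))"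
    by (simp add: V_def rank_one_sum_left rank_one_scaleR_left rank_one_scaleR_right)
  also have "\<dots> = (\<Sum>k<K. \<Sum>l\<in>?G. rank_one (v k) ((real (l ! k) / real N) *\<^sub>R \<mu> l))" by (rule sum.swap)
  also have "\<dots> = (\<Sum>k<K. rank_one (v k) (\<Sum>l\<in>?G. (real (l ! k) / real N) *\<^sub>R \<mu> l))"
    by (simp add: rank_one_sum_right)
  also have "\<dots> = B"
    unfolding B_eq
  proof (intro sum.cong refl arg_cong2[where f=rank_one])
    fix k assume "k \<in> {..<K}"
    then have k: "k < K" by simp
    have "(\<Sum>l\<in>?G. (real (l ! k) / real N) *\<^sub>R \<mu> l) = (1 / real N) *\<^sub>R (\<Sum>l\<in>?G. real (l ! k) *\<^sub>R \<mu> l)"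
      by (simp add: scaleR_sum_right)
    also have "\<dots> = x k" using \<mu>(3) k N_pos by (simp add: x'_def)
    finally show "(\<Sum>l\<in>?G. (real (l ! k) / real N) *\<^sub>R \<mu> l) = x k" .
  qed
  finally have "maj_rep B ?y" using maj_rep_sum[of ?G \<mu> V] \<mu>(1) by simp
  moreover have "?y \<le> t + \<epsilon> *\<^sub>R e"
  proof -
    have "?y \<le> (\<Sum>l\<in>?G. (real (l ! K + K + 2) / real N) *\<^sub>R \<mu> l)" by (intro sum_mono dir)
    also have "\<dots> = (1 / real N) *\<^sub>R (\<Sum>l\<in>?G. real (l ! K) *\<^sub>R \<mu> l) + (real (K + 2) / real N) *\<^sub>R (\<Sum>l\<in>?G. \<mu> l)"
      by (simp add: scaleR_sum_right add_divide_distrib scaleR_add_left sum.distrib add.assoc)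
    also have "\<dots> = t + (real (K + 2) / real N) *\<^sub>R e" using \<mu>(2,3) N_pos by (simp add: x'_def)
    also have "\<dots> \<le> t + \<epsilon> *\<^sub>R e" by (intro add_left_mono scaleR_right_mono N_le e)
    finally show ?thesis .
  qed
  then have "bidual ?y \<le> w + \<epsilon> *\<^sub>R bidual e"
  proof -
    have "0 \<le> bidual (t + \<epsilon> *\<^sub>R e - ?y)" by (intro bidual_nonneg) (use \<open>?y \<le> t + \<epsilon> *\<^sub>R e\<close> in simp)
    then have "0 \<le> (bidual t + \<epsilon> *\<^sub>R bidual e) - bidual ?y"
      by (simp add: blinfun.diff_right blinfun.add_right blinfun.scaleR_right del: bidual_apply)
    then have "bidual ?y \<le> bidual t + \<epsilon> *\<^sub>R bidual e" using cone_le_iff[of "bidual ?y"] by blast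
    also note cone_add_mono[OF t(3) cone_refl, of "\<epsilon> *\<^sub>R bidual e"]
    finally (cone_trans) show ?thesis .
  qed
  ultimately show ?thesis by blast
qed

text \<open>
  For \<open>p = \<infinity>\<close> the tails of \<open>\<Sum> \<xi>\<^sub>j\<close> need not be small in norm, although positive functionals are summable
  along \<open>\<xi>\<close>. Therefore a representation carries a majorant of its partial sums in the lattice
  instead of a norm bound.
\<close>

definition inf_rep_seq ::
  "'e::real_normed_vector \<Rightarrow>\<^sub>L 'y::{real_normed_vector, ord} \<Rightarrow> 'y \<Rightarrow> (nat \<Rightarrow> 'e dual) \<Rightarrow> (nat \<Rightarrow> 'y) \<Rightarrow> bool"
  where "inf_rep_seq T \<zeta> u \<xi> \<longleftrightarrow> (\<forall>j. norm (u j) \<le> 1 \<and> 0 \<le> \<xi> j) \<and> (\<forall>m. (\<Sum>j<m. \<xi> j) \<le> \<zeta>) \<and>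
    (\<lambda>j. rank_one (u j) (\<xi> j)) sums T"

definition inf_rep :: "'e::real_normed_vector \<Rightarrow>\<^sub>L 'y::{real_normed_vector, ord} \<Rightarrow> 'y \<Rightarrow> bool"
  where "inf_rep T \<zeta> \<longleftrightarrow> (\<exists>u \<xi>. inf_rep_seq T \<zeta> u \<xi>)"

lemma inf_rep_seqI:
  assumes "\<And>j. norm (u j) \<le> 1" "\<And>j. 0 \<le> \<xi> j" "\<And>m. (\<Sum>j<m. \<xi> j) \<le> \<zeta>" "(\<lambda>j. rank_one (u j) (\<xi> j)) sums T"
  shows "inf_rep_seq T \<zeta> u \<xi>"
  using assms unfolding inf_rep_seq_def by blast

lemma inf_rep_seqD:
  assumes "inf_rep_seq T \<zeta> u \<xi>"
  shows "norm (u j) \<le> 1" "0 \<le> \<xi> j" "(\<Sum>j<m. \<xi> j) \<le> \<zeta>" "(\<lambda>j. rank_one (u j) (\<xi> j)) sums T"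
  using assms unfolding inf_rep_seq_def by blast+

lemma inf_rep_nonneg: "inf_rep T \<zeta> \<Longrightarrow> 0 \<le> \<zeta>"
  unfolding inf_rep_def using inf_rep_seqD(3)[of T \<zeta> _ _ 0] by auto

lemma inf_rep_mono:
  fixes \<zeta> :: "'y::cone_space"
  assumes "inf_rep T \<zeta>" "\<zeta> \<le> \<zeta>'"
  shows "inf_rep T \<zeta>'"
  using assms unfolding inf_rep_def inf_rep_seq_def by (meson cone_trans)

lemma inf_rep_scaleR:
  fixes \<zeta> :: "'y::cone_space"
  assumes "inf_rep T \<zeta>" and c: "0 \<le> c"
  shows "inf_rep (c *\<^sub>R T) (c *\<^sub>R \<zeta>)"
proof -
  obtain u \<xi> where r: "inf_rep_seq T \<zeta> u \<xi>" using assms(1) unfolding inf_rep_def by blast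
  have "inf_rep_seq (c *\<^sub>R T) (c *\<^sub>R \<zeta>) u (\<lambda>j. c *\<^sub>R \<xi> j)"
  proof (rule inf_rep_seqI)
    show "(\<Sum>j<m. c *\<^sub>R \<xi> j) \<le> c *\<^sub>R \<zeta>" for m
      using cone_scaleR_mono[OF c inf_rep_seqD(3)[OF r]] by (simp add: scaleR_sum_right)
    show "(\<lambda>j. rank_one (u j) (c *\<^sub>R \<xi> j)) sums (c *\<^sub>R T)"
      unfolding rank_one_scaleR_right by (intro sums_scaleR_right inf_rep_seqD(4)[OF r])
  qed (auto intro: cone_scaleR c inf_rep_seqD[OF r])
  then show ?thesis unfolding inf_rep_def by blast
qed

lemma sum_interleave:
  fixes f g :: "nat \<Rightarrow> 'a::comm_monoid_add"
  shows "(\<Sum>j<m. if even j then f (j div 2) else g (j div 2)) = (\<Sum>j<(m + 1) div 2. f j) + (\<Sum>j<m div 2. g j)"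
proof (induction m)
  case (Suc m)
  show ?case
  proof (cases "even m")
    case True
    then obtain k where "m = 2 * k" by blast
    then show ?thesis using Suc by (simp add: ac_simps)
  next
    case False
    then obtain k where "m = 2 * k + 1" using oddE by blast
    then show ?thesis using Suc by (simp add: ac_simps)
  qed
qed simp

text \<open>Two infinite series cannot be concatenated, so they are interleaved; every partial sum
  then consists of a partial sum of either series.\<close>

lemma inf_rep_add:
  fixes \<zeta> \<zeta>' :: "'y::cone_space"
  assumes "inf_rep T \<zeta>" "inf_rep T' \<zeta>'"
  shows "inf_rep (T + T') (\<zeta> + \<zeta>')"
proof -
  obtain u \<xi> where r: "inf_rep_seq T \<zeta> u \<xi>" using assms(1) unfolding inf_rep_def by blast
  obtain u' \<xi>' where r': "inf_rep_seq T' \<zeta>' u' \<xi>'" using assms(2) unfolding inf_rep_def by blast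
  define v where "v j = (if even j then u (j div 2) else u' (j div 2))" for j
  define x where "x j = (if even j then \<xi> (j div 2) else \<xi>' (j div 2))" for j
  have "inf_rep_seq (T + T') (\<zeta> + \<zeta>') v x"
  proof (rule inf_rep_seqI)
    show "norm (v j) \<le> 1" "0 \<le> x j" for j
      using inf_rep_seqD(1,2)[OF r] inf_rep_seqD(1,2)[OF r'] by (simp_all add: v_def x_def)
    show "(\<Sum>j<m. x j) \<le> \<zeta> + \<zeta>'" for m
      unfolding x_def sum_interleave by (intro cone_add_mono inf_rep_seqD(3)[OF r] inf_rep_seqD(3)[OF r'])
    have half: "filterlim (\<lambda>m::nat. m div 2) sequentially sequentially"
      unfolding filterlim_at_top
    proof
      fix Z :: nat
      show "\<forall>\<^sub>F m in sequentially. Z \<le> m div 2"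
        using eventually_ge_at_top[of "2 * Z"] by eventually_elim linarith
    qed
    have half': "filterlim (\<lambda>m::nat. (m + 1) div 2) sequentially sequentially"
      by (rule filterlim_at_top_mono[OF half]) (simp add: div_le_mono)
    have "(\<lambda>m. (\<Sum>j<(m + 1) div 2. rank_one (u j) (\<xi> j)) + (\<Sum>j<m div 2. rank_one (u' j) (\<xi>' j))) \<longlonglongrightarrow> T + T'"
      using filterlim_compose[OF inf_rep_seqD(4)[OF r, unfolded sums_def] half']
        filterlim_compose[OF inf_rep_seqD(4)[OF r', unfolded sums_def] half] by (rule tendsto_add)
    then have "(\<lambda>m. \<Sum>j<m. if even j then rank_one (u (j div 2)) (\<xi> (j div 2)) else rank_one (u' (j div 2)) (\<xi>' (j div 2))) \<longlonglongrightarrow> T + T'"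
      unfolding sum_interleave[of "\<lambda>j. rank_one (u j) (\<xi> j)" "\<lambda>j. rank_one (u' j) (\<xi>' j)"] .
    moreover have "(\<lambda>j. if even j then rank_one (u (j div 2)) (\<xi> (j div 2)) else rank_one (u' (j div 2)) (\<xi>' (j div 2))) =
        (\<lambda>j. rank_one (v j) (x j))" by (auto simp: v_def x_def)
    ultimately show "(\<lambda>j. rank_one (v j) (x j)) sums (T + T')" unfolding sums_def by (simp only:)
  qed
  then show ?thesis unfolding inf_rep_def by blast
qed

lemma cone_sum_mono2:
  fixes f :: "'i \<Rightarrow> 'y::cone_space"
  assumes "finite B" "A \<subseteq> B" "\<And>i. i \<in> B \<Longrightarrow> 0 \<le> f i"
  shows "sum f A \<le> sum f B"
proof -
  have "sum f B - sum f A = sum f (B - A)" using assms by (simp add: sum_diff)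
  moreover have "0 \<le> sum f (B - A)" using assms by (intro cone_sum) auto
  ultimately show ?thesis using cone_le_iff[of "sum f A" "sum f B"] by simp
qed

lemma maj_rep_imp_inf_rep:
  fixes y :: "'y::cone_space"
  assumes "maj_rep B y"
  shows "inf_rep B y"
proof -
  obtain n :: nat and v x where 1: "\<And>i. i < n \<Longrightarrow> norm (v i) \<le> 1" "\<And>i. i < n \<Longrightarrow> 0 \<le> x i"
    "B = (\<Sum>i<n. rank_one (v i) (x i))" "y = (\<Sum>i<n. x i)" by (rule maj_repE[OF assms], rule that)
  define v' where "v' i = (if i < n then v i else 0)" for i
  define x' where "x' i = (if i < n then x i else 0)" for i
  have x': "0 \<le> x' i" for i using 1(2) cone_zero[where 'a='y] by (simp add: x'_def)
  have "inf_rep_seq B y v' x'"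
  proof (rule inf_rep_seqI)
    show "(\<Sum>j<m. x' j) \<le> y" for m
    proof -
      have "(\<Sum>j<m. x' j) \<le> (\<Sum>j<max m n. x' j)" by (intro cone_sum_mono2 x') auto
      also have "(\<Sum>j<max m n. x' j) = (\<Sum>j<n. x' j)" by (rule sum.mono_neutral_right) (auto simp: x'_def)
      also have "\<dots> = y" unfolding 1(4) by (rule sum.cong) (auto simp: x'_def)
      finally show ?thesis .
    qed
    have "(\<lambda>j. rank_one (v' j) (x' j)) sums (\<Sum>j<n. rank_one (v' j) (x' j))"
      by (rule sums_finite) (auto simp: x'_def rank_one_0_right)
    moreover have "(\<Sum>j<n. rank_one (v' j) (x' j)) = B"
      unfolding 1(3) by (rule sum.cong) (auto simp: x'_def v'_def)
    ultimately show "(\<lambda>j. rank_one (v' j) (x' j)) sums B" by simp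
  qed (use 1(1) x' in \<open>auto simp: v'_def\<close>)
  then show ?thesis unfolding inf_rep_def by blast
qed

lemma inf_rep_tail:
  fixes \<zeta> :: "'y::cone_space"
  assumes r: "inf_rep_seq T \<zeta> u \<xi>"
  shows "inf_rep (T - (\<Sum>j<m. rank_one (u j) (\<xi> j))) (\<zeta> - (\<Sum>j<m. \<xi> j))"
proof -
  have "inf_rep_seq (T - (\<Sum>j<m. rank_one (u j) (\<xi> j))) (\<zeta> - (\<Sum>j<m. \<xi> j)) (\<lambda>j. u (j + m)) (\<lambda>j. \<xi> (j + m))"
  proof (rule inf_rep_seqI)
    fix k
    have "\<zeta> - (\<Sum>j<m. \<xi> j) - (\<Sum>j<k. \<xi> (j + m)) = \<zeta> - (\<Sum>j<m + k. \<xi> j)"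
      by (simp add: sum_lessThan_add add.commute[of _ m])
    moreover have "0 \<le> \<zeta> - (\<Sum>j<m + k. \<xi> j)"
      using inf_rep_seqD(3)[OF r] cone_le_iff[of "\<Sum>j<m + k. \<xi> j" \<zeta>] by blast
    ultimately have "0 \<le> \<zeta> - (\<Sum>j<m. \<xi> j) - (\<Sum>j<k. \<xi> (j + m))" by (simp only:)
    then show "(\<Sum>j<k. \<xi> (j + m)) \<le> \<zeta> - (\<Sum>j<m. \<xi> j)"
      using cone_le_iff[of "\<Sum>j<k. \<xi> (j + m)" "\<zeta> - (\<Sum>j<m. \<xi> j)"] by blast
  qed (intro inf_rep_seqD[OF r] sums_split_initial_segment)+
  then show ?thesis unfolding inf_rep_def by blast
qed

section \<open>Traces and separation for majorized series\<close>

lemma functional_sum_le: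
  fixes a :: "nat \<Rightarrow> 'y::cone_space" and h :: "'y dual"
  assumes "0 \<le> h" "(\<Sum>j<m. a j) \<le> \<zeta>"
  shows "(\<Sum>j<m. h (a j)) \<le> h \<zeta>"
  using dual_nonneg_mono[OF assms] by (simp add: blinfun.sum_right)

lemma sums_partial_le:
  fixes f :: "nat \<Rightarrow> real"
  assumes "f sums s" "\<And>n. (\<Sum>i<n. f i) \<le> b"
  shows "s \<le> b"
  using LIMSEQ_le_const2[OF assms(1)[unfolded sums_def]] assms(2) by blast

text \<open>The series of the \<open>a j\<close> need not converge in norm. Every functional is
  dominated by a positive one of no larger norm, whose sums are bounded through the majorant; so the
  series converges absolutely against functionals and has a weak* sum in the bidual.\<close>

lemma majorized_sum_functional:
  fixes a :: "nat \<Rightarrow> 'y::cone_space"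
  assumes Y: "regular_norm TYPE('y)" and a: "\<And>j. 0 \<le> a j" "\<And>m. (\<Sum>j<m. a j) \<le> \<zeta>"
  obtains \<Xi> :: "'y dual dual" where "\<And>h::'y dual. (\<lambda>j. blinfun_apply h (a j)) sums \<Xi> h"
proof -
  have bound: "(\<Sum>j<m. \<bar>h (a j)\<bar>) \<le> norm h * norm \<zeta>" for m and h :: "'y dual"
  proof -
    obtain k where k: "h \<le> k" "- h \<le> k" "0 \<le> k" "norm k \<le> norm h"
      by (rule regular_norm_modulus[OF regular_norm_dual[OF Y], of h])
    have "\<bar>h (a j)\<bar> \<le> k (a j)" for j
      using blinfun_leD[OF k(1) a(1)[of j]] blinfun_leD[OF k(2) a(1)[of j]] by (simp add: blinfun.minus_left)
    then have "(\<Sum>j<m. \<bar>h (a j)\<bar>) \<le> (\<Sum>j<m. k (a j))" by (intro sum_mono)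
    also have "\<dots> \<le> k \<zeta>" by (rule functional_sum_le[OF k(3) a(2)])
    also have "\<dots> \<le> norm k * norm \<zeta>" using norm_blinfun[of k \<zeta>] by simp
    also have "\<dots> \<le> norm h * norm \<zeta>" using k(4) by (intro mult_right_mono) auto
    finally show ?thesis .
  qed
  have abs_sm: "summable (\<lambda>j. \<bar>h (a j)\<bar>)" for h :: "'y dual"
    by (rule summableI_nonneg_bounded[OF _ bound]) simp
  then have sm: "summable (\<lambda>j. h (a j))" for h :: "'y dual" by (rule summable_rabs_cancel)
  define F where "F h = (\<Sum>j. h (a j))" for h :: "'y dual"
  have "bounded_linear F"
  proof (rule bounded_linear_intro[of _ "norm \<zeta>"])
    show "F (h + k) = F h + F k" for h k by (simp add: F_def blinfun.add_left suminf_add sm)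
    show "F (c *\<^sub>R h) = c *\<^sub>R F h" for c h by (simp add: F_def blinfun.scaleR_left suminf_mult sm)
    have "\<bar>F h\<bar> \<le> norm h * norm \<zeta>" for h
      unfolding F_def using summable_rabs[OF abs_sm] suminf_le_const[OF abs_sm bound] by (meson order_trans)
    then show "norm (F h) \<le> norm h * norm \<zeta>" for h by simp
  qed
  then have "blinfun_apply (Blinfun F) = F" by (rule bounded_linear_Blinfun_apply)
  then show thesis using that[of "Blinfun F"] summable_sums[OF sm] by (simp add: F_def)
qed

text \<open>Measuring majorants by a fixed positive functional instead of the norm restores
  additivity of the cost, and with it a sublinear gauge.\<close>

lemma maj_gauge:
  fixes L :: "'y::cone_space dual"
  assumes L: "0 \<le> L"
  defines "U \<equiv> {T :: 'e::real_normed_vector \<Rightarrow>\<^sub>L 'y. \<exists>d. maj_rep T d}"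
    and "\<nu> \<equiv> \<lambda>T :: 'e \<Rightarrow>\<^sub>L 'y. Inf {blinfun_apply L d | d. maj_rep T d}"
  shows "subspace U" "sublinear_on U \<nu>" "\<And>T d. maj_rep T d \<Longrightarrow> \<nu> T \<le> L d"
    "\<And>T b. T \<in> U \<Longrightarrow> (\<And>d. maj_rep T d \<Longrightarrow> b \<le> L d) \<Longrightarrow> b \<le> \<nu> T"
proof -
  have Ld: "0 \<le> L d" if "maj_rep T d" for T :: "'e \<Rightarrow>\<^sub>L 'y" and d
    by (rule dual_nonnegD[OF L maj_rep_nonneg[OF that]])
  have bdd: "bdd_below {blinfun_apply L d | d. maj_rep T d}" for T :: "'e \<Rightarrow>\<^sub>L 'y"
    using Ld by (intro bdd_belowI[of _ 0]) auto
  show le: "\<nu> T \<le> L d" if "maj_rep T d" for T d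
    unfolding \<nu>_def using bdd that by (intro cInf_lower) auto
  show ge: "b \<le> \<nu> T" if T: "T \<in> U" and b: "\<And>d. maj_rep T d \<Longrightarrow> b \<le> L d" for T b
    unfolding \<nu>_def using T b by (intro cInf_greatest) (auto simp: U_def)
  have U0: "0 \<in> U" unfolding U_def using maj_rep_0 by (intro CollectI exI)
  show U: "subspace U"
  proof (rule subspaceI)
    show "0 \<in> U" by (rule U0)
    show "T + T' \<in> U" if TT': "T \<in> U" "T' \<in> U" for T T'
    proof -
      obtain d d' where "maj_rep T d" "maj_rep T' d'" using TT' unfolding U_def by auto
      then have "maj_rep (T + T') (d + d')" by (rule maj_rep_add)
      then show ?thesis unfolding U_def by (intro CollectI exI)
    qed
    show "r *\<^sub>R T \<in> U" if T: "T \<in> U" for r T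
    proof -
      obtain d where d: "maj_rep T d" using T unfolding U_def by auto
      have "maj_rep (r *\<^sub>R T) (\<bar>r\<bar> *\<^sub>R d)"
      proof (cases "0 \<le> r")
        case True
        then show ?thesis using maj_rep_scaleR[OF d, of r] by simp
      next
        case False
        then show ?thesis using maj_rep_scaleR[OF maj_rep_uminus[OF d], of "- r"] by simp
      qed
      then show ?thesis unfolding U_def by (intro CollectI exI)
    qed
  qed
  show "sublinear_on U \<nu>"
  proof (rule sublinear_onI[OF U])
    fix T T' assume T: "T \<in> U" "T' \<in> U"
    have *: "\<nu> (T + T') \<le> L s + L t" if "maj_rep T s" "maj_rep T' t" for s t
      using le[OF maj_rep_add[OF that]] by (simp add: blinfun.add_right)
    have "\<nu> (T + T') - L s \<le> \<nu> T'" if s: "maj_rep T s" for s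
    proof (rule ge[OF T(2)])
      fix t assume "maj_rep T' t"
      then show "\<nu> (T + T') - L s \<le> L t" using *[OF s, of t] by simp
    qed
    then have **: "\<nu> (T + T') - \<nu> T' \<le> L s" if "maj_rep T s" for s using that by fastforce
    have "\<nu> (T + T') - \<nu> T' \<le> \<nu> T" by (rule ge[OF T(1) **])
    then show "\<nu> (T + T') \<le> \<nu> T + \<nu> T'" by simp
  next
    fix T and r :: real assume T: "T \<in> U" and r: "0 < r"
    have "\<nu> (r *\<^sub>R T) / r \<le> \<nu> T"
    proof (rule ge[OF T])
      fix d assume "maj_rep T d"
      then have "\<nu> (r *\<^sub>R T) \<le> L (r *\<^sub>R d)" by (intro le maj_rep_scaleR) (use r in auto)
      then show "\<nu> (r *\<^sub>R T) / r \<le> L d" using r by (simp add: field_simps blinfun.scaleR_right)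
    qed
    then show "\<nu> (r *\<^sub>R T) \<le> r * \<nu> T" using r by (simp add: field_simps)
  next
    have "0 \<le> \<nu> 0" by (rule ge[OF U0 Ld])
    then show "\<nu> 0 = 0" using le[OF maj_rep_0] by simp
  qed
qed

lemma dual_map_bidual_eq_0:
  fixes h :: "'x::real_normed_vector dual dual dual"
  shows "(\<And>x. h (bidual x) = 0) \<Longrightarrow> dual_map bidual h = 0"
  by (rule blinfun_eqI) simp

text \<open>As \<open>W\<close> vanishes on X, its trace is already the defect trace. In the case of
  the fourth dual, the tails of the \<xi>_j are small only when evaluated at \<open>L\<close>, and
  contractivity of \<open>R\<close> does not preserve that. Hence \<open>R\<close> is taken close to
  the identity at the two weak* tails \<open>w1\<close> and \<open>w2\<close>, which majorize the
  partial sums of the tails.\<close>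

lemma majorized_trace_tendsto_0:
  fixes S :: "'e::real_normed_vector \<Rightarrow>\<^sub>L 'x::cone_space" and W :: "'e dual \<Rightarrow>\<^sub>L 'x dual dual dual"
  assumes X: "regular_norm TYPE('x)"
    and r: "inf_rep_seq (bidual o\<^sub>L S) \<zeta> u \<xi>" and L: "0 \<le> L"
    and W0: "\<And>v x. blinfun_apply (W v) (bidual x) = 0"
    and W: "\<And>v y. 0 \<le> y \<Longrightarrow> blinfun_apply (W v) y \<le> norm v * blinfun_apply L y"
    and AP: "approximation_property TYPE('e dual) \<or>
      positive_metric_approximation_property TYPE('x dual dual dual dual)"
  shows "(\<lambda>m. \<Sum>j<m. blinfun_apply (W (u j)) (\<xi> j)) \<longlonglongrightarrow> 0"
proof -
  note u = inf_rep_seqD(1)[OF r] and \<xi> = inf_rep_seqD(2)[OF r] and part = inf_rep_seqD(3)[OF r]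
  interpret bidual_series S u \<xi> by unfold_locales (rule inf_rep_seqD(4)[OF r])
  have Wdef: "bidual_defect \<eta> (W v) = W v \<eta>" for \<eta> v
    using dual_map_bidual_eq_0[OF W0, of v] by (simp add: bidual_defect_apply blinfun.zero_right)
  have W_abs: "\<bar>W v y\<bar> \<le> norm v * L y" if "0 \<le> y" for v y
    using W[OF that, of v] W[OF that, of "- v"] by (simp add: blinfun.bilinear_simps)
  have L\<xi>: "0 \<le> L (\<xi> j)" for j by (rule dual_nonnegD[OF L \<xi>])
  have L_sum: "(\<Sum>j<m. L (\<xi> j)) \<le> L \<zeta>" for m by (rule functional_sum_le[OF L part])
  have "(\<lambda>m. \<Sum>j<m. bidual_defect (\<xi> j) (W (u j))) \<longlonglongrightarrow> 0"
    using AP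
  proof
    assume AP: "approximation_property TYPE('e dual)"
    define a where "a j = L (\<xi> j) + (1/2) ^ j" for j
    have "summable (\<lambda>j. L (\<xi> j))" by (rule summableI_nonneg_bounded[OF L\<xi> L_sum])
    then have sa: "summable a" unfolding a_def by (intro summable_add) auto
    have a0: "0 < a j" for j unfolding a_def using L\<xi> by (intro add_nonneg_pos) auto
    obtain \<gamma> K where \<gamma>: "\<And>j. 0 < \<gamma> j" "(\<lambda>j. 1 / \<gamma> j) \<longlonglongrightarrow> 0" "\<And>n. (\<Sum>j<n. \<gamma> j * a j) \<le> K"
      by (rule summable_growing_weights[OF sa a0], rule that)
    show ?thesis
    proof (rule defect_trace_approximation_property[OF AP \<gamma>(1), where K = K])
      show "(\<lambda>j. u j /\<^sub>R \<gamma> j) \<longlonglongrightarrow> 0"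
      proof (rule Lim_null_comparison[OF _ \<gamma>(2)])
        have "norm (u j /\<^sub>R \<gamma> j) \<le> 1 / \<gamma> j" for j
          using u[of j] \<gamma>(1)[of j] by (simp add: field_simps)
        then show "\<forall>\<^sub>F j in sequentially. norm (u j /\<^sub>R \<gamma> j) \<le> 1 / \<gamma> j" by simp
      qed
    next
      fix v :: "nat \<Rightarrow> 'e dual" and m assume v: "\<And>j. norm (v j) \<le> \<gamma> j"
      have "\<bar>\<Sum>j<m. bidual_defect (\<xi> j) (W (v j))\<bar> \<le> (\<Sum>j<m. \<bar>W (v j) (\<xi> j)\<bar>)"
        unfolding Wdef by (rule sum_abs)
      also have "\<dots> \<le> (\<Sum>j<m. \<gamma> j * a j)"
      proof (rule sum_mono)
        fix j
        have "\<bar>W (v j) (\<xi> j)\<bar> \<le> norm (v j) * L (\<xi> j)" by (rule W_abs[OF \<xi>])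
        also have "\<dots> \<le> \<gamma> j * a j"
          using v \<gamma>(1)[of j] L\<xi>[of j] by (intro mult_mono) (auto simp: a_def)
        finally show "\<bar>W (v j) (\<xi> j)\<bar> \<le> \<gamma> j * a j" .
      qed
      also have "\<dots> \<le> K" by (rule \<gamma>(3))
      finally show "\<bar>\<Sum>j<m. bidual_defect (\<xi> j) (W (v j))\<bar> \<le> K" .
    qed
  next
    assume AP: "positive_metric_approximation_property TYPE('x dual dual dual dual)"
    define \<R> where "\<R> = {R :: 'x dual dual dual dual \<Rightarrow>\<^sub>L 'x dual dual dual dual. 0 \<le> R \<and> norm R \<le> 1}"
    have Y: "regular_norm TYPE('x dual dual)" by (intro regular_norm_dual X)
    obtain \<Xi> :: "'x dual dual dual dual" where \<Xi>: "\<And>h. (\<lambda>j. blinfun_apply h (\<xi> j)) sums \<Xi> h"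
      by (rule majorized_sum_functional[OF Y \<xi> part], rule that)
    let ?J = "\<lambda>j. bidual (\<xi> j)" and ?K = "\<lambda>j. dual_map (dual_map bidual) (\<xi> j)"
    define \<Xi>' where "\<Xi>' = dual_map (dual_map bidual) (dual_map bidual \<Xi>)"
    have \<Xi>': "(\<lambda>j. ?K j h) sums \<Xi>' h" for h using \<Xi>[of "bidual (dual_map bidual h)"] by (simp add: \<Xi>'_def)
    have J: "0 \<le> ?J j" and K: "0 \<le> ?K j" for j
      by (intro bidual_nonneg dual_map_dual_map_bidual_nonneg \<xi>)+
    have abs_le: "\<bar>w (W v)\<bar> \<le> norm v * w L" if w: "0 \<le> w" for w :: "'x dual dual dual dual" and v
    proof -
      have "W v \<le> norm v *\<^sub>R L" "W (- v) \<le> norm v *\<^sub>R L"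
        using W[of _ v] W[of _ "- v"] by (intro blinfun_leI; simp add: blinfun.scaleR_left)+
      from this[THEN dual_nonneg_mono[OF w]] show ?thesis by (simp add: blinfun.bilinear_simps abs_le_iff)
    qed
    show ?thesis
    proof (rule defect_trace_positive_approximation_property[where \<R> = \<R>])
      show "\<exists>R\<in>\<R>. finite_rank R \<and> (\<forall>w\<in>Z. norm (R w - w) < \<epsilon>)" if "0 < \<epsilon>" "compact Z" for \<epsilon> Z
        using AP that unfolding positive_metric_approximation_property_def \<R>_def by blast
    next
      fix r :: real assume r: "0 < r"
      \<comment> \<open>Replacing a tail by its image under \<open>R\<close> changes the value at
        \<open>L\<close> by at most \<open>r / 8\<close>; with the tails themselves below
        \<open>r / 8\<close>, each of the four traces is at most \<open>r / 4\<close>.\<close>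
      define \<delta> where "\<delta> = r / (8 * (norm L + 1))"
      have L1: "0 < norm L + 1" by (simp add: add_nonneg_pos)
      have "\<delta> * norm L = (r / 8) * (norm L / (norm L + 1))" by (simp add: \<delta>_def)
      also have "\<dots> \<le> (r / 8) * 1" using r L1 by (intro mult_left_mono) (auto simp: pos_divide_le_eq)
      finally have \<delta>: "0 < \<delta>" "\<delta> * norm L \<le> r / 8" using r L1 by (simp_all add: \<delta>_def)
      obtain N1 where N1: "\<And>n m. N1 \<le> n \<Longrightarrow> (\<Sum>i<m. L (\<xi> (n + i))) \<le> r / 8"
        by (rule tail_sums_small[of "\<lambda>j. L (\<xi> j)" "L \<zeta>" "r / 8"]) (use L\<xi> L_sum r in auto)
      \<comment> \<open>The value of \<open>L'\<close> at \<open>\<xi> j\<close> is the value at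
        \<open>L\<close> of the second embedding of \<open>\<xi> j\<close>.\<close>
      define L' where "L' = bidual (dual_map bidual L)"
      have L': "0 \<le> L'" unfolding L'_def by (intro bidual_nonneg dual_map_bidual_nonneg L)
      obtain N2 where N2: "\<And>n m. N2 \<le> n \<Longrightarrow> (\<Sum>i<m. L' (\<xi> (n + i))) \<le> r / 8"
        by (rule tail_sums_small[of "\<lambda>j. L' (\<xi> j)" "L' \<zeta>" "r / 8"])
          (use dual_nonnegD[OF L' \<xi>] functional_sum_le[OF L' part] r in auto)
      define N where "N = max N1 N2"
      define w1 where "w1 = \<Xi> - (\<Sum>j<N. ?J j)"
      define w2 where "w2 = \<Xi>' - (\<Sum>j<N. ?K j)"
      have tail_sums: "(\<lambda>i. ?J (i + N) h) sums w1 h" "(\<lambda>i. ?K (i + N) h) sums w2 h" for h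
        using sums_split_initial_segment[OF \<Xi>[of h], of N] sums_split_initial_segment[OF \<Xi>'[of h], of N]
        by (simp_all add: w1_def w2_def blinfun.diff_left blinfun.sum_left)
      have tail_le: "(\<Sum>i<n. ?J (i + N)) \<le> w1" "(\<Sum>i<n. ?K (i + N)) \<le> w2" for n
      proof -
        have "(\<Sum>i<n. ?J (i + N) h) \<le> w1 h" "(\<Sum>i<n. ?K (i + N) h) \<le> w2 h" if "0 \<le> h" for h
          using tail_sums[of h] dual_nonnegD[OF J that] dual_nonnegD[OF K that]
          by (intro sum_le_suminf[of _ "{..<n}", THEN order_trans] sums_summable; force simp: sums_iff)+
        then show "(\<Sum>i<n. ?J (i + N)) \<le> w1" "(\<Sum>i<n. ?K (i + N)) \<le> w2"
          by (intro blinfun_leI; simp only: blinfun.sum_left)+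
      qed
      have w1L: "w1 L \<le> r / 8"
        by (rule sums_partial_le[OF tail_sums(1)]) (use N1[of N] in \<open>auto simp: N_def add.commute\<close>)
      have w2L: "w2 L \<le> r / 8"
        by (rule sums_partial_le[OF tail_sums(2)]) (use N2[of N] in \<open>auto simp: N_def L'_def add.commute\<close>)
      have "\<bar>\<Sum>j=N..<m. (bidual_defect (\<xi> j) - R (bidual_defect (\<xi> j))) (W (u j))\<bar> \<le> r"
        if R: "R \<in> \<R>" and Z: "\<forall>w\<in>{w1, w2}. norm (R w - w) < \<delta>" for R m
      proof -
        have R_pos: "0 \<le> R w" if "0 \<le> w" for w
          using R that blinfun_leD[of 0 R w] unfolding \<R>_def by simp
        have R_mono: "R v \<le> R w" if "v \<le> w" for v w
          using R_pos[of "w - v"] that cone_le_iff[of v w] cone_le_iff[of "R v" "R w"] by (simp add: blinfun.diff_right)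
        have RwL: "R w L \<le> r / 4" if "w \<in> {w1, w2}" "w L \<le> r / 8" for w
        proof -
          have "(R w - w) L \<le> norm (R w - w) * norm L" using norm_blinfun[of "R w - w" L] by simp
          also have "\<dots> \<le> \<delta> * norm L" using Z that(1) by (intro mult_right_mono) (auto intro: less_imp_le)
          finally show ?thesis using \<delta>(2) that(2) by (simp add: blinfun.diff_left)
        qed
        let ?n = "m - N"
        have shift: "(\<Sum>j=N..<m. f j) = (\<Sum>i<?n. f (i + N))" for f :: "nat \<Rightarrow> real"
          by (simp add: sum.atLeastLessThan_shift_0 atLeast0LessThan add.commute comp_def)
        have 1: "\<bar>\<Sum>i<?n. w i (W (u (i + N)))\<bar> \<le> b"
          if w: "\<And>i. 0 \<le> w i" "(\<Sum>i<?n. w i) L \<le> b" for w :: "nat \<Rightarrow> 'x dual dual dual dual" and b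
        proof -
          have "\<bar>\<Sum>i<?n. w i (W (u (i + N)))\<bar> \<le> (\<Sum>i<?n. \<bar>w i (W (u (i + N)))\<bar>)" by (rule sum_abs)
          also have "\<dots> \<le> (\<Sum>i<?n. w i L)"
          proof (rule sum_mono)
            fix i
            have "\<bar>w i (W (u (i + N)))\<bar> \<le> norm (u (i + N)) * w i L" by (rule abs_le[OF w(1)])
            also have "\<dots> \<le> 1 * w i L" by (intro mult_right_mono u dual_nonnegD[OF w(1) L])
            finally show "\<bar>w i (W (u (i + N)))\<bar> \<le> w i L" by simp
          qed
          finally show ?thesis using w(2) by (simp add: blinfun.sum_left)
        qed
        have "(\<Sum>i<?n. ?J (i + N)) L \<le> w1 L" "(\<Sum>i<?n. ?K (i + N)) L \<le> w2 L"
          by (intro blinfun_leD tail_le L)+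
        then have b1: "(\<Sum>i<?n. ?J (i + N)) L \<le> r / 4" "(\<Sum>i<?n. ?K (i + N)) L \<le> r / 4"
          using w1L w2L r by linarith+
        have "R (\<Sum>i<?n. ?J (i + N)) L \<le> R w1 L" "R (\<Sum>i<?n. ?K (i + N)) L \<le> R w2 L"
          by (intro blinfun_leD[OF R_mono] tail_le L)+
        then have "(\<Sum>i<?n. R (?J (i + N))) L \<le> r / 4" "(\<Sum>i<?n. R (?K (i + N))) L \<le> r / 4"
          using RwL[of w1] RwL[of w2] w1L w2L unfolding blinfun.sum_right by simp_all
        note bounds = 1[OF J b1(1)] 1[OF K b1(2)] 1[OF R_pos[OF J] this(1)] 1[OF R_pos[OF K] this(2)]
        have "(\<Sum>j=N..<m. (bidual_defect (\<xi> j) - R (bidual_defect (\<xi> j))) (W (u j))) =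
            (\<Sum>i<?n. ?J (i + N) (W (u (i + N)))) - (\<Sum>i<?n. ?K (i + N) (W (u (i + N))))
            - (\<Sum>i<?n. R (?J (i + N)) (W (u (i + N)))) + (\<Sum>i<?n. R (?K (i + N)) (W (u (i + N))))"
          unfolding shift
          by (simp add: bidual_defect_def blinfun.bilinear_simps sum_subtractf sum.distrib del: dual_map_blinfun_apply bidual_apply)
        then show ?thesis using bounds by linarith
      qed
      then show "\<exists>N Z \<delta>. finite Z \<and> 0 < \<delta> \<and> (\<forall>R\<in>\<R>. (\<forall>w\<in>Z. norm (R w - w) < \<delta>) \<longrightarrow>
          (\<forall>m\<ge>N. \<bar>\<Sum>j=N..<m. (bidual_defect (\<xi> j) - R (bidual_defect (\<xi> j))) (W (u j))\<bar> \<le> r))"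
        using \<delta>(1) by (intro exI[of _ N] exI[of _ "{w1, w2}"] exI[of _ \<delta>] conjI ballI impI allI) auto
    qed
  qed
  then show ?thesis unfolding Wdef .
qed

text \<open>No bound is imposed on the majorant of \<open>B\<close>. Such operators form a subspace,
  so a functional that separates a partial sum from it vanishes on operators into X, and the traces
  of the corresponding \<open>W\<close> tend to 0. On the other hand they start at
  \<open>\<epsilon>\<close> or more and the tail takes away at most \<open>\<epsilon> / 2\<close>.
  The bound \<open>m0\<close> lets the application demand a remainder of small norm.\<close>

lemma maj_rep_absorb:
  fixes S :: "'e::real_normed_vector \<Rightarrow>\<^sub>L 'x::cone_space" and L :: "'x dual dual dual"
  assumes X: "regular_norm TYPE('x)"
    and r: "inf_rep_seq (bidual o\<^sub>L S) \<zeta> u \<xi>" and L: "0 \<le> L" and \<epsilon>: "0 < \<epsilon>"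
    and AP: "approximation_property TYPE('e dual) \<or>
      positive_metric_approximation_property TYPE('x dual dual dual dual)"
  shows "\<exists>m\<ge>m0. \<exists>B y d. maj_rep B y \<and>
    maj_rep ((\<Sum>j<m. rank_one (u j) (\<xi> j)) - (bidual o\<^sub>L B)) d \<and> L d \<le> \<epsilon>"
proof (rule ccontr)
  assume neg: "\<not> ?thesis"
  note \<xi> = inf_rep_seqD(2)[OF r] and part = inf_rep_seqD(3)[OF r]
  define A where "A m = (\<Sum>j<m. rank_one (u j) (\<xi> j))" for m
  have L\<xi>: "0 \<le> L (\<xi> j)" for j by (rule dual_nonnegD[OF L \<xi>])
  obtain N0 where N0: "\<And>n m. N0 \<le> n \<Longrightarrow> (\<Sum>i<m. L (\<xi> (n + i))) \<le> \<epsilon> / 2"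
    by (rule tail_sums_small[of "\<lambda>j. L (\<xi> j)" "L \<zeta>" "\<epsilon> / 2"]) (use L\<xi> functional_sum_le[OF L part] \<epsilon> in auto)
  define N where "N = max m0 N0"
  have big: "\<epsilon> \<le> L d" if "maj_rep B y" "maj_rep (A N - (bidual o\<^sub>L B)) d" for B y d
  proof -
    have "m0 \<le> N" by (simp add: N_def)
    then have "\<not> L d \<le> \<epsilon>" using neg that unfolding A_def by blast
    then show ?thesis by simp
  qed
  define U where "U = {T :: 'e \<Rightarrow>\<^sub>L 'x dual dual. \<exists>d. maj_rep T d}"
  define \<nu> where "\<nu> T = Inf {blinfun_apply L d | d. maj_rep T d}" for T :: "'e \<Rightarrow>\<^sub>L 'x dual dual"
  note U = maj_gauge(1)[OF L, where 'e = 'e, folded U_def]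
  note \<nu> = maj_gauge(2)[OF L, where 'e = 'e, folded U_def \<nu>_def]
  note \<nu>_le = maj_gauge(3)[OF L, where 'e = 'e, folded \<nu>_def]
  note le_\<nu> = maj_gauge(4)[OF L, where 'e = 'e, folded U_def \<nu>_def]
  have in_U: "T \<in> U" if "maj_rep T d" for T d using that unfolding U_def by (intro CollectI exI)
  have A_rep: "maj_rep (A m) (\<Sum>j<m. \<xi> j)" for m
    unfolding A_def by (rule maj_repI[of m u \<xi>]) (simp_all add: inf_rep_seqD(1,2)[OF r])
  define G where "G = {(s *\<^sub>R A N - (bidual o\<^sub>L B), b) | s B b. 0 \<le> s \<and> (\<exists>y. maj_rep B y) \<and> b \<le> s * \<epsilon>}"
  have G_I: "(s *\<^sub>R A N - (bidual o\<^sub>L B), b) \<in> G" if "0 \<le> s" "maj_rep B y" "b \<le> s * \<epsilon>" for s B y b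
    unfolding G_def using that by blast
  have cone: "convex_cone_set G"
    unfolding convex_cone_set_def
  proof (intro conjI ballI allI impI)
    have "bidual o\<^sub>L 0 = (0 :: 'e \<Rightarrow>\<^sub>L 'x dual dual)" by (rule blinfun_eqI) (simp add: blinfun.zero_right)
    then show "0 \<in> G" using G_I[OF order_refl maj_rep_0, of 0] by (simp add: zero_prod_def)
  next
    fix g h assume "g \<in> G" "h \<in> G"
    then obtain s B b y s' B' b' y' where
      1: "0 \<le> s" "maj_rep B y" "b \<le> s * \<epsilon>" "g = (s *\<^sub>R A N - (bidual o\<^sub>L B), b)" and
      2: "0 \<le> s'" "maj_rep B' y'" "b' \<le> s' * \<epsilon>" "h = (s' *\<^sub>R A N - (bidual o\<^sub>L B'), b')"
      unfolding G_def by blast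
    have "((s + s') *\<^sub>R A N - (bidual o\<^sub>L (B + B')), b + b') \<in> G"
      by (rule G_I[OF _ maj_rep_add[OF 1(2) 2(2)]]) (use 1 2 in \<open>auto simp: distrib_right\<close>)
    moreover have "g + h = ((s + s') *\<^sub>R A N - (bidual o\<^sub>L (B + B')), b + b')"
      using 1 2 by (simp add: algebra_simps blinfun_compose_simps)
    ultimately show "g + h \<in> G" by simp
  next
    fix g and t :: real assume "g \<in> G" and t: "0 < t"
    then obtain s B b y where 1: "0 \<le> s" "maj_rep B y" "b \<le> s * \<epsilon>" "g = (s *\<^sub>R A N - (bidual o\<^sub>L B), b)"
      unfolding G_def by blast
    have "((t * s) *\<^sub>R A N - (bidual o\<^sub>L (t *\<^sub>R B)), t * b) \<in> G"
      by (rule G_I[OF _ maj_rep_scaleR[OF 1(2)]]) (use 1 t in \<open>auto simp: mult.assoc\<close>)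
    moreover have "t *\<^sub>R g = ((t * s) *\<^sub>R A N - (bidual o\<^sub>L (t *\<^sub>R B)), t * b)"
      using 1 by (simp add: blinfun_compose_simps scaleR_diff_right)
    ultimately show "t *\<^sub>R g \<in> G" by simp
  qed
  have bound: "v \<in> U \<and> b \<le> \<nu> v" if vb: "(v, b) \<in> G" for v b
  proof -
    obtain s B y where s: "0 \<le> s" "maj_rep B y" "b \<le> s * \<epsilon>" "v = s *\<^sub>R A N - (bidual o\<^sub>L B)"
      using vb unfolding G_def by blast
    have JB: "(bidual o\<^sub>L B) \<in> U" if "maj_rep B y" for B y by (rule in_U[OF maj_rep_bidual[OF that]])
    have v: "v \<in> U" unfolding s(4) by (intro subspace_diff subspace_scale U in_U[OF A_rep] JB[OF s(2)])
    show ?thesis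
    proof (cases "s = 0")
      case True
      have "0 \<le> \<nu> v" by (rule le_\<nu>[OF v]) (rule dual_nonnegD[OF L maj_rep_nonneg])
      then show ?thesis using v s(3) True by simp
    next
      case False
      define B' where "B' = inverse s *\<^sub>R B"
      have B': "maj_rep B' (inverse s *\<^sub>R y)" unfolding B'_def using s by (intro maj_rep_scaleR) auto
      have m: "A N - (bidual o\<^sub>L B') \<in> U" by (intro subspace_diff U in_U[OF A_rep] JB[OF B'])
      have "\<epsilon> \<le> \<nu> (A N - (bidual o\<^sub>L B'))" by (rule le_\<nu>[OF m big[OF B']])
      then have "s * \<epsilon> \<le> s * \<nu> (A N - (bidual o\<^sub>L B'))" by (intro mult_left_mono s)
      also have "\<dots> = \<nu> (s *\<^sub>R (A N - (bidual o\<^sub>L B')))" using \<nu> m s(1) unfolding sublinear_on_def by simp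
      also have "s *\<^sub>R (A N - (bidual o\<^sub>L B')) = v"
        using False by (simp add: s(4) B'_def blinfun_compose_simps scaleR_diff_right)
      finally show ?thesis using s(3) v by simp
    qed
  qed
  obtain \<phi> where \<phi>_le: "\<And>T. T \<in> U \<Longrightarrow> \<phi> T \<le> \<nu> T"
    and \<phi>_add: "\<And>T T'. T \<in> U \<Longrightarrow> T' \<in> U \<Longrightarrow> \<phi> (T + T') = \<phi> T + \<phi> T'"
    and \<phi>_scale: "\<And>T r. T \<in> U \<Longrightarrow> \<phi> (r *\<^sub>R T) = r * \<phi> T"
    and \<phi>_ge: "\<And>v b. (v, b) \<in> G \<Longrightarrow> b \<le> \<phi> v"
    by (rule hahn_banach_cone[OF U \<nu> cone bound], assumption, rule that)
  have Y: "regular_norm TYPE('x dual dual)" by (intro regular_norm_dual X)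
  have pos_U: "rank_one v y \<in> U" if "0 \<le> y" for v :: "'e dual" and y :: "'x dual dual"
    using in_U[OF maj_rep_rank_one[OF that]] .
  have rank_one_U: "rank_one v y \<in> U" for v :: "'e dual" and y :: "'x dual dual"
  proof -
    obtain z where z: "y \<le> z" "0 \<le> z" using regular_norm_modulus[OF Y, of y] by metis
    have "rank_one v (z - (z - y)) \<in> U"
      unfolding rank_one_diff_right[of v z "z - y"]
      using z unfolding cone_le_iff[of y z] by (intro subspace_diff U pos_U)
    then show ?thesis by simp
  qed
  have W_le: "\<phi> (rank_one v y) \<le> norm v * L y" if "0 \<le> y" for v :: "'e dual" and y :: "'x dual dual"
    using \<phi>_le[OF rank_one_U, of v y] \<nu>_le[OF maj_rep_rank_one[OF that, of v]] by (simp add: blinfun.scaleR_right)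
  obtain W :: "'e dual \<Rightarrow>\<^sub>L 'x dual dual dual" where W: "\<And>v y. W v y = \<phi> (rank_one v y)"
  proof (rule positive_form_blinfun[OF Y, of "\<lambda>v y. \<phi> (rank_one v y)" "norm L"])
    show "\<phi> (rank_one v y) \<le> norm L * (norm v * norm y)" if "0 \<le> y" for v :: "'e dual" and y :: "'x dual dual"
    proof -
      have "norm v * L y \<le> norm v * (norm L * norm y)"
        using norm_blinfun[of L y] by (intro mult_left_mono) auto
      then show ?thesis using W_le[OF that, of v] by (simp add: mult.left_commute)
    qed
  next
    fix W' :: "'e dual \<Rightarrow>\<^sub>L 'x dual dual dual" assume "\<And>v y. W' v y = \<phi> (rank_one v y)"
    then show thesis by (rule that)
  qed (simp_all add: rank_one_add_left rank_one_add_right rank_one_scaleR_left rank_one_scaleR_right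
      \<phi>_add \<phi>_scale rank_one_U)
  have \<phi>_A: "\<phi> (A m) = (\<Sum>j<m. W (u j) (\<xi> j))" for m
  proof (induction m)
    case 0
    then show ?case using \<phi>_scale[OF rank_one_U, of 0 undefined undefined] by (simp add: A_def)
  next
    case (Suc m)
    have "\<phi> (A m + rank_one (u m) (\<xi> m)) = \<phi> (A m) + \<phi> (rank_one (u m) (\<xi> m))"
      by (rule \<phi>_add[OF in_U[OF A_rep] rank_one_U])
    then show ?case using Suc by (simp add: A_def W)
  qed
  have W0: "W v (bidual x) = 0" for v x
  proof -
    have pos: "W v (bidual x) = 0" if x: "0 \<le> x" for v and x :: 'x
    proof -
      have le: "W v (bidual x) \<le> 0" for v
      proof -
        have "(0 *\<^sub>R A N - (bidual o\<^sub>L rank_one v x), 0) \<in> G"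
          by (rule G_I[OF _ maj_rep_rank_one[OF x]]) auto
        from \<phi>_ge[OF this] have "0 \<le> \<phi> ((-1) *\<^sub>R rank_one v (bidual x))"
          by (simp add: blinfun_compose_rank_one del: bidual_apply)
        then show ?thesis unfolding \<phi>_scale[OF rank_one_U] W by simp
      qed
      show ?thesis using le[of v] le[of "- v"] by (simp add: blinfun.bilinear_simps)
    qed
    obtain z where z: "x \<le> z" "0 \<le> z" using regular_norm_modulus[OF X, of x] by metis
    have "0 \<le> z - x" using z(1) cone_le_iff[of x z] by simp
    from pos[OF this, of v] pos[OF z(2), of v] show ?thesis
      by (simp add: blinfun.diff_right del: bidual_apply)
  qed
  have lim: "(\<lambda>m. \<Sum>j<m. W (u j) (\<xi> j)) \<longlonglongrightarrow> 0"
    by (rule majorized_trace_tendsto_0[OF X r L W0 _ AP]) (unfold W, rule W_le)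
  have "\<epsilon> / 2 \<le> (\<Sum>j<m. W (u j) (\<xi> j))" if m: "N \<le> m" for m
  proof -
    have "bidual o\<^sub>L 0 = (0 :: 'e \<Rightarrow>\<^sub>L 'x dual dual)" by (rule blinfun_eqI) (simp add: blinfun.zero_right)
    then have "\<epsilon> \<le> \<phi> (A N)" using \<phi>_ge[OF G_I[OF _ maj_rep_0, of 1 \<epsilon>]] by simp
    moreover have "- L (\<xi> j) \<le> W (u j) (\<xi> j)" for j
    proof -
      have "W (- u j) (\<xi> j) \<le> norm (u j) * L (\<xi> j)" unfolding W using W_le[OF \<xi>, of "- u j"] by simp
      also have "\<dots> \<le> 1 * L (\<xi> j)" by (intro mult_right_mono inf_rep_seqD(1)[OF r] L\<xi>)
      finally show ?thesis by (simp add: blinfun.bilinear_simps)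
    qed
    then have "(\<Sum>i<m - N. - L (\<xi> (N + i))) \<le> (\<Sum>i<m - N. W (u (N + i)) (\<xi> (N + i)))" by (intro sum_mono)
    moreover have "(\<Sum>i<m - N. L (\<xi> (N + i))) \<le> \<epsilon> / 2" by (rule N0) (simp add: N_def)
    moreover have "(\<Sum>j<m. W (u j) (\<xi> j)) = \<phi> (A N) + (\<Sum>i<m - N. W (u (N + i)) (\<xi> (N + i)))"
      unfolding \<phi>_A using sum_lessThan_add[of "\<lambda>j. W (u j) (\<xi> j)" N "m - N"] m by simp
    ultimately show ?thesis by (simp add: sum_negf)
  qed
  then have "\<epsilon> / 2 \<le> 0" by (intro LIMSEQ_le_const[OF lim]) blast
  then show False using \<epsilon> by simp
qed

section \<open>One step of the descent for the infinite exponent\<close>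

lemma hahn_banach_pair:
  fixes F :: "('a::real_normed_vector \<times> 'b::real_normed_vector) set"
  assumes F: "convex F" "F \<noteq> {}" and c: "\<And>a d. (a, d) \<in> F \<Longrightarrow> c \<le> norm a + K * norm d" and K: "0 \<le> K"
  obtains G :: "'a dual" and H :: "'b dual" where "norm G \<le> 1" "\<And>a d. (a, d) \<in> F \<Longrightarrow> c \<le> G a + H d"
proof -
  define p where "p v = norm (fst v) + K * norm (snd v)" for v :: "'a \<times> 'b"
  have p: "sublinear_on UNIV p"
  proof (rule sublinear_onI[OF subspace_UNIV])
    fix v w :: "'a \<times> 'b"
    have "K * norm (snd v + snd w) \<le> K * (norm (snd v) + norm (snd w))"
      by (intro mult_left_mono norm_triangle_ineq K)
    then show "p (v + w) \<le> p v + p w"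
      using norm_triangle_ineq[of "fst v" "fst w"] by (simp add: p_def distrib_left)
  qed (simp_all add: p_def algebra_simps)
  define C where "C = {(t *\<^sub>R v, b) | t v b. 0 \<le> t \<and> v \<in> F \<and> b \<le> t * c}"
  have C_I: "(t *\<^sub>R v, b) \<in> C" if "0 \<le> t" "v \<in> F" "b \<le> t * c" for t v b
    unfolding C_def using that by blast
  have cone: "convex_cone_set C"
    unfolding convex_cone_set_def
  proof (intro conjI ballI allI impI)
    obtain v where "v \<in> F" using F(2) by blast
    then show "0 \<in> C" using C_I[OF order_refl, of v 0] by (simp add: zero_prod_def)
  next
    fix g h assume "g \<in> C" "h \<in> C"
    then obtain s v b t w b' where
      1: "0 \<le> s" "v \<in> F" "b \<le> s * c" "g = (s *\<^sub>R v, b)" and 2: "0 \<le> t" "w \<in> F" "b' \<le> t * c" "h = (t *\<^sub>R w, b')"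
      unfolding C_def by blast
    show "g + h \<in> C"
    proof (cases "s + t = 0")
      case True
      then have "s = 0" "t = 0" using 1 2 by auto
      then show ?thesis using C_I[OF order_refl 1(2), of "b + b'"] 1 2 by simp
    next
      case False
      define q where "q = (s / (s + t)) *\<^sub>R v + (t / (s + t)) *\<^sub>R w"
      have "q \<in> F" unfolding q_def using 1 2 False by (intro convexD[OF F(1)]) (auto simp flip: add_divide_distrib)
      moreover have "(s + t) *\<^sub>R q = s *\<^sub>R v + t *\<^sub>R w" using False by (simp add: q_def scaleR_add_right)
      ultimately show ?thesis using C_I[of "s + t" q "b + b'"] 1 2 by (simp add: distrib_right)
    qed
  next
    fix g and r :: real assume "g \<in> C" and r: "0 < r"
    then obtain s v b where "0 \<le> s" "v \<in> F" "b \<le> s * c" "g = (s *\<^sub>R v, b)" unfolding C_def by blast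
    then show "r *\<^sub>R g \<in> C" using C_I[of "r * s" v "r * b"] r by (simp add: mult.assoc)
  qed
  have bound: "v \<in> UNIV \<and> b \<le> p v" if vb: "(v, b) \<in> C" for v b
  proof -
    obtain t w where t: "v = t *\<^sub>R w" "0 \<le> t" "w \<in> F" "b \<le> t * c" using vb unfolding C_def by blast
    have "t * c \<le> t * p w" using c[of "fst w" "snd w"] t by (intro mult_left_mono) (auto simp: p_def)
    also have "\<dots> = p v" using t(1,2) by (simp add: p_def distrib_left)
    finally show ?thesis using t(4) by simp
  qed
  obtain \<phi> where \<phi>_le: "\<And>v. v \<in> UNIV \<Longrightarrow> \<phi> v \<le> p v"
    and \<phi>_add: "\<And>v w. v \<in> UNIV \<Longrightarrow> w \<in> UNIV \<Longrightarrow> \<phi> (v + w) = \<phi> v + \<phi> w"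
    and \<phi>_scale: "\<And>v r. v \<in> UNIV \<Longrightarrow> \<phi> (r *\<^sub>R v) = r * \<phi> v"
    and \<phi>_ge: "\<And>v b. (v, b) \<in> C \<Longrightarrow> b \<le> \<phi> v"
    by (rule hahn_banach_cone[OF subspace_UNIV p cone bound], assumption, rule that)
  have abs: "\<bar>\<phi> v\<bar> \<le> p v" for v
    using \<phi>_le[of v] \<phi>_le[of "- v"] \<phi>_scale[of v "-1"] by (auto simp: p_def abs_le_iff)
  have "bounded_linear (\<lambda>a. \<phi> (a, 0))"
  proof (rule bounded_linear_intro[of _ 1])
    show "norm (\<phi> (a, 0)) \<le> norm a * 1" for a using abs[of "(a, 0)"] by (simp add: p_def)
  qed (use \<phi>_add[of "(_, 0)" "(_, 0)"] \<phi>_scale[of "(_, 0)"] in simp_all)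
  then have G: "Blinfun (\<lambda>a. \<phi> (a, 0)) a = \<phi> (a, 0)" for a by (simp add: bounded_linear_Blinfun_apply)
  have "bounded_linear (\<lambda>d. \<phi> (0, d))"
  proof (rule bounded_linear_intro[of _ K])
    show "norm (\<phi> (0, d)) \<le> norm d * K" for d using abs[of "(0, d)"] by (simp add: p_def mult.commute)
  qed (use \<phi>_add[of "(0, _)" "(0, _)"] \<phi>_scale[of "(0, _)"] in simp_all)
  then have H: "Blinfun (\<lambda>d. \<phi> (0, d)) d = \<phi> (0, d)" for d by (simp add: bounded_linear_Blinfun_apply)
  show thesis
  proof (rule that)
    show "norm (Blinfun (\<lambda>a. \<phi> (a, 0))) \<le> 1"
    proof (rule norm_blinfun_bound)
      show "norm (Blinfun (\<lambda>a. \<phi> (a, 0)) a) \<le> 1 * norm a" for a using abs[of "(a, 0)"] by (simp add: G p_def)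
    qed simp
    show "c \<le> Blinfun (\<lambda>a. \<phi> (a, 0)) a + Blinfun (\<lambda>d. \<phi> (0, d)) d" if "(a, d) \<in> F" for a d
      using \<phi>_ge[OF C_I[of 1 "(a, d)" c]] that \<phi>_add[of "(a, 0)" "(0, d)"] by (simp add: G H)
  qed
qed

lemma nonneg_of_linear_growth:
  fixes b c x :: real
  assumes "\<And>n :: nat. b \<le> c + real n * x"
  shows "0 \<le> x"
proof (rule ccontr)
  assume "\<not> ?thesis"
  then have x: "0 < - x" by simp
  obtain n :: nat where "(c - b) / (- x) < real n" using reals_Archimedean2 by blast
  then have "c - b < real n * (- x)" using x by (simp only: pos_divide_less_eq)
  then show False using assms[of n] by simp
qed

text \<open>
  The functional \<open>G\<close> separates the possible remaining majorants from a ball, and \<open>H\<close> penalises a defect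
  \<open>d\<close> of the approximation of a partial sum by an operator into \<open>X\<close>. Slack in the majorants makes
  \<open>G\<close> and \<open>G + H\<close> positive. As \<open>d\<close> enters the final estimate only through \<open>L d\<close> with
  \<open>L = G + (G + H)\<close>, it suffices to make \<open>L d\<close> small.
\<close>

lemma inf_rep_step:
  fixes S :: "'e::real_normed_vector \<Rightarrow>\<^sub>L 'x::banach_lattice"
  assumes rep: "inf_rep (bidual o\<^sub>L S) \<zeta>" and C: "norm (bidual z + \<zeta>) \<le> C" and \<epsilon>: "0 < \<epsilon>" and \<delta>: "0 < \<delta>"
    and AP: "approximation_property TYPE('e dual) \<or>
      positive_metric_approximation_property TYPE('x dual dual dual dual)"
  shows "\<exists>B y \<zeta>'. maj_rep B y \<and> inf_rep (bidual o\<^sub>L (S - B)) \<zeta>' \<and>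
    norm (bidual (z + y) + \<zeta>') \<le> C + \<epsilon> \<and> norm (S - B) \<le> \<delta>"
proof (rule ccontr)
  assume neg: "\<not> ?thesis"
  have X: "regular_norm TYPE('x)" by (rule regular_norm_banach_lattice)
  have Y: "regular_norm TYPE('x dual dual)" by (intro regular_norm_dual X)
  obtain u \<xi> where r: "inf_rep_seq (bidual o\<^sub>L S) \<zeta> u \<xi>" using rep unfolding inf_rep_def by blast
  define A where "A m = (\<Sum>j<m. rank_one (u j) (\<xi> j))" for m
  have A_rep: "maj_rep (A m) (\<Sum>j<m. \<xi> j)" for m
    unfolding A_def by (rule maj_repI[of m u \<xi>]) (simp_all add: inf_rep_seqD(1,2)[OF r])
  \<comment> \<open>The operator is split into a finite representation in X, a finite defect
    \<open>D\<close> in the bidual and a remainder series \<open>T\<close> of small norm. Here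
    \<open>a\<close> collects the majorants of all three parts, and \<open>d\<close> is also kept
    apart because its norm has to be controlled.\<close>
  define good where "good a d \<longleftrightarrow> (\<exists>B y D T \<zeta>'. maj_rep B y \<and> maj_rep D d \<and> inf_rep T \<zeta>' \<and> norm T \<le> \<delta> / 2 \<and>
    (bidual o\<^sub>L B) + D + T = (bidual o\<^sub>L S) \<and> a = bidual y + \<zeta>' + d)" for a d
  have goodI: "good (bidual y + \<zeta>' + d) d"
    if "maj_rep B y" "maj_rep D d" "inf_rep T \<zeta>'" "norm T \<le> \<delta> / 2" "(bidual o\<^sub>L B) + D + T = (bidual o\<^sub>L S)"
    for B y D d T \<zeta>' unfolding good_def using that by blast
  have "A \<longlonglongrightarrow> (bidual o\<^sub>L S)" using inf_rep_seqD(4)[OF r] unfolding sums_def A_def .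
  then obtain m0 where m0: "\<And>m. m0 \<le> m \<Longrightarrow> norm (A m - (bidual o\<^sub>L S)) < \<delta> / 2"
    using LIMSEQ_D[of A "bidual o\<^sub>L S" "\<delta> / 2"] \<delta> by auto
  have good_m: "good (bidual y + (\<zeta> - (\<Sum>j<m. \<xi> j)) + d) d"
    if m: "m0 \<le> m" and B: "maj_rep B y" and D: "maj_rep (A m - (bidual o\<^sub>L B)) d" for m B y d
  proof (rule goodI[OF B D])
    show "inf_rep ((bidual o\<^sub>L S) - A m) (\<zeta> - (\<Sum>j<m. \<xi> j))" unfolding A_def by (rule inf_rep_tail[OF r])
    show "norm ((bidual o\<^sub>L S) - A m) \<le> \<delta> / 2" using m0[OF m] by (simp add: norm_minus_commute)
  qed simp
  have JO: "bidual o\<^sub>L 0 = (0 :: 'e \<Rightarrow>\<^sub>L 'x dual dual)" by (rule blinfun_eqI) (simp add: blinfun.zero_right)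
  have ex_good: "\<exists>a d. good a d"
    using good_m[OF order_refl maj_rep_0, of "\<Sum>j<m0. \<xi> j"] A_rep[of m0] unfolding JO diff_zero by blast
  \<comment> \<open>A defect with \<open>norm d\<close> above \<open>\<delta> / 2\<close> makes the
    penalty alone at least \<open>C + \<epsilon>\<close>; with a smaller defect, \<open>B\<close>
    would be the step that is assumed not to exist unless the inequality holds.\<close>
  define K where "K = (C + \<epsilon>) / (\<delta> / 2)"
  have C0: "0 \<le> C" using C norm_ge_zero order_trans by blast
  have K: "0 \<le> K" using C0 \<epsilon> \<delta> by (simp add: K_def)
  have far: "C + \<epsilon> \<le> norm (bidual z + a) + K * norm d" if ad: "good a d" for a d
  proof (cases "norm d \<le> \<delta> / 2")
    case True
    obtain B y D T \<zeta>' where 1: "maj_rep B y" "maj_rep D d" "inf_rep T \<zeta>'" "norm T \<le> \<delta> / 2"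
      "(bidual o\<^sub>L B) + D + T = (bidual o\<^sub>L S)" "a = bidual y + \<zeta>' + d"
      using ad unfolding good_def by blast
    have eq: "(bidual o\<^sub>L (S - B)) = D + T" using 1(5) by (simp add: blinfun_compose_simps algebra_simps)
    have "norm (S - B) = norm (D + T)" unfolding eq[symmetric] by simp
    also have "\<dots> \<le> norm D + norm T" by (rule norm_triangle_ineq)
    also have "\<dots> \<le> \<delta>" using maj_rep_norm[OF Y 1(2)] True 1(4) by simp
    finally have "norm (S - B) \<le> \<delta>" .
    moreover have "inf_rep (bidual o\<^sub>L (S - B)) (d + \<zeta>')"
      unfolding eq by (intro inf_rep_add maj_rep_imp_inf_rep 1)
    ultimately have "\<not> norm (bidual (z + y) + (d + \<zeta>')) \<le> C + \<epsilon>" using neg 1(1) by blast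
    then have "C + \<epsilon> \<le> norm (bidual z + a)" by (simp add: 1(6) blinfun.add_right algebra_simps)
    then show ?thesis using K by (simp add: add_increasing2)
  next
    case False
    have "C + \<epsilon> = K * (\<delta> / 2)" using \<delta> by (simp add: K_def)
    also have "\<dots> \<le> K * norm d" using False K by (intro mult_left_mono) auto
    finally show ?thesis by (simp add: add_increasing)
  qed
  define F where "F = {(bidual z + a, d) | a d. good a d}"
  have F_I: "(bidual z + a, d) \<in> F" if "good a d" for a d using that unfolding F_def by blast
  have "convex F"
    unfolding convex_def
  proof (intro ballI allI impI)
    fix v w and s t :: real assume "v \<in> F" "w \<in> F" and st: "0 \<le> s" "0 \<le> t" "s + t = 1"
    then obtain a d a' d' where v: "v = (bidual z + a, d)" "good a d" and w: "w = (bidual z + a', d')" "good a' d'"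
      unfolding F_def by blast
    obtain B y D T \<zeta>1 where 1: "maj_rep B y" "maj_rep D d" "inf_rep T \<zeta>1" "norm T \<le> \<delta> / 2"
      "(bidual o\<^sub>L B) + D + T = (bidual o\<^sub>L S)" "a = bidual y + \<zeta>1 + d"
      using v(2) unfolding good_def by blast
    obtain B' y' D' T' \<zeta>2 where 2: "maj_rep B' y'" "maj_rep D' d'" "inf_rep T' \<zeta>2" "norm T' \<le> \<delta> / 2"
      "(bidual o\<^sub>L B') + D' + T' = (bidual o\<^sub>L S)" "a' = bidual y' + \<zeta>2 + d'"
      using w(2) unfolding good_def by blast
    have "good (bidual (s *\<^sub>R y + t *\<^sub>R y') + (s *\<^sub>R \<zeta>1 + t *\<^sub>R \<zeta>2) + (s *\<^sub>R d + t *\<^sub>R d')) (s *\<^sub>R d + t *\<^sub>R d')"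
    proof (rule goodI)
      show "maj_rep (s *\<^sub>R B + t *\<^sub>R B') (s *\<^sub>R y + t *\<^sub>R y')" by (intro maj_rep_add maj_rep_scaleR 1 2 st)
      show "maj_rep (s *\<^sub>R D + t *\<^sub>R D') (s *\<^sub>R d + t *\<^sub>R d')" by (intro maj_rep_add maj_rep_scaleR 1 2 st)
      show "inf_rep (s *\<^sub>R T + t *\<^sub>R T') (s *\<^sub>R \<zeta>1 + t *\<^sub>R \<zeta>2)" by (intro inf_rep_add inf_rep_scaleR 1 2 st)
      have "norm (s *\<^sub>R T + t *\<^sub>R T') \<le> s * norm T + t * norm T'"
        using norm_triangle_ineq[of "s *\<^sub>R T" "t *\<^sub>R T'"] st by simp
      also have "\<dots> \<le> s * (\<delta> / 2) + t * (\<delta> / 2)" by (intro add_mono mult_left_mono 1 2 st)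
      also have "\<dots> = \<delta> / 2" using st(3) by (simp flip: distrib_right)
      finally show "norm (s *\<^sub>R T + t *\<^sub>R T') \<le> \<delta> / 2" .
      have "(bidual o\<^sub>L (s *\<^sub>R B + t *\<^sub>R B')) + (s *\<^sub>R D + t *\<^sub>R D') + (s *\<^sub>R T + t *\<^sub>R T') =
          s *\<^sub>R ((bidual o\<^sub>L B) + D + T) + t *\<^sub>R ((bidual o\<^sub>L B') + D' + T')"
        by (simp add: blinfun_compose_simps scaleR_add_right)
      also have "\<dots> = (bidual o\<^sub>L S)" unfolding 1(5) 2(5) using st(3) by (simp flip: scaleR_add_left)
      finally show "(bidual o\<^sub>L (s *\<^sub>R B + t *\<^sub>R B')) + (s *\<^sub>R D + t *\<^sub>R D') + (s *\<^sub>R T + t *\<^sub>R T') = (bidual o\<^sub>L S)" .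
    qed
    then have mem: "(bidual z + (bidual (s *\<^sub>R y + t *\<^sub>R y') + (s *\<^sub>R \<zeta>1 + t *\<^sub>R \<zeta>2) + (s *\<^sub>R d + t *\<^sub>R d')), s *\<^sub>R d + t *\<^sub>R d') \<in> F"
      by (rule F_I)
    have "bidual z = s *\<^sub>R bidual z + t *\<^sub>R bidual z" using st(3) by (simp flip: scaleR_add_left)
    then have "s *\<^sub>R (bidual z + a) + t *\<^sub>R (bidual z + a') =
        bidual z + (bidual (s *\<^sub>R y + t *\<^sub>R y') + (s *\<^sub>R \<zeta>1 + t *\<^sub>R \<zeta>2) + (s *\<^sub>R d + t *\<^sub>R d'))"
      unfolding 1(6) 2(6) by (simp add: scaleR_add_right blinfun.add_right blinfun.scaleR_right del: bidual_apply)
    then show "s *\<^sub>R v + t *\<^sub>R w \<in> F" using mem by (simp add: v w)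
  qed
  moreover have "F \<noteq> {}" using ex_good F_I by blast
  moreover have "C + \<epsilon> \<le> norm a + K * norm d" if "(a, d) \<in> F" for a d using that far unfolding F_def by blast
  ultimately obtain G :: "'x dual dual dual" and H :: "'x dual dual dual" where G: "norm G \<le> 1" and GH: "\<And>a d. (a, d) \<in> F \<Longrightarrow> C + \<epsilon> \<le> G a + H d"
    using hahn_banach_pair[OF _ _ _ K, of F "C + \<epsilon>"] by blast
  have GH: "C + \<epsilon> \<le> G (bidual z) + G a + H d" if "good a d" for a d
    using GH[OF F_I[OF that]] by (simp add: blinfun.add_right)
  obtain a0 d0 where g0: "good a0 d0" using ex_good by blast
  obtain B0 y0 D0 T0 \<zeta>0 where 0: "maj_rep B0 y0" "maj_rep D0 d0" "inf_rep T0 \<zeta>0" "norm T0 \<le> \<delta> / 2"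
      "(bidual o\<^sub>L B0) + D0 + T0 = (bidual o\<^sub>L S)" "a0 = bidual y0 + \<zeta>0 + d0"
    using g0 unfolding good_def by blast
  have slack: "w \<le> w + w'" if "0 \<le> w'" for w w' :: "'x dual dual" using that cone_le_iff[of w "w + w'"] by simp
  \<comment> \<open>Adding multiples of \<open>w\<close> to the majorant of the remainder changes
    \<open>a\<close> alone. Adding them to \<open>d\<close> changes both components, hence the
    functional \<open>G + H\<close> in the next claim.\<close>
  have G_pos: "0 \<le> G"
    unfolding blinfun_nonneg_iff[of G]
  proof (intro allI impI nonneg_of_linear_growth)
    fix w :: "'x dual dual" and n :: nat assume w: "0 \<le> w"
    have "inf_rep T0 (\<zeta>0 + real n *\<^sub>R w)" by (rule inf_rep_mono[OF 0(3)]) (intro slack cone_scaleR w, simp)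
    from GH[OF goodI[OF 0(1,2) this 0(4,5)]]
    show "C + \<epsilon> \<le> (G (bidual z) + G a0 + H d0) + real n * G w"
      by (simp add: 0(6) blinfun.add_right blinfun.scaleR_right del: bidual_apply)
  qed
  have GH_pos: "0 \<le> G + H"
    unfolding blinfun_nonneg_iff[of "G + H"]
  proof (intro allI impI nonneg_of_linear_growth)
    fix w :: "'x dual dual" and n :: nat assume w: "0 \<le> w"
    have "maj_rep D0 (d0 + real n *\<^sub>R w)" by (rule maj_rep_mono[OF 0(2)]) (intro slack cone_scaleR w, simp)
    from GH[OF goodI[OF 0(1) this 0(3,4,5)]]
    show "C + \<epsilon> \<le> (G (bidual z) + G a0 + H d0) + real n * (G + H) w"
      by (simp add: 0(6) blinfun.bilinear_simps distrib_left del: bidual_apply)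
  qed
  define L where "L = G + (G + H)"
  have L: "0 \<le> L" unfolding L_def by (intro cone_add G_pos GH_pos)
  obtain m B y1 d where m: "m0 \<le> m" and B: "maj_rep B y1" and D: "maj_rep (A m - (bidual o\<^sub>L B)) d"
    and Ld: "L d \<le> \<epsilon> / 4"
    using maj_rep_absorb[OF X r L _ AP, of "\<epsilon> / 4" m0] \<epsilon> unfolding A_def by auto
  \<comment> \<open>The partial sum contributes \<open>\<Sum>j<m. \<xi> j\<close> and the defect
    contributes \<open>d\<close> to a bound for the image of the unit ball under
    \<open>bidual o\<^sub>L B\<close>. By \<open>maj_rep_of_bidual_bound\<close> the uncontrolled
    majorant \<open>y1\<close> can then be exchanged for one that is hardly above
    \<open>w\<close>.\<close>
  define w where "w = d + (\<Sum>j<m. \<xi> j)"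
  have "bidual (B e) \<le> w" if e: "norm e \<le> 1" for e
  proof -
    have "(- (A m - (bidual o\<^sub>L B))) e \<le> d" by (rule maj_rep_apply_le[OF maj_rep_uminus[OF D] e])
    from cone_add_mono[OF this maj_rep_apply_le[OF A_rep e, of m]] show ?thesis
      by (simp add: w_def blinfun.bilinear_simps del: bidual_apply)
  qed
  define \<rho> where "\<rho> = \<epsilon> / (4 * (norm y1 + 1))"
  have y1: "0 < norm y1 + 1" by (simp add: add_nonneg_pos)
  have \<rho>: "0 < \<rho>" "\<rho> * norm y1 \<le> \<epsilon> / 4"
  proof -
    have "\<rho> * norm y1 = (\<epsilon> / 4) * (norm y1 / (norm y1 + 1))" by (simp add: \<rho>_def)
    also have "\<dots> \<le> (\<epsilon> / 4) * 1" using \<epsilon> y1 by (intro mult_left_mono) (auto simp: pos_divide_le_eq)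
    finally show "\<rho> * norm y1 \<le> \<epsilon> / 4" by simp
    show "0 < \<rho>" using \<epsilon> y1 by (simp add: \<rho>_def)
  qed
  obtain y where y: "maj_rep B y" "bidual y \<le> w + \<rho> *\<^sub>R bidual y1"
    using maj_rep_of_bidual_bound[OF B \<open>\<And>e. norm e \<le> 1 \<Longrightarrow> bidual (B e) \<le> w\<close> \<rho>(1)] by blast
  have "G (bidual y) \<le> G (w + \<rho> *\<^sub>R bidual y1)" by (rule dual_nonneg_mono[OF G_pos y(2)])
  also have "\<dots> = G d + G (\<Sum>j<m. \<xi> j) + \<rho> * G (bidual y1)"
    by (simp add: w_def blinfun.add_right blinfun.scaleR_right del: bidual_apply)
  also have "\<rho> * G (bidual y1) \<le> \<rho> * norm y1"
    using blinfun_le_norm[OF G, of "bidual y1"] \<rho>(1) by (intro mult_left_mono) auto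
  finally have Gy: "G (bidual y) \<le> G d + G (\<Sum>j<m. \<xi> j) + \<epsilon> / 4" using \<rho>(2) by simp
  \<comment> \<open>The majorant of \<open>B\<close> is paid for by the sum of the \<xi>_j removed
    from \<open>\<zeta>\<close>, up to \<open>G d + \<epsilon> / 4\<close>. Together with
    \<open>G d + H d\<close> from the separation the defect contributes exactly
    \<open>L d\<close>.\<close>
  have "C + \<epsilon> \<le> G (bidual z) + G (bidual y + (\<zeta> - (\<Sum>j<m. \<xi> j)) + d) + H d"
    by (rule GH[OF good_m[OF m y(1) D]])
  also have "\<dots> = (G (bidual z) + G \<zeta>) + (G (bidual y) - G (\<Sum>j<m. \<xi> j)) + (G d + H d)"
    by (simp add: blinfun.bilinear_simps del: bidual_apply)
  also have "\<dots> \<le> C + (G d + \<epsilon> / 4) + (G d + H d)"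
  proof -
    have "G (bidual z) + G \<zeta> \<le> C"
      using blinfun_le_norm[OF G, of "bidual z + \<zeta>"] C by (simp add: blinfun.add_right)
    then show ?thesis using Gy by simp
  qed
  also have "\<dots> = C + \<epsilon> / 4 + L d" by (simp add: L_def blinfun.add_left)
  also have "\<dots> \<le> C + \<epsilon> / 4 + \<epsilon> / 4" using Ld by simp
  finally show False using \<epsilon> by simp
qed

section \<open>Assembling the blocks for the infinite exponent\<close>

lemma sum_mod:
  fixes F :: "nat \<Rightarrow> 'a::real_vector"
  assumes "0 < n"
  shows "(\<Sum>i<m. F (i mod n)) = real (m div n) *\<^sub>R (\<Sum>i<n. F i) + (\<Sum>i<m mod n. F i)"
proof (induction m)
  case (Suc m)
  show ?case
  proof (cases "Suc (m mod n) = n")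
    case True
    have "(\<Sum>i<n. F i) = (\<Sum>i<m mod n. F i) + F (m mod n)" by (subst True[symmetric]) simp
    then show ?thesis using Suc True by (simp add: mod_Suc div_Suc scaleR_add_left add.assoc)
  next
    case False
    then show ?thesis using Suc by (simp add: mod_Suc div_Suc add.assoc)
  qed
qed simp

text \<open>Partial sums of a representation may be much larger than \<open>B\<close> itself.
  Running through it \<open>N\<close> times with weight \<open>1 / N\<close> leaves \<open>B\<close>
  and \<open>y\<close> unchanged, while every partial sum is a multiple of \<open>B\<close> by a
  factor of at most 1 plus \<open>1 / N\<close> times a partial sum bounded by
  \<open>norm y\<close>.\<close>

lemma maj_rep_fine:
  fixes y :: "'y::cone_space" and B :: "'e::real_normed_vector \<Rightarrow>\<^sub>L 'y"
  assumes Y: "regular_norm TYPE('y)" and B: "maj_rep B y" and \<rho>: "0 < \<rho>"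
  obtains n :: nat and v x where "0 < n" "\<And>i. norm (v i) \<le> 1" "\<And>i. 0 \<le> x i"
    "B = (\<Sum>i<n. rank_one (v i) (x i))" "y = (\<Sum>i<n. x i)"
    "\<And>m. m \<le> n \<Longrightarrow> norm (\<Sum>i<m. rank_one (v i) (x i)) \<le> norm B + \<rho>"
proof -
  obtain k :: nat and v0 x0 where 1: "\<And>i. i < k \<Longrightarrow> norm (v0 i) \<le> 1" "\<And>i. i < k \<Longrightarrow> 0 \<le> x0 i"
    "B = (\<Sum>i<k. rank_one (v0 i) (x0 i))" "y = (\<Sum>i<k. x0 i)" by (rule maj_repE[OF B], rule that)
  define n where "n = Suc k"
  define v where "v i = (if i < k then v0 i else 0)" for i
  define x where "x i = (if i < k then x0 i else 0)" for i
  have v: "norm (v i) \<le> 1" and x: "0 \<le> x i" for i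
    using 1(1,2) cone_zero[where 'a = 'y] by (simp_all add: v_def x_def)
  have B_eq: "B = (\<Sum>i<n. rank_one (v i) (x i))" and y_eq: "y = (\<Sum>i<n. x i)"
    unfolding 1(3,4) n_def by (auto simp: v_def x_def intro: sum.cong)
  obtain N :: nat where "norm y / \<rho> < real N" using reals_Archimedean2 by blast
  then have N: "0 < real N" "norm y / real N \<le> \<rho>"
    using \<rho> by (smt (verit) divide_nonneg_pos norm_ge_zero, smt (verit) divide_nonneg_pos norm_ge_zero pos_divide_less_eq pos_divide_le_eq mult.commute)
  let ?v = "\<lambda>i. v (i mod n)" and ?x = "\<lambda>i. (1 / real N) *\<^sub>R x (i mod n)"
  have n: "0 < n" by (simp add: n_def)
  have op: "(\<Sum>i<m. rank_one (?v i) (?x i)) = (real (m div n) / real N) *\<^sub>R B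
      + (1 / real N) *\<^sub>R (\<Sum>i<m mod n. rank_one (v i) (x i))" for m
    using sum_mod[OF n, of "\<lambda>i. (1 / real N) *\<^sub>R rank_one (v i) (x i)" m]
    unfolding B_eq by (simp add: rank_one_scaleR_right flip: scaleR_sum_right)
  show thesis
  proof (rule that[of "n * N" ?v ?x])
    show "0 < n * N" using n N(1) by simp
    show "norm (?v i) \<le> 1" for i by (rule v)
    show "0 \<le> ?x i" for i by (intro cone_scaleR x) simp
    show "B = (\<Sum>i<n * N. rank_one (?v i) (?x i))" unfolding op using n N(1) by simp
    show "y = (\<Sum>i<n * N. ?x i)"
      using sum_mod[OF n, of "\<lambda>i. (1 / real N) *\<^sub>R x i" "n * N"] n N(1)
      unfolding y_eq by (simp flip: scaleR_sum_right)
    show "norm (\<Sum>i<m. rank_one (?v i) (?x i)) \<le> norm B + \<rho>" if m: "m \<le> n * N" for m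
    proof -
      have "m div n \<le> N" using div_le_mono[OF m, of n] n by simp
      then have "real (m div n) / real N \<le> 1" using N(1) by simp
      then have b1: "norm ((real (m div n) / real N) *\<^sub>R B) \<le> norm B"
        using mult_right_mono[of "real (m div n) / real N" 1 "norm B"] by simp
      have "maj_rep (\<Sum>i<m mod n. rank_one (v i) (x i)) (\<Sum>i<m mod n. x i)"
        by (rule maj_repI[OF v x refl refl])
      then have "norm (\<Sum>i<m mod n. rank_one (v i) (x i)) \<le> norm (\<Sum>i<m mod n. x i)"
        by (rule maj_rep_norm[OF Y])
      also have "\<dots> \<le> norm y"
        unfolding y_eq using n by (intro regular_norm_mono[OF Y] cone_sum cone_sum_mono2 x) (auto simp: less_imp_le)
      finally have "norm ((1 / real N) *\<^sub>R (\<Sum>i<m mod n. rank_one (v i) (x i))) \<le> norm y / real N"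
        using N(1) by (simp add: divide_right_mono)
      with b1 show ?thesis unfolding op using N(2) norm_triangle_ineq by (smt (verit))
    qed
  qed
qed

lemma inf_rep_descend:
  fixes S :: "'e::real_normed_vector \<Rightarrow>\<^sub>L 'x::banach_lattice"
  assumes rep: "inf_rep (bidual o\<^sub>L S) \<zeta>" and C: "norm \<zeta> \<le> C" and \<eta>: "0 < \<eta>"
    and AP: "approximation_property TYPE('e dual) \<or>
      positive_metric_approximation_property TYPE('x dual dual dual dual)"
  shows "\<exists>v x. (\<forall>j. norm (v j) \<le> 1) \<and> (\<forall>j. 0 \<le> x j) \<and> (\<forall>m. norm (\<Sum>j<m. x j) \<le> C + \<eta>) \<and>
    (\<lambda>j. rank_one (v j) (x j)) sums S"
proof -
  have X: "regular_norm TYPE('x)" by (rule regular_norm_banach_lattice)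
  have Y: "regular_norm TYPE('x dual dual)" by (intro regular_norm_dual X)
  \<comment> \<open>A state consists of the remaining operator and the majorant in X accumulated so
    far. The norm bound is for the accumulated and the remaining majorant added as vectors, since
    norms of the majorants of single blocks need not be summable.\<close>
  define inv where "inv n s \<longleftrightarrow> (\<exists>\<zeta>. inf_rep (bidual o\<^sub>L fst s) \<zeta> \<and>
      norm (bidual (snd s) + \<zeta>) \<le> C + \<eta> * (1 - (1/2) ^ n)) \<and>
      0 \<le> snd s \<and> (if n = 0 then s = (S, 0) else norm (fst s) \<le> (1/2) ^ n)"
    for n :: nat and s :: "('e \<Rightarrow>\<^sub>L 'x) \<times> 'x"
  have "\<exists>f. \<forall>n. inv n (f n) \<and> maj_rep (fst (f n) - fst (f (Suc n))) (snd (f (Suc n)) - snd (f n))"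
  proof (rule dependent_nat_choice)
    have "bidual (0 :: 'x) = 0" by (rule blinfun.zero_right)
    then have "inv 0 (S, 0)" using rep C by (auto simp: inv_def)
    then show "\<exists>s. inv 0 s" by blast
  next
    fix s :: "('e \<Rightarrow>\<^sub>L 'x) \<times> 'x" and n :: nat assume s: "inv n s"
    then obtain \<zeta> where \<zeta>: "inf_rep (bidual o\<^sub>L fst s) \<zeta>" "norm (bidual (snd s) + \<zeta>) \<le> C + \<eta> * (1 - (1/2) ^ n)"
      unfolding inv_def by blast
    obtain B y \<zeta>' where B: "maj_rep B y" "inf_rep (bidual o\<^sub>L (fst s - B)) \<zeta>'"
      "norm (bidual (snd s + y) + \<zeta>') \<le> C + \<eta> * (1 - (1/2) ^ n) + \<eta> * (1/2) ^ Suc n" "norm (fst s - B) \<le> (1/2) ^ Suc n"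
      using inf_rep_step[OF \<zeta> _ _ AP, of "\<eta> * (1/2) ^ Suc n" "(1/2) ^ Suc n"] \<eta> by auto
    have "C + \<eta> * (1 - (1/2) ^ n) + \<eta> * (1/2) ^ Suc n = C + \<eta> * (1 - (1/2) ^ Suc n)" by (simp add: algebra_simps)
    moreover have "0 \<le> snd s + y" using s maj_rep_nonneg[OF B(1)] by (simp add: inv_def)
    ultimately have "inv (Suc n) (fst s - B, snd s + y)"
      using B unfolding inv_def fst_conv snd_conv by auto
    moreover have "maj_rep (fst s - fst (fst s - B, snd s + y)) (snd (fst s - B, snd s + y) - snd s)" using B(1) by simp
    ultimately show "\<exists>s'. inv (Suc n) s' \<and> maj_rep (fst s - fst s') (snd s' - snd s)" by blast
  qed
  then obtain f where f: "\<And>n. inv n (f n)"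
    "\<And>n. maj_rep (fst (f n) - fst (f (Suc n))) (snd (f (Suc n)) - snd (f n))" by blast
  define T where "T n = fst (f n)" for n
  define z where "z n = snd (f n)" for n
  have T0: "T 0 = S" "z 0 = 0" using f(1)[of 0] by (simp_all add: inv_def T_def z_def)
  have maj: "maj_rep (T n - T (Suc n)) (z (Suc n) - z n)" for n unfolding T_def z_def by (rule f(2))
  have z_norm: "norm (z n) \<le> C + \<eta>" for n
  proof -
    obtain \<zeta> where \<zeta>: "inf_rep (bidual o\<^sub>L T n) \<zeta>" "norm (bidual (z n) + \<zeta>) \<le> C + \<eta> * (1 - (1/2) ^ n)" "0 \<le> z n"
      using f(1)[of n] unfolding inv_def T_def z_def by blast
    have "norm (bidual (z n)) \<le> norm (bidual (z n) + \<zeta>)"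
    proof (rule regular_norm_mono[OF Y bidual_nonneg[OF \<zeta>(3)]])
      show "bidual (z n) \<le> bidual (z n) + \<zeta>"
        using inf_rep_nonneg[OF \<zeta>(1)] cone_le_iff[of "bidual (z n)" "bidual (z n) + \<zeta>"] by simp
    qed
    moreover have "\<eta> * (1 - (1/2) ^ n) \<le> \<eta> * 1" using \<eta> by (intro mult_left_mono) auto
    ultimately show ?thesis using \<zeta>(2) by simp
  qed
  have half: "(\<lambda>n. (1/2 :: real) ^ n) \<longlonglongrightarrow> 0" by (rule LIMSEQ_power_zero) simp
  have T_lim: "T \<longlonglongrightarrow> 0"
  proof (rule Lim_null_comparison[OF _ half])
    show "\<forall>\<^sub>F n in sequentially. norm (T n) \<le> (1/2) ^ n"
      using eventually_gt_at_top[of 0]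
    proof eventually_elim
      case (elim n)
      then show ?case using f(1)[of n] by (simp add: inv_def T_def)
    qed
  qed
  define B where "B n = T n - T (Suc n)" for n
  have "B sums (T 0 - 0)" unfolding B_def by (rule telescope_sums'[OF T_lim])
  then have sums: "B sums S" by (simp add: T0)
  \<comment> \<open>The majorants of the blocks need not tend to 0, but the norms of the block
    operators do; by \<open>maj_rep_fine\<close> the latter bound incomplete blocks up to the chosen
    error \<open>(1/2) ^ n\<close>.\<close>
  define e where "e n = norm (B n) + (1/2) ^ n" for n
  have "(\<lambda>n. norm (B n)) \<longlonglongrightarrow> 0"
    using summable_LIMSEQ_zero[OF sums_summable[OF sums]] by (rule tendsto_norm_zero)
  then have e_lim: "e \<longlonglongrightarrow> 0" unfolding e_def using tendsto_add[OF _ half] by fastforce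
  define good where "good l q \<longleftrightarrow> 0 < fst q \<and> (\<forall>i. norm (fst (snd q) i) \<le> 1) \<and> (\<forall>i. 0 \<le> snd (snd q) i) \<and>
      B l = (\<Sum>i<fst q. rank_one (fst (snd q) i) (snd (snd q) i)) \<and> z (Suc l) - z l = (\<Sum>i<fst q. snd (snd q) i) \<and>
      (\<forall>m\<le>fst q. norm (\<Sum>i<m. rank_one (fst (snd q) i) (snd (snd q) i)) \<le> e l)"
    for l and q :: "nat \<times> (nat \<Rightarrow> 'e dual) \<times> (nat \<Rightarrow> 'x)"
  have "\<exists>q. good l q" for l
  proof (rule maj_rep_fine[OF X maj[of l], of "(1/2) ^ l"])
    fix n :: nat and v x
    assume "0 < n" "\<And>i. norm (v i) \<le> 1" "\<And>i. 0 \<le> x i" "T l - T (Suc l) = (\<Sum>i<n. rank_one (v i) (x i))"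
      "z (Suc l) - z l = (\<Sum>i<n. x i)"
      "\<And>m. m \<le> n \<Longrightarrow> norm (\<Sum>i<m. rank_one (v i) (x i)) \<le> norm (T l - T (Suc l)) + (1/2) ^ l"
    then have "good l (n, v, x)" unfolding good_def e_def B_def by simp
    then show "\<exists>q. good l q" by blast
  qed simp
  then obtain q where q: "\<And>l. good l (q l)" by metis
  define r V Y where "r l = fst (q l)" and "V l = fst (snd (q l))" and "Y l = snd (snd (q l))" for l
  have r: "0 < r l" and V: "norm (V l i) \<le> 1" and Y0: "0 \<le> Y l i"
    and B_eq: "B l = (\<Sum>i<r l. rank_one (V l i) (Y l i))" and z_eq: "z (Suc l) - z l = (\<Sum>i<r l. Y l i)"
    and part: "m \<le> r l \<Longrightarrow> norm (\<Sum>i<m. rank_one (V l i) (Y l i)) \<le> e l" for l i m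
    using q[of l] by (simp_all add: good_def r_def V_def Y_def)
  interpret blocks r by unfold_locales (rule r)
  define v x where "v n = (case block_index r n of (l, q) \<Rightarrow> V l q)"
    and "x n = (case block_index r n of (l, q) \<Rightarrow> Y l q)" for n
  have x0: "0 \<le> x j" for j using Y0 by (simp add: x_def split: prod.split)
  have "norm (v j) \<le> 1" for j using V by (simp add: v_def split: prod.split)
  moreover have "norm (\<Sum>j<n. x j) \<le> C + \<eta>" for n
  proof -
    obtain k i where ki: "block_index r n = (k, i)" by fastforce
    have i: "i \<le> r k" using block_index_less[OF ki] by simp
    have "(\<Sum>j<n. x j) = (\<Sum>l<k. \<Sum>q<r l. Y l q) + (\<Sum>q<i. Y k q)"
      unfolding x_def by (rule block_sum[OF ki])
    also have "\<dots> \<le> (\<Sum>l<k. \<Sum>q<r l. Y l q) + (\<Sum>q<r k. Y k q)"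
      using i Y0 by (intro add_left_mono sum_mono2) auto
    also have "\<dots> = (\<Sum>l<Suc k. z (Suc l) - z l)" by (simp add: z_eq)
    also have "\<dots> = z (Suc k)" by (subst sum_lessThan_telescope) (simp add: T0)
    finally have "norm (\<Sum>j<n. x j) \<le> norm (z (Suc k))"
      by (intro regular_norm_mono[OF X] sum_nonneg x0)
    then show ?thesis using z_norm[of "Suc k"] by simp
  qed
  moreover have "(\<lambda>j. rank_one (v j) (x j)) sums S"
  proof -
    have "(\<lambda>n. case block_index r n of (l, q) \<Rightarrow> rank_one (V l q) (Y l q)) sums S"
    proof (rule block_sums[OF _ _ e_lim])
      show "(\<lambda>l. \<Sum>q<r l. rank_one (V l q) (Y l q)) sums S" using sums by (simp flip: B_eq)
      show "norm (\<Sum>q<i. rank_one (V l q) (Y l q)) \<le> e l" if "i < r l" for l i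
        using that by (intro part) simp
    qed
    moreover have "(\<lambda>n. case block_index r n of (l, q) \<Rightarrow> rank_one (V l q) (Y l q)) = (\<lambda>j. rank_one (v j) (x j))"
      by (auto simp: v_def x_def split: prod.split)
    ultimately show ?thesis by simp
  qed
  ultimately show ?thesis using x0 by blast
qed

text \<open>The bound applied to signs makes the series absolutely convergent at each point. The
  pointwise sum has norm at most \<open>w\<close> and, the terms being positive, majorizes all
  partial sums; it is the majorant from which the descent starts.\<close>

lemma weak_sum_majorant:
  fixes \<xi> :: "nat \<Rightarrow> 'z::{real_normed_vector, ord} dual"
  assumes pos: "\<And>j. 0 \<le> \<xi> j"
    and w: "\<And>n a. (\<And>i. i < n \<Longrightarrow> \<bar>a i\<bar> \<le> 1) \<Longrightarrow> norm (\<Sum>i<n. a i *\<^sub>R \<xi> i) \<le> w"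
  obtains \<zeta> where "norm \<zeta> \<le> w" "\<And>m. (\<Sum>j<m. \<xi> j) \<le> \<zeta>"
proof -
  have bound: "(\<Sum>j<n. \<bar>\<xi> j f\<bar>) \<le> w * norm f" for n f
  proof -
    have "(\<Sum>j<n. \<bar>\<xi> j f\<bar>) = (\<Sum>j<n. sgn (\<xi> j f) *\<^sub>R \<xi> j) f"
      by (simp add: blinfun.sum_left blinfun.scaleR_left abs_sgn mult.commute)
    also have "\<dots> \<le> norm (\<Sum>j<n. sgn (\<xi> j f) *\<^sub>R \<xi> j) * norm f"
      using norm_blinfun[of "\<Sum>j<n. sgn (\<xi> j f) *\<^sub>R \<xi> j" f] by simp
    also have "\<dots> \<le> w * norm f" by (intro mult_right_mono w) (simp_all add: abs_sgn_eq)
    finally show ?thesis .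
  qed
  have abs_sm: "summable (\<lambda>j. \<bar>\<xi> j f\<bar>)" for f by (rule summableI_nonneg_bounded[OF _ bound]) simp
  then have sm: "summable (\<lambda>j. \<xi> j f)" for f by (rule summable_rabs_cancel)
  define F where "F f = (\<Sum>j. \<xi> j f)" for f
  have F_le: "norm (F f) \<le> norm f * w" for f
    unfolding F_def using summable_rabs[OF abs_sm] suminf_le_const[OF abs_sm bound]
    by (metis mult.commute order_trans real_norm_def)
  have "bounded_linear F"
  proof (rule bounded_linear_intro[of _ w])
    show "F (f + g) = F f + F g" for f g by (simp add: F_def blinfun.add_right suminf_add sm)
    show "F (c *\<^sub>R f) = c *\<^sub>R F f" for c f by (simp add: F_def blinfun.scaleR_right suminf_mult sm)
  qed (rule F_le)
  then have F: "blinfun_apply (Blinfun F) = F" by (rule bounded_linear_Blinfun_apply)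
  show thesis
  proof (rule that)
    have "0 \<le> w" using w[of 0 "\<lambda>_. 0"] by simp
    then show "norm (Blinfun F) \<le> w" using F_le by (intro norm_blinfun_bound) (simp_all add: F mult.commute)
    show "(\<Sum>j<m. \<xi> j) \<le> Blinfun F" for m
    proof (rule blinfun_leI)
      fix f :: 'z assume f: "0 \<le> f"
      show "(\<Sum>j<m. \<xi> j) f \<le> Blinfun F f"
        unfolding F F_def blinfun.sum_left by (intro sum_le_suminf sm dual_nonnegD[OF pos f]) simp
    qed
  qed
qed

lemma lp_norm_infinity_ge:
  assumes "in_lp \<infinity> u"
  shows "norm (u n) \<le> lp_norm \<infinity> u"
proof -
  have "bdd_above (range (\<lambda>n. norm (u n)))" using assms by (auto simp: in_lp_def bounded_iff bdd_above_def)
  from cSUP_upper[OF UNIV_I this, of n] show ?thesis by (simp add: lp_norm_def)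
qed

lemma lp_norm_nonneg: "in_lp p u \<Longrightarrow> 0 \<le> lp_norm p u"
  using lp_norm_infinity_ge[of u 0] by (cases "p = \<infinity>") (auto simp: lp_norm_def intro: order_trans[OF norm_ge_zero])

lemma latticially_nuclear_rep_infinite_exponent:
  fixes S :: "'e::real_normed_vector \<Rightarrow>\<^sub>L 'x::banach_lattice"
  assumes p: "p = \<infinity>"
    and AP: "approximation_property TYPE('e dual) \<or>
      positive_metric_approximation_property TYPE('x dual dual dual dual)"
    and rep: "positively_nuclear_rep p (dual_map S) \<xi> u" and e: "0 < e"
  shows "\<exists>v x. latticially_nuclear_rep p S v x \<and>
    lp_norm p v * weak_lp_norm (conjugate_exponent p) x \<le>
      weak_lp_norm (conjugate_exponent p) \<xi> * lp_norm p u + e"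
proof -
  have p1: "1 \<le> p" by (simp add: p)
  have \<xi>: "in_weak_lp (conjugate_exponent p) \<xi>" "\<And>j. 0 \<le> \<xi> j" and u: "in_lp p u"
    and sums: "(\<lambda>j. rank_one (u j) (\<xi> j)) sums (bidual o\<^sub>L S)"
    using rep sums_bidual_of_sums_dual_map by (auto simp: positively_nuclear_rep_def)
  obtain b a where ab: "weak_lp_norm (conjugate_exponent p) \<xi> < b" "lp_norm p u < a"
    "b * a \<le> weak_lp_norm (conjugate_exponent p) \<xi> * lp_norm p u + e / 2"
    using product_perturbation[of "weak_lp_norm (conjugate_exponent p) \<xi>" "lp_norm p u" "e / 2"]
      weak_lp_norm_nonneg[OF p1 \<xi>(1)] lp_norm_nonneg[OF u] e by auto
  have a0: "0 < a" using ab(2) lp_norm_nonneg[OF u] by simp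
  obtain \<zeta> where \<zeta>: "norm \<zeta> \<le> weak_lp_norm (conjugate_exponent p) \<xi>" "\<And>m. (\<Sum>j<m. \<xi> j) \<le> \<zeta>"
  proof (rule weak_sum_majorant[OF \<xi>(2)])
    show "norm (\<Sum>i<n. a i *\<^sub>R \<xi> i) \<le> weak_lp_norm (conjugate_exponent p) \<xi>"
      if "\<And>i. i < n \<Longrightarrow> \<bar>a i\<bar> \<le> 1" for n a
      by (rule norm_sum_le_weak_lp_norm[OF p1 \<xi>(1)]) (use that in \<open>simp add: unit_coeffs_def p\<close>)
  qed (rule that)
  \<comment> \<open>The functionals are normalised to norm at most 1 and the vectors take over the
    factor \<open>a\<close>, so that the whole cost sits in the majorant.\<close>
  have "inf_rep_seq (bidual o\<^sub>L S) (a *\<^sub>R \<zeta>) (\<lambda>j. (1 / a) *\<^sub>R u j) (\<lambda>j. a *\<^sub>R \<xi> j)"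
  proof (rule inf_rep_seqI)
    show "norm ((1 / a) *\<^sub>R u j) \<le> 1" for j
      using lp_norm_infinity_ge[of u j] u ab(2) a0 by (simp add: p)
    show "0 \<le> a *\<^sub>R \<xi> j" for j using a0 \<xi>(2) by (intro cone_scaleR) auto
    show "(\<Sum>j<m. a *\<^sub>R \<xi> j) \<le> a *\<^sub>R \<zeta>" for m
      unfolding scaleR_sum_right[symmetric] using a0 by (intro cone_scaleR_mono \<zeta>) simp
    show "(\<lambda>j. rank_one ((1 / a) *\<^sub>R u j) (a *\<^sub>R \<xi> j)) sums (bidual o\<^sub>L S)"
      using sums a0 by (simp add: rank_one_scaleR_left rank_one_scaleR_right)
  qed
  then have "inf_rep (bidual o\<^sub>L S) (a *\<^sub>R \<zeta>)" unfolding inf_rep_def by blast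
  moreover have "norm (a *\<^sub>R \<zeta>) \<le> b * a"
    using \<zeta>(1) ab(1) a0 mult_left_mono[of "norm \<zeta>" b a] by (simp add: mult.commute)
  moreover have "0 < e / 2" using e by simp
  ultimately obtain v x where v: "\<And>j. norm (v j) \<le> 1" and x: "\<And>j. 0 \<le> x j"
    and le: "\<And>m. norm (\<Sum>j<m. x j) \<le> b * a + e / 2" and S: "(\<lambda>j. rank_one (v j) (x j)) sums S"
    using inf_rep_descend[OF _ _ _ AP, of S "a *\<^sub>R \<zeta>" "b * a" "e / 2"] by blast
  have inl: "in_lp p v" using v by (auto simp: in_lp_def p bounded_iff)
  have v1: "lp_norm p v \<le> 1" unfolding lp_norm_def using v by (auto simp: p intro: cSUP_least)
  have *: "norm (\<Sum>i<n. c i *\<^sub>R x i) \<le> b * a + e / 2" if "unit_coeffs p n c" for n c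
  proof -
    have c: "\<bar>c i\<bar> \<le> 1" if "i < n" for i using \<open>unit_coeffs p n c\<close> that by (simp add: unit_coeffs_def p)
    have "(\<Sum>i<n. c i *\<^sub>R x i) \<le> (\<Sum>i<n. 1 *\<^sub>R x i)" "(\<Sum>i<n. - 1 *\<^sub>R x i) \<le> (\<Sum>i<n. c i *\<^sub>R x i)"
      using c by (intro sum_mono scaleR_right_mono x; force)+
    then have "- (\<Sum>i<n. x i) \<le> (\<Sum>i<n. c i *\<^sub>R x i)" "(\<Sum>i<n. c i *\<^sub>R x i) \<le> (\<Sum>i<n. x i)"
      by (simp_all add: sum_negf)
    then have "norm (\<Sum>i<n. c i *\<^sub>R x i) \<le> norm (\<Sum>i<n. x i)"
      using regular_norm_banach_lattice[where 'a = 'x] unfolding regular_norm_def by blast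
    then show ?thesis using le[of n] by simp
  qed
  have xw: "in_weak_lp (conjugate_exponent p) x" "weak_lp_norm (conjugate_exponent p) x \<le> b * a + e / 2"
    by (rule in_weak_lpI[OF p1 *], assumption)+
  have "latticially_nuclear_rep p S v x" using inl xw x S by (simp add: latticially_nuclear_rep_def)
  moreover have "lp_norm p v * weak_lp_norm (conjugate_exponent p) x \<le>
      weak_lp_norm (conjugate_exponent p) \<xi> * lp_norm p u + e"
  proof -
    have "lp_norm p v * weak_lp_norm (conjugate_exponent p) x \<le> 1 * (b * a + e / 2)"
      using v1 xw weak_lp_norm_nonneg[OF p1 xw(1)] by (intro mult_mono) auto
    also have "\<dots> = b * a + e / 2" by simp
    also have "\<dots> \<le> weak_lp_norm (conjugate_exponent p) \<xi> * lp_norm p u + e / 2 + e / 2"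
      by (intro add_right_mono ab)
    also have "\<dots> = weak_lp_norm (conjugate_exponent p) \<xi> * lp_norm p u + e" by (simp only: add.assoc field_sum_of_halves)
    finally show ?thesis .
  qed
  ultimately show ?thesis by blast
qed

theorem theorem2p14:
  fixes S :: "'e::banach \<Rightarrow>\<^sub>L 'x::banach_lattice" and p :: ennreal
  assumes "1 \<le> p"
    and "approximation_property TYPE('e dual) \<or>
         positive_metric_approximation_property TYPE('x dual dual dual dual)"
    and "positively_nuclear p (dual_map S)"
  shows "latticially_nuclear p S \<and>
         latticially_nuclear_norm p S = positively_nuclear_norm p (dual_map S)"
proof -
  have ex: "\<exists>v x. latticially_nuclear_rep p S v x \<and> lp_norm p v * weak_lp_norm (conjugate_exponent p) x \<le>
      weak_lp_norm (conjugate_exponent p) \<xi> * lp_norm p u + e"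
    if "positively_nuclear_rep p (dual_map S) \<xi> u" "0 < e" for \<xi> u e
    using latticially_nuclear_rep_finite_exponent[OF assms(1) _ assms(2) that]
      latticially_nuclear_rep_infinite_exponent[OF _ assms(2) that] by (cases "p = \<infinity>") blast+
  define A where "A = {lp_norm p v * weak_lp_norm (conjugate_exponent p) x | v x. latticially_nuclear_rep p S v x}"
  define B where "B = {weak_lp_norm (conjugate_exponent p) \<xi> * lp_norm p u | \<xi> u. positively_nuclear_rep p (dual_map S) \<xi> u}"
  obtain \<xi>0 u0 where "positively_nuclear_rep p (dual_map S) \<xi>0 u0" using assms(3) unfolding positively_nuclear_def by blast
  from ex[OF this zero_less_one] this have ne: "A \<noteq> {}" "B \<noteq> {}" unfolding A_def B_def by blast+
  then have nuc: "latticially_nuclear p S" unfolding latticially_nuclear_def A_def by blast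
  have "bdd_below A"
    unfolding A_def using lp_norm_nonneg weak_lp_norm_nonneg[OF assms(1)]
    by (intro bdd_belowI[of _ 0]) (auto simp: latticially_nuclear_rep_def intro!: mult_nonneg_nonneg)
  have "bdd_below B"
    unfolding B_def using lp_norm_nonneg weak_lp_norm_nonneg[OF assms(1)]
    by (intro bdd_belowI[of _ 0]) (auto simp: positively_nuclear_rep_def intro!: mult_nonneg_nonneg)
  \<comment> \<open>The hard inequality: \<open>ex\<close> matches every cost in \<open>B\<close> by
    one in \<open>A\<close> up to an arbitrary \<open>e\<close>. The reverse inequality below only
    transposes and embeds representations.\<close>
  have "Inf A \<le> Inf B"
  proof (rule cInf_greatest[OF ne(2)])
    fix b assume "b \<in> B"
    then obtain \<xi> u where b: "b = weak_lp_norm (conjugate_exponent p) \<xi> * lp_norm p u"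
      and rep: "positively_nuclear_rep p (dual_map S) \<xi> u" unfolding B_def by blast
    show "Inf A \<le> b"
    proof (rule field_le_epsilon)
      fix e :: real assume "0 < e"
      from ex[OF rep this] obtain a where "a \<in> A" "a \<le> b + e" unfolding A_def b by blast
      then show "Inf A \<le> b + e" using cInf_lower[OF _ \<open>bdd_below A\<close>] by (meson order_trans)
    qed
  qed
  moreover have "Inf B \<le> Inf A"
  proof (rule cInf_greatest[OF ne(1)])
    fix a assume "a \<in> A"
    then obtain v x where a: "a = lp_norm p v * weak_lp_norm (conjugate_exponent p) x"
      and rep: "latticially_nuclear_rep p S v x" unfolding A_def by blast
    note prep = positively_nuclear_rep_dual_map[OF assms(1) rep]
    have "Inf B \<le> weak_lp_norm (conjugate_exponent p) (\<lambda>j. bidual (x j)) * lp_norm p v"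
      by (rule cInf_lower[OF _ \<open>bdd_below B\<close>]) (use prep(1) in \<open>unfold B_def, blast\<close>)
    also have "\<dots> \<le> weak_lp_norm (conjugate_exponent p) x * lp_norm p v"
      using rep by (intro mult_right_mono prep(2) lp_norm_nonneg) (simp add: latticially_nuclear_rep_def)
    finally show "Inf B \<le> a" by (simp add: a mult.commute)
  qed
  ultimately show ?thesis
    using nuc unfolding latticially_nuclear_norm_def positively_nuclear_norm_def A_def B_def by simp
qed

end
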